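(* Let $m,m'$ be multiplicity functions, $H,H'$ filters relative to $m$ and $\alpha^*$, respectively $m'$ and $\alpha^*$, such that $S_H$ and $S_{H'}$ are pure isometries, and $G,G'$ complementary filters to $H,H'$ respectively. The canonical GMRAs $\{V_j^{m,H,G}\}$ and $\{V_j^{m',H',G'}\}$ are equivalent if and only if $m=m'$ and there exists a (Borel measurable) matrix-valued function $A$ on $\widehat\Gamma$ such that, for almost all $\omega\in\widehat\Gamma$, (1) $A(\omega)=\begin{pmatrix}A_1(\omega)&0\\0&0\end{pmatrix}$, where $A_1(\omega)$ is a unitary matrix of dimension $m(\omega)$; and (2) $H(\omega)A^t(\omega)=A^t(\alpha^*(\omega))H'(\omega)$.
   Context: Setting: $\Gamma$ is a countable (discrete) abelian group, $\alpha:\Gamma\to\Gamma$ is an injective homomorphism whose image has finite index $N>1$ in $\Gamma$, and $\bigcap_{n}\alpha^n(\Gamma)=\{0\}$. $\widehat\Gamma$ is the (compact) dual group, written multiplicatively, with Haar measure $\mu$. The dual endomorphism $\alpha^*:\widehat\Gamma\to\widehat\Gamma$, $[\alpha^*(\omega)](\gamma)=\omega(\alpha(\gamma))$, is onto and its kernel has exactly $N$ elements. Sets and functions on $\widehat\Gamma$ are considered up to Haar-null sets (so $m=m'$ means almost everywhere), identities and inequalities are understood almost everywhere, and $L^2(\sigma)$ for Borel $\sigma\subseteq\widehat\Gamma$ is taken with respect to Haar measure restricted to $\sigma$. A multiplicity function is a Borel function $m:\widehat\Gamma\to\{0,1,2,\dots\}$ with $m(\omega)\le\sum_{\alpha^*(\zeta)=\omega}m(\zeta)$.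 Put $\sigma_i=\{m\ge i\}$, $\widetilde m(\omega)=\sum_{\alpha^*(\zeta)=\omega}m(\zeta)-m(\omega)$, $\widetilde\sigma_k=\{\widetilde m\ge k\}$. A filter relative to $m$ and $\alpha^*$ is a (possibly infinite) matrix $H=[h_{i,j}]$ of Borel complex-valued functions on $\widehat\Gamma$, $h_{i,j}$ supported in $\sigma_j$, with $\sum_{\alpha^*(\zeta)=\omega}\sum_j h_{i,j}(\zeta)\overline{h_{i',j}(\zeta)}=N\delta_{i,i'}\chi_{\sigma_i}(\omega)$. A complementary filter to $H$ is a matrix $G=[g_{k,j}]$ of Borel complex-valued functions, $g_{k,j}$ supported in $\sigma_j$, with $\sum_{\alpha^*(\zeta)=\omega}\sum_j g_{k,j}(\zeta)\overline{g_{k',j}(\zeta)}=N\delta_{k,k'}\chi_{\widetilde\sigma_k}(\omega)$ and $\sum_{\alpha^*(\zeta)=\omega}\sum_j g_{k,j}(\zeta)\overline{h_{i,j}(\zeta)}=0$. The Ruelle operators are $S_H$ on $\bigoplus_iL^2(\sigma_i)$, $[S_H(f)](\omega)=H^t(\omega)f(\alpha^*(\omega))$, and $S_G:\bigoplus_kL^2(\widetilde\sigma_k)\to\bigoplus_iL^2(\sigma_i)$, $[S_G(f)](\omega)=G^t(\omega)f(\alpha^*(\omega))$. An isometry $S$ on $\mathcal K$ is pure if $\bigcap_{n\ge0}S^n(\mathcal K)=\{0\}$. Here $H(\omega)$ is regarded as a matrix-valued function; its nonzero part lies in the upper left $m(\alpha^*(\omega))\times m(\omega)$ block. Dilation by $\alpha^*$: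 fix a Borel cross-section $c$ of $\alpha^*$ (so $\alpha^*(c(\omega))=\omega$) and let $\tau(\omega)=c(\alpha^*(\omega))\omega^{-1}\in\ker\alpha^*$. Given $\mathcal K=\bigoplus_iL^2(E_i,\nu_i)$ (countable direct sum, $E_i\subseteq\widehat\Gamma$ Borel, $\nu_i$ a finite Borel measure on $E_i$), for $\zeta\in\ker\alpha^*$ put $E_{i,\zeta}=\{\omega\in E_i:\tau(\omega)=\zeta\}$, $E'_{i,\zeta}=\alpha^*(E_{i,\zeta})$, $\nu'_{i,\zeta}(F)=N\nu_i(E_{i,\zeta}\cap{\alpha^*}^{-1}(F))$, and $\mathcal D(\mathcal K)=\bigoplus_{i,\zeta}L^2(E'_{i,\zeta},\nu'_{i,\zeta})$, with $\mathcal D:\mathcal K\to\mathcal D(\mathcal K)$ the surjective isometry $[\mathcal D(f)]_{i,\zeta}(\omega)=\frac1{\sqrt N}f_i(\zeta^{-1}c(\omega))$. GMRA: let $\pi$ be a unitary representation of $\Gamma$ and $\delta$ a unitary operator on a separable Hilbert space $\mathcal H$ with $\delta^{-1}\pi_\gamma\delta=\pi_{\alpha(\gamma)}$ for all $\gamma$. A collection $\{V_j\}_{j\in\mathbb Z}$ of closed subspaces is a GMRA relative to $\pi$ and $\delta$ if $V_j\subseteq V_{j+1}$ and $V_{j+1}=\delta(V_j)$ for all $j$, $\bigcap_jV_j=\{0\}$, $\bigcup_jV_j$ is dense in $\mathcal H$, and $V_0$ is invariant under $\pi$. Canonical GMRA: for $m$ a multiplicity function, $H$ a filter relative to $m$ and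 $\alpha^*$ with $S_H$ a pure isometry, and $G$ complementary to $H$, let $\mathcal V_0=\bigoplus_iL^2(\sigma_i)$, $\mathcal W_0=\bigoplus_kL^2(\widetilde\sigma_k)$, $\mathcal W_n=\mathcal D(\mathcal W_{n-1})$ for $n\ge1$, $\mathcal H=\mathcal V_0\oplus\bigoplus_{n\ge0}\mathcal W_n$; let $\Gamma$ act by $[\pi_\gamma(f)](\omega)=\omega(\gamma)f(\omega)$ and let $T$ be the unitary on $\mathcal H$ with $[T(f)]_{\mathcal V_0}=S_H(f_{\mathcal V_0})+S_G(f_{\mathcal W_0})$ and $[T(f)]_{\mathcal W_n}=\mathcal D^{-1}(f_{\mathcal W_{n+1}})$ for $n\ge0$. Then $V_j^{m,H,G}=T^{-j}(\mathcal V_0)$, $j\in\mathbb Z$, is a GMRA relative to $\pi$ and $\delta=T^{-1}$, called the canonical GMRA with these parameters. Equivalence: GMRAs $\{V_j\}$ (in $\mathcal H$, relative to $\pi,\delta$) and $\{V'_j\}$ (in $\mathcal H'$, relative to $\pi',\delta'$) are equivalent if there is a unitary $U:\mathcal H\to\mathcal H'$ with $U(V_j)=V'_j$ for all $j$, $U\circ\pi_\gamma=\pi'_\gamma\circ U$ for all $\gamma\in\Gamma$, and $U\circ\delta=\delta'\circ U$. *)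

theory Defs
  imports "HOL-Analysis.Analysis"
begin

section \<open>Hilbert spaces with explicit carriers\<close>

text \<open>The spaces below depend on terms (a multiplicity function, a filter), so they are
  records with a carrier set rather than instances of a type class.\<close>

record 'v hilb =
  hcarrier :: "'v set"
  hzero :: 'v
  hplus :: "'v \<Rightarrow> 'v \<Rightarrow> 'v"
  hscale :: "complex \<Rightarrow> 'v \<Rightarrow> 'v"
  hinner :: "'v \<Rightarrow> 'v \<Rightarrow> complex"

definition hnorm :: "'v hilb \<Rightarrow> 'v \<Rightarrow> real" where
  "hnorm K x = sqrt (Re (hinner K x x))"

definition linear_map :: "'v hilb \<Rightarrow> 'w hilb \<Rightarrow> ('v \<Rightarrow> 'w) \<Rightarrow> bool" where
  "linear_map K L S \<longleftrightarrow>
     S \<in> hcarrier K \<rightarrow> hcarrier L \<and>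
     (\<forall>x\<in>hcarrier K. \<forall>y\<in>hcarrier K. S (hplus K x y) = hplus L (S x) (S y)) \<and>
     (\<forall>a. \<forall>x\<in>hcarrier K. S (hscale K a x) = hscale L a (S x))"

definition isometry :: "'v hilb \<Rightarrow> 'w hilb \<Rightarrow> ('v \<Rightarrow> 'w) \<Rightarrow> bool" where
  "isometry K L S \<longleftrightarrow> linear_map K L S \<and> (\<forall>x\<in>hcarrier K. hnorm L (S x) = hnorm K x)"

definition pure_isometry :: "'v hilb \<Rightarrow> ('v \<Rightarrow> 'v) \<Rightarrow> bool" where
  "pure_isometry K S \<longleftrightarrow> isometry K K S \<and> (\<Inter>n. (S ^^ n) ` hcarrier K) = {hzero K}"

definition unitary :: "'v hilb \<Rightarrow> 'w hilb \<Rightarrow> ('v \<Rightarrow> 'w) \<Rightarrow> bool" where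
  "unitary K L U \<longleftrightarrow> linear_map K L U \<and> bij_betw U (hcarrier K) (hcarrier L) \<and>
     (\<forall>x\<in>hcarrier K. \<forall>y\<in>hcarrier K. hinner L (U x) (U y) = hinner K x y)"

text \<open>Elements of \<open>L2 \<nu>\<close> are classes of almost everywhere equal functions. The functions in a
  class are required to vanish off \<open>space \<nu>\<close>, so that a representative of an element of
  $L^2(\sigma)$ is extended by zero to the whole dual group.\<close>

definition l2_class :: "'a measure \<Rightarrow> ('a \<Rightarrow> complex) \<Rightarrow> ('a \<Rightarrow> complex) set" where
  "l2_class \<nu> f =
     {g \<in> borel_measurable \<nu>. (AE x in \<nu>. g x = f x) \<and> (\<forall>x. x \<notin> space \<nu> \<longrightarrow> g x = 0)}"

definition l2_rep :: "('a \<Rightarrow> complex) set \<Rightarrow> 'a \<Rightarrow> complex" where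
  "l2_rep X = (SOME f. f \<in> X)"

definition L2 :: "'a measure \<Rightarrow> ('a \<Rightarrow> complex) set hilb" where
  "L2 \<nu> = \<lparr>
     hcarrier = l2_class \<nu> ` {f \<in> borel_measurable \<nu>. integrable \<nu> (\<lambda>x. (norm (f x))\<^sup>2)},
     hzero = l2_class \<nu> (\<lambda>_. 0),
     hplus = (\<lambda>X Y. l2_class \<nu> (\<lambda>x. l2_rep X x + l2_rep Y x)),
     hscale = (\<lambda>a X. l2_class \<nu> (\<lambda>x. a * l2_rep X x)),
     hinner = (\<lambda>X Y. \<integral>x. l2_rep X x * cnj (l2_rep Y x) \<partial>\<nu>)\<rparr>"

definition hsum :: "'i set \<Rightarrow> ('i \<Rightarrow> 'v hilb) \<Rightarrow> ('i \<Rightarrow> 'v) hilb" where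
  "hsum I K = \<lparr>
     hcarrier = {x \<in> (\<Pi>\<^sub>E i\<in>I. hcarrier (K i)). (\<lambda>i. (hnorm (K i) (x i))\<^sup>2) summable_on I},
     hzero = (\<lambda>i\<in>I. hzero (K i)),
     hplus = (\<lambda>x y. \<lambda>i\<in>I. hplus (K i) (x i) (y i)),
     hscale = (\<lambda>a x. \<lambda>i\<in>I. hscale (K i) a (x i)),
     hinner = (\<lambda>x y. \<Sum>\<^sub>\<infinity>i\<in>I. hinner (K i) (x i) (y i))\<rparr>"

definition hprod :: "'v hilb \<Rightarrow> 'w hilb \<Rightarrow> ('v \<times> 'w) hilb" where
  "hprod K L = \<lparr>
     hcarrier = hcarrier K \<times> hcarrier L,
     hzero = (hzero K, hzero L),
     hplus = (\<lambda>x y. (hplus K (fst x) (fst y), hplus L (snd x) (snd y))),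
     hscale = (\<lambda>a x. (hscale K a (fst x), hscale L a (snd x))),
     hinner = (\<lambda>x y. hinner K (fst x) (fst y) + hinner L (snd x) (snd y))\<rparr>"


section \<open>Equivalence of generalized multiresolution analyses\<close>

record ('g, 'v) gmra =
  ambient :: "'v hilb"
  repr :: "'g \<Rightarrow> 'v \<Rightarrow> 'v"
  dil :: "'v \<Rightarrow> 'v"
  subsp :: "int \<Rightarrow> 'v set"

definition gmra_equivalent :: "('g, 'v) gmra \<Rightarrow> ('g, 'w) gmra \<Rightarrow> bool" where
  "gmra_equivalent M M' \<longleftrightarrow>
     (\<exists>U. unitary (ambient M) (ambient M') U \<and>
          (\<forall>j. U ` subsp M j = subsp M' j) \<and>
          (\<forall>\<gamma>. \<forall>x\<in>hcarrier (ambient M). U (repr M \<gamma> x) = repr M' \<gamma> (U x)) \<and>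
          (\<forall>x\<in>hcarrier (ambient M). U (dil M x) = dil M' (U x)))"


section \<open>The dual group and the dual endomorphism\<close>

definition dual_group :: "('g::ab_group_add \<Rightarrow> complex) set" where
  "dual_group = {\<omega>. (\<forall>\<gamma>. norm (\<omega> \<gamma>) = 1) \<and> (\<forall>\<gamma> \<gamma>'. \<omega> (\<gamma> + \<gamma>') = \<omega> \<gamma> * \<omega> \<gamma>')}"

definition char_mult :: "('g \<Rightarrow> complex) \<Rightarrow> ('g \<Rightarrow> complex) \<Rightarrow> ('g \<Rightarrow> complex)" where
  "char_mult \<xi> \<omega> = (\<lambda>\<gamma>. \<xi> \<gamma> * \<omega> \<gamma>)"

definition char_inv :: "('g \<Rightarrow> complex) \<Rightarrow> ('g \<Rightarrow> complex)" where
  "char_inv \<omega> = (\<lambda>\<gamma>. inverse (\<omega> \<gamma>))"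

text \<open>The group being discrete, the topology of its dual is that of pointwise convergence,
  i.e. the subspace topology of the product topology on \<open>'g \<Rightarrow> complex\<close>.\<close>

definition dual_borel :: "('g::ab_group_add \<Rightarrow> complex) measure" where
  "dual_borel = restrict_space borel dual_group"

definition haar_measure :: "('g::ab_group_add \<Rightarrow> complex) measure \<Rightarrow> bool" where
  "haar_measure \<mu> \<longleftrightarrow>
     sets \<mu> = sets dual_borel \<and> emeasure \<mu> (space \<mu>) = 1 \<and>
     (\<forall>\<xi>\<in>dual_group. \<forall>S\<in>sets \<mu>. emeasure \<mu> (char_mult \<xi> ` S) = emeasure \<mu> S)"

text \<open>The value is 0 if the index is infinite, so \<open>image_index \<alpha> > 1\<close> includes finiteness.\<close>

definition image_index :: "('g::ab_group_add \<Rightarrow> 'g) \<Rightarrow> nat" where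
  "image_index \<alpha> = card (range (\<lambda>x. (\<lambda>y. x + y) ` range \<alpha>))"

definition dual_endo :: "('g \<Rightarrow> 'g) \<Rightarrow> ('g \<Rightarrow> complex) \<Rightarrow> ('g \<Rightarrow> complex)" where
  "dual_endo \<alpha> \<omega> = (\<lambda>\<gamma>. \<omega> (\<alpha> \<gamma>))"

definition fibre ::
  "('g::ab_group_add \<Rightarrow> 'g) \<Rightarrow> ('g \<Rightarrow> complex) \<Rightarrow> ('g \<Rightarrow> complex) set" where
  "fibre \<alpha> \<omega> = {\<zeta> \<in> dual_group. dual_endo \<alpha> \<zeta> = \<omega>}"

definition dual_kernel :: "('g::ab_group_add \<Rightarrow> 'g) \<Rightarrow> ('g \<Rightarrow> complex) set" where
  "dual_kernel \<alpha> = fibre \<alpha> (\<lambda>_. 1)"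

definition borel_cross_section ::
  "('g::ab_group_add \<Rightarrow> 'g) \<Rightarrow> (('g \<Rightarrow> complex) \<Rightarrow> ('g \<Rightarrow> complex)) \<Rightarrow> bool" where
  "borel_cross_section \<alpha> c \<longleftrightarrow>
     c \<in> measurable dual_borel dual_borel \<and> (\<forall>\<omega>\<in>dual_group. dual_endo \<alpha> (c \<omega>) = \<omega>)"


section \<open>Multiplicity functions and filters\<close>

text \<open>All rows and columns are indexed by the integers from 1 on.\<close>

definition multiplicity_function ::
  "('g::ab_group_add \<Rightarrow> 'g) \<Rightarrow> ('g \<Rightarrow> complex) measure \<Rightarrow> (('g \<Rightarrow> complex) \<Rightarrow> nat) \<Rightarrow> bool" where
  "multiplicity_function \<alpha> \<mu> m \<longleftrightarrow>
     m \<in> measurable \<mu> (count_space UNIV) \<and> (AE \<omega> in \<mu>. m \<omega> \<le> (\<Sum>\<zeta>\<in>fibre \<alpha> \<omega>. m \<zeta>))"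

text \<open>The truncation in the subtraction is effective only on a null set.\<close>

definition compl_mult ::
  "('g::ab_group_add \<Rightarrow> 'g) \<Rightarrow> (('g \<Rightarrow> complex) \<Rightarrow> nat) \<Rightarrow> ('g \<Rightarrow> complex) \<Rightarrow> nat" where
  "compl_mult \<alpha> m \<omega> = (\<Sum>\<zeta>\<in>fibre \<alpha> \<omega>. m \<zeta>) - m \<omega>"

definition level :: "(('g::ab_group_add \<Rightarrow> complex) \<Rightarrow> nat) \<Rightarrow> nat \<Rightarrow> ('g \<Rightarrow> complex) set" where
  "level m i = {\<omega> \<in> dual_group. i \<le> m \<omega>}"

text \<open>For almost all arguments only finitely many terms of the infinite sums over the columns
  are nonzero, by the support condition.\<close>

definition filter_relative ::
  "('g::ab_group_add \<Rightarrow> 'g) \<Rightarrow> ('g \<Rightarrow> complex) measure \<Rightarrow> (('g \<Rightarrow> complex) \<Rightarrow> nat) \<Rightarrow>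
   (nat \<Rightarrow> nat \<Rightarrow> ('g \<Rightarrow> complex) \<Rightarrow> complex) \<Rightarrow> bool" where
  "filter_relative \<alpha> \<mu> m H \<longleftrightarrow>
     (\<forall>i\<ge>1. \<forall>j\<ge>1. H i j \<in> borel_measurable \<mu> \<and> (AE \<omega> in \<mu>. \<omega> \<notin> level m j \<longrightarrow> H i j \<omega> = 0)) \<and>
     (\<forall>i\<ge>1. \<forall>i'\<ge>1. AE \<omega> in \<mu>.
        (\<Sum>\<zeta>\<in>fibre \<alpha> \<omega>. \<Sum>\<^sub>\<infinity>j\<in>{1..}. H i j \<zeta> * cnj (H i' j \<zeta>)) =
        of_nat (image_index \<alpha>) * (if i = i' then 1 else 0) * indicator (level m i) \<omega>)"

definition complementary_filter ::
  "('g::ab_group_add \<Rightarrow> 'g) \<Rightarrow> ('g \<Rightarrow> complex) measure \<Rightarrow> (('g \<Rightarrow> complex) \<Rightarrow> nat) \<Rightarrow>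
   (nat \<Rightarrow> nat \<Rightarrow> ('g \<Rightarrow> complex) \<Rightarrow> complex) \<Rightarrow>
   (nat \<Rightarrow> nat \<Rightarrow> ('g \<Rightarrow> complex) \<Rightarrow> complex) \<Rightarrow> bool" where
  "complementary_filter \<alpha> \<mu> m H G \<longleftrightarrow>
     (\<forall>k\<ge>1. \<forall>j\<ge>1. G k j \<in> borel_measurable \<mu> \<and> (AE \<omega> in \<mu>. \<omega> \<notin> level m j \<longrightarrow> G k j \<omega> = 0)) \<and>
     (\<forall>k\<ge>1. \<forall>k'\<ge>1. AE \<omega> in \<mu>.
        (\<Sum>\<zeta>\<in>fibre \<alpha> \<omega>. \<Sum>\<^sub>\<infinity>j\<in>{1..}. G k j \<zeta> * cnj (G k' j \<zeta>)) =
        of_nat (image_index \<alpha>) * (if k = k' then 1 else 0) *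
          indicator (level (compl_mult \<alpha> m) k) \<omega>) \<and>
     (\<forall>k\<ge>1. \<forall>i\<ge>1. AE \<omega> in \<mu>.
        (\<Sum>\<zeta>\<in>fibre \<alpha> \<omega>. \<Sum>\<^sub>\<infinity>j\<in>{1..}. G k j \<zeta> * cnj (H i j \<zeta>)) = 0)"


section \<open>Dilation by the dual endomorphism\<close>

text \<open>A direct sum $\bigoplus_{i\in I} L^2(E_i,\nu_i)$ is given by the index set \<open>I\<close> and the
  measures \<open>\<nu> i\<close>, with \<open>space (\<nu> i)\<close> in the role of $E_i$. To iterate the dilation within one
  type, the index pair $(i,\zeta)$ of a dilated space is written \<open>Dil i \<zeta>\<close>.\<close>

datatype 'd dindex = Base nat | Dil "'d dindex" 'd

definition l2_sum :: "'i set \<Rightarrow> ('i \<Rightarrow> 'd measure) \<Rightarrow> ('i \<Rightarrow> ('d \<Rightarrow> complex) set) hilb" where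
  "l2_sum I \<nu> = hsum I (\<lambda>i. L2 (\<nu> i))"

definition cocycle ::
  "('g \<Rightarrow> 'g) \<Rightarrow> (('g \<Rightarrow> complex) \<Rightarrow> ('g \<Rightarrow> complex)) \<Rightarrow> ('g \<Rightarrow> complex) \<Rightarrow> ('g \<Rightarrow> complex)" where
  "cocycle \<alpha> c \<omega> = char_mult (c (dual_endo \<alpha> \<omega>)) (char_inv \<omega>)"

definition dilate_measure ::
  "('g::ab_group_add \<Rightarrow> 'g) \<Rightarrow> (('g \<Rightarrow> complex) \<Rightarrow> ('g \<Rightarrow> complex)) \<Rightarrow>
   ('g \<Rightarrow> complex) measure \<Rightarrow> ('g \<Rightarrow> complex) \<Rightarrow> ('g \<Rightarrow> complex) measure" where
  "dilate_measure \<alpha> c \<nu> \<zeta> =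
     (let E = {\<omega> \<in> space \<nu>. cocycle \<alpha> c \<omega> = \<zeta>} in
      scale_measure (of_nat (image_index \<alpha>))
        (distr (restrict_space \<nu> E) (restrict_space dual_borel (dual_endo \<alpha> ` E)) (dual_endo \<alpha>)))"

definition dilate_index ::
  "('g::ab_group_add \<Rightarrow> 'g) \<Rightarrow> ('g \<Rightarrow> complex) dindex set \<Rightarrow> ('g \<Rightarrow> complex) dindex set" where
  "dilate_index \<alpha> I = {Dil i \<zeta> | i \<zeta>. i \<in> I \<and> \<zeta> \<in> dual_kernel \<alpha>}"

definition dilate_family ::
  "('g::ab_group_add \<Rightarrow> 'g) \<Rightarrow> (('g \<Rightarrow> complex) \<Rightarrow> ('g \<Rightarrow> complex)) \<Rightarrow>
   (('g \<Rightarrow> complex) dindex \<Rightarrow> ('g \<Rightarrow> complex) measure) \<Rightarrow>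
   ('g \<Rightarrow> complex) dindex \<Rightarrow> ('g \<Rightarrow> complex) measure" where
  "dilate_family \<alpha> c \<nu> d =
     (case d of Base k \<Rightarrow> undefined | Dil i \<zeta> \<Rightarrow> dilate_measure \<alpha> c (\<nu> i) \<zeta>)"

definition dilate ::
  "('g::ab_group_add \<Rightarrow> 'g) \<Rightarrow> (('g \<Rightarrow> complex) \<Rightarrow> ('g \<Rightarrow> complex)) \<Rightarrow>
   ('g \<Rightarrow> complex) dindex set \<Rightarrow> (('g \<Rightarrow> complex) dindex \<Rightarrow> ('g \<Rightarrow> complex) measure) \<Rightarrow>
   (('g \<Rightarrow> complex) dindex \<Rightarrow> (('g \<Rightarrow> complex) \<Rightarrow> complex) set) \<Rightarrow>
   ('g \<Rightarrow> complex) dindex \<Rightarrow> (('g \<Rightarrow> complex) \<Rightarrow> complex) set" where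
  "dilate \<alpha> c I \<nu> f =
     (\<lambda>d\<in>dilate_index \<alpha> I. case d of Base k \<Rightarrow> undefined | Dil i \<zeta> \<Rightarrow>
        l2_class (dilate_measure \<alpha> c (\<nu> i) \<zeta>)
          (\<lambda>\<omega>. 1 / sqrt (real (image_index \<alpha>)) * l2_rep (f i) (char_mult (char_inv \<zeta>) (c \<omega>))))"


section \<open>The canonical generalized multiresolution analysis\<close>

definition level_measure ::
  "('g::ab_group_add \<Rightarrow> complex) measure \<Rightarrow> (('g \<Rightarrow> complex) \<Rightarrow> nat) \<Rightarrow> nat \<Rightarrow>
   ('g \<Rightarrow> complex) measure" where
  "level_measure \<mu> m i = restrict_space \<mu> (level m i)"

definition core_space ::
  "('g::ab_group_add \<Rightarrow> complex) measure \<Rightarrow> (('g \<Rightarrow> complex) \<Rightarrow> nat) \<Rightarrow>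
   (nat \<Rightarrow> (('g \<Rightarrow> complex) \<Rightarrow> complex) set) hilb" where
  "core_space \<mu> m = l2_sum {1..} (level_measure \<mu> m)"

text \<open>The operator $f \mapsto K^t\,(f\circ\alpha^*)$ into \<open>core_space \<mu> m\<close>; it serves for both
  Ruelle operators.\<close>

definition ruelle ::
  "('g::ab_group_add \<Rightarrow> 'g) \<Rightarrow> ('g \<Rightarrow> complex) measure \<Rightarrow> (('g \<Rightarrow> complex) \<Rightarrow> nat) \<Rightarrow>
   (nat \<Rightarrow> nat \<Rightarrow> ('g \<Rightarrow> complex) \<Rightarrow> complex) \<Rightarrow>
   (nat \<Rightarrow> (('g \<Rightarrow> complex) \<Rightarrow> complex) set) \<Rightarrow> nat \<Rightarrow> (('g \<Rightarrow> complex) \<Rightarrow> complex) set" where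
  "ruelle \<alpha> \<mu> m K f =
     (\<lambda>j\<in>{1..}. l2_class (level_measure \<mu> m j)
        (\<lambda>\<omega>. \<Sum>\<^sub>\<infinity>i\<in>{1..}. K i j \<omega> * l2_rep (f i) (dual_endo \<alpha> \<omega>)))"

primrec wavelet_index ::
  "('g::ab_group_add \<Rightarrow> 'g) \<Rightarrow> nat \<Rightarrow> ('g \<Rightarrow> complex) dindex set" where
  "wavelet_index \<alpha> 0 = Base ` {1..}"
| "wavelet_index \<alpha> (Suc n) = dilate_index \<alpha> (wavelet_index \<alpha> n)"

primrec wavelet_family ::
  "('g::ab_group_add \<Rightarrow> 'g) \<Rightarrow> (('g \<Rightarrow> complex) \<Rightarrow> ('g \<Rightarrow> complex)) \<Rightarrow>
   ('g \<Rightarrow> complex) measure \<Rightarrow> (('g \<Rightarrow> complex) \<Rightarrow> nat) \<Rightarrow> nat \<Rightarrow>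
   ('g \<Rightarrow> complex) dindex \<Rightarrow> ('g \<Rightarrow> complex) measure" where
  "wavelet_family \<alpha> c \<mu> m 0 =
     (\<lambda>d. case d of Base k \<Rightarrow> level_measure \<mu> (compl_mult \<alpha> m) k | Dil i \<zeta> \<Rightarrow> undefined)"
| "wavelet_family \<alpha> c \<mu> m (Suc n) = dilate_family \<alpha> c (wavelet_family \<alpha> c \<mu> m n)"

definition wavelet_space ::
  "('g::ab_group_add \<Rightarrow> 'g) \<Rightarrow> (('g \<Rightarrow> complex) \<Rightarrow> ('g \<Rightarrow> complex)) \<Rightarrow>
   ('g \<Rightarrow> complex) measure \<Rightarrow> (('g \<Rightarrow> complex) \<Rightarrow> nat) \<Rightarrow> nat \<Rightarrow>
   (('g \<Rightarrow> complex) dindex \<Rightarrow> (('g \<Rightarrow> complex) \<Rightarrow> complex) set) hilb" where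
  "wavelet_space \<alpha> c \<mu> m n = l2_sum (wavelet_index \<alpha> n) (wavelet_family \<alpha> c \<mu> m n)"

type_synonym 'g canonical_vec =
  "(nat \<Rightarrow> (('g \<Rightarrow> complex) \<Rightarrow> complex) set) \<times>
   (nat \<Rightarrow> ('g \<Rightarrow> complex) dindex \<Rightarrow> (('g \<Rightarrow> complex) \<Rightarrow> complex) set)"

definition canonical_space ::
  "('g::ab_group_add \<Rightarrow> 'g) \<Rightarrow> (('g \<Rightarrow> complex) \<Rightarrow> ('g \<Rightarrow> complex)) \<Rightarrow>
   ('g \<Rightarrow> complex) measure \<Rightarrow> (('g \<Rightarrow> complex) \<Rightarrow> nat) \<Rightarrow> 'g canonical_vec hilb" where
  "canonical_space \<alpha> c \<mu> m = hprod (core_space \<mu> m) (hsum UNIV (wavelet_space \<alpha> c \<mu> m))"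

definition mult_char ::
  "'i set \<Rightarrow> ('i \<Rightarrow> ('g \<Rightarrow> complex) measure) \<Rightarrow> 'g \<Rightarrow>
   ('i \<Rightarrow> (('g \<Rightarrow> complex) \<Rightarrow> complex) set) \<Rightarrow> 'i \<Rightarrow> (('g \<Rightarrow> complex) \<Rightarrow> complex) set" where
  "mult_char I \<nu> \<gamma> f = (\<lambda>i\<in>I. l2_class (\<nu> i) (\<lambda>\<omega>. \<omega> \<gamma> * l2_rep (f i) \<omega>))"

definition canonical_repr ::
  "('g::ab_group_add \<Rightarrow> 'g) \<Rightarrow> (('g \<Rightarrow> complex) \<Rightarrow> ('g \<Rightarrow> complex)) \<Rightarrow>
   ('g \<Rightarrow> complex) measure \<Rightarrow> (('g \<Rightarrow> complex) \<Rightarrow> nat) \<Rightarrow>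
   'g \<Rightarrow> 'g canonical_vec \<Rightarrow> 'g canonical_vec" where
  "canonical_repr \<alpha> c \<mu> m \<gamma> x =
     (mult_char {1..} (level_measure \<mu> m) \<gamma> (fst x),
      \<lambda>n. mult_char (wavelet_index \<alpha> n) (wavelet_family \<alpha> c \<mu> m n) \<gamma> (snd x n))"

definition canonical_T ::
  "('g::ab_group_add \<Rightarrow> 'g) \<Rightarrow> (('g \<Rightarrow> complex) \<Rightarrow> ('g \<Rightarrow> complex)) \<Rightarrow>
   ('g \<Rightarrow> complex) measure \<Rightarrow> (('g \<Rightarrow> complex) \<Rightarrow> nat) \<Rightarrow>
   (nat \<Rightarrow> nat \<Rightarrow> ('g \<Rightarrow> complex) \<Rightarrow> complex) \<Rightarrow>
   (nat \<Rightarrow> nat \<Rightarrow> ('g \<Rightarrow> complex) \<Rightarrow> complex) \<Rightarrow>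
   'g canonical_vec \<Rightarrow> 'g canonical_vec" where
  "canonical_T \<alpha> c \<mu> m H G x =
     (hplus (core_space \<mu> m)
        (ruelle \<alpha> \<mu> m H (fst x)) (ruelle \<alpha> \<mu> m G (\<lambda>k. snd x 0 (Base k))),
      \<lambda>n. inv_into (hcarrier (wavelet_space \<alpha> c \<mu> m n))
            (dilate \<alpha> c (wavelet_index \<alpha> n) (wavelet_family \<alpha> c \<mu> m n)) (snd x (Suc n)))"

definition canonical_gmra ::
  "('g::ab_group_add \<Rightarrow> 'g) \<Rightarrow> (('g \<Rightarrow> complex) \<Rightarrow> ('g \<Rightarrow> complex)) \<Rightarrow>
   ('g \<Rightarrow> complex) measure \<Rightarrow> (('g \<Rightarrow> complex) \<Rightarrow> nat) \<Rightarrow>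
   (nat \<Rightarrow> nat \<Rightarrow> ('g \<Rightarrow> complex) \<Rightarrow> complex) \<Rightarrow>
   (nat \<Rightarrow> nat \<Rightarrow> ('g \<Rightarrow> complex) \<Rightarrow> complex) \<Rightarrow>
   ('g, 'g canonical_vec) gmra" where
  "canonical_gmra \<alpha> c \<mu> m H G =
     (let K = canonical_space \<alpha> c \<mu> m;
          T = canonical_T \<alpha> c \<mu> m H G;
          \<delta> = inv_into (hcarrier K) T;
          V0 = hcarrier (core_space \<mu> m) \<times> {hzero (hsum UNIV (wavelet_space \<alpha> c \<mu> m))}
      in \<lparr>ambient = K, repr = canonical_repr \<alpha> c \<mu> m, dil = \<delta>,
          subsp = (\<lambda>j. if 0 \<le> j then (\<delta> ^^ nat j) ` V0 else (T ^^ nat (- j)) ` V0)\<rparr>)"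


section \<open>Matrices with a unitary corner\<close>

definition unitary_corner :: "nat \<Rightarrow> (nat \<Rightarrow> nat \<Rightarrow> complex) \<Rightarrow> bool" where
  "unitary_corner n a \<longleftrightarrow>
     (\<forall>i\<in>{1..n}. \<forall>k\<in>{1..n}.
        (\<Sum>j=1..n. a i j * cnj (a k j)) = (if i = k then 1 else 0) \<and>
        (\<Sum>j=1..n. cnj (a j i) * a j k) = (if i = k then 1 else 0)) \<and>
     (\<forall>i\<ge>1. \<forall>j\<ge>1. n < i \<or> n < j \<longrightarrow> a i j = 0)"

end

theory Submission
  imports Defs
begin

text \<open>Write \<open>\<alpha>\<^sup>*\<close> for the dual endomorphism, $S_H$ and $S_G$ for the Ruelle operators and
  \<open>core m\<close> for $\mathcal V_0 = \bigoplus_i L^2(\sigma_i)$.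

  The whole canonical structure is rigid over its core. By the filter equations the rows of $H$ and
  $G$ over a fibre of \<open>\<alpha>\<^sup>*\<close> form a square matrix with orthogonal rows of squared length $N$: there are
  \<open>m(\<omega>) + \<close>$\widetilde m(\omega)$ of them, which is the sum of \<open>m\<close> over the fibre. Such a matrix is a
  multiple of a unitary one (\<open>square_orthonormal\<close>), so that $(f, g) \mapsto S_H f + S_G g$ is a
  unitary from $\mathcal V_0 \oplus \mathcal W_0$ onto $\mathcal V_0$ (\<open>join_unitary\<close>). As the
  dilation is unitary from $\mathcal W_n$ onto $\mathcal W_{n+1}$ (\<open>dilate_unitary\<close>), $T$ is
  bijective, and an equivalence restricts to a unitary $U_0$ between the cores that commutes with the
  characters and satisfies $U_0 S_H = S_{H'} U_0$. Conversely such a $U_0$ extends: the unitary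
  $(S_{H'} \oplus S_{G'})^{-1} U_0 (S_H \oplus S_G)$ agrees with $U_0$ on the first summand, hence maps
  the orthogonal complement $\mathcal W_0$ onto $\mathcal W_0'$, and conjugation with the dilations
  carries it to all $\mathcal W_n$. The dilation turns the action of \<open>\<alpha> \<gamma>\<close> into that of \<open>\<gamma>\<close>,
  and the Ruelle operators turn the action of \<open>\<gamma>\<close> into that of \<open>\<alpha> \<gamma>\<close>, so that the maps obtained by
  conjugation commute with the characters, too. This part
  is pure Hilbert space theory and is carried out for an abstract \<open>ladder\<close> of spaces
  (\<open>ladder_equivalence\<close>).

  It remains to see what the operators $U_0$ are. If $U_0$ commutes with the characters, then for
  $f, g$ in the core the functions $\langle (U_0 f)(\omega), (U_0 g)(\omega)\rangle$ and
  $\langle f(\omega), g(\omega)\rangle$ have the same Fourier coefficients, so they agree almost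
  everywhere (\<open>fourier_unique\<close>, \<open>pointwise_isometry\<close>). The values of $U_0$ on the unit vectors
  therefore are the columns of a matrix $A(\omega)$ with orthonormal columns, and the same argument for
  $U_0^{-1}$, whose matrix is the adjoint of $A(\omega)$, shows that the rows are orthonormal, too.
  Counting the squared Frobenius norm by columns and by rows gives $m = m'$
  (\<open>matrix_of_unitary_corner\<close>). Testing $U_0 S_H = S_{H'} U_0$ on the unit vectors gives the matrix
  equation. Conversely, multiplication by a unitary matrix-valued function that solves the matrix
  equation is such a $U_0$.

  The passage between statements about fibres and statements about integrals rests on the formula
  $\int \sum_{\alpha^*(\zeta) = \omega} f(\zeta)\, d\mu(\omega) = |\ker\alpha^*| \int f\, d\mu$
  (\<open>nn_integral_sum_fibre\<close>), which also shows that null sets may be moved along \<open>\<alpha>\<^sup>*\<close> in both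
  directions.\<close>


section \<open>The dual group, Haar measure and the fibres of the dual endomorphism\<close>

lemma dual_group_mult: "\<xi> \<in> dual_group \<Longrightarrow> \<omega> \<in> dual_group \<Longrightarrow> char_mult \<xi> \<omega> \<in> dual_group"
  by (auto simp: dual_group_def char_mult_def norm_mult)

lemma dual_group_one: "(\<lambda>_. 1) \<in> dual_group"
  by (simp add: dual_group_def)

lemma dual_group_nonzero: "\<omega> \<in> dual_group \<Longrightarrow> \<omega> \<gamma> \<noteq> 0"
  by (auto simp: dual_group_def dest: spec[of _ \<gamma>])

lemma dual_group_norm: "\<omega> \<in> dual_group \<Longrightarrow> norm (\<omega> \<gamma>) = 1"
  by (simp add: dual_group_def)

lemma dual_group_add: "\<omega> \<in> dual_group \<Longrightarrow> \<omega> (\<gamma> + \<gamma>') = \<omega> \<gamma> * \<omega> \<gamma>'"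
  by (simp add: dual_group_def)

lemma dual_group_zero: 
  assumes "\<omega> \<in> dual_group" shows "\<omega> 0 = 1"
  using dual_group_add[OF assms, of 0 0] dual_group_nonzero[OF assms, of 0] by simp

lemma dual_group_inv: "\<omega> \<in> dual_group \<Longrightarrow> char_inv \<omega> \<in> dual_group"
  by (auto simp: dual_group_def char_inv_def norm_inverse)

lemma dual_group_uminus:
  assumes "\<omega> \<in> dual_group" shows "\<omega> (- \<gamma>) = cnj (\<omega> \<gamma>)"
proof -
  have "\<omega> (-\<gamma>) * \<omega> \<gamma> = 1"
    using dual_group_add[OF assms, of "-\<gamma>" \<gamma>] dual_group_zero[OF assms] by simp
  moreover have "cnj (\<omega> \<gamma>) * \<omega> \<gamma> = 1"
    using complex_norm_square[of "\<omega> \<gamma>"] dual_group_norm[OF assms, of \<gamma>] by (simp add: mult.commute)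
  ultimately show ?thesis
    using dual_group_nonzero[OF assms, of \<gamma>] by (metis mult_right_cancel)
qed

lemma char_mult_commute: "char_mult \<xi> \<omega> = char_mult \<omega> \<xi>"
  by (simp add: char_mult_def mult.commute)

lemma char_mult_assoc: "char_mult (char_mult \<xi> \<omega>) \<eta> = char_mult \<xi> (char_mult \<omega> \<eta>)"
  by (simp add: char_mult_def mult.assoc)

lemma char_mult_inv [simp]:
  assumes "\<xi> \<in> dual_group"
  shows "char_mult (char_inv \<xi>) (char_mult \<xi> \<omega>) = \<omega>"
    and "char_mult \<xi> (char_mult (char_inv \<xi>) \<omega>) = \<omega>"
  using dual_group_nonzero[OF assms] by (auto simp: char_mult_def char_inv_def fun_eq_iff)

lemma char_mult_div [simp]:
  "\<omega> \<in> dual_group \<Longrightarrow> char_mult (char_mult \<xi> (char_inv \<omega>)) \<omega> = \<xi>"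
  by (metis char_mult_assoc char_mult_commute char_mult_inv(2))

lemma char_inv_eq_iff:
  assumes "\<omega> \<in> dual_group" "\<zeta> \<in> dual_group"
  shows "char_mult \<xi> (char_inv \<omega>) = \<zeta> \<longleftrightarrow> \<omega> = char_mult (char_inv \<zeta>) \<xi>"
proof
  assume "char_mult \<xi> (char_inv \<omega>) = \<zeta>"
  then show "\<omega> = char_mult (char_inv \<zeta>) \<xi>"
    using assms by (metis char_mult_div char_mult_inv(1))
next
  assume "\<omega> = char_mult (char_inv \<zeta>) \<xi>"
  then show "char_mult \<xi> (char_inv \<omega>) = \<zeta>"
    using assms by (metis char_mult_assoc char_mult_commute char_mult_inv(1))
qed

lemma closed_dual_group: "closed (dual_group :: ('g::ab_group_add \<Rightarrow> complex) set)"
proof -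
  have eq: "dual_group = {\<omega>::'g \<Rightarrow> complex. \<forall>\<gamma>. norm (\<omega> \<gamma>) = 1} \<inter>
      {\<omega>. \<forall>\<gamma> \<gamma>'. \<omega> (\<gamma> + \<gamma>') = \<omega> \<gamma> * \<omega> \<gamma>'}"
    by (auto simp: dual_group_def)
  show ?thesis
    unfolding eq
    by (intro closed_Int closed_Collect_all closed_Collect_eq continuous_intros continuous_on_product_coordinates)
qed

lemma compact_dual_group: "compact (dual_group :: ('g::ab_group_add \<Rightarrow> complex) set)"
proof -
  have "compactin (product_topology (\<lambda>_::'g. euclidean) UNIV) (PiE UNIV (\<lambda>_. sphere (0::complex) 1))"
    by (simp add: compactin_PiE)
  then have "compact (PiE UNIV (\<lambda>_::'g. sphere (0::complex) 1))"
    by (simp add: euclidean_product_topology)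
  moreover have "dual_group = dual_group \<inter> PiE UNIV (\<lambda>_::'g. sphere (0::complex) 1)"
    by (auto simp: dual_group_def)
  ultimately show ?thesis
    by (metis closed_Int_compact closed_dual_group)
qed

lemma space_dual_borel [simp]: "space dual_borel = dual_group"
  by (simp add: dual_borel_def space_restrict_space)

lemma measurable_into_dual:
  fixes f :: "'a \<Rightarrow> 'g::{ab_group_add,countable} \<Rightarrow> complex"
  assumes "\<And>\<gamma>. (\<lambda>x. f x \<gamma>) \<in> borel_measurable M" "f \<in> space M \<rightarrow> dual_group"
  shows "f \<in> measurable M dual_borel"
  unfolding dual_borel_def
  by (intro measurable_restrict_space2 measurable_coordinatewise_then_product assms)

lemma measurable_eval: "(\<lambda>\<omega>. \<omega> \<gamma>) \<in> borel_measurable dual_borel"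
  unfolding dual_borel_def
  by (intro measurable_restrict_space1 borel_measurable_continuous_onI continuous_on_product_coordinates)


locale dual_setting =
  fixes \<alpha> :: "'g::{ab_group_add,countable} \<Rightarrow> 'g"
    and \<mu> :: "('g \<Rightarrow> complex) measure"
    and c :: "('g \<Rightarrow> complex) \<Rightarrow> ('g \<Rightarrow> complex)"
  assumes hom: "\<alpha> (x + y) = \<alpha> x + \<alpha> y"
    and index: "image_index \<alpha> > 1"
    and haar: "haar_measure \<mu>"
    and cross: "borel_cross_section \<alpha> c"
begin

abbreviation p :: "('g \<Rightarrow> complex) \<Rightarrow> ('g \<Rightarrow> complex)" where "p \<equiv> dual_endo \<alpha>"

abbreviation deg :: nat where "deg \<equiv> card (dual_kernel \<alpha>)"

lemma sets_haar [simp, measurable_cong]: "sets \<mu> = sets dual_borel"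
  using haar by (simp add: haar_measure_def)

lemma space_haar [simp]: "space \<mu> = dual_group"
  using sets_eq_imp_space_eq[OF sets_haar] by simp

sublocale haar_finite: finite_measure \<mu>
  using haar by (intro finite_measureI) (simp add: haar_measure_def)

lemma emeasure_haar_space: "emeasure \<mu> dual_group = 1"
  using haar by (simp add: haar_measure_def)

lemma measurable_haar_cong: "measurable \<mu> N = measurable dual_borel N"
  by (rule measurable_cong_sets) simp_all

lemma measurable_haar_cong': "measurable M \<mu> = measurable M dual_borel"
  by (rule measurable_cong_sets) simp_all

lemma measurable_eval_haar [measurable]: "(\<lambda>\<omega>. \<omega> \<gamma>) \<in> borel_measurable \<mu>"
  by (simp add: measurable_eval measurable_haar_cong)

lemma measurable_endo [measurable]: "p \<in> measurable \<mu> \<mu>"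
  unfolding measurable_haar_cong'
  by (intro measurable_into_dual) (auto simp: dual_endo_def dual_group_def hom)

lemma endo_dual: "\<omega> \<in> dual_group \<Longrightarrow> p \<omega> \<in> dual_group"
  by (auto simp: dual_endo_def dual_group_def hom)

lemma endo_mult: "p (char_mult \<xi> \<omega>) = char_mult (p \<xi>) (p \<omega>)"
  by (simp add: dual_endo_def char_mult_def)

lemma measurable_section [measurable]: "c \<in> measurable \<mu> \<mu>"
  using cross by (simp add: borel_cross_section_def measurable_haar_cong measurable_haar_cong')

lemma section_dual: "\<omega> \<in> dual_group \<Longrightarrow> c \<omega> \<in> dual_group"
  using measurable_space[OF measurable_section] by simp

lemma endo_section: "\<omega> \<in> dual_group \<Longrightarrow> p (c \<omega>) = \<omega>"
  using cross by (simp add: borel_cross_section_def)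

lemma measurable_char_mult [measurable]:
  assumes [measurable]: "f \<in> measurable M \<mu>" "g \<in> measurable M \<mu>"
  shows "(\<lambda>x. char_mult (f x) (g x)) \<in> measurable M \<mu>"
  unfolding measurable_haar_cong'
proof (rule measurable_into_dual)
  show "(\<lambda>x. char_mult (f x) (g x)) \<in> space M \<rightarrow> dual_group"
    using measurable_space[OF assms(1)] measurable_space[OF assms(2)] by (auto intro: dual_group_mult)
qed (simp add: char_mult_def)

lemma kernel_dual: "\<xi> \<in> dual_kernel \<alpha> \<Longrightarrow> \<xi> \<in> dual_group"
  by (simp add: dual_kernel_def fibre_def)

lemma fibre_dual: "\<zeta> \<in> fibre \<alpha> \<omega> \<Longrightarrow> \<zeta> \<in> dual_group"
  by (simp add: fibre_def)

lemma kernel_endo: "\<xi> \<in> dual_kernel \<alpha> \<Longrightarrow> p \<xi> = (\<lambda>_. 1)"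
  by (simp add: dual_kernel_def fibre_def)

lemma alpha_zero: "\<alpha> 0 = 0"
  using hom[of 0 0] by (metis add_cancel_left_right add_0)

text \<open>Some multiple of every group element lies in the image of \<open>\<alpha>\<close>, so a character in the kernel
  only takes values among the roots of unity of order at most the index, and there it is
  determined by its values on a finite set of coset representatives.\<close>

lemma finite_kernel: "finite (dual_kernel \<alpha>)"
proof -
  let ?coset = "\<lambda>x. (\<lambda>y. x + y) ` range \<alpha>"
  have fin: "finite (range ?coset)"
    by (rule card_ge_0_finite) (use index in \<open>unfold image_index_def, linarith\<close>)
  have self: "x \<in> ?coset x" for x
    using alpha_zero by (metis add_0_right image_eqI rangeI)
  define R where "R = (\<lambda>C. SOME x. x \<in> C) ` range ?coset"
  have finR: "finite R" using fin by (simp add: R_def)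
  define Z where "Z = (\<Union>k\<in>{1..image_index \<alpha>}. {z::complex. z ^ k = 1})"
  have finZ: "finite Z"
    unfolding Z_def by (auto intro!: finite_roots_unity)
  have "\<xi> \<gamma> = \<xi> (SOME x. x \<in> ?coset \<gamma>)" if "\<xi> \<in> dual_kernel \<alpha>" for \<xi> \<gamma>
  proof -
    have "(SOME x. x \<in> ?coset \<gamma>) \<in> ?coset \<gamma>"
      using self by (rule someI)
    then obtain y where y: "(SOME x. x \<in> ?coset \<gamma>) = \<gamma> + \<alpha> y" by auto
    have "\<xi> (\<alpha> y) = 1"
      using kernel_endo[OF that] by (auto simp: dual_endo_def fun_eq_iff)
    then show ?thesis
      unfolding y using dual_group_add[OF kernel_dual[OF that]] by simp
  qed
  then have rep: "\<exists>r\<in>R. \<forall>\<xi>\<in>dual_kernel \<alpha>. \<xi> \<gamma> = \<xi> r" for \<gamma>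
    unfolding R_def by blast
  have inj: "inj_on (\<lambda>\<xi>. restrict \<xi> R) (dual_kernel \<alpha>)"
  proof (intro inj_onI ext)
    fix \<xi> \<eta> \<gamma> assume "\<xi> \<in> dual_kernel \<alpha>" "\<eta> \<in> dual_kernel \<alpha>" and eq: "restrict \<xi> R = restrict \<eta> R"
    moreover obtain r where "r \<in> R" "\<forall>\<xi>\<in>dual_kernel \<alpha>. \<xi> \<gamma> = \<xi> r" using rep by blast
    ultimately show "\<xi> \<gamma> = \<eta> \<gamma>" by (metis eq restrict_apply')
  qed
  (* multiples of group elements; two of the first N + 1 multiples lie in the same coset *)
  define mul where "mul \<gamma> k = ((\<lambda>x. x + \<gamma>) ^^ k) 0" for \<gamma> :: 'g and k :: nat
  have mul_Suc: "mul \<gamma> (Suc k) = mul \<gamma> k + \<gamma>" for \<gamma> k by (simp add: mul_def)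
  have mul0: "mul \<gamma> 0 = 0" for \<gamma> by (simp add: mul_def)
  have mul_add: "mul \<gamma> (j + k) = mul \<gamma> j + mul \<gamma> k" for \<gamma> j k
    by (induction k) (simp_all add: mul_Suc mul0 add.assoc)
  have mul_char: "\<xi> (mul \<gamma> k) = \<xi> \<gamma> ^ k" if "\<xi> \<in> dual_group" for \<xi> \<gamma> k
    by (induction k) (simp_all add: mul_Suc mul0 dual_group_zero[OF that] dual_group_add[OF that] mult.commute)
  have "\<xi> \<gamma> \<in> Z" if "\<xi> \<in> dual_kernel \<alpha>" for \<xi> \<gamma>
  proof -
    have "\<not> inj_on (\<lambda>k. ?coset (mul \<gamma> k)) {0..image_index \<alpha>}"
    proof
      assume "inj_on (\<lambda>k. ?coset (mul \<gamma> k)) {0..image_index \<alpha>}"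
      then have "card {0..image_index \<alpha>} \<le> card (range ?coset)"
        by (rule card_inj_on_le) (use fin in auto)
      then show False by (simp add: image_index_def)
    qed
    then obtain j k where jk: "j < k" "k \<le> image_index \<alpha>" "?coset (mul \<gamma> j) = ?coset (mul \<gamma> k)"
      unfolding inj_on_def by (metis atLeastAtMost_iff linorder_neqE_nat)
    have "mul \<gamma> k \<in> ?coset (mul \<gamma> j)"
      unfolding jk(3) by (rule self)
    then obtain y where "mul \<gamma> k = mul \<gamma> j + \<alpha> y" by blast
    moreover have "mul \<gamma> k = mul \<gamma> j + mul \<gamma> (k - j)"
      using mul_add[of \<gamma> j "k - j"] jk by simp
    ultimately have "mul \<gamma> (k - j) = \<alpha> y" by simp
    then have "\<xi> \<gamma> ^ (k - j) = 1"
      using mul_char[OF kernel_dual[OF that], of \<gamma> "k - j"] kernel_endo[OF that]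
      by (auto simp: dual_endo_def fun_eq_iff)
    moreover have "k - j \<in> {1..image_index \<alpha>}" using jk by auto
    ultimately show ?thesis unfolding Z_def by blast
  qed
  then have "(\<lambda>\<xi>. restrict \<xi> R) ` dual_kernel \<alpha> \<subseteq> PiE R (\<lambda>_. Z)"
    by auto
  then have "finite ((\<lambda>\<xi>. restrict \<xi> R) ` dual_kernel \<alpha>)"
    by (rule finite_subset) (intro finite_PiE finR finZ)
  then show ?thesis
    using inj by (rule finite_imageD)
qed

lemma one_kernel: "(\<lambda>_. 1) \<in> dual_kernel \<alpha>"
  by (simp add: dual_kernel_def fibre_def dual_group_one dual_endo_def)

lemma deg_pos: "deg > 0"
  using finite_kernel one_kernel by (auto simp: card_gt_0_iff)

lemma fibre_section:
  assumes "\<omega> \<in> dual_group"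
  shows "bij_betw (\<lambda>\<xi>. char_mult \<xi> (c \<omega>)) (dual_kernel \<alpha>) (fibre \<alpha> \<omega>)"
proof (rule bij_betw_byWitness[where f' = "\<lambda>\<zeta>. char_mult \<zeta> (char_inv (c \<omega>))"])
  have c: "c \<omega> \<in> dual_group" using assms by (rule section_dual)
  show "\<forall>\<xi>\<in>dual_kernel \<alpha>. char_mult (char_mult \<xi> (c \<omega>)) (char_inv (c \<omega>)) = \<xi>"
    by (metis c char_mult_assoc char_mult_commute char_mult_inv(1))
  show "\<forall>\<zeta>\<in>fibre \<alpha> \<omega>. char_mult (char_mult \<zeta> (char_inv (c \<omega>))) (c \<omega>) = \<zeta>"
    using c by simp
  show "(\<lambda>\<xi>. char_mult \<xi> (c \<omega>)) ` dual_kernel \<alpha> \<subseteq> fibre \<alpha> \<omega>"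
    using c assms by (auto simp: dual_kernel_def fibre_def endo_mult endo_section dual_group_mult)
      (simp add: char_mult_def)
  show "(\<lambda>\<zeta>. char_mult \<zeta> (char_inv (c \<omega>))) ` fibre \<alpha> \<omega> \<subseteq> dual_kernel \<alpha>"
  proof clarify
    fix \<zeta> assume z: "\<zeta> \<in> fibre \<alpha> \<omega>"
    have "p (char_inv (c \<omega>)) = char_inv (p (c \<omega>))" by (simp add: dual_endo_def char_inv_def)
    then show "char_mult \<zeta> (char_inv (c \<omega>)) \<in> dual_kernel \<alpha>"
      using z c assms dual_group_nonzero[OF assms]
      by (auto simp: dual_kernel_def fibre_def endo_mult endo_section dual_group_mult dual_group_inv)
         (auto simp: char_mult_def char_inv_def)
  qed
qed

lemma finite_fibre: "\<omega> \<in> dual_group \<Longrightarrow> finite (fibre \<alpha> \<omega>)"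
  using bij_betw_finite[OF fibre_section] finite_kernel by blast

lemma card_fibre: "\<omega> \<in> dual_group \<Longrightarrow> card (fibre \<alpha> \<omega>) = deg"
  using bij_betw_same_card[OF fibre_section] by simp

lemma sum_fibre:
  "\<omega> \<in> dual_group \<Longrightarrow> (\<Sum>\<zeta>\<in>fibre \<alpha> \<omega>. f \<zeta>) = (\<Sum>\<xi>\<in>dual_kernel \<alpha>. f (char_mult \<xi> (c \<omega>)))"
  using sum.reindex_bij_betw[OF fibre_section, of \<omega> f] by simp

lemma mem_fibre_iff: "\<zeta> \<in> fibre \<alpha> \<omega> \<longleftrightarrow> \<zeta> \<in> dual_group \<and> p \<zeta> = \<omega>"
  by (simp add: fibre_def)

lemma measurable_sum_fibre [measurable]:
  fixes f :: "('g \<Rightarrow> complex) \<Rightarrow> 'b::{second_countable_topology, topological_comm_monoid_add}"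
  assumes [measurable]: "f \<in> borel_measurable \<mu>"
  shows "(\<lambda>\<omega>. \<Sum>\<zeta>\<in>fibre \<alpha> \<omega>. f \<zeta>) \<in> borel_measurable \<mu>"
proof -
  have "(\<lambda>\<omega>. f (char_mult \<xi> (c \<omega>))) \<in> borel_measurable \<mu>" if "\<xi> \<in> dual_kernel \<alpha>" for \<xi>
  proof -
    have [measurable]: "(\<lambda>_. \<xi>) \<in> measurable \<mu> \<mu>" using kernel_dual[OF that] by simp
    show ?thesis by measurable
  qed
  then have "(\<lambda>\<omega>. \<Sum>\<xi>\<in>dual_kernel \<alpha>. f (char_mult \<xi> (c \<omega>))) \<in> borel_measurable \<mu>"
    by (rule borel_measurable_sum)
  then show ?thesis
    by (subst measurable_cong[OF sum_fibre]) simp_all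
qed

lemma nn_integral_translate:
  assumes [measurable]: "f \<in> borel_measurable \<mu>" and \<xi>: "\<xi> \<in> dual_group"
  shows "(\<integral>\<^sup>+\<omega>. f (char_mult \<xi> \<omega>) \<partial>\<mu>) = (\<integral>\<^sup>+\<omega>. f \<omega> \<partial>\<mu>)"
proof -
  have m[measurable]: "(\<lambda>\<omega>. char_mult \<xi> \<omega>) \<in> measurable \<mu> \<mu>"
    by (intro measurable_char_mult) (use \<xi> in auto)
  have "distr \<mu> \<mu> (char_mult \<xi>) = \<mu>"
  proof (rule measure_eqI)
    fix S assume "S \<in> sets (distr \<mu> \<mu> (char_mult \<xi>))"
    then have S: "S \<in> sets \<mu>" by simp
    have sub: "S \<subseteq> dual_group" using sets.sets_into_space[OF S] by simp
    have "char_mult \<xi> -` S \<inter> space \<mu> = char_mult (char_inv \<xi>) ` S"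
    proof (intro equalityI subsetI)
      fix \<omega> assume "\<omega> \<in> char_mult \<xi> -` S \<inter> space \<mu>"
      then show "\<omega> \<in> char_mult (char_inv \<xi>) ` S"
        using \<xi> by (intro image_eqI[of _ _ "char_mult \<xi> \<omega>"]) auto
    qed (use sub \<xi> in \<open>auto simp: dual_group_mult dual_group_inv\<close>)
    moreover have "emeasure \<mu> (char_mult (char_inv \<xi>) ` S) = emeasure \<mu> S"
      using haar S dual_group_inv[OF \<xi>] unfolding haar_measure_def by blast
    ultimately show "emeasure (distr \<mu> \<mu> (char_mult \<xi>)) S = emeasure \<mu> S"
      using m S by (simp add: emeasure_distr)
  qed simp
  then have "(\<integral>\<^sup>+\<omega>. f \<omega> \<partial>\<mu>) = (\<integral>\<^sup>+\<omega>. f \<omega> \<partial>distr \<mu> \<mu> (char_mult \<xi>))" by simp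
  also have "\<dots> = (\<integral>\<^sup>+\<omega>. f (char_mult \<xi> \<omega>) \<partial>\<mu>)"
    by (rule nn_integral_distr) (use m in simp_all)
  finally show ?thesis by simp
qed

lemma sum_fibre_translate:
  assumes "\<omega> \<in> dual_group" "\<eta> \<in> dual_group"
  shows "(\<Sum>\<zeta>\<in>fibre \<alpha> \<omega>. f (char_mult \<eta> \<zeta>)) = (\<Sum>\<zeta>\<in>fibre \<alpha> (char_mult (p \<eta>) \<omega>). f \<zeta>)"
proof (rule sum.reindex_bij_witness[where i = "\<lambda>\<zeta>. char_mult (char_inv \<eta>) \<zeta>" and j = "\<lambda>\<zeta>. char_mult \<eta> \<zeta>"])
  fix \<zeta> assume "\<zeta> \<in> fibre \<alpha> (char_mult (p \<eta>) \<omega>)"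
  moreover have "p (char_inv \<eta>) = char_inv (p \<eta>)" by (simp add: dual_endo_def char_inv_def)
  ultimately show "char_mult (char_inv \<eta>) \<zeta> \<in> fibre \<alpha> \<omega>"
    using assms by (simp add: mem_fibre_iff endo_mult dual_group_mult dual_group_inv endo_dual)
qed (use assms in \<open>auto simp: mem_fibre_iff endo_mult dual_group_mult\<close>)

text \<open>Averaging over translates and exchanging the integrals reduces the inner integral to the
  integral of \<open>f\<close>: the sum over a fibre of a translate by \<open>\<eta>\<close> is the sum over the fibre translated
  by \<open>\<alpha>\<^sup>* \<eta>\<close>, so translating \<open>f\<close> does not change the left-hand side.\<close>

lemma nn_integral_sum_fibre:
  assumes [measurable]: "f \<in> borel_measurable \<mu>"
  shows "(\<integral>\<^sup>+\<omega>. (\<Sum>\<zeta>\<in>fibre \<alpha> \<omega>. f \<zeta>) \<partial>\<mu>) = of_nat deg * (\<integral>\<^sup>+\<omega>. f \<omega> \<partial>\<mu>)"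
proof -
  interpret P: pair_sigma_finite \<mu> \<mu> ..
  let ?\<Phi> = "\<integral>\<^sup>+\<omega>. (\<Sum>\<zeta>\<in>fibre \<alpha> \<omega>. f \<zeta>) \<partial>\<mu>"
  have inv: "(\<integral>\<^sup>+\<omega>. (\<Sum>\<zeta>\<in>fibre \<alpha> \<omega>. f (char_mult \<eta> \<zeta>)) \<partial>\<mu>) = ?\<Phi>" if "\<eta> \<in> dual_group" for \<eta>
  proof -
    have "(\<integral>\<^sup>+\<omega>. (\<Sum>\<zeta>\<in>fibre \<alpha> \<omega>. f (char_mult \<eta> \<zeta>)) \<partial>\<mu>)
        = (\<integral>\<^sup>+\<omega>. (\<Sum>\<zeta>\<in>fibre \<alpha> (char_mult (p \<eta>) \<omega>). f \<zeta>) \<partial>\<mu>)"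
      by (intro nn_integral_cong sum_fibre_translate) (use that in simp_all)
    also have "\<dots> = ?\<Phi>"
      by (rule nn_integral_translate[of "\<lambda>\<omega>. \<Sum>\<zeta>\<in>fibre \<alpha> \<omega>. f \<zeta>"]) (use that endo_dual in simp_all)
    finally show ?thesis .
  qed
  have k: "(\<lambda>_. \<xi>) \<in> measurable M \<mu>" if "\<xi> \<in> dual_kernel \<alpha>" for \<xi> and M :: "'z measure"
    using kernel_dual[OF that] by simp
  have m: "(\<lambda>(\<eta>, \<omega>). \<Sum>\<xi>\<in>dual_kernel \<alpha>. f (char_mult \<eta> (char_mult \<xi> (c \<omega>)))) \<in> borel_measurable (\<mu> \<Otimes>\<^sub>M \<mu>)"
  proof -
    have "(\<lambda>x. f (char_mult (fst x) (char_mult \<xi> (c (snd x))))) \<in> borel_measurable (\<mu> \<Otimes>\<^sub>M \<mu>)"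
      if "\<xi> \<in> dual_kernel \<alpha>" for \<xi>
    proof -
      have [measurable]: "(\<lambda>_. \<xi>) \<in> measurable (\<mu> \<Otimes>\<^sub>M \<mu>) \<mu>" using that by (rule k)
      show ?thesis by measurable
    qed
    then show ?thesis unfolding split_beta by (rule borel_measurable_sum)
  qed
  have "?\<Phi> = (\<integral>\<^sup>+\<eta>. ?\<Phi> \<partial>\<mu>)"
    by (simp add: emeasure_haar_space)
  also have "\<dots> = (\<integral>\<^sup>+\<eta>. (\<integral>\<^sup>+\<omega>. (\<Sum>\<xi>\<in>dual_kernel \<alpha>. f (char_mult \<eta> (char_mult \<xi> (c \<omega>)))) \<partial>\<mu>) \<partial>\<mu>)"
  proof (rule nn_integral_cong)
    fix \<eta> assume "\<eta> \<in> space \<mu>"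
    then have "?\<Phi> = (\<integral>\<^sup>+\<omega>. (\<Sum>\<zeta>\<in>fibre \<alpha> \<omega>. f (char_mult \<eta> \<zeta>)) \<partial>\<mu>)"
      using inv by simp
    also have "\<dots> = (\<integral>\<^sup>+\<omega>. (\<Sum>\<xi>\<in>dual_kernel \<alpha>. f (char_mult \<eta> (char_mult \<xi> (c \<omega>)))) \<partial>\<mu>)"
      by (intro nn_integral_cong sum_fibre) simp
    finally show "?\<Phi> = (\<integral>\<^sup>+\<omega>. (\<Sum>\<xi>\<in>dual_kernel \<alpha>. f (char_mult \<eta> (char_mult \<xi> (c \<omega>)))) \<partial>\<mu>)" .
  qed
  also have "\<dots> = (\<integral>\<^sup>+\<omega>. (\<integral>\<^sup>+\<eta>. (\<Sum>\<xi>\<in>dual_kernel \<alpha>. f (char_mult \<eta> (char_mult \<xi> (c \<omega>)))) \<partial>\<mu>) \<partial>\<mu>)"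
    using P.Fubini'[OF m] by simp
  also have "\<dots> = (\<integral>\<^sup>+\<omega>. (\<Sum>\<xi>\<in>dual_kernel \<alpha>. \<integral>\<^sup>+\<eta>. f (char_mult (char_mult \<xi> (c \<omega>)) \<eta>) \<partial>\<mu>) \<partial>\<mu>)"
  proof (intro nn_integral_cong)
    fix \<omega> assume "\<omega> \<in> space \<mu>"
    then have d: "char_mult \<xi> (c \<omega>) \<in> dual_group" if "\<xi> \<in> dual_kernel \<alpha>" for \<xi>
      using dual_group_mult[OF kernel_dual section_dual] that by simp
    have "(\<lambda>\<eta>. f (char_mult (char_mult \<xi> (c \<omega>)) \<eta>)) \<in> borel_measurable \<mu>" if "\<xi> \<in> dual_kernel \<alpha>" for \<xi>
    proof -
      have [measurable]: "(\<lambda>\<eta>. char_mult (char_mult \<xi> (c \<omega>)) \<eta>) \<in> measurable \<mu> \<mu>"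
        by (rule measurable_char_mult) (use d[OF that] in auto)
      show ?thesis by measurable
    qed
    then show "(\<integral>\<^sup>+\<eta>. (\<Sum>\<xi>\<in>dual_kernel \<alpha>. f (char_mult \<eta> (char_mult \<xi> (c \<omega>)))) \<partial>\<mu>)
        = (\<Sum>\<xi>\<in>dual_kernel \<alpha>. \<integral>\<^sup>+\<eta>. f (char_mult (char_mult \<xi> (c \<omega>)) \<eta>) \<partial>\<mu>)"
      by (subst char_mult_commute, subst nn_integral_sum) auto
  qed
  also have "\<dots> = (\<integral>\<^sup>+\<omega>. (\<Sum>\<xi>\<in>dual_kernel \<alpha>. \<integral>\<^sup>+\<eta>. f \<eta> \<partial>\<mu>) \<partial>\<mu>)"
  proof (rule nn_integral_cong, rule sum.cong[OF refl])
    fix \<omega> \<xi> assume "\<omega> \<in> space \<mu>" "\<xi> \<in> dual_kernel \<alpha>"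
    then have "char_mult \<xi> (c \<omega>) \<in> dual_group"
      using dual_group_mult[OF kernel_dual section_dual] by simp
    then show "(\<integral>\<^sup>+\<eta>. f (char_mult (char_mult \<xi> (c \<omega>)) \<eta>) \<partial>\<mu>) = (\<integral>\<^sup>+\<eta>. f \<eta> \<partial>\<mu>)"
      by (rule nn_integral_translate[OF assms])
  qed
  also have "\<dots> = of_nat deg * (\<integral>\<^sup>+\<omega>. f \<omega> \<partial>\<mu>)"
    by (simp add: emeasure_haar_space)
  finally show ?thesis .
qed

text \<open>The fibre formula for the indicator function of a null set, and of its preimage, moves null sets
  along the endomorphism.\<close>

lemma AE_fibre:
  assumes "AE \<zeta> in \<mu>. Q \<zeta>"
  shows "AE \<omega> in \<mu>. \<forall>\<zeta>\<in>fibre \<alpha> \<omega>. Q \<zeta>"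
proof -
  obtain N where N: "N \<in> null_sets \<mu>" "{\<zeta>\<in>space \<mu>. \<not> Q \<zeta>} \<subseteq> N"
    using assms by (auto simp: eventually_ae_filter)
  have Nm: "N \<in> sets \<mu>" using N by blast
  note [measurable] = Nm
  have N0: "(\<integral>\<^sup>+\<omega>. indicator N \<omega> \<partial>\<mu>) = 0"
    using N nn_integral_indicator[OF Nm] by (simp add: null_setsD1)
  have "(\<integral>\<^sup>+\<omega>. (\<Sum>\<zeta>\<in>fibre \<alpha> \<omega>. indicator N \<zeta> :: ennreal) \<partial>\<mu>) = 0"
    using N0 by (subst nn_integral_sum_fibre) simp_all
  then have "AE \<omega> in \<mu>. (\<Sum>\<zeta>\<in>fibre \<alpha> \<omega>. indicator N \<zeta> :: ennreal) = 0"
    by (subst (asm) nn_integral_0_iff_AE) measurable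
  then show ?thesis
  proof (rule AE_mp, intro AE_I2 impI ballI)
    fix \<omega> \<zeta> assume "\<omega> \<in> space \<mu>" "(\<Sum>\<zeta>\<in>fibre \<alpha> \<omega>. indicator N \<zeta> :: ennreal) = 0" "\<zeta> \<in> fibre \<alpha> \<omega>"
    then have "\<zeta> \<notin> N" "\<zeta> \<in> space \<mu>"
      using finite_fibre by (auto simp: sum_eq_0_iff fibre_dual split: split_indicator_asm)
    then show "Q \<zeta>" using N by auto
  qed
qed

lemma AE_endo:
  assumes "AE \<omega> in \<mu>. P \<omega>"
  shows "AE \<zeta> in \<mu>. P (p \<zeta>)"
proof -
  obtain N where N: "N \<in> null_sets \<mu>" "{\<zeta>\<in>space \<mu>. \<not> P \<zeta>} \<subseteq> N"
    using assms by (auto simp: eventually_ae_filter)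
  have Nm: "N \<in> sets \<mu>" using N by blast
  note [measurable] = Nm
  have N0: "(\<integral>\<^sup>+\<omega>. indicator N \<omega> \<partial>\<mu>) = 0"
    using N nn_integral_indicator[OF Nm] by (simp add: null_setsD1)
  have "of_nat deg * (\<integral>\<^sup>+\<zeta>. indicator N (p \<zeta>) \<partial>\<mu>) = (\<integral>\<^sup>+\<omega>. (\<Sum>\<zeta>\<in>fibre \<alpha> \<omega>. indicator N (p \<zeta>)) \<partial>\<mu>)"
    by (subst nn_integral_sum_fibre) simp_all
  also have "\<dots> = (\<integral>\<^sup>+\<omega>. of_nat deg * indicator N \<omega> \<partial>\<mu>)"
  proof (intro nn_integral_cong)
    fix \<omega> assume "\<omega> \<in> space \<mu>"
    then have "(\<Sum>\<zeta>\<in>fibre \<alpha> \<omega>. indicator N (p \<zeta>) :: ennreal) = (\<Sum>\<zeta>\<in>fibre \<alpha> \<omega>. indicator N \<omega>)"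
      by (intro sum.cong) (auto simp: mem_fibre_iff)
    then show "(\<Sum>\<zeta>\<in>fibre \<alpha> \<omega>. indicator N (p \<zeta>)) = of_nat deg * (indicator N \<omega> :: ennreal)"
      using \<open>\<omega> \<in> space \<mu>\<close> by (simp add: card_fibre)
  qed
  also have "\<dots> = 0"
    using N0 by (subst nn_integral_cmult) simp_all
  finally have "(\<integral>\<^sup>+\<zeta>. indicator N (p \<zeta>) \<partial>\<mu>) = 0"
    using deg_pos by simp
  then have "AE \<zeta> in \<mu>. (indicator N (p \<zeta>) :: ennreal) = 0"
    by (subst (asm) nn_integral_0_iff_AE) measurable
  then show ?thesis
  proof (rule AE_mp, intro AE_I2 impI)
    fix \<zeta> assume "\<zeta> \<in> space \<mu>" "(indicator N (p \<zeta>) :: ennreal) = 0"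
    then have "p \<zeta> \<notin> N" "p \<zeta> \<in> space \<mu>"
      by (auto simp: endo_dual split: split_indicator_asm)
    then show "P (p \<zeta>)" using N by auto
  qed
qed


end

section \<open>Uniqueness of Fourier coefficients\<close>

text \<open>Multiplication by a character and by its conjugate are closure rules, so that the vanishing of
  all integrals against characters passes to all trigonometric polynomials by induction.\<close>

inductive_set trig_poly :: "(('g::ab_group_add \<Rightarrow> complex) \<Rightarrow> complex) set" where
  const: "(\<lambda>_. a) \<in> trig_poly"
| char: "P \<in> trig_poly \<Longrightarrow> (\<lambda>\<omega>. \<omega> \<gamma> * P \<omega>) \<in> trig_poly"
| cnj_char: "P \<in> trig_poly \<Longrightarrow> (\<lambda>\<omega>. cnj (\<omega> \<gamma>) * P \<omega>) \<in> trig_poly"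
| add: "P \<in> trig_poly \<Longrightarrow> Q \<in> trig_poly \<Longrightarrow> (\<lambda>\<omega>. P \<omega> + Q \<omega>) \<in> trig_poly"

lemma trig_poly_mult:
  assumes "P \<in> trig_poly" "Q \<in> trig_poly"
  shows "(\<lambda>\<omega>. P \<omega> * Q \<omega>) \<in> trig_poly"
  using assms
proof (induction P rule: trig_poly.induct)
  case (const a)
  from const show ?case
  proof (induction Q rule: trig_poly.induct)
    case (const b)
    show ?case using trig_poly.const[of "a * b"] by simp
  next
    case (char P \<gamma>)
    then show ?case using trig_poly.char[of "\<lambda>\<omega>. a * P \<omega>" \<gamma>] by (simp add: mult.left_commute)
  next
    case (cnj_char P \<gamma>)
    then show ?case using trig_poly.cnj_char[of "\<lambda>\<omega>. a * P \<omega>" \<gamma>] by (simp add: mult.left_commute)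
  next
    case (add P Q)
    then show ?case using trig_poly.add[of "\<lambda>\<omega>. a * P \<omega>" "\<lambda>\<omega>. a * Q \<omega>"] by (simp add: distrib_left)
  qed
next
  case (char P \<gamma>)
  then show ?case using trig_poly.char[of "\<lambda>\<omega>. P \<omega> * Q \<omega>" \<gamma>] by (simp add: mult.assoc)
next
  case (cnj_char P \<gamma>)
  then show ?case using trig_poly.cnj_char[of "\<lambda>\<omega>. P \<omega> * Q \<omega>" \<gamma>] by (simp add: mult.assoc)
next
  case (add P P')
  then show ?case using trig_poly.add[of "\<lambda>\<omega>. P \<omega> * Q \<omega>" "\<lambda>\<omega>. P' \<omega> * Q \<omega>"] by (simp add: distrib_right)
qed

lemma continuous_on_trig_poly: "P \<in> trig_poly \<Longrightarrow> continuous_on UNIV P"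
  by (induction P rule: trig_poly.induct)
     (auto intro!: continuous_intros continuous_on_product_coordinates)

lemma function_ring_on_trig_poly:
  "function_ring_on {f. \<exists>P\<in>trig_poly. \<forall>\<omega>. complex_of_real (f \<omega>) = P \<omega>}
     (dual_group :: ('g::{ab_group_add,countable} \<Rightarrow> complex) set)"
proof
  show "compact (dual_group :: ('g \<Rightarrow> complex) set)" by (rule compact_dual_group)
next
  fix f :: "('g \<Rightarrow> complex) \<Rightarrow> real"
  assume "f \<in> {f. \<exists>P\<in>trig_poly. \<forall>\<omega>. complex_of_real (f \<omega>) = P \<omega>}"
  then obtain P where P: "P \<in> trig_poly" "\<forall>\<omega>. complex_of_real (f \<omega>) = P \<omega>" by auto
  have "f = (\<lambda>\<omega>. Re (P \<omega>))" using P(2) by (metis Re_complex_of_real)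
  then show "continuous_on dual_group f"
    using continuous_on_trig_poly[OF P(1)] by (auto intro!: continuous_intros intro: continuous_on_subset)
next
  fix f g :: "('g \<Rightarrow> complex) \<Rightarrow> real"
  assume f: "f \<in> {f. \<exists>P\<in>trig_poly. \<forall>\<omega>. complex_of_real (f \<omega>) = P \<omega>}"
    and g: "g \<in> {f. \<exists>P\<in>trig_poly. \<forall>\<omega>. complex_of_real (f \<omega>) = P \<omega>}"
  from f obtain P where P: "P \<in> trig_poly" "\<forall>\<omega>. complex_of_real (f \<omega>) = P \<omega>" by auto
  from g obtain Q where Q: "Q \<in> trig_poly" "\<forall>\<omega>. complex_of_real (g \<omega>) = Q \<omega>" by auto
  show "(\<lambda>\<omega>. f \<omega> + g \<omega>) \<in> {f. \<exists>P\<in>trig_poly. \<forall>\<omega>. complex_of_real (f \<omega>) = P \<omega>}"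
    using trig_poly.add[OF P(1) Q(1)] P(2) Q(2) by auto
  show "(\<lambda>\<omega>. f \<omega> * g \<omega>) \<in> {f. \<exists>P\<in>trig_poly. \<forall>\<omega>. complex_of_real (f \<omega>) = P \<omega>}"
    using trig_poly_mult[OF P(1) Q(1)] P(2) Q(2) by auto
next
  fix a :: real
  show "(\<lambda>_. a) \<in> {f. \<exists>P\<in>trig_poly. \<forall>\<omega>::'g \<Rightarrow> complex. complex_of_real (f \<omega>) = P \<omega>}"
    using trig_poly.const[of "complex_of_real a"] by auto
next
  fix x y :: "'g \<Rightarrow> complex"
  assume "x \<noteq> y"
  then obtain \<gamma> where \<gamma>: "x \<gamma> \<noteq> y \<gamma>" by auto
  have c: "(\<lambda>\<omega>::'g \<Rightarrow> complex. a * \<omega> \<gamma>) \<in> trig_poly" "(\<lambda>\<omega>::'g \<Rightarrow> complex. a * cnj (\<omega> \<gamma>)) \<in> trig_poly" for a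
    using trig_poly.char[OF trig_poly.const, of \<gamma> a] trig_poly.cnj_char[OF trig_poly.const, of \<gamma> a]
    by (simp_all add: mult.commute)
  have re: "complex_of_real (Re z) = (1/2) * z + (1/2) * cnj z"
    and im: "complex_of_real (Im z) = (- \<i>/2) * z + (\<i>/2) * cnj z" for z
    by (simp_all add: complex_eq_iff)
  have "(\<lambda>\<omega>. Re (\<omega> \<gamma>)) \<in> {f. \<exists>P\<in>trig_poly. \<forall>\<omega>::'g \<Rightarrow> complex. complex_of_real (f \<omega>) = P \<omega>}"
    using trig_poly.add[OF c(1)[of "1/2"] c(2)[of "1/2"]] re by (intro CollectI bexI) auto
  moreover have "(\<lambda>\<omega>. Im (\<omega> \<gamma>)) \<in> {f. \<exists>P\<in>trig_poly. \<forall>\<omega>::'g \<Rightarrow> complex. complex_of_real (f \<omega>) = P \<omega>}"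
    using trig_poly.add[OF c(1)[of "- \<i>/2"] c(2)[of "\<i>/2"]] im by (intro CollectI bexI) auto
  moreover have "Re (x \<gamma>) \<noteq> Re (y \<gamma>) \<or> Im (x \<gamma>) \<noteq> Im (y \<gamma>)"
    using \<gamma> by (auto simp: complex_eq_iff)
  ultimately show "\<exists>f\<in>{f. \<exists>P\<in>trig_poly. \<forall>\<omega>. complex_of_real (f \<omega>) = P \<omega>}. f x \<noteq> f y"
    by (elim disjE) (rule bexI, assumption, assumption)+
qed

lemma (in dual_setting) integrable_continuous_mult:
  fixes f :: "('g \<Rightarrow> complex) \<Rightarrow> complex"
  assumes F: "integrable \<mu> F" and f: "continuous_on dual_group f"
  shows "integrable \<mu> (\<lambda>\<omega>. f \<omega> * F \<omega>)"
proof -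
  have "compact (f ` dual_group)" using f compact_dual_group by (rule compact_continuous_image)
  then obtain B where B: "\<forall>\<omega>\<in>dual_group. norm (f \<omega>) \<le> B"
    using compact_imp_bounded by (force simp: bounded_iff)
  have [measurable]: "f \<in> borel_measurable \<mu>"
    unfolding measurable_haar_cong dual_borel_def
    by (rule borel_measurable_continuous_on_restrict[OF f])
  show ?thesis
  proof (rule Bochner_Integration.integrable_bound)
    show "integrable \<mu> (\<lambda>\<omega>. B * norm (F \<omega>))" using F by simp
    show "(\<lambda>\<omega>. f \<omega> * F \<omega>) \<in> borel_measurable \<mu>" using F by measurable
    show "AE \<omega> in \<mu>. norm (f \<omega> * F \<omega>) \<le> norm (B * norm (F \<omega>))"
    proof (rule AE_I2)
      fix \<omega> assume "\<omega> \<in> space \<mu>"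
      then have "norm (f \<omega>) \<le> B" using B by simp
      then have "norm (f \<omega>) * norm (F \<omega>) \<le> \<bar>B\<bar> * norm (F \<omega>)" by (intro mult_right_mono) auto
      then show "norm (f \<omega> * F \<omega>) \<le> norm (B * norm (F \<omega>))" by (simp add: norm_mult abs_mult)
    qed
  qed
qed

context dual_setting
begin

lemma trig_poly_orthogonal:
  assumes F: "integrable \<mu> F" and zero: "\<And>\<gamma>. (\<integral>\<omega>. \<omega> \<gamma> * F \<omega> \<partial>\<mu>) = 0" and P: "P \<in> trig_poly"
  shows "(\<integral>\<omega>. \<omega> \<gamma> * (P \<omega> * F \<omega>) \<partial>\<mu>) = 0"
  using P
proof (induction P arbitrary: \<gamma> rule: trig_poly.induct)
  case (const a)
  have "(\<integral>\<omega>. \<omega> \<gamma> * (a * F \<omega>) \<partial>\<mu>) = (\<integral>\<omega>. a * (\<omega> \<gamma> * F \<omega>) \<partial>\<mu>)"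
    by (simp add: mult.left_commute)
  then show ?case using zero[of \<gamma>] by simp
next
  case (char P \<delta>)
  have "(\<integral>\<omega>. \<omega> \<gamma> * (\<omega> \<delta> * P \<omega> * F \<omega>) \<partial>\<mu>) = (\<integral>\<omega>. \<omega> (\<gamma> + \<delta>) * (P \<omega> * F \<omega>) \<partial>\<mu>)"
    by (intro Bochner_Integration.integral_cong) (simp_all add: dual_group_add mult.assoc)
  then show ?case using char.IH by simp
next
  case (cnj_char P \<delta>)
  have "(\<integral>\<omega>. \<omega> \<gamma> * (cnj (\<omega> \<delta>) * P \<omega> * F \<omega>) \<partial>\<mu>) = (\<integral>\<omega>. \<omega> (\<gamma> + - \<delta>) * (P \<omega> * F \<omega>) \<partial>\<mu>)"
    by (intro Bochner_Integration.integral_cong refl)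
       (simp add: dual_group_add dual_group_uminus mult.assoc del: add_uminus_conv_diff)
  then show ?case using cnj_char.IH by simp
next
  case (add P Q)
  have i: "integrable \<mu> (\<lambda>\<omega>. \<omega> \<gamma> * (P \<omega> * F \<omega>))" if "P \<in> trig_poly" for P
  proof -
    have "(\<lambda>\<omega>. \<omega> \<gamma> * P \<omega>) \<in> trig_poly" using that by (rule trig_poly.char)
    then have "continuous_on dual_group (\<lambda>\<omega>. \<omega> \<gamma> * P \<omega>)"
      using continuous_on_trig_poly continuous_on_subset by blast
    from integrable_continuous_mult[OF F this] show ?thesis by (simp add: mult.assoc)
  qed
  have "(\<integral>\<omega>. \<omega> \<gamma> * ((P \<omega> + Q \<omega>) * F \<omega>) \<partial>\<mu>)
      = (\<integral>\<omega>. \<omega> \<gamma> * (P \<omega> * F \<omega>) + \<omega> \<gamma> * (Q \<omega> * F \<omega>) \<partial>\<mu>)"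
    by (simp add: algebra_simps)
  also have "\<dots> = 0" using add i by simp
  finally show ?case .
qed

text \<open>Uniform approximation by trigonometric polynomials changes the integral by at most a small
  multiple of the integral of \<open>norm F\<close>.\<close>

lemma continuous_orthogonal:
  fixes f :: "('g \<Rightarrow> complex) \<Rightarrow> real"
  assumes F: "integrable \<mu> F" and zero: "\<And>\<gamma>. (\<integral>\<omega>. \<omega> \<gamma> * F \<omega> \<partial>\<mu>) = 0"
    and f: "continuous_on dual_group f"
  shows "(\<integral>\<omega>. of_real (f \<omega>) * F \<omega> \<partial>\<mu>) = 0"
proof -
  interpret R: function_ring_on "{f. \<exists>P\<in>trig_poly. \<forall>\<omega>. complex_of_real (f \<omega>) = P \<omega>}"
      "dual_group :: ('g \<Rightarrow> complex) set"
    by (rule function_ring_on_trig_poly)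
  let ?I = "\<integral>\<omega>. of_real (f \<omega>) * F \<omega> \<partial>\<mu>" and ?N = "\<integral>\<omega>. norm (F \<omega>) \<partial>\<mu>"
  have "norm ?I \<le> e * ?N" if "e > 0" for e
  proof -
    obtain g P where g: "\<forall>\<omega>\<in>dual_group. \<bar>f \<omega> - g \<omega>\<bar> < e" and P: "P \<in> trig_poly" "\<forall>\<omega>. complex_of_real (g \<omega>) = P \<omega>"
      using R.Stone_Weierstrass_basic[OF f \<open>e > 0\<close>] by auto
    have "(\<integral>\<omega>. P \<omega> * F \<omega> \<partial>\<mu>) = (\<integral>\<omega>. \<omega> 0 * (P \<omega> * F \<omega>) \<partial>\<mu>)"
      by (intro Bochner_Integration.integral_cong) (simp_all add: dual_group_zero)
    then have P0: "(\<integral>\<omega>. P \<omega> * F \<omega> \<partial>\<mu>) = 0"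
      using trig_poly_orthogonal[OF F zero P(1), of 0] by simp
    have cP: "continuous_on dual_group P"
      using continuous_on_trig_poly[OF P(1)] continuous_on_subset by blast
    have i1: "integrable \<mu> (\<lambda>\<omega>. of_real (f \<omega>) * F \<omega>)" "integrable \<mu> (\<lambda>\<omega>. P \<omega> * F \<omega>)"
      using f cP by (auto intro!: integrable_continuous_mult F continuous_intros)
    have "?I = (\<integral>\<omega>. of_real (f \<omega>) * F \<omega> - P \<omega> * F \<omega> \<partial>\<mu>)"
      using i1 P0 by simp
    also have "norm \<dots> \<le> (\<integral>\<omega>. norm (of_real (f \<omega>) * F \<omega> - P \<omega> * F \<omega>) \<partial>\<mu>)"
      by (rule integral_norm_bound)
    also have "\<dots> \<le> (\<integral>\<omega>. e * norm (F \<omega>) \<partial>\<mu>)"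
    proof (rule integral_mono)
      fix \<omega> assume "\<omega> \<in> space \<mu>"
      then have "norm (of_real (f \<omega>) - P \<omega>) \<le> e"
        using g P(2)[rule_format, symmetric] by (simp flip: of_real_diff) (metis less_imp_le)
      then show "norm (of_real (f \<omega>) * F \<omega> - P \<omega> * F \<omega>) \<le> e * norm (F \<omega>)"
        by (simp add: norm_mult mult_right_mono flip: left_diff_distrib)
    qed (use i1 F in auto)
    finally show ?thesis by simp
  qed
  note bound = this
  have "?N \<ge> 0" by simp
  have "norm ?I \<le> 0"
  proof (rule field_le_epsilon)
    fix e :: real assume "e > 0"
    have "norm ?I \<le> e / (?N + 1) * ?N" using bound[of "e / (?N + 1)"] \<open>e > 0\<close> \<open>?N \<ge> 0\<close> by simp
    also have "\<dots> \<le> e / (?N + 1) * (?N + 1)" using \<open>e > 0\<close> \<open>?N \<ge> 0\<close> by (intro mult_left_mono) auto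
    also have "\<dots> = e" using \<open>?N \<ge> 0\<close> by (metis add_le_same_cancel2 le_add_same_cancel2 nonzero_eq_divide_eq not_one_le_zero order_trans)
    finally show "norm ?I \<le> 0 + e" by simp
  qed
  then show ?thesis by simp
qed

lemma closed_orthogonal:
  fixes C :: "('g \<Rightarrow> complex) set"
  assumes F: "integrable \<mu> F" and zero: "\<And>\<gamma>. (\<integral>\<omega>. \<omega> \<gamma> * F \<omega> \<partial>\<mu>) = 0"
    and C: "closed C"
  shows "(\<integral>\<omega>. indicator C \<omega> * F \<omega> \<partial>\<mu>) = 0"
proof (cases "C = {}")
  case False
  (* continuous functions that decrease to the indicator function of the closed set *)
  define f where "f n \<omega> = max 0 (1 - of_nat n * infdist \<omega> C)" for n :: nat and \<omega> :: "'g \<Rightarrow> complex"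
  have cf: "continuous_on dual_group (f n)" for n
    unfolding f_def by (intro continuous_intros)
  have lim: "(\<lambda>n. f n \<omega>) \<longlonglongrightarrow> indicator C \<omega>" for \<omega>
  proof (cases "\<omega> \<in> C")
    case True
    then show ?thesis by (simp add: f_def)
  next
    case out: False
    then have d: "infdist \<omega> C > 0"
      using in_closed_iff_infdist_zero[OF C False] infdist_nonneg[of \<omega> C] by (metis less_eq_real_def)
    obtain k :: nat where k: "1 / infdist \<omega> C < of_nat k" using reals_Archimedean2 by blast
    have "f n \<omega> = 0" if "n \<ge> k" for n
    proof -
      have "1 / infdist \<omega> C < of_nat n" using k that by (meson less_le_trans of_nat_le_iff)
      then show ?thesis using d by (simp add: f_def field_simps)
    qed
    then have "eventually (\<lambda>n. f n \<omega> = 0) sequentially" by (auto simp: eventually_sequentially)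
    then show ?thesis using out by (simp add: tendsto_eventually)
  qed
  have m: "(\<lambda>\<omega>. of_real (f n \<omega>) * F \<omega>) \<in> borel_measurable \<mu>" for n
    using F cf by (intro borel_measurable_integrable integrable_continuous_mult continuous_intros) auto
  have l: "(\<lambda>n. of_real (f n \<omega>) * F \<omega>) \<longlonglongrightarrow> indicator C \<omega> * F \<omega>" for \<omega>
    using tendsto_mult[OF tendsto_of_real[OF lim[of \<omega>]] tendsto_const[of "F \<omega>"]]
    by (simp add: indicator_def of_bool_def split: if_splits)
  have "(\<lambda>n. \<integral>\<omega>. of_real (f n \<omega>) * F \<omega> \<partial>\<mu>) \<longlonglongrightarrow> (\<integral>\<omega>. indicator C \<omega> * F \<omega> \<partial>\<mu>)"
  proof (rule integral_dominated_convergence[where w = "\<lambda>\<omega>. norm (F \<omega>)"])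
    show "(\<lambda>\<omega>. indicator C \<omega> * F \<omega>) \<in> borel_measurable \<mu>"
      by (rule borel_measurable_LIMSEQ_metric[OF m l])
    show "AE \<omega> in \<mu>. norm (of_real (f n \<omega>) * F \<omega>) \<le> norm (F \<omega>)" for n
      using infdist_nonneg[of _ C] by (intro AE_I2) (simp add: f_def norm_mult mult_left_le_one_le)
  qed (use m l F in auto)
  moreover have "(\<lambda>n. \<integral>\<omega>. of_real (f n \<omega>) * F \<omega> \<partial>\<mu>) = (\<lambda>_. 0)"
    using continuous_orthogonal[OF F zero cf] by auto
  ultimately show ?thesis
    by (metis LIMSEQ_unique tendsto_const)
qed simp

text \<open>The closed sets are stable under intersection and generate the Borel sets, so that the integral
  of \<open>F\<close> over every Borel set vanishes.\<close>

theorem fourier_unique: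
  assumes F: "integrable \<mu> F" and zero: "\<And>\<gamma>. (\<integral>\<omega>. \<omega> \<gamma> * F \<omega> \<partial>\<mu>) = 0"
  shows "AE \<omega> in \<mu>. F \<omega> = 0"
proof (rule haar_finite.density_zero[OF F])
  fix S assume "S \<in> sets \<mu>"
  then obtain A :: "('g \<Rightarrow> complex) set" where A: "A \<in> sets borel" "S = dual_group \<inter> A"
    by (auto simp: dual_borel_def sets_restrict_space)
  have mA: "dual_group \<inter> A \<in> sets \<mu>" if "A \<in> sets borel" for A :: "('g \<Rightarrow> complex) set"
    using that by (auto simp: dual_borel_def sets_restrict_space)
  have borel: "sets borel = sigma_sets UNIV (Collect closed :: ('g \<Rightarrow> complex) set set)"
    by (simp add: borel_eq_closed)
  have closed_case: "(LINT \<omega>:(dual_group \<inter> C)|\<mu>. F \<omega>) = 0" if "closed C" for C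
  proof -
    have "(LINT \<omega>:(dual_group \<inter> C)|\<mu>. F \<omega>) = (\<integral>\<omega>. indicator C \<omega> * F \<omega> \<partial>\<mu>)"
      unfolding set_lebesgue_integral_def
      by (intro Bochner_Integration.integral_cong) (auto simp: indicator_def)
    then show ?thesis using closed_orthogonal[OF F zero that] by simp
  qed
  have stable: "Int_stable (Collect closed :: ('g \<Rightarrow> complex) set set)"
    by (auto simp: Int_stable_def)
  have closed_Pow: "Collect closed \<subseteq> Pow (UNIV :: ('g \<Rightarrow> complex) set)" by simp
  have "(LINT \<omega>:(dual_group \<inter> A)|\<mu>. F \<omega>) = 0"
    using stable closed_Pow A(1)[unfolded borel]
  proof (induction A rule: sigma_sets_induct_disjoint)
    case (basic A)
    then show ?case using closed_case by simp
  next
    case empty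
    show ?case using closed_case[of "{}"] by simp
  next
    case (compl A)
    then have m: "dual_group \<inter> A \<in> sets \<mu>" using mA borel by blast
    then have m': "dual_group - A \<in> sets \<mu>" using sets.compl_sets[OF m] by (simp add: Diff_Int)
    have "(LINT \<omega>:((dual_group \<inter> A) \<union> (dual_group - A))|\<mu>. F \<omega>)
        = (LINT \<omega>:(dual_group \<inter> A)|\<mu>. F \<omega>) + (LINT \<omega>:(dual_group - A)|\<mu>. F \<omega>)"
      using F m m' by (intro set_integral_Un) (auto simp: set_integrable_def intro!: integrable_mult_indicator)
    moreover have "(dual_group \<inter> A) \<union> (dual_group - A) = dual_group \<inter> UNIV" by auto
    ultimately have "(LINT \<omega>:(dual_group - A)|\<mu>. F \<omega>) = 0"
      using compl(2) closed_case[of UNIV] by simp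
    moreover have "dual_group \<inter> (UNIV - A) = dual_group - A" by auto
    ultimately show ?case by simp
  next
    case (union A)
    then have m: "dual_group \<inter> A i \<in> sets \<mu>" for i using mA borel by blast
    have "(LINT \<omega>:(\<Union>i. dual_group \<inter> A i)|\<mu>. F \<omega>) = (\<Sum>i. LINT \<omega>:(dual_group \<inter> A i)|\<mu>. F \<omega>)"
    proof (rule lebesgue_integral_countable_add)
      show "set_integrable \<mu> (\<Union>i. dual_group \<inter> A i) F"
        unfolding set_integrable_def using F m by (intro integrable_mult_indicator sets.countable_UN') blast+
    qed (use m union(1) in \<open>auto simp: disjoint_family_on_def\<close>)
    moreover have "(\<Union>i. dual_group \<inter> A i) = dual_group \<inter> (\<Union>i. A i)" by auto
    ultimately show ?case using union(3) by simp
  qed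
  then show "(LINT \<omega>:S|\<mu>. F \<omega>) = 0" using A(2) by simp
qed

end

section \<open>Pre-Hilbert spaces with explicit carriers\<close>

text \<open>The last axiom is definiteness, stated for differences. In this form it yields the injectivity
  of isometries, and the equality of vectors with the same inner products, directly.\<close>

locale prehilbert =
  fixes K :: "'v hilb"
  assumes zero_closed: "hzero K \<in> hcarrier K"
    and plus_closed: "\<lbrakk>x \<in> hcarrier K; y \<in> hcarrier K\<rbrakk> \<Longrightarrow> hplus K x y \<in> hcarrier K"
    and scale_closed: "x \<in> hcarrier K \<Longrightarrow> hscale K a x \<in> hcarrier K"
    and zero_right: "x \<in> hcarrier K \<Longrightarrow> hplus K x (hzero K) = x"
    and zero_left: "x \<in> hcarrier K \<Longrightarrow> hplus K (hzero K) x = x"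
    and inner_add: "\<lbrakk>x \<in> hcarrier K; y \<in> hcarrier K; z \<in> hcarrier K\<rbrakk> \<Longrightarrow>
      hinner K (hplus K x y) z = hinner K x z + hinner K y z"
    and inner_scale: "\<lbrakk>x \<in> hcarrier K; y \<in> hcarrier K\<rbrakk> \<Longrightarrow>
      hinner K (hscale K a x) y = a * hinner K x y"
    and inner_cnj: "\<lbrakk>x \<in> hcarrier K; y \<in> hcarrier K\<rbrakk> \<Longrightarrow> hinner K y x = cnj (hinner K x y)"
    and inner_nonneg: "x \<in> hcarrier K \<Longrightarrow> 0 \<le> Re (hinner K x x)"
    and definite: "\<lbrakk>x \<in> hcarrier K; y \<in> hcarrier K; hnorm K (hplus K x (hscale K (-1) y)) = 0\<rbrakk> \<Longrightarrow> x = y"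
begin

lemma inner_add_right:
  "\<lbrakk>x \<in> hcarrier K; y \<in> hcarrier K; z \<in> hcarrier K\<rbrakk> \<Longrightarrow>
      hinner K z (hplus K x y) = hinner K z x + hinner K z y"
  using inner_cnj[of z "hplus K x y"] inner_cnj[of z x] inner_cnj[of z y]
  by (metis complex_cnj_add complex_cnj_cnj inner_add plus_closed)

lemma inner_scale_right:
  "\<lbrakk>x \<in> hcarrier K; y \<in> hcarrier K\<rbrakk> \<Longrightarrow> hinner K x (hscale K a y) = cnj a * hinner K x y"
  by (metis complex_cnj_cnj complex_cnj_mult inner_cnj inner_scale scale_closed)

lemma norm_square: "x \<in> hcarrier K \<Longrightarrow> (hnorm K x)\<^sup>2 = Re (hinner K x x)"
  by (simp add: hnorm_def inner_nonneg)

lemma inner_self: "x \<in> hcarrier K \<Longrightarrow> hinner K x x = of_real ((hnorm K x)\<^sup>2)"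
  using inner_cnj[of x x] by (simp add: norm_square complex_eq_iff)

text \<open>For \<open>a = 1\<close> and \<open>a = \<i>\<close> this recovers the real and the imaginary part of an inner
  product from norms.\<close>

lemma norm_combination:
  assumes "x \<in> hcarrier K" "y \<in> hcarrier K"
  shows "(hnorm K (hplus K x (hscale K a y)))\<^sup>2
    = (hnorm K x)\<^sup>2 + (norm a)\<^sup>2 * (hnorm K y)\<^sup>2 + 2 * Re (cnj a * hinner K x y)"
proof -
  have s: "hscale K a y \<in> hcarrier K" using assms by (simp add: scale_closed)
  have "hinner K (hplus K x (hscale K a y)) (hplus K x (hscale K a y))
      = hinner K x x + cnj a * hinner K x y + (a * cnj (hinner K x y) + a * cnj a * hinner K y y)"
    using assms s
    by (simp add: inner_add inner_add_right plus_closed inner_scale inner_scale_right inner_cnj[of x y]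
        algebra_simps)
  also have "a * cnj a * hinner K y y = of_real ((norm a)\<^sup>2 * (hnorm K y)\<^sup>2)"
    using assms by (simp only: inner_self of_real_mult complex_norm_square)
  finally have "Re (hinner K (hplus K x (hscale K a y)) (hplus K x (hscale K a y)))
      = Re (hinner K x x) + Re (cnj a * hinner K x y) + (Re (cnj (cnj a * hinner K x y)) + (norm a)\<^sup>2 * (hnorm K y)\<^sup>2)"
    by simp
  then show ?thesis
    using assms s by (simp only: norm_square plus_closed complex_cnj) simp
qed

text \<open>A crude form of the Cauchy--Schwarz inequality, good enough for the summability of the inner
  products in a Hilbert sum.\<close>

lemma norm_inner_le:
  assumes "x \<in> hcarrier K" "y \<in> hcarrier K"
  shows "norm (hinner K x y) \<le> (hnorm K x)\<^sup>2 + (hnorm K y)\<^sup>2"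
proof -
  have "0 \<le> (hnorm K x)\<^sup>2 + (norm a)\<^sup>2 * (hnorm K y)\<^sup>2 + 2 * Re (cnj a * hinner K x y)" for a
    using norm_combination[OF assms, of a] zero_le_power2[of "hnorm K (hplus K x (hscale K a y))"] by simp
  from this[of 1] this[of "-1"] this[of \<i>] this[of "-\<i>"]
  have "2 * \<bar>Re (hinner K x y)\<bar> \<le> (hnorm K x)\<^sup>2 + (hnorm K y)\<^sup>2"
    "2 * \<bar>Im (hinner K x y)\<bar> \<le> (hnorm K x)\<^sup>2 + (hnorm K y)\<^sup>2" by auto
  then show ?thesis using cmod_le[of "hinner K x y"] by linarith
qed

lemma zero_unique:
  assumes "x \<in> hcarrier K" "hinner K x x = 0"
  shows "x = hzero K"
proof (rule definite)
  have z: "hinner K (hzero K) (hzero K) = 0"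
    using inner_add[OF zero_closed zero_closed zero_closed] by (simp add: zero_right zero_closed)
  have "hnorm K x = 0" "hnorm K (hzero K) = 0"
    using assms z by (auto simp: hnorm_def)
  moreover from this have "2 * norm (hinner K x (hzero K)) \<le> 0"
    using norm_inner_le[OF assms(1) zero_closed] by simp
  ultimately have "(hnorm K (hplus K x (hscale K (- 1) (hzero K))))\<^sup>2 = 0"
    using norm_combination[OF assms(1) zero_closed, of "-1"] by simp
  then show "hnorm K (hplus K x (hscale K (- 1) (hzero K))) = 0" by simp
qed (use assms zero_closed in auto)

lemma inner_zero: "x \<in> hcarrier K \<Longrightarrow> hinner K (hzero K) x = 0" "x \<in> hcarrier K \<Longrightarrow> hinner K x (hzero K) = 0"
  using inner_add[of "hzero K" "hzero K" x] inner_cnj[of x "hzero K"]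
  by (auto simp: zero_closed zero_right)

end

lemma (in prehilbert) inner_ext:
  assumes x: "x \<in> hcarrier K" and y: "y \<in> hcarrier K"
    and eq: "\<And>z. z \<in> hcarrier K \<Longrightarrow> hinner K x z = hinner K y z"
  shows "x = y"
proof (rule definite[OF x y])
  let ?d = "hplus K x (hscale K (-1) y)"
  have s: "hscale K (-1) y \<in> hcarrier K" and d: "?d \<in> hcarrier K"
    using x y by (auto intro: plus_closed scale_closed)
  have "hinner K ?d ?d = 0"
    unfolding inner_add[OF x s d] inner_scale[OF y d] using eq[OF d] by simp
  then show "hnorm K ?d = 0" by (simp add: hnorm_def)
qed

lemma linear_mapD:
  assumes "linear_map K L S"
  shows "x \<in> hcarrier K \<Longrightarrow> S x \<in> hcarrier L"
    and "x \<in> hcarrier K \<Longrightarrow> y \<in> hcarrier K \<Longrightarrow> S (hplus K x y) = hplus L (S x) (S y)"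
    and "x \<in> hcarrier K \<Longrightarrow> S (hscale K a x) = hscale L a (S x)"
  using assms by (auto simp: linear_map_def)

lemma isometry_inner:
  assumes "prehilbert K" "prehilbert L" "isometry K L S" "x \<in> hcarrier K" "y \<in> hcarrier K"
  shows "hinner L (S x) (S y) = hinner K x y"
proof -
  interpret K: prehilbert K by fact
  interpret L: prehilbert L by fact
  have lin: "linear_map K L S" and iso: "\<And>x. x \<in> hcarrier K \<Longrightarrow> hnorm L (S x) = hnorm K x"
    using assms by (auto simp: isometry_def)
  note S = linear_mapD[OF lin]
  have "Re (cnj a * hinner L (S x) (S y)) = Re (cnj a * hinner K x y)" for a
  proof -
    have "hnorm L (hplus L (S x) (hscale L a (S y))) = hnorm K (hplus K x (hscale K a y))"
      using assms by (metis K.plus_closed K.scale_closed S(2) S(3) iso)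
    then have "(hnorm L (hplus L (S x) (hscale L a (S y))))\<^sup>2 = (hnorm K (hplus K x (hscale K a y)))\<^sup>2"
      by simp
    then show ?thesis
      using assms S(1) by (simp add: K.norm_combination L.norm_combination iso)
  qed
  from this[of 1] this[of \<i>] show ?thesis by (simp add: complex_eq_iff)
qed

lemma isometry_inj_on:
  assumes "prehilbert K" "prehilbert L" "isometry K L S"
  shows "inj_on S (hcarrier K)"
proof (rule inj_onI)
  interpret K: prehilbert K by fact
  interpret L: prehilbert L by fact
  have lin: "linear_map K L S" and iso: "\<And>x. x \<in> hcarrier K \<Longrightarrow> hnorm L (S x) = hnorm K x"
    using assms by (auto simp: isometry_def)
  note S = linear_mapD[OF lin]
  fix x y assume xy: "x \<in> hcarrier K" "y \<in> hcarrier K" "S x = S y"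
  have "(hnorm K (hplus K x (hscale K (-1) y)))\<^sup>2 = (hnorm L (hplus L (S y) (hscale L (-1) (S y))))\<^sup>2"
    using xy by (metis K.plus_closed K.scale_closed S(2) S(3) iso)
  also have "\<dots> = 0"
    using xy S(1) L.norm_combination[of "S y" "S y" "-1"] L.norm_square[of "S y"] by simp
  finally show "x = y" using xy by (intro K.definite) auto
qed

lemma unitaryI:
  assumes "prehilbert K" "prehilbert L" "isometry K L S" "hcarrier L \<subseteq> S ` hcarrier K"
  shows "unitary K L S"
  unfolding unitary_def
proof (intro conjI ballI)
  show lin: "linear_map K L S" using assms(3) by (simp add: isometry_def)
  show "bij_betw S (hcarrier K) (hcarrier L)"
    using isometry_inj_on[OF assms(1-3)] assms(4) linear_mapD(1)[OF lin] by (auto simp: bij_betw_def)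
qed (rule isometry_inner[OF assms(1-3)])

lemma unitaryD:
  assumes "unitary K L U"
  shows "x \<in> hcarrier K \<Longrightarrow> U x \<in> hcarrier L"
    and "x \<in> hcarrier K \<Longrightarrow> y \<in> hcarrier K \<Longrightarrow> U (hplus K x y) = hplus L (U x) (U y)"
    and "x \<in> hcarrier K \<Longrightarrow> U (hscale K a x) = hscale L a (U x)"
    and "bij_betw U (hcarrier K) (hcarrier L)"
    and "x \<in> hcarrier K \<Longrightarrow> y \<in> hcarrier K \<Longrightarrow> hinner L (U x) (U y) = hinner K x y"
    and "x \<in> hcarrier K \<Longrightarrow> hnorm L (U x) = hnorm K x"
    and "linear_map K L U"
    and "isometry K L U"
  using assms by (auto simp: unitary_def linear_map_def isometry_def hnorm_def)

lemma unitary_inv: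
  assumes U: "unitary K L U"
  shows "x \<in> hcarrier K \<Longrightarrow> inv_into (hcarrier K) U (U x) = x"
    and "y \<in> hcarrier L \<Longrightarrow> U (inv_into (hcarrier K) U y) = y"
    and "y \<in> hcarrier L \<Longrightarrow> inv_into (hcarrier K) U y \<in> hcarrier K"
  using unitaryD(4)[OF U]
  by (auto simp: bij_betw_def inv_into_into f_inv_into_f)

lemma unitary_inv_into:
  assumes "prehilbert K" and U: "unitary K L U"
  shows "unitary L K (inv_into (hcarrier K) U)"
proof -
  interpret K: prehilbert K by fact
  let ?V = "inv_into (hcarrier K) U"
  note V = unitary_inv[OF U] and UD = unitaryD[OF U]
  show ?thesis
    unfolding unitary_def linear_map_def
  proof (intro conjI ballI allI)
    show "?V \<in> hcarrier L \<rightarrow> hcarrier K" using V(3) by auto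
    show "bij_betw ?V (hcarrier L) (hcarrier K)" using UD(4) by (rule bij_betw_inv_into)
    fix x y a assume x: "x \<in> hcarrier L" and y: "y \<in> hcarrier L"
    show "?V (hplus L x y) = hplus K (?V x) (?V y)"
      using x y by (metis K.plus_closed UD(2) V)
    show "hinner K (?V x) (?V y) = hinner L x y"
      using x y by (metis UD(5) V(2) V(3))
  next
    fix x a assume x: "x \<in> hcarrier L"
    show "?V (hscale L a x) = hscale K a (?V x)"
      using x by (metis K.scale_closed UD(3) V)
  qed
qed

lemma unitary_comp:
  assumes U: "unitary K L U" and V: "unitary L M V"
  shows "unitary K M (V \<circ> U)"
  unfolding unitary_def linear_map_def
  using unitaryD[OF U] unitaryD[OF V] bij_betw_trans[OF unitaryD(4)[OF U] unitaryD(4)[OF V]]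
  by (auto simp: Pi_iff)

lemma hprod_simps [simp]:
  "hcarrier (hprod K L) = hcarrier K \<times> hcarrier L"
  "hzero (hprod K L) = (hzero K, hzero L)"
  "hplus (hprod K L) x y = (hplus K (fst x) (fst y), hplus L (snd x) (snd y))"
  "hscale (hprod K L) a x = (hscale K a (fst x), hscale L a (snd x))"
  "hinner (hprod K L) x y = hinner K (fst x) (fst y) + hinner L (snd x) (snd y)"
  by (simp_all add: hprod_def)

lemma hnorm_hprod:
  assumes "prehilbert K" "prehilbert L" "x \<in> hcarrier K" "y \<in> hcarrier L"
  shows "(hnorm (hprod K L) (x, y))\<^sup>2 = (hnorm K x)\<^sup>2 + (hnorm L y)\<^sup>2"
  using prehilbert.norm_square[OF assms(1)] prehilbert.norm_square[OF assms(2)] assms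
    prehilbert.inner_nonneg[OF assms(1)] prehilbert.inner_nonneg[OF assms(2)]
  by (simp add: hnorm_def[of "hprod K L"])

lemma prehilbert_hprod:
  assumes "prehilbert K" "prehilbert L"
  shows "prehilbert (hprod K L)"
proof -
  interpret K: prehilbert K by fact
  interpret L: prehilbert L by fact
  show ?thesis
  proof
    fix x y assume x: "x \<in> hcarrier (hprod K L)" and y: "y \<in> hcarrier (hprod K L)"
      and z: "hnorm (hprod K L) (hplus (hprod K L) x (hscale (hprod K L) (- 1) y)) = 0"
    have "(hnorm (hprod K L) (hplus K (fst x) (hscale K (-1) (fst y)), hplus L (snd x) (hscale L (-1) (snd y))))\<^sup>2 = 0"
      using z by simp
    then have "(hnorm K (hplus K (fst x) (hscale K (-1) (fst y))))\<^sup>2 +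
        (hnorm L (hplus L (snd x) (hscale L (-1) (snd y))))\<^sup>2 = 0"
      using x y by (subst (asm) hnorm_hprod[OF assms]) (auto simp: K.plus_closed K.scale_closed L.plus_closed L.scale_closed)
    then have "hnorm K (hplus K (fst x) (hscale K (-1) (fst y))) = 0"
        "hnorm L (hplus L (snd x) (hscale L (-1) (snd y))) = 0"
      by (auto simp: sum_power2_eq_zero_iff)
    then show "x = y"
      using x y by (intro prod_eqI K.definite L.definite) auto
  next
    fix x y assume "x \<in> hcarrier (hprod K L)" "y \<in> hcarrier (hprod K L)"
    then show "hinner (hprod K L) y x = cnj (hinner (hprod K L) x y)"
      using K.inner_cnj[of "fst x" "fst y"] L.inner_cnj[of "snd x" "snd y"] by auto
  qed (auto simp: K.zero_closed L.zero_closed K.plus_closed L.plus_closed K.scale_closed L.scale_closed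
      K.zero_left L.zero_left K.zero_right L.zero_right K.inner_add L.inner_add K.inner_scale L.inner_scale
      K.inner_nonneg L.inner_nonneg algebra_simps)
qed

lemma linear_map_sum:
  assumes "prehilbert K" "prehilbert L" "prehilbert M" and S: "linear_map K M S" and T: "linear_map L M T"
  shows "linear_map (hprod K L) M (\<lambda>z. hplus M (S (fst z)) (T (snd z)))"
proof -
  interpret M: prehilbert M by fact
  note SD = linear_mapD[OF S] and TD = linear_mapD[OF T]
  have medial: "hplus M (hplus M a b) (hplus M d e) = hplus M (hplus M a d) (hplus M b e)"
    if "a \<in> hcarrier M" "b \<in> hcarrier M" "d \<in> hcarrier M" "e \<in> hcarrier M" for a b d e
    using that by (intro M.inner_ext) (simp_all add: M.plus_closed M.inner_add)
  have distrib: "hplus M (hscale M r a) (hscale M r b) = hscale M r (hplus M a b)"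
    if "a \<in> hcarrier M" "b \<in> hcarrier M" for a b r
    using that
    by (intro M.inner_ext) (simp_all add: M.plus_closed M.scale_closed M.inner_add M.inner_scale distrib_left)
  show ?thesis
    unfolding linear_map_def
    by (auto simp: SD TD M.plus_closed medial distrib)
qed

text \<open>A unitary between orthogonal sums that maps the first summand onto the first summand also maps
  the second onto the second, the latter being the orthogonal complements.\<close>

lemma unitary_splits:
  assumes "prehilbert K1" "prehilbert K2" "prehilbert M1" "prehilbert M2"
    and W: "unitary (hprod K1 M1) (hprod K2 M2) W"
    and U: "bij_betw U (hcarrier K1) (hcarrier K2)"
    and WU: "\<And>x. x \<in> hcarrier K1 \<Longrightarrow> W (x, hzero M1) = (U x, hzero M2)"
  obtains V where "unitary M1 M2 V"
    and "\<And>x y. x \<in> hcarrier K1 \<Longrightarrow> y \<in> hcarrier M1 \<Longrightarrow> W (x, y) = (U x, V y)"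
proof -
  interpret K1: prehilbert K1 by fact
  interpret K2: prehilbert K2 by fact
  interpret M1: prehilbert M1 by fact
  interpret M2: prehilbert M2 by fact
  note WD = unitaryD[OF W]
  define V where "V y = snd (W (hzero K1, y))" for y
  have Uz: "U x \<in> hcarrier K2" if "x \<in> hcarrier K1" for x using U that by (auto simp: bij_betw_def)
  (* the first component of W (0, y) is orthogonal to the range of U, that is, to everything *)
  have W0: "W (hzero K1, y) = (hzero K2, V y)" and Vc: "V y \<in> hcarrier M2" if y: "y \<in> hcarrier M1" for y
  proof -
    have c: "W (hzero K1, y) \<in> hcarrier K2 \<times> hcarrier M2"
      using WD(1)[of "(hzero K1, y)"] y K1.zero_closed by simp
    then obtain x where x: "x \<in> hcarrier K1" "U x = fst (W (hzero K1, y))"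
      using U unfolding bij_betw_def by (metis imageE mem_Times_iff)
    have "hinner (hprod K2 M2) (W (hzero K1, y)) (W (x, hzero M1)) = 0"
      using WD(5)[of "(hzero K1, y)" "(x, hzero M1)"] x y K1.zero_closed M1.zero_closed
      by (simp add: K1.inner_zero M1.inner_zero)
    moreover have "hinner (hprod K2 M2) (W (hzero K1, y)) (W (x, hzero M1))
        = hinner K2 (fst (W (hzero K1, y))) (fst (W (hzero K1, y)))"
      using x c by (auto simp: WU M2.inner_zero)
    ultimately have "fst (W (hzero K1, y)) = hzero K2"
      using c by (intro K2.zero_unique) auto
    then show "W (hzero K1, y) = (hzero K2, V y)" by (simp add: V_def prod_eq_iff)
    show "V y \<in> hcarrier M2" using c by (auto simp: V_def)
  qed
  have Wxy: "W (x, y) = (U x, V y)" if "x \<in> hcarrier K1" "y \<in> hcarrier M1" for x y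
  proof -
    have "W (x, y) = hplus (hprod K2 M2) (W (x, hzero M1)) (W (hzero K1, y))"
      using that WD(2)[of "(x, hzero M1)" "(hzero K1, y)"] K1.zero_closed M1.zero_closed
      by (simp add: K1.zero_right M1.zero_left)
    then show ?thesis
      using that by (simp add: WU W0 K2.zero_right M2.zero_left Uz Vc)
  qed
  have z0: "hzero K1 \<in> hcarrier K1" by (rule K1.zero_closed)
  have iso: "isometry M1 M2 V"
    unfolding isometry_def linear_map_def
  proof (intro conjI ballI allI)
    show "V \<in> hcarrier M1 \<rightarrow> hcarrier M2" using Vc by auto
  next
    fix x y assume xy: "x \<in> hcarrier M1" "y \<in> hcarrier M1"
    show "V (hplus M1 x y) = hplus M2 (V x) (V y)"
      using xy WD(2)[of "(hzero K1, x)" "(hzero K1, y)"] z0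
      by (simp add: W0 K1.zero_right M1.plus_closed)
  next
    fix a x assume x: "x \<in> hcarrier M1"
    have k: "hscale K1 a (hzero K1) \<in> hcarrier K1" by (intro K1.scale_closed z0)
    show "V (hscale M1 a x) = hscale M2 a (V x)"
      using x WD(3)[of "(hzero K1, x)" a] z0 k
      by (simp add: W0 Wxy M1.scale_closed)
  next
    fix x assume x: "x \<in> hcarrier M1"
    have "hinner M2 (V x) (V x) = hinner M1 x x"
      using WD(5)[of "(hzero K1, x)" "(hzero K1, x)"] x z0
      by (simp add: W0 K1.inner_zero K2.inner_zero K2.zero_closed)
    then show "hnorm M2 (V x) = hnorm M1 x" by (simp add: hnorm_def)
  qed
  have "hcarrier M2 \<subseteq> V ` hcarrier M1"
  proof
    fix w assume w: "w \<in> hcarrier M2"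
    then have "(hzero K2, w) \<in> hcarrier (hprod K2 M2)" by (simp add: K2.zero_closed)
    then obtain z where "z \<in> hcarrier (hprod K1 M1)" "W z = (hzero K2, w)"
      using WD(4) unfolding bij_betw_def by (metis imageE)
    then show "w \<in> V ` hcarrier M1"
      using Wxy[of "fst z" "snd z"] by (intro image_eqI[of _ _ "snd z"]) auto
  qed
  then have "unitary M1 M2 V" by (intro unitaryI assms iso)
  then show ?thesis using Wxy by (rule that)
qed

lemma hsum_simps [simp]:
  "hcarrier (hsum I K) = {x \<in> (\<Pi>\<^sub>E i\<in>I. hcarrier (K i)). (\<lambda>i. (hnorm (K i) (x i))\<^sup>2) summable_on I}"
  "hzero (hsum I K) = (\<lambda>i\<in>I. hzero (K i))"
  "hplus (hsum I K) x y = (\<lambda>i\<in>I. hplus (K i) (x i) (y i))"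
  "hscale (hsum I K) a x = (\<lambda>i\<in>I. hscale (K i) a (x i))"
  "hinner (hsum I K) x y = (\<Sum>\<^sub>\<infinity>i\<in>I. hinner (K i) (x i) (y i))"
  by (simp_all add: hsum_def)

lemma hsum_memD:
  assumes "x \<in> hcarrier (hsum I K)"
  shows "i \<in> I \<Longrightarrow> x i \<in> hcarrier (K i)" and "i \<notin> I \<Longrightarrow> x i = undefined"
    and "(\<lambda>i. (hnorm (K i) (x i))\<^sup>2) summable_on I"
  using assms by (auto simp: PiE_iff extensional_def)

lemma hsum_memI:
  assumes "\<And>i. i \<in> I \<Longrightarrow> x i \<in> hcarrier (K i)" "x \<in> extensional I"
    and "(\<lambda>i. (hnorm (K i) (x i))\<^sup>2) summable_on I"
  shows "x \<in> hcarrier (hsum I K)"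
  using assms by (simp add: PiE_iff)

lemma hsum_inner_summable:
  assumes K: "\<And>i. i \<in> I \<Longrightarrow> prehilbert (K i)"
    and x: "x \<in> hcarrier (hsum I K)" and y: "y \<in> hcarrier (hsum I K)"
  shows "(\<lambda>i. hinner (K i) (x i) (y i)) summable_on I"
proof (rule abs_summable_summable, rule Infinite_Sum.abs_summable_on_comparison_test')
  show "(\<lambda>i. (hnorm (K i) (x i))\<^sup>2 + (hnorm (K i) (y i))\<^sup>2) summable_on I"
    using x y by (auto intro: summable_on_add)
  show "norm (hinner (K i) (x i) (y i)) \<le> (hnorm (K i) (x i))\<^sup>2 + (hnorm (K i) (y i))\<^sup>2" if "i \<in> I" for i
    using prehilbert.norm_inner_le[OF K[OF that]] hsum_memD(1)[OF x that] hsum_memD(1)[OF y that] by auto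
qed

lemma hnorm_hsum:
  assumes K: "\<And>i. i \<in> I \<Longrightarrow> prehilbert (K i)" and x: "x \<in> hcarrier (hsum I K)"
  shows "(hnorm (hsum I K) x)\<^sup>2 = (\<Sum>\<^sub>\<infinity>i\<in>I. (hnorm (K i) (x i))\<^sup>2)"
proof -
  have "hinner (hsum I K) x x = (\<Sum>\<^sub>\<infinity>i\<in>I. of_real ((hnorm (K i) (x i))\<^sup>2))"
    using x prehilbert.inner_self[OF K] by (auto intro!: infsum_cong)
  also have "\<dots> = of_real (\<Sum>\<^sub>\<infinity>i\<in>I. (hnorm (K i) (x i))\<^sup>2)"
    by (rule infsumI, rule has_sum_of_real, rule has_sum_infsum, rule hsum_memD(3)[OF x])
  finally have "Re (hinner (hsum I K) x x) = (\<Sum>\<^sub>\<infinity>i\<in>I. (hnorm (K i) (x i))\<^sup>2)" by simp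
  then show ?thesis
    unfolding hnorm_def[of "hsum I K"] by (simp add: infsum_nonneg)
qed

lemma prehilbert_hsum:
  assumes K: "\<And>i. i \<in> I \<Longrightarrow> prehilbert (K i)"
  shows "prehilbert (hsum I K)"
proof -
  note closed = prehilbert.zero_closed[OF K] prehilbert.plus_closed[OF K] prehilbert.scale_closed[OF K]
  have scale: "hscale (hsum I K) a x \<in> hcarrier (hsum I K)" if x: "x \<in> hcarrier (hsum I K)" for a x
  proof -
    have "(hnorm (K i) (hscale (K i) a (x i)))\<^sup>2 = (norm a)\<^sup>2 * (hnorm (K i) (x i))\<^sup>2" if i: "i \<in> I" for i
    proof -
      interpret prehilbert "K i" by (rule K[OF i])
      have xi: "x i \<in> hcarrier (K i)" using x i by auto
      have "hinner (K i) (hscale (K i) a (x i)) (hscale (K i) a (x i)) = a * (cnj a * hinner (K i) (x i) (x i))"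
        using xi by (simp add: inner_scale inner_scale_right scale_closed)
      also have "\<dots> = of_real ((norm a)\<^sup>2 * (hnorm (K i) (x i))\<^sup>2)"
        using xi by (simp only: inner_self of_real_mult complex_norm_square mult.assoc)
      finally show ?thesis using xi by (simp add: norm_square scale_closed)
    qed
    moreover have "(\<lambda>i. (norm a)\<^sup>2 * (hnorm (K i) (x i))\<^sup>2) summable_on I"
      using x by (auto intro: summable_on_cmult_right)
    ultimately show ?thesis
      using closed hsum_memD[OF x] by (intro hsum_memI) (auto cong: summable_on_cong)
  qed
  have plus: "hplus (hsum I K) x y \<in> hcarrier (hsum I K)"
    if x: "x \<in> hcarrier (hsum I K)" and y: "y \<in> hcarrier (hsum I K)" for x y
  proof -
    (* 3 = 1 + 2, the cross term being twice a real part, which norm_inner_le bounds *)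
    have "(hnorm (K i) (hplus (K i) (x i) (y i)))\<^sup>2 \<le> 3 * ((hnorm (K i) (x i))\<^sup>2 + (hnorm (K i) (y i))\<^sup>2)"
      if i: "i \<in> I" for i
    proof -
      interpret prehilbert "K i" by (rule K[OF i])
      have c: "x i \<in> hcarrier (K i)" "y i \<in> hcarrier (K i)" using x y i by auto
      have "hinner (K i) (hplus (K i) (x i) (y i)) (hplus (K i) (x i) (y i))
          = hinner (K i) (x i) (x i) + hinner (K i) (y i) (y i) + hinner (K i) (x i) (y i) + cnj (hinner (K i) (x i) (y i))"
        using c by (simp add: inner_add inner_add_right plus_closed inner_cnj[of "x i" "y i"])
      then have "(hnorm (K i) (hplus (K i) (x i) (y i)))\<^sup>2
          = (hnorm (K i) (x i))\<^sup>2 + (hnorm (K i) (y i))\<^sup>2 + 2 * Re (hinner (K i) (x i) (y i))"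
        using c by (simp add: norm_square plus_closed)
      then show ?thesis
        using norm_inner_le[OF c] complex_Re_le_cmod[of "hinner (K i) (x i) (y i)"] by simp
    qed
    moreover have "(\<lambda>i. 3 * ((hnorm (K i) (x i))\<^sup>2 + (hnorm (K i) (y i))\<^sup>2)) summable_on I"
      using x y by (auto intro!: summable_on_cmult_right summable_on_add)
    ultimately have "(\<lambda>i. (hnorm (K i) (hplus (K i) (x i) (y i)))\<^sup>2) summable_on I"
      by (intro summable_on_comparison_test[where g = "\<lambda>i. (hnorm (K i) (hplus (K i) (x i) (y i)))\<^sup>2"]) auto
    then show ?thesis
      using closed hsum_memD[OF x] hsum_memD[OF y] by (intro hsum_memI) (auto cong: summable_on_cong)
  qed
  have norm0: "hnorm (K i) (hzero (K i)) = 0" if "i \<in> I" for i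
    using prehilbert.inner_zero[OF K[OF that] closed(1)[OF that]] by (simp add: hnorm_def)
  note ext = hsum_memD(2)
  show ?thesis
  proof
    show "hzero (hsum I K) \<in> hcarrier (hsum I K)"
      using closed norm0 by (auto cong: summable_on_cong)
  next
    fix x assume x: "x \<in> hcarrier (hsum I K)"
    show "hplus (hsum I K) x (hzero (hsum I K)) = x" "hplus (hsum I K) (hzero (hsum I K)) x = x"
      using hsum_memD(1)[OF x] prehilbert.zero_left[OF K] prehilbert.zero_right[OF K] ext[OF x]
      by (auto intro!: HOL.ext simp: restrict_def)
    show "0 \<le> Re (hinner (hsum I K) x x)"
      using hsum_inner_summable[OF K x x] x prehilbert.inner_nonneg[OF K]
      by (auto simp: infsum_Re[symmetric] intro!: infsum_nonneg)
    show "hscale (hsum I K) a x \<in> hcarrier (hsum I K)" for a by (rule scale[OF x])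
    fix y assume y: "y \<in> hcarrier (hsum I K)"
    show "hplus (hsum I K) x y \<in> hcarrier (hsum I K)" by (rule plus[OF x y])
    show "hinner (hsum I K) (hscale (hsum I K) a x) y = a * hinner (hsum I K) x y" for a
      using hsum_memD(1)[OF x] hsum_memD(1)[OF y] prehilbert.inner_scale[OF K]
      by (auto simp: infsum_cmult_right'[symmetric] intro!: infsum_cong)
    have "(\<Sum>\<^sub>\<infinity>i\<in>I. hinner (K i) (y i) (x i)) = (\<Sum>\<^sub>\<infinity>i\<in>I. cnj (hinner (K i) (x i) (y i)))"
      by (rule infsum_cong, rule prehilbert.inner_cnj[OF K hsum_memD(1)[OF x] hsum_memD(1)[OF y]])
    then show "hinner (hsum I K) y x = cnj (hinner (hsum I K) x y)" by simp
    show "hinner (hsum I K) (hplus (hsum I K) x y) z = hinner (hsum I K) x z + hinner (hsum I K) y z"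
      if z: "z \<in> hcarrier (hsum I K)" for z
    proof -
      have "hinner (hsum I K) (hplus (hsum I K) x y) z
          = (\<Sum>\<^sub>\<infinity>i\<in>I. hinner (K i) (x i) (z i) + hinner (K i) (y i) (z i))"
        using hsum_memD(1)[OF x] hsum_memD(1)[OF y] hsum_memD(1)[OF z] prehilbert.inner_add[OF K] by (auto intro!: infsum_cong)
      then show ?thesis
        using infsum_add[OF hsum_inner_summable[OF K x z] hsum_inner_summable[OF K y z]] by simp
    qed
    assume z: "hnorm (hsum I K) (hplus (hsum I K) x (hscale (hsum I K) (- 1) y)) = 0"
    let ?d = "hplus (hsum I K) x (hscale (hsum I K) (- 1) y)"
    have d: "?d \<in> hcarrier (hsum I K)" by (intro plus x scale y)
    have "(\<Sum>\<^sub>\<infinity>i\<in>I. (hnorm (K i) (?d i))\<^sup>2) = 0"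
      using hnorm_hsum[OF K d] z by simp
    then have "(hnorm (K i) (?d i))\<^sup>2 = 0" if "i \<in> I" for i
      using d that nonneg_infsum_le_0D[of "\<lambda>i. (hnorm (K i) (?d i))\<^sup>2" I i] by simp
    then have "x i = y i" if "i \<in> I" for i
      using that x y prehilbert.definite[OF K[OF that], of "x i" "y i"] by auto
    then show "x = y" using ext[OF x] ext[OF y] by (metis HOL.ext)
  qed
qed

lemma unitary_hsum:
  assumes K: "\<And>i. prehilbert (K i)" and L: "\<And>i. prehilbert (L i)"
    and U: "\<And>i. unitary (K i) (L i) (U i)"
  shows "unitary (hsum UNIV K) (hsum UNIV L) (\<lambda>x i. U i (x i))"
proof (rule unitaryI)
  show "prehilbert (hsum UNIV K)" "prehilbert (hsum UNIV L)" by (intro prehilbert_hsum K L)+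
  have c: "(\<lambda>i. U i (x i)) \<in> hcarrier (hsum UNIV L)" if "x \<in> hcarrier (hsum UNIV K)" for x
    using unitaryD(1,6)[OF U] hsum_memD[OF that] by (intro hsum_memI) (auto cong: summable_on_cong)
  show "isometry (hsum UNIV K) (hsum UNIV L) (\<lambda>x i. U i (x i))"
    unfolding isometry_def linear_map_def
  proof (intro conjI ballI allI)
    show "(\<lambda>x i. U i (x i)) \<in> hcarrier (hsum UNIV K) \<rightarrow> hcarrier (hsum UNIV L)" using c by auto
    fix x assume x: "x \<in> hcarrier (hsum UNIV K)"
    have "(hnorm (hsum UNIV L) (\<lambda>i. U i (x i)))\<^sup>2 = (hnorm (hsum UNIV K) x)\<^sup>2"
      using hnorm_hsum[OF L c[OF x]] hnorm_hsum[OF K x] unitaryD(6)[OF U] hsum_memD(1)[OF x]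
      by (auto intro!: infsum_cong)
    moreover have "hnorm (hsum UNIV L) (\<lambda>i. U i (x i)) \<ge> 0" "hnorm (hsum UNIV K) x \<ge> 0"
      using prehilbert.inner_nonneg[OF prehilbert_hsum[OF K] x]
        prehilbert.inner_nonneg[OF prehilbert_hsum[OF L] c[OF x]] by (simp_all add: hnorm_def del: hsum_simps)
    ultimately show "hnorm (hsum UNIV L) (\<lambda>i. U i (x i)) = hnorm (hsum UNIV K) x"
      by (simp add: power2_eq_iff_nonneg)
  next
    fix x y assume x: "x \<in> hcarrier (hsum UNIV K)" and y: "y \<in> hcarrier (hsum UNIV K)"
    show "(\<lambda>i. U i (hplus (hsum UNIV K) x y i)) = hplus (hsum UNIV L) (\<lambda>i. U i (x i)) (\<lambda>i. U i (y i))"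
      using unitaryD(2)[OF U hsum_memD(1)[OF x] hsum_memD(1)[OF y]] by (simp add: restrict_def)
  next
    fix a x assume x: "x \<in> hcarrier (hsum UNIV K)"
    show "(\<lambda>i. U i (hscale (hsum UNIV K) a x i)) = hscale (hsum UNIV L) a (\<lambda>i. U i (x i))"
      using unitaryD(3)[OF U hsum_memD(1)[OF x]] by (simp add: restrict_def)
  qed
  show "hcarrier (hsum UNIV L) \<subseteq> (\<lambda>x i. U i (x i)) ` hcarrier (hsum UNIV K)"
  proof
    fix y assume y: "y \<in> hcarrier (hsum UNIV L)"
    let ?x = "\<lambda>i. inv_into (hcarrier (K i)) (U i) (y i)"
    have "hnorm (K i) (?x i) = hnorm (L i) (y i)" for i
      using hsum_memD(1)[OF y, of i] unitary_inv(2,3)[OF U, of "y i" i] unitaryD(6)[OF U, of "?x i" i] by simp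
    then have "?x \<in> hcarrier (hsum UNIV K)"
      using hsum_memD[OF y] unitary_inv(3)[OF U] by (intro hsum_memI) auto
    moreover have "y = (\<lambda>i. U i (?x i))"
      using hsum_memD(1)[OF y] unitary_inv(2)[OF U] by (intro HOL.ext) auto
    ultimately show "y \<in> (\<lambda>x i. U i (x i)) ` hcarrier (hsum UNIV K)" by (intro image_eqI)
  qed
qed

section \<open>Square-integrable functions and their direct sums\<close>

definition nsq :: "'a measure \<Rightarrow> ('a \<Rightarrow> complex) \<Rightarrow> ennreal" where
  "nsq \<nu> f = (\<integral>\<^sup>+x. ennreal ((norm (f x))\<^sup>2) \<partial>\<nu>)"

lemma nsq_cong_AE: "AE x in \<nu>. f x = g x \<Longrightarrow> nsq \<nu> f = nsq \<nu> g"
  unfolding nsq_def by (rule nn_integral_cong_AE) auto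

lemma integrable_square_iff:
  "f \<in> borel_measurable \<nu> \<Longrightarrow> integrable \<nu> (\<lambda>x. (norm (f x))\<^sup>2) \<longleftrightarrow> nsq \<nu> f < \<infinity>"
  by (simp add: integrable_iff_bounded nsq_def)

lemma l2_class_cong:
  assumes "AE x in \<nu>. f x = g x" shows "l2_class \<nu> f = l2_class \<nu> g"
proof -
  have "(AE x in \<nu>. h x = f x) \<longleftrightarrow> (AE x in \<nu>. h x = g x)" for h
    using assms by (auto elim: AE_mp)
  then show ?thesis by (simp add: l2_class_def)
qed

lemma l2_rep_class:
  assumes "f \<in> borel_measurable \<nu>"
  shows "l2_rep (l2_class \<nu> f) \<in> l2_class \<nu> f"
proof -
  let ?g = "\<lambda>x. if x \<in> space \<nu> then f x else 0"
  have "?g \<in> borel_measurable \<nu>" using assms by (simp cong: measurable_cong)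
  then have "?g \<in> l2_class \<nu> f" by (auto simp: l2_class_def)
  then show ?thesis unfolding l2_rep_def by (rule someI[of "\<lambda>h. h \<in> l2_class \<nu> f"])
qed

lemma l2_rep_classD:
  assumes "f \<in> borel_measurable \<nu>"
  shows "l2_rep (l2_class \<nu> f) \<in> borel_measurable \<nu>"
    and "AE x in \<nu>. l2_rep (l2_class \<nu> f) x = f x"
  using l2_rep_class[OF assms] by (auto simp: l2_class_def)

lemma L2_simps [simp]:
  "hzero (L2 \<nu>) = l2_class \<nu> (\<lambda>_. 0)"
  "hplus (L2 \<nu>) X Y = l2_class \<nu> (\<lambda>x. l2_rep X x + l2_rep Y x)"
  "hscale (L2 \<nu>) a X = l2_class \<nu> (\<lambda>x. a * l2_rep X x)"
  "hinner (L2 \<nu>) X Y = (\<integral>x. l2_rep X x * cnj (l2_rep Y x) \<partial>\<nu>)"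
  by (simp_all add: L2_def)

lemma L2_carrierI: "f \<in> borel_measurable \<nu> \<Longrightarrow> nsq \<nu> f < \<infinity> \<Longrightarrow> l2_class \<nu> f \<in> hcarrier (L2 \<nu>)"
  by (auto simp: L2_def integrable_square_iff)

lemma L2_carrierD:
  assumes "X \<in> hcarrier (L2 \<nu>)"
  shows "l2_rep X \<in> borel_measurable \<nu>" and "nsq \<nu> (l2_rep X) < \<infinity>"
    and "l2_class \<nu> (l2_rep X) = X" and "x \<notin> space \<nu> \<Longrightarrow> l2_rep X x = 0"
proof -
  obtain f where f: "f \<in> borel_measurable \<nu>" "nsq \<nu> f < \<infinity>" "X = l2_class \<nu> f"
    using assms by (auto simp: L2_def integrable_square_iff)
  note rep = l2_rep_classD[OF f(1), folded f(3)]
  show "l2_rep X \<in> borel_measurable \<nu>" by (rule rep(1))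
  show "nsq \<nu> (l2_rep X) < \<infinity>" using nsq_cong_AE[OF rep(2)] f(2) by simp
  show "l2_class \<nu> (l2_rep X) = X" using l2_class_cong[OF rep(2)] f(3) by simp
  show "x \<notin> space \<nu> \<Longrightarrow> l2_rep X x = 0"
    using l2_rep_class[OF f(1), folded f(3)] f(3) by (simp add: l2_class_def)
qed

lemma L2_integrable_mult:
  assumes X: "X \<in> hcarrier (L2 \<nu>)" and Y: "Y \<in> hcarrier (L2 \<nu>)"
  shows "integrable \<nu> (\<lambda>x. l2_rep X x * cnj (l2_rep Y x))"
proof (rule Bochner_Integration.integrable_bound)
  note m[measurable] = L2_carrierD(1)[OF X] L2_carrierD(1)[OF Y]
  show "integrable \<nu> (\<lambda>x. (norm (l2_rep X x))\<^sup>2 + (norm (l2_rep Y x))\<^sup>2)"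
    using L2_carrierD(2)[OF X] L2_carrierD(2)[OF Y] by (simp add: integrable_square_iff m)
  show "(\<lambda>x. l2_rep X x * cnj (l2_rep Y x)) \<in> borel_measurable \<nu>"
    by (intro borel_measurable_times m borel_measurable_continuous_on[OF _ m(2)] continuous_intros)
  have "a * b \<le> a\<^sup>2 + b\<^sup>2" if "0 \<le> a" "0 \<le> b" for a b :: real
    using sum_squares_bound[of a b] mult_nonneg_nonneg[OF that] by linarith
  then show "AE x in \<nu>. norm (l2_rep X x * cnj (l2_rep Y x)) \<le> norm ((norm (l2_rep X x))\<^sup>2 + (norm (l2_rep Y x))\<^sup>2)"
    by (simp add: norm_mult)
qed

lemma L2_inner_self:
  assumes X: "X \<in> hcarrier (L2 \<nu>)"
  shows "hinner (L2 \<nu>) X X = of_real (\<integral>x. (norm (l2_rep X x))\<^sup>2 \<partial>\<nu>)"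
proof -
  have "hinner (L2 \<nu>) X X = (\<integral>x. of_real ((norm (l2_rep X x))\<^sup>2) \<partial>\<nu>)"
    by (simp only: L2_simps complex_norm_square)
  then show ?thesis by (simp only: integral_complex_of_real)
qed

lemma hnorm_L2:
  assumes X: "X \<in> hcarrier (L2 \<nu>)"
  shows "ennreal ((hnorm (L2 \<nu>) X)\<^sup>2) = nsq \<nu> (l2_rep X)"
proof -
  have "(hnorm (L2 \<nu>) X)\<^sup>2 = (\<integral>x. (norm (l2_rep X x))\<^sup>2 \<partial>\<nu>)"
    unfolding hnorm_def L2_inner_self[OF X] by simp
  then show ?thesis
    unfolding nsq_def using L2_carrierD(1,2)[OF X]
    by (simp add: nn_integral_eq_integral integrable_square_iff)
qed

lemma nsq_add_finite:
  assumes [measurable]: "f \<in> borel_measurable \<nu>" "g \<in> borel_measurable \<nu>" and fin: "nsq \<nu> f < \<infinity>" "nsq \<nu> g < \<infinity>"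
  shows "nsq \<nu> (\<lambda>x. f x + g x) < \<infinity>"
proof -
  have "nsq \<nu> (\<lambda>x. f x + g x) \<le> (\<integral>\<^sup>+x. 2 * ennreal ((norm (f x))\<^sup>2) + 2 * ennreal ((norm (g x))\<^sup>2) \<partial>\<nu>)"
    unfolding nsq_def
  proof (rule nn_integral_mono)
    fix x
    have "(norm (f x + g x))\<^sup>2 \<le> (norm (f x) + norm (g x))\<^sup>2"
      by (intro power_mono norm_triangle_ineq) simp
    also have "\<dots> \<le> 2 * (norm (f x))\<^sup>2 + 2 * (norm (g x))\<^sup>2"
      using sum_squares_bound[of "norm (f x)" "norm (g x)"] by (simp add: power2_sum)
    finally show "ennreal ((norm (f x + g x))\<^sup>2) \<le> 2 * ennreal ((norm (f x))\<^sup>2) + 2 * ennreal ((norm (g x))\<^sup>2)"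
      by (simp add: ennreal_leI flip: ennreal_plus ennreal_mult' ennreal_numeral)
  qed
  also have "\<dots> = 2 * nsq \<nu> f + 2 * nsq \<nu> g"
    by (simp add: nsq_def nn_integral_add nn_integral_cmult)
  also have "\<dots> < \<infinity>" using fin by (simp add: ennreal_mult_less_top)
  finally show ?thesis .
qed

lemma nsq_scale:
  assumes [measurable]: "f \<in> borel_measurable \<nu>"
  shows "nsq \<nu> (\<lambda>x. a * f x) = ennreal ((norm a)\<^sup>2) * nsq \<nu> f"
  unfolding nsq_def by (simp add: norm_mult power_mult_distrib ennreal_mult nn_integral_cmult)

lemma nsq_eq_0_iff: "f \<in> borel_measurable \<nu> \<Longrightarrow> nsq \<nu> f = 0 \<longleftrightarrow> (AE x in \<nu>. f x = 0)"
  unfolding nsq_def by (simp add: nn_integral_0_iff_AE)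

lemma prehilbert_L2: "prehilbert (L2 \<nu>)"
proof
  note m = L2_carrierD(1)
  have mc: "(\<lambda>x. cnj (l2_rep X x)) \<in> borel_measurable \<nu>" if "X \<in> hcarrier (L2 \<nu>)" for X
    by (intro borel_measurable_continuous_on[OF _ m[OF that]] continuous_intros)
  show "hzero (L2 \<nu>) \<in> hcarrier (L2 \<nu>)" by (auto intro!: L2_carrierI simp: nsq_def)
  fix x assume x: "x \<in> hcarrier (L2 \<nu>)"
  have "AE t in \<nu>. l2_rep (l2_class \<nu> (\<lambda>_. 0)) t = 0" by (rule l2_rep_classD(2)) simp
  then have "l2_class \<nu> (\<lambda>t. l2_rep x t + l2_rep (l2_class \<nu> (\<lambda>_. 0)) t) = l2_class \<nu> (l2_rep x)"
    by (intro l2_class_cong) (auto elim: AE_mp)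
  then show "hplus (L2 \<nu>) x (hzero (L2 \<nu>)) = x" "hplus (L2 \<nu>) (hzero (L2 \<nu>)) x = x"
    by (simp_all add: L2_carrierD(3)[OF x] add.commute)
  have "(\<lambda>t. a * l2_rep x t) \<in> borel_measurable \<nu>" for a using m[OF x] by simp
  then show "hscale (L2 \<nu>) a x \<in> hcarrier (L2 \<nu>)" for a
    using L2_carrierD[OF x] by (auto intro!: L2_carrierI simp: nsq_scale ennreal_mult_less_top)
  show "0 \<le> Re (hinner (L2 \<nu>) x x)"
    unfolding L2_inner_self[OF x] by simp
  fix y assume y: "y \<in> hcarrier (L2 \<nu>)"
  have ms: "(\<lambda>t. l2_rep x t + b * l2_rep y t) \<in> borel_measurable \<nu>" for b using m[OF x] m[OF y] by simp
  show plus: "hplus (L2 \<nu>) x y \<in> hcarrier (L2 \<nu>)"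
    using nsq_add_finite[OF m[OF x] m[OF y]] L2_carrierD(2)[OF x] L2_carrierD(2)[OF y] ms[of 1]
    by (auto intro!: L2_carrierI)
  have "hinner (L2 \<nu>) (hscale (L2 \<nu>) a x) y = (\<integral>t. a * (l2_rep x t * cnj (l2_rep y t)) \<partial>\<nu>)" for a
  proof -
    have r: "AE t in \<nu>. l2_rep (hscale (L2 \<nu>) a x) t = a * l2_rep x t"
      using l2_rep_classD(2)[of "\<lambda>t. a * l2_rep x t" \<nu>] m[OF x] by simp
    have "l2_rep (hscale (L2 \<nu>) a x) \<in> borel_measurable \<nu>"
      using l2_rep_classD(1)[of "\<lambda>t. a * l2_rep x t" \<nu>] m[OF x] by simp
    then show ?thesis
      unfolding L2_simps(4) using r m[OF x] mc[OF y] by (intro integral_cong_AE) (auto simp: mult.assoc)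
  qed
  then show "hinner (L2 \<nu>) (hscale (L2 \<nu>) a x) y = a * hinner (L2 \<nu>) x y" for a by simp
  have "(\<integral>t. l2_rep y t * cnj (l2_rep x t) \<partial>\<nu>) = (\<integral>t. cnj (l2_rep x t * cnj (l2_rep y t)) \<partial>\<nu>)"
    by (simp add: mult.commute)
  then show "hinner (L2 \<nu>) y x = cnj (hinner (L2 \<nu>) x y)"
    by (simp del: complex_cnj_mult)
  show "hinner (L2 \<nu>) (hplus (L2 \<nu>) x y) z = hinner (L2 \<nu>) x z + hinner (L2 \<nu>) y z"
    if z: "z \<in> hcarrier (L2 \<nu>)" for z
  proof -
    have r: "AE t in \<nu>. l2_rep (hplus (L2 \<nu>) x y) t = l2_rep x t + l2_rep y t"
      using l2_rep_classD(2)[OF ms[of 1]] by simp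
    have "hinner (L2 \<nu>) (hplus (L2 \<nu>) x y) z
        = (\<integral>t. l2_rep x t * cnj (l2_rep z t) + l2_rep y t * cnj (l2_rep z t) \<partial>\<nu>)"
      unfolding L2_simps(4) using r m[OF plus] m[OF x] m[OF y] mc[OF z]
      by (intro integral_cong_AE) (auto simp: distrib_right)
    then show ?thesis using L2_integrable_mult[OF x z] L2_integrable_mult[OF y z] by simp
  qed
  assume z: "hnorm (L2 \<nu>) (hplus (L2 \<nu>) x (hscale (L2 \<nu>) (- 1) y)) = 0"
  let ?d = "hplus (L2 \<nu>) x (hscale (L2 \<nu>) (- 1) y)"
  have r1: "AE t in \<nu>. l2_rep (hscale (L2 \<nu>) (-1) y) t = - l2_rep y t"
    using l2_rep_classD(2)[of "\<lambda>t. -1 * l2_rep y t" \<nu>] m[OF y] by simp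
  have d: "?d = l2_class \<nu> (\<lambda>t. l2_rep x t + (-1) * l2_rep y t)"
    unfolding L2_simps(2) by (rule l2_class_cong) (use r1 in auto)
  have "nsq \<nu> (\<lambda>t. l2_rep x t + (-1) * l2_rep y t) < \<infinity>"
    using nsq_add_finite[OF m[OF x], of "\<lambda>t. -1 * l2_rep y t"] nsq_scale[OF m[OF y], of "-1"]
      L2_carrierD(2)[OF x] L2_carrierD(2)[OF y] m[OF y] by simp
  then have dc: "?d \<in> hcarrier (L2 \<nu>)" unfolding d by (rule L2_carrierI[OF ms])
  have "nsq \<nu> (l2_rep ?d) = 0" using hnorm_L2[OF dc] z by simp
  then have "AE t in \<nu>. l2_rep ?d t = 0" using nsq_eq_0_iff[OF m[OF dc]] by simp
  moreover have "AE t in \<nu>. l2_rep ?d t = l2_rep x t + (-1) * l2_rep y t"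
    unfolding d by (rule l2_rep_classD(2)[OF ms])
  ultimately have "AE t in \<nu>. l2_rep x t = l2_rep y t" by (auto elim: AE_mp)
  then have "l2_class \<nu> (l2_rep x) = l2_class \<nu> (l2_rep y)" by (rule l2_class_cong)
  then show "x = y" by (simp add: L2_carrierD(3)[OF x] L2_carrierD(3)[OF y])
qed

lemma summable_on_iff_nn_integral:
  fixes f :: "'i \<Rightarrow> real"
  assumes nonneg: "\<And>i. i \<in> I \<Longrightarrow> 0 \<le> f i"
  shows "f summable_on I \<longleftrightarrow> (\<integral>\<^sup>+i. ennreal (f i) \<partial>count_space I) < \<infinity>"
    and "f summable_on I \<Longrightarrow> ennreal (\<Sum>\<^sub>\<infinity>i\<in>I. f i) = (\<integral>\<^sup>+i. ennreal (f i) \<partial>count_space I)"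
proof -
  have "f summable_on I \<longleftrightarrow> (\<lambda>i. norm (f i)) summable_on I"
    using nonneg by (auto cong: summable_on_cong)
  also have "\<dots> \<longleftrightarrow> integrable (count_space I) f"
    unfolding abs_summable_equivalent Infinite_Set_Sum.abs_summable_on_def ..
  finally have iff: "f summable_on I \<longleftrightarrow> integrable (count_space I) f" .
  have eq: "(\<integral>\<^sup>+i. ennreal (norm (f i)) \<partial>count_space I) = (\<integral>\<^sup>+i. ennreal (f i) \<partial>count_space I)"
    using nonneg by (intro nn_integral_cong) simp
  show "f summable_on I \<longleftrightarrow> (\<integral>\<^sup>+i. ennreal (f i) \<partial>count_space I) < \<infinity>"
    using eq unfolding iff integrable_iff_bounded by simp
  assume s: "f summable_on I"
  then have "(\<lambda>i. norm (f i)) summable_on I"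
    using nonneg by (auto cong: summable_on_cong)
  then have "infsetsum f I = infsum f I"
    by (intro infsetsum_infsum) (simp add: abs_summable_equivalent[symmetric])
  then have "(\<Sum>\<^sub>\<infinity>i\<in>I. f i) = (\<integral>i. f i \<partial>count_space I)" by (simp add: infsetsum_def)
  moreover have "(\<integral>\<^sup>+i. ennreal (f i) \<partial>count_space I) = ennreal (\<integral>i. f i \<partial>count_space I)"
    using s nonneg by (intro nn_integral_eq_integral) (auto simp: iff)
  ultimately show "ennreal (\<Sum>\<^sub>\<infinity>i\<in>I. f i) = (\<integral>\<^sup>+i. ennreal (f i) \<partial>count_space I)" by simp
qed

text \<open>Families of functions stand for the elements of a direct sum, with \<open>l2_vec\<close> and \<open>l2_reps\<close> passing
  between the two. The squared norm of a family is kept in \<^typ>\<open>ennreal\<close>, where sums and integrals may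
  be exchanged before anything is known to be finite.\<close>

definition fsq :: "'i set \<Rightarrow> ('i \<Rightarrow> 'a measure) \<Rightarrow> ('i \<Rightarrow> 'a \<Rightarrow> complex) \<Rightarrow> ennreal" where
  "fsq I \<nu> F = (\<integral>\<^sup>+i. nsq (\<nu> i) (F i) \<partial>count_space I)"

definition l2_fam :: "'i set \<Rightarrow> ('i \<Rightarrow> 'a measure) \<Rightarrow> ('i \<Rightarrow> 'a \<Rightarrow> complex) \<Rightarrow> bool" where
  "l2_fam I \<nu> F \<longleftrightarrow> (\<forall>i\<in>I. F i \<in> borel_measurable (\<nu> i)) \<and> fsq I \<nu> F < \<infinity>"

definition l2_vec :: "'i set \<Rightarrow> ('i \<Rightarrow> 'a measure) \<Rightarrow> ('i \<Rightarrow> 'a \<Rightarrow> complex) \<Rightarrow> 'i \<Rightarrow> ('a \<Rightarrow> complex) set" where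
  "l2_vec I \<nu> F = (\<lambda>i\<in>I. l2_class (\<nu> i) (F i))"

abbreviation l2_reps :: "('i \<Rightarrow> ('a \<Rightarrow> complex) set) \<Rightarrow> 'i \<Rightarrow> 'a \<Rightarrow> complex" where
  "l2_reps X \<equiv> \<lambda>i. l2_rep (X i)"

lemma prehilbert_l2_sum: "prehilbert (l2_sum I \<nu>)"
  unfolding l2_sum_def by (intro prehilbert_hsum prehilbert_L2)

lemma fsq_cong_AE: "(\<And>i. i \<in> I \<Longrightarrow> AE x in \<nu> i. F i x = G i x) \<Longrightarrow> fsq I \<nu> F = fsq I \<nu> G"
  unfolding fsq_def by (intro nn_integral_cong nsq_cong_AE) simp

lemma nsq_le_fsq: "i \<in> I \<Longrightarrow> nsq (\<nu> i) (F i) \<le> fsq I \<nu> F"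
  unfolding fsq_def by (rule nn_integral_ge_point)

lemma l2_famD:
  assumes "l2_fam I \<nu> F" "i \<in> I"
  shows "F i \<in> borel_measurable (\<nu> i)" and "nsq (\<nu> i) (F i) < \<infinity>"
  using assms nsq_le_fsq[of i I \<nu> F] by (auto simp: l2_fam_def intro: le_less_trans)

lemma l2_vec_cong: "(\<And>i. i \<in> I \<Longrightarrow> AE x in \<nu> i. F i x = G i x) \<Longrightarrow> l2_vec I \<nu> F = l2_vec I \<nu> G"
  unfolding l2_vec_def by (intro restrict_ext l2_class_cong)

lemma l2_rep_vec:
  "i \<in> I \<Longrightarrow> F i \<in> borel_measurable (\<nu> i) \<Longrightarrow> AE x in \<nu> i. l2_rep (l2_vec I \<nu> F i) x = F i x"
  using l2_rep_classD(2)[of "F i" "\<nu> i"] by (simp add: l2_vec_def)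

lemma l2_sum_memD:
  assumes X: "X \<in> hcarrier (l2_sum I \<nu>)"
  shows "i \<in> I \<Longrightarrow> X i \<in> hcarrier (L2 (\<nu> i))"
    and "l2_fam I \<nu> (l2_reps X)" and "l2_vec I \<nu> (l2_reps X) = X"
    and "ennreal ((hnorm (l2_sum I \<nu>) X)\<^sup>2) = fsq I \<nu> (l2_reps X)"
proof -
  note X' = X[unfolded l2_sum_def]
  note h = hsum_memD[OF X']
  show mem: "i \<in> I \<Longrightarrow> X i \<in> hcarrier (L2 (\<nu> i))" for i by (rule h(1))
  have eq: "(\<integral>\<^sup>+i. ennreal ((hnorm (L2 (\<nu> i)) (X i))\<^sup>2) \<partial>count_space I) = fsq I \<nu> (l2_reps X)"
    unfolding fsq_def by (intro nn_integral_cong) (simp add: hnorm_L2 mem)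
  show n: "ennreal ((hnorm (l2_sum I \<nu>) X)\<^sup>2) = fsq I \<nu> (l2_reps X)"
    unfolding l2_sum_def hnorm_hsum[OF prehilbert_L2 X'] eq[symmetric]
    by (rule summable_on_iff_nn_integral(2)) (use h(3) in auto)
  have "fsq I \<nu> (l2_reps X) < \<infinity>" unfolding n[symmetric] by simp
  then show "l2_fam I \<nu> (l2_reps X)" by (simp add: l2_fam_def L2_carrierD(1) mem)
  show "l2_vec I \<nu> (l2_reps X) = X"
  proof (rule HOL.ext)
    fix i show "l2_vec I \<nu> (l2_reps X) i = X i"
      using h(2)[of i] mem[of i] by (cases "i \<in> I") (simp_all add: l2_vec_def L2_carrierD(3))
  qed
qed

lemma l2_vec_mem:
  assumes F: "l2_fam I \<nu> F"
  shows "l2_vec I \<nu> F \<in> hcarrier (l2_sum I \<nu>)"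
    and "ennreal ((hnorm (l2_sum I \<nu>) (l2_vec I \<nu> F))\<^sup>2) = fsq I \<nu> F"
proof -
  have mem: "l2_vec I \<nu> F i \<in> hcarrier (L2 (\<nu> i))" if "i \<in> I" for i
    using that l2_famD[OF F that] by (simp add: l2_vec_def L2_carrierI)
  have "ennreal ((hnorm (L2 (\<nu> i)) (l2_vec I \<nu> F i))\<^sup>2) = nsq (\<nu> i) (F i)" if "i \<in> I" for i
    unfolding hnorm_L2[OF mem[OF that]] by (intro nsq_cong_AE l2_rep_vec that l2_famD(1)[OF F])
  then have "(\<integral>\<^sup>+i. ennreal ((hnorm (L2 (\<nu> i)) (l2_vec I \<nu> F i))\<^sup>2) \<partial>count_space I) = fsq I \<nu> F"
    unfolding fsq_def by (intro nn_integral_cong) simp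
  then have "(\<lambda>i. (hnorm (L2 (\<nu> i)) (l2_vec I \<nu> F i))\<^sup>2) summable_on I"
    using F by (subst summable_on_iff_nn_integral) (auto simp: l2_fam_def)
  then show m: "l2_vec I \<nu> F \<in> hcarrier (l2_sum I \<nu>)"
    unfolding l2_sum_def by (intro hsum_memI mem) (auto simp: l2_vec_def)
  show "ennreal ((hnorm (l2_sum I \<nu>) (l2_vec I \<nu> F))\<^sup>2) = fsq I \<nu> F"
    unfolding l2_sum_memD(4)[OF m] by (intro fsq_cong_AE l2_rep_vec l2_famD(1)[OF F])
qed

lemma l2_sum_zero: "hzero (l2_sum I \<nu>) = l2_vec I \<nu> (\<lambda>_ _. 0)"
  by (simp add: l2_sum_def l2_vec_def)

lemma l2_sum_plus:
  "hplus (l2_sum I \<nu>) X Y = l2_vec I \<nu> (\<lambda>i x. l2_rep (X i) x + l2_rep (Y i) x)"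
  by (simp add: l2_sum_def l2_vec_def)

lemma l2_sum_scale: "hscale (l2_sum I \<nu>) a X = l2_vec I \<nu> (\<lambda>i x. a * l2_rep (X i) x)"
  by (simp add: l2_sum_def l2_vec_def)

lemma l2_vec_plus:
  assumes "\<And>i. i \<in> I \<Longrightarrow> F i \<in> borel_measurable (\<nu> i)" "\<And>i. i \<in> I \<Longrightarrow> G i \<in> borel_measurable (\<nu> i)"
  shows "hplus (l2_sum I \<nu>) (l2_vec I \<nu> F) (l2_vec I \<nu> G) = l2_vec I \<nu> (\<lambda>i x. F i x + G i x)"
  unfolding l2_sum_plus
proof (rule l2_vec_cong)
  fix i assume i: "i \<in> I"
  show "AE x in \<nu> i. l2_rep (l2_vec I \<nu> F i) x + l2_rep (l2_vec I \<nu> G i) x = F i x + G i x"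
    using l2_rep_vec[OF i, of F \<nu>] l2_rep_vec[OF i, of G \<nu>] assms i by (auto elim: AE_mp)
qed

lemma l2_vec_scale:
  assumes "\<And>i. i \<in> I \<Longrightarrow> F i \<in> borel_measurable (\<nu> i)"
  shows "hscale (l2_sum I \<nu>) a (l2_vec I \<nu> F) = l2_vec I \<nu> (\<lambda>i x. a * F i x)"
  unfolding l2_sum_scale
proof (rule l2_vec_cong)
  fix i assume i: "i \<in> I"
  show "AE x in \<nu> i. a * l2_rep (l2_vec I \<nu> F i) x = a * F i x"
    using l2_rep_vec[OF i, of F \<nu>] assms i by (auto elim: AE_mp)
qed

text \<open>An operator between direct sums is described by what it does to families of functions. It is
  well defined and isometric as soon as the map \<open>\<Phi>\<close> of families respects almost everywhere equality,
  is linear almost everywhere and preserves the squared norm.\<close>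

lemma l2_isometryI:
  assumes fam: "\<And>F. l2_fam I \<nu> F \<Longrightarrow> \<forall>j\<in>J. \<Phi> F j \<in> borel_measurable (\<rho> j)"
    and norm: "\<And>F. l2_fam I \<nu> F \<Longrightarrow> fsq J \<rho> (\<Phi> F) = fsq I \<nu> F"
    and cong: "\<And>F G j. \<lbrakk>l2_fam I \<nu> F; l2_fam I \<nu> G; \<And>i. i \<in> I \<Longrightarrow> AE x in \<nu> i. F i x = G i x; j \<in> J\<rbrakk>
      \<Longrightarrow> AE x in \<rho> j. \<Phi> F j x = \<Phi> G j x"
    and add: "\<And>F G j. \<lbrakk>l2_fam I \<nu> F; l2_fam I \<nu> G; j \<in> J\<rbrakk>
      \<Longrightarrow> AE x in \<rho> j. \<Phi> (\<lambda>i x. F i x + G i x) j x = \<Phi> F j x + \<Phi> G j x"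
    and scale: "\<And>a F j. \<lbrakk>l2_fam I \<nu> F; j \<in> J\<rbrakk> \<Longrightarrow> AE x in \<rho> j. \<Phi> (\<lambda>i x. a * F i x) j x = a * \<Phi> F j x"
    and S: "\<And>X. X \<in> hcarrier (l2_sum I \<nu>) \<Longrightarrow> S X = l2_vec J \<rho> (\<Phi> (l2_reps X))"
  shows "isometry (l2_sum I \<nu>) (l2_sum J \<rho>) S \<and>
    (\<forall>F. l2_fam I \<nu> F \<longrightarrow> l2_fam J \<rho> (\<Phi> F) \<and> S (l2_vec I \<nu> F) = l2_vec J \<rho> (\<Phi> F))"
proof -
  interpret A: prehilbert "l2_sum I \<nu>" by (rule prehilbert_l2_sum)
  have famJ: "l2_fam J \<rho> (\<Phi> F)" if "l2_fam I \<nu> F" for F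
    using fam[OF that] norm[OF that] that by (simp add: l2_fam_def)
  have vec: "S (l2_vec I \<nu> F) = l2_vec J \<rho> (\<Phi> F)" if F: "l2_fam I \<nu> F" for F
    unfolding S[OF l2_vec_mem(1)[OF F]]
    by (intro l2_vec_cong cong l2_sum_memD(2)[OF l2_vec_mem(1)[OF F]] F l2_rep_vec l2_famD(1)[OF F])
  have sumfam: "l2_fam I \<nu> (\<lambda>i x. l2_rep (X i) x + l2_rep (Y i) x)"
    if X: "X \<in> hcarrier (l2_sum I \<nu>)" and Y: "Y \<in> hcarrier (l2_sum I \<nu>)" for X Y
  proof -
    have c: "hplus (l2_sum I \<nu>) X Y \<in> hcarrier (l2_sum I \<nu>)" using X Y by (rule A.plus_closed)
    have m: "(\<lambda>x. l2_rep (X i) x + l2_rep (Y i) x) \<in> borel_measurable (\<nu> i)" if "i \<in> I" for i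
      using l2_famD(1)[OF l2_sum_memD(2)[OF X] that] l2_famD(1)[OF l2_sum_memD(2)[OF Y] that] by simp
    have "fsq I \<nu> (l2_reps (hplus (l2_sum I \<nu>) X Y)) = fsq I \<nu> (\<lambda>i x. l2_rep (X i) x + l2_rep (Y i) x)"
      unfolding l2_sum_plus by (intro fsq_cong_AE l2_rep_vec m)
    then show ?thesis
      using l2_sum_memD(2)[OF c] m by (simp add: l2_fam_def)
  qed
  have scalefam: "l2_fam I \<nu> (\<lambda>i x. a * l2_rep (X i) x)" if X: "X \<in> hcarrier (l2_sum I \<nu>)" for X a
  proof -
    have c: "hscale (l2_sum I \<nu>) a X \<in> hcarrier (l2_sum I \<nu>)" using X by (rule A.scale_closed)
    have m: "(\<lambda>x. a * l2_rep (X i) x) \<in> borel_measurable (\<nu> i)" if "i \<in> I" for i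
      using l2_famD(1)[OF l2_sum_memD(2)[OF X] that] by simp
    have "fsq I \<nu> (l2_reps (hscale (l2_sum I \<nu>) a X)) = fsq I \<nu> (\<lambda>i x. a * l2_rep (X i) x)"
      unfolding l2_sum_scale by (intro fsq_cong_AE l2_rep_vec m)
    then show ?thesis
      using l2_sum_memD(2)[OF c] m by (simp add: l2_fam_def)
  qed
  have "isometry (l2_sum I \<nu>) (l2_sum J \<rho>) S"
    unfolding isometry_def linear_map_def
  proof (intro conjI ballI allI)
    show "S \<in> hcarrier (l2_sum I \<nu>) \<rightarrow> hcarrier (l2_sum J \<rho>)"
      using S l2_vec_mem(1)[OF famJ[OF l2_sum_memD(2)]] by auto
  next
    fix X Y assume X: "X \<in> hcarrier (l2_sum I \<nu>)" and Y: "Y \<in> hcarrier (l2_sum I \<nu>)"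
    have "S (hplus (l2_sum I \<nu>) X Y) = l2_vec J \<rho> (\<Phi> (\<lambda>i x. l2_rep (X i) x + l2_rep (Y i) x))"
      unfolding l2_sum_plus by (rule vec[OF sumfam[OF X Y]])
    also have "\<dots> = l2_vec J \<rho> (\<lambda>j x. \<Phi> (l2_reps X) j x + \<Phi> (l2_reps Y) j x)"
      by (intro l2_vec_cong add l2_sum_memD(2)[OF X] l2_sum_memD(2)[OF Y])
    also have "\<dots> = hplus (l2_sum J \<rho>) (S X) (S Y)"
      unfolding S[OF X] S[OF Y]
      by (rule l2_vec_plus[symmetric]) (use fam l2_sum_memD(2)[OF X] l2_sum_memD(2)[OF Y] in auto)
    finally show "S (hplus (l2_sum I \<nu>) X Y) = hplus (l2_sum J \<rho>) (S X) (S Y)" .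
  next
    fix a X assume X: "X \<in> hcarrier (l2_sum I \<nu>)"
    have "S (hscale (l2_sum I \<nu>) a X) = l2_vec J \<rho> (\<Phi> (\<lambda>i x. a * l2_rep (X i) x))"
      unfolding l2_sum_scale by (rule vec[OF scalefam[OF X]])
    also have "\<dots> = l2_vec J \<rho> (\<lambda>j x. a * \<Phi> (l2_reps X) j x)"
      by (intro l2_vec_cong scale l2_sum_memD(2)[OF X])
    also have "\<dots> = hscale (l2_sum J \<rho>) a (S X)"
      unfolding S[OF X]
      by (rule l2_vec_scale[symmetric]) (use fam l2_sum_memD(2)[OF X] in auto)
    finally show "S (hscale (l2_sum I \<nu>) a X) = hscale (l2_sum J \<rho>) a (S X)" .
  next
    fix X assume X: "X \<in> hcarrier (l2_sum I \<nu>)"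
    have "ennreal ((hnorm (l2_sum J \<rho>) (S X))\<^sup>2) = ennreal ((hnorm (l2_sum I \<nu>) X)\<^sup>2)"
      using l2_vec_mem(2)[OF famJ[OF l2_sum_memD(2)[OF X]]] norm[OF l2_sum_memD(2)[OF X]]
        l2_sum_memD(4)[OF X] S[OF X] by simp
    moreover have "hnorm (l2_sum J \<rho>) (S X) \<ge> 0" "hnorm (l2_sum I \<nu>) X \<ge> 0"
      using prehilbert.inner_nonneg[OF prehilbert_l2_sum] l2_vec_mem(1)[OF famJ[OF l2_sum_memD(2)[OF X]]] X
      by (auto simp: hnorm_def S[OF X])
    ultimately show "hnorm (l2_sum J \<rho>) (S X) = hnorm (l2_sum I \<nu>) X"
      by (simp add: power2_eq_iff_nonneg)
  qed
  then show ?thesis using famJ vec by blast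
qed

section \<open>The dilation is unitary\<close>

lemma mult_char_eq: "mult_char I \<nu> \<gamma> X = l2_vec I \<nu> (\<lambda>i \<omega>. \<omega> \<gamma> * l2_rep (X i) \<omega>)"
  by (simp add: mult_char_def l2_vec_def)

text \<open>The measures \<open>\<nu>\<close> that occur in the direct sums live on a Borel part of the dual group, which is
  recorded as their \<^term>\<open>space \<nu>\<close>. Dilation preserves this class.\<close>

definition borel_part :: "('g::ab_group_add \<Rightarrow> complex) measure \<Rightarrow> bool" where
  "borel_part \<nu> \<longleftrightarrow> space \<nu> \<in> sets dual_borel \<and> sets \<nu> = sets (restrict_space dual_borel (space \<nu>))"

lemma borel_part_space: "borel_part \<nu> \<Longrightarrow> space \<nu> \<subseteq> dual_group"
  unfolding borel_part_def using sets.sets_into_space by fastforce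

lemma borel_part_sets_iff:
  assumes "borel_part \<nu>"
  shows "A \<in> sets \<nu> \<longleftrightarrow> A \<subseteq> space \<nu> \<and> A \<in> sets dual_borel"
proof -
  have "space \<nu> \<inter> space dual_borel \<in> sets dual_borel"
    using assms borel_part_space[OF assms] by (simp add: borel_part_def Int_absorb2)
  then have "A \<in> sets (restrict_space dual_borel (space \<nu>)) \<longleftrightarrow> A \<subseteq> space \<nu> \<and> A \<in> sets dual_borel"
    by (rule sets_restrict_space_iff)
  then show ?thesis using assms by (metis borel_part_def)
qed

lemma borel_part_measurable:
  assumes \<nu>: "borel_part \<nu>" and f: "f \<in> measurable dual_borel N"
  shows "f \<in> measurable \<nu> N"
proof -
  have "f \<in> measurable (restrict_space dual_borel (space \<nu>)) N"
    using f by (rule measurable_restrict_space1)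
  moreover have "measurable (restrict_space dual_borel (space \<nu>)) N = measurable \<nu> N"
    using \<nu> by (intro measurable_cong_sets) (auto simp: borel_part_def)
  ultimately show ?thesis by simp
qed

lemma borel_part_extend:
  fixes f :: "('g::ab_group_add \<Rightarrow> complex) \<Rightarrow> complex"
  assumes \<nu>: "borel_part \<nu>" and f: "f \<in> borel_measurable \<nu>" and zero: "\<And>x. x \<notin> space \<nu> \<Longrightarrow> f x = 0"
  shows "f \<in> borel_measurable dual_borel"
proof -
  have S: "space \<nu> \<inter> space dual_borel \<in> sets dual_borel"
    using \<nu> borel_part_space[OF \<nu>] by (simp add: borel_part_def Int_absorb2)
  have "f \<in> borel_measurable (restrict_space dual_borel (space \<nu>))"
    using f \<nu> measurable_cong_sets[of \<nu> "restrict_space dual_borel (space \<nu>)"] by (auto simp: borel_part_def)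
  then have "(\<lambda>x. indicator (space \<nu>) x *\<^sub>R f x) \<in> borel_measurable dual_borel"
    by (simp add: borel_measurable_restrict_space_iff[OF S])
  moreover have "(\<lambda>x. indicator (space \<nu>) x *\<^sub>R f x) = f"
    using zero by (auto simp: indicator_def)
  ultimately show ?thesis by simp
qed

lemma mult_char_vec:
  assumes \<nu>: "\<And>i. i \<in> I \<Longrightarrow> borel_part (\<nu> i)" and F: "\<And>i. i \<in> I \<Longrightarrow> F i \<in> borel_measurable (\<nu> i)"
  shows "mult_char I \<nu> \<gamma> (l2_vec I \<nu> F) = l2_vec I \<nu> (\<lambda>i \<omega>. \<omega> \<gamma> * F i \<omega>)"
  unfolding mult_char_eq
proof (rule l2_vec_cong)
  fix i assume "i \<in> I"
  with l2_rep_vec[of i I F \<nu>] F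
  show "AE x in \<nu> i. x \<gamma> * l2_rep (l2_vec I \<nu> F i) x = x \<gamma> * F i x" by (auto elim: AE_mp)
qed

lemma l2_fam_char:
  fixes \<nu> :: "'i \<Rightarrow> ('g::{ab_group_add,countable} \<Rightarrow> complex) measure"
  assumes \<nu>: "\<And>i. i \<in> I \<Longrightarrow> borel_part (\<nu> i)" and F: "l2_fam I \<nu> F"
  shows "l2_fam I \<nu> (\<lambda>i \<omega>. \<omega> \<gamma> * F i \<omega>)"
proof -
  have "nsq (\<nu> i) (\<lambda>\<omega>. \<omega> \<gamma> * F i \<omega>) = nsq (\<nu> i) (F i)" if "i \<in> I" for i
    unfolding nsq_def
  proof (rule nn_integral_cong)
    fix x assume "x \<in> space (\<nu> i)"
    then have "norm (x \<gamma>) = 1"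
      using borel_part_space[OF \<nu>[OF that]] by (auto intro: dual_group_norm)
    then show "ennreal ((norm (x \<gamma> * F i x))\<^sup>2) = ennreal ((norm (F i x))\<^sup>2)" by (simp add: norm_mult)
  qed
  then have "fsq I \<nu> (\<lambda>i \<omega>. \<omega> \<gamma> * F i \<omega>) = fsq I \<nu> F"
    unfolding fsq_def by (intro nn_integral_cong) simp
  moreover have "(\<lambda>\<omega>. \<omega> \<gamma> * F i \<omega>) \<in> borel_measurable (\<nu> i)" if "i \<in> I" for i
    using l2_famD(1)[OF F that] borel_part_measurable[OF \<nu>[OF that] measurable_eval[of \<gamma>]] by simp
  ultimately show ?thesis using F by (simp add: l2_fam_def)
qed

lemma mult_char_closed:
  fixes \<nu> :: "'i \<Rightarrow> ('g::{ab_group_add,countable} \<Rightarrow> complex) measure"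
  assumes "\<And>i. i \<in> I \<Longrightarrow> borel_part (\<nu> i)" "X \<in> hcarrier (l2_sum I \<nu>)"
  shows "mult_char I \<nu> \<gamma> X \<in> hcarrier (l2_sum I \<nu>)"
  unfolding mult_char_eq by (intro l2_vec_mem l2_fam_char assms l2_sum_memD(2)) 

context dual_setting
begin

lemma kernel_cocycle: "\<omega> \<in> dual_group \<Longrightarrow> cocycle \<alpha> c \<omega> \<in> dual_kernel \<alpha>"
  using dual_group_nonzero[of "p \<omega>"]
  by (auto simp: cocycle_def dual_kernel_def fibre_def endo_mult endo_dual section_dual endo_section
      dual_group_mult dual_group_inv)
     (auto simp: char_mult_def char_inv_def dual_endo_def)

text \<open>The inverse branches of the dual endomorphism: \<open>branch \<zeta>\<close> inverts it on the set of all
  \<open>\<omega>\<close> with cocycle \<open>\<zeta>\<close>, the cell of \<open>\<zeta>\<close>.\<close>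

definition branch :: "('g \<Rightarrow> complex) \<Rightarrow> ('g \<Rightarrow> complex) \<Rightarrow> ('g \<Rightarrow> complex)" where
  "branch \<zeta> \<omega> = char_mult (char_inv \<zeta>) (c \<omega>)"

lemma measurable_branch:
  assumes "\<zeta> \<in> dual_kernel \<alpha>" shows "branch \<zeta> \<in> measurable \<mu> \<mu>"
proof -
  have [measurable]: "(\<lambda>_. char_inv \<zeta>) \<in> measurable \<mu> \<mu>"
    using dual_group_inv[OF kernel_dual[OF assms]] by simp
  show ?thesis unfolding branch_def[abs_def] by measurable
qed

lemma branch_dual: "\<zeta> \<in> dual_kernel \<alpha> \<Longrightarrow> \<omega> \<in> dual_group \<Longrightarrow> branch \<zeta> \<omega> \<in> dual_group"
  by (simp add: branch_def dual_group_mult dual_group_inv kernel_dual section_dual)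

lemma endo_branch: "\<zeta> \<in> dual_kernel \<alpha> \<Longrightarrow> \<omega> \<in> dual_group \<Longrightarrow> p (branch \<zeta> \<omega>) = \<omega>"
  using kernel_endo[of \<zeta>]
  by (simp add: branch_def endo_mult endo_section) (auto simp: char_mult_def char_inv_def dual_endo_def fun_eq_iff)

lemma cocycle_eq_iff:
  "\<omega> \<in> dual_group \<Longrightarrow> \<zeta> \<in> dual_kernel \<alpha> \<Longrightarrow> cocycle \<alpha> c \<omega> = \<zeta> \<longleftrightarrow> branch \<zeta> (p \<omega>) = \<omega>"
  using char_inv_eq_iff[of \<omega> \<zeta> "c (p \<omega>)"] by (auto simp: cocycle_def branch_def kernel_dual)

lemma cocycle_branch: "\<omega> \<in> dual_group \<Longrightarrow> \<zeta> \<in> dual_kernel \<alpha> \<Longrightarrow> cocycle \<alpha> c (branch \<zeta> \<omega>) = \<zeta>"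
  by (simp add: cocycle_eq_iff branch_dual endo_branch)

definition cell :: "('g \<Rightarrow> complex) measure \<Rightarrow> ('g \<Rightarrow> complex) \<Rightarrow> ('g \<Rightarrow> complex) set" where
  "cell \<nu> \<zeta> = {\<omega> \<in> space \<nu>. cocycle \<alpha> c \<omega> = \<zeta>}"

lemma cell_measurable:
  assumes \<nu>: "borel_part \<nu>" and \<zeta>: "\<zeta> \<in> dual_kernel \<alpha>"
  shows "cell \<nu> \<zeta> \<in> sets \<nu>" "cell \<nu> \<zeta> \<in> sets dual_borel"
proof -
  have S: "space \<nu> \<subseteq> dual_group" by (rule borel_part_space[OF \<nu>])
  have m: "(\<lambda>\<omega>. branch \<zeta> (p \<omega>)) \<in> measurable \<mu> \<mu>"
    using measurable_compose[OF measurable_endo measurable_branch[OF \<zeta>]] .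
  have m1: "(\<lambda>\<omega>. branch \<zeta> (p \<omega>) \<gamma>) \<in> borel_measurable \<mu>" for \<gamma>
    using measurable_compose[OF m measurable_eval_haar] .
  have "{\<omega>\<in>space \<mu>. norm (branch \<zeta> (p \<omega>) \<gamma> - \<omega> \<gamma>) = 0} \<in> sets \<mu>" for \<gamma>
    using m1[of \<gamma>] measurable_eval_haar[of \<gamma>] by measurable
  then have "{\<omega>\<in>space \<mu>. \<forall>\<gamma>. branch \<zeta> (p \<omega>) \<gamma> = \<omega> \<gamma>} \<in> sets \<mu>"
    by (intro sets.sets_Collect_countable_All) simp
  then have "{\<omega>\<in>dual_group. branch \<zeta> (p \<omega>) = \<omega>} \<in> sets dual_borel" by (simp add: fun_eq_iff)
  moreover have eq: "cell \<nu> \<zeta> = space \<nu> \<inter> {\<omega>\<in>dual_group. branch \<zeta> (p \<omega>) = \<omega>}"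
    using S cocycle_eq_iff[OF _ \<zeta>] unfolding cell_def by blast
  ultimately show b: "cell \<nu> \<zeta> \<in> sets dual_borel"
    using \<nu> by (auto simp: borel_part_def)
  show "cell \<nu> \<zeta> \<in> sets \<nu>"
    using b unfolding borel_part_sets_iff[OF \<nu>] by (auto simp: cell_def)
qed

lemma endo_cell:
  assumes \<nu>: "borel_part \<nu>" and \<zeta>: "\<zeta> \<in> dual_kernel \<alpha>"
  shows "p ` cell \<nu> \<zeta> = branch \<zeta> -` space \<nu> \<inter> dual_group"
proof (intro equalityI subsetI)
  have S: "space \<nu> \<subseteq> dual_group" by (rule borel_part_space[OF \<nu>])
  fix \<omega> assume "\<omega> \<in> p ` cell \<nu> \<zeta>"
  then obtain \<omega>' where "\<omega> = p \<omega>'" "\<omega>' \<in> space \<nu>" "cocycle \<alpha> c \<omega>' = \<zeta>" by (auto simp: cell_def)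
  moreover from this have "\<omega>' \<in> dual_group" using S by auto
  ultimately show "\<omega> \<in> branch \<zeta> -` space \<nu> \<inter> dual_group"
    using cocycle_eq_iff[of \<omega>' \<zeta>] \<zeta> by (auto simp: endo_dual)
next
  fix \<omega> assume "\<omega> \<in> branch \<zeta> -` space \<nu> \<inter> dual_group"
  then show "\<omega> \<in> p ` cell \<nu> \<zeta>"
    using \<zeta> by (intro image_eqI[of _ _ "branch \<zeta> \<omega>"]) (auto simp: cell_def cocycle_branch endo_branch)
qed

lemma endo_cell_measurable:
  assumes \<nu>: "borel_part \<nu>" and \<zeta>: "\<zeta> \<in> dual_kernel \<alpha>"
  shows "p ` cell \<nu> \<zeta> \<in> sets dual_borel"
proof -
  have "branch \<zeta> -` space \<nu> \<inter> space \<mu> \<in> sets \<mu>"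
    by (rule measurable_sets[OF measurable_branch[OF \<zeta>]]) (use \<nu> in \<open>simp add: borel_part_def\<close>)
  then show ?thesis by (simp add: endo_cell[OF \<nu> \<zeta>])
qed

lemma dilate_measure_eq:
  "dilate_measure \<alpha> c \<nu> \<zeta> = scale_measure (of_nat (image_index \<alpha>))
     (distr (restrict_space \<nu> (cell \<nu> \<zeta>)) (restrict_space dual_borel (p ` cell \<nu> \<zeta>)) p)"
  by (simp add: dilate_measure_def cell_def Let_def)

lemma space_dilate:
  assumes \<nu>: "borel_part \<nu>" and \<zeta>: "\<zeta> \<in> dual_kernel \<alpha>"
  shows "space (dilate_measure \<alpha> c \<nu> \<zeta>) = p ` cell \<nu> \<zeta>"
proof -
  have "p ` cell \<nu> \<zeta> \<subseteq> dual_group" using endo_cell[OF \<nu> \<zeta>] by auto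
  then show ?thesis
    by (auto simp: dilate_measure_eq space_scale_measure space_restrict_space)
qed

lemma borel_part_dilate:
  assumes "borel_part \<nu>" "\<zeta> \<in> dual_kernel \<alpha>"
  shows "borel_part (dilate_measure \<alpha> c \<nu> \<zeta>)"
  unfolding borel_part_def space_dilate[OF assms]
  using endo_cell_measurable[OF assms] by (simp add: dilate_measure_eq)

lemma measurable_endo_cell:
  assumes \<nu>: "borel_part \<nu>" and \<zeta>: "\<zeta> \<in> dual_kernel \<alpha>"
  shows "p \<in> measurable (restrict_space \<nu> (cell \<nu> \<zeta>)) (restrict_space dual_borel (p ` cell \<nu> \<zeta>))"
proof (rule measurable_restrict_space2)
  show "p \<in> space (restrict_space \<nu> (cell \<nu> \<zeta>)) \<rightarrow> p ` cell \<nu> \<zeta>"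
    by (auto simp: space_restrict_space)
  have "p \<in> measurable dual_borel dual_borel"
    using measurable_endo by (simp add: measurable_haar_cong measurable_haar_cong')
  then show "p \<in> measurable (restrict_space \<nu> (cell \<nu> \<zeta>)) dual_borel"
    by (intro measurable_restrict_space1 borel_part_measurable[OF \<nu>])
qed

lemma measurable_dilate_cong:
  "measurable (dilate_measure \<alpha> c \<nu> \<zeta>) L = measurable (restrict_space dual_borel (p ` cell \<nu> \<zeta>)) L"
  by (rule measurable_cong_sets) (simp_all add: dilate_measure_eq)

lemma nn_integral_dilate:
  assumes \<nu>: "borel_part \<nu>" and \<zeta>: "\<zeta> \<in> dual_kernel \<alpha>"
    and f: "f \<in> borel_measurable (dilate_measure \<alpha> c \<nu> \<zeta>)"
  shows "(\<integral>\<^sup>+\<omega>. f \<omega> \<partial>dilate_measure \<alpha> c \<nu> \<zeta>)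
    = of_nat (image_index \<alpha>) * (\<integral>\<^sup>+\<omega>. f (p \<omega>) * indicator (cell \<nu> \<zeta>) \<omega> \<partial>\<nu>)"
proof -
  have f': "f \<in> borel_measurable (restrict_space dual_borel (p ` cell \<nu> \<zeta>))"
    using f by (simp add: measurable_dilate_cong)
  have E: "cell \<nu> \<zeta> \<inter> space \<nu> \<in> sets \<nu>"
    using cell_measurable(1)[OF \<nu> \<zeta>] by auto
  show ?thesis
    unfolding dilate_measure_eq using f'
    by (simp add: nn_integral_scale_measure nn_integral_distr[OF measurable_endo_cell[OF \<nu> \<zeta>]]
        nn_integral_restrict_space[OF E])
qed

lemma cellD:
  assumes "borel_part \<nu>" "\<omega> \<in> cell \<nu> \<zeta>"
  shows "\<omega> \<in> space \<nu>" "\<omega> \<in> dual_group" "cocycle \<alpha> c \<omega> = \<zeta>"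
  using assms borel_part_space[OF assms(1)] by (auto simp: cell_def)

lemma branch_cell:
  assumes "borel_part \<nu>" "\<zeta> \<in> dual_kernel \<alpha>" "\<omega> \<in> cell \<nu> \<zeta>"
  shows "branch \<zeta> (p \<omega>) = \<omega>"
  using cellD[OF assms(1,3)] cocycle_eq_iff[OF _ assms(2), of \<omega>] by simp

text \<open>The dilated measure is the image of a part of \<open>\<nu>\<close> under the endomorphism, and the inverse branch
  undoes the latter.\<close>

lemma AE_dilate:
  assumes \<nu>: "borel_part \<nu>" and \<zeta>: "\<zeta> \<in> dual_kernel \<alpha>" and AE: "AE \<omega> in \<nu>. P \<omega>"
  shows "AE \<omega> in dilate_measure \<alpha> c \<nu> \<zeta>. P (branch \<zeta> \<omega>)"
proof -
  let ?D = "dilate_measure \<alpha> c \<nu> \<zeta>"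
  obtain N where N: "{\<omega>\<in>space \<nu>. \<not> P \<omega>} \<subseteq> N" "N \<in> null_sets \<nu>"
    using AE by (auto simp: eventually_ae_filter)
  have Nb: "N \<in> sets dual_borel"
    using null_setsD2[OF N(2)] borel_part_sets_iff[OF \<nu>] by simp
  have "branch \<zeta> \<in> measurable ?D dual_borel"
    using measurable_branch[OF \<zeta>] by (intro borel_part_measurable[OF borel_part_dilate[OF \<nu> \<zeta>]])
      (simp add: measurable_haar_cong measurable_haar_cong')
  then have m: "(\<lambda>\<omega>. indicator N (branch \<zeta> \<omega>) :: ennreal) \<in> borel_measurable ?D"
    using Nb by (intro measurable_compose[OF _ borel_measurable_indicator])
  have "(\<integral>\<^sup>+\<omega>. indicator N (branch \<zeta> \<omega>) \<partial>?D)
      = of_nat (image_index \<alpha>) * (\<integral>\<^sup>+\<omega>. indicator N (branch \<zeta> (p \<omega>)) * indicator (cell \<nu> \<zeta>) \<omega> \<partial>\<nu>)"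
    by (rule nn_integral_dilate[OF \<nu> \<zeta> m])
  also have "(\<integral>\<^sup>+\<omega>. indicator N (branch \<zeta> (p \<omega>)) * indicator (cell \<nu> \<zeta>) \<omega> \<partial>\<nu>) = 0"
  proof -
    have "(\<integral>\<^sup>+\<omega>. indicator N (branch \<zeta> (p \<omega>)) * indicator (cell \<nu> \<zeta>) \<omega> \<partial>\<nu>) \<le> (\<integral>\<^sup>+\<omega>. indicator N \<omega> \<partial>\<nu>)"
      using branch_cell[OF \<nu> \<zeta>] by (intro nn_integral_mono) (auto simp: indicator_def)
    then show ?thesis using N(2) by (simp add: null_setsD1 null_setsD2)
  qed
  finally have "(\<integral>\<^sup>+\<omega>. indicator N (branch \<zeta> \<omega>) \<partial>?D) = 0" by simp
  then have "AE \<omega> in ?D. (indicator N (branch \<zeta> \<omega>) :: ennreal) = 0"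
    using m by (simp add: nn_integral_0_iff_AE)
  then show ?thesis
  proof (rule AE_mp, intro AE_I2 impI)
    fix \<omega> assume "\<omega> \<in> space ?D" "(indicator N (branch \<zeta> \<omega>) :: ennreal) = 0"
    then have "branch \<zeta> \<omega> \<in> space \<nu>" "branch \<zeta> \<omega> \<notin> N"
      by (auto simp: space_dilate[OF \<nu> \<zeta>] endo_cell[OF \<nu> \<zeta>] split: split_indicator_asm)
    then show "P (branch \<zeta> \<omega>)" using N(1) by auto
  qed
qed

definition dilate_fun ::
  "(('g \<Rightarrow> complex) dindex \<Rightarrow> ('g \<Rightarrow> complex) \<Rightarrow> complex) \<Rightarrow>
   ('g \<Rightarrow> complex) dindex \<Rightarrow> ('g \<Rightarrow> complex) \<Rightarrow> complex" where
  "dilate_fun F d \<omega> = (case d of Base k \<Rightarrow> undefined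
     | Dil i \<zeta> \<Rightarrow> complex_of_real (1 / sqrt (real (image_index \<alpha>))) * F i (branch \<zeta> \<omega>))"

lemma dilate_fun_Dil:
  "dilate_fun F (Dil i \<zeta>) = (\<lambda>\<omega>. complex_of_real (1 / sqrt (real (image_index \<alpha>))) * F i (branch \<zeta> \<omega>))"
  by (simp add: dilate_fun_def fun_eq_iff)

lemma dilate_eq:
  "dilate \<alpha> c I \<nu> X = l2_vec (dilate_index \<alpha> I) (dilate_family \<alpha> c \<nu>) (dilate_fun (l2_reps X))"
  unfolding dilate_def l2_vec_def dilate_family_def dilate_fun_def branch_def
  by (rule restrict_ext) (auto simp: dilate_index_def)

lemma dilate_family_Dil: "dilate_family \<alpha> c \<nu> (Dil i \<zeta>) = dilate_measure \<alpha> c (\<nu> i) \<zeta>"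
  by (simp add: dilate_family_def)

lemma borel_part_dilate_family:
  "(\<And>i. i \<in> I \<Longrightarrow> borel_part (\<nu> i)) \<Longrightarrow> d \<in> dilate_index \<alpha> I \<Longrightarrow> borel_part (dilate_family \<alpha> c \<nu> d)"
  by (auto simp: dilate_index_def dilate_family_Dil borel_part_dilate)

text \<open>The kernel is finite, so a sum over the dilated index set is a finite sum of sums over \<open>I\<close>.\<close>

lemma nn_integral_dilate_index:
  fixes f :: "('g \<Rightarrow> complex) dindex \<Rightarrow> ennreal"
  shows "(\<integral>\<^sup>+d. f d \<partial>count_space (dilate_index \<alpha> I))
    = (\<integral>\<^sup>+i. (\<Sum>\<zeta>\<in>dual_kernel \<alpha>. f (Dil i \<zeta>)) \<partial>count_space I)"
proof -
  let ?g = "\<lambda>(i, \<zeta>). f (Dil i \<zeta>) * indicator I i * indicator (dual_kernel \<alpha>) \<zeta>"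
  have "bij_betw (\<lambda>(i, \<zeta>). Dil i \<zeta>) (I \<times> dual_kernel \<alpha>) (dilate_index \<alpha> I)"
    by (auto simp: bij_betw_def inj_on_def dilate_index_def)
  from nn_integral_bij_count_space[OF this, of f]
  have "(\<integral>\<^sup>+d. f d \<partial>count_space (dilate_index \<alpha> I))
      = (\<integral>\<^sup>+x. f (case x of (i, \<zeta>) \<Rightarrow> Dil i \<zeta>) \<partial>count_space (I \<times> dual_kernel \<alpha>))" by simp
  also have "\<dots> = (\<integral>\<^sup>+x. ?g x \<partial>count_space UNIV)"
    by (subst nn_integral_count_space_indicator) (auto intro!: nn_integral_cong simp: indicator_def)
  also have "\<dots> = (\<integral>\<^sup>+i. \<integral>\<^sup>+\<zeta>. ?g (i, \<zeta>) \<partial>count_space UNIV \<partial>count_space UNIV)"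
    by (rule nn_integral_fst_count_space[symmetric])
  also have "\<dots> = (\<integral>\<^sup>+i. (\<Sum>\<zeta>\<in>dual_kernel \<alpha>. f (Dil i \<zeta>)) * indicator I i \<partial>count_space UNIV)"
  proof (rule nn_integral_cong)
    fix i
    have "(\<integral>\<^sup>+\<zeta>. ?g (i, \<zeta>) \<partial>count_space UNIV) = (\<integral>\<^sup>+\<zeta>. f (Dil i \<zeta>) * indicator I i \<partial>count_space (dual_kernel \<alpha>))"
      by (simp add: nn_integral_count_space_indicator)
    also have "\<dots> = (\<Sum>\<zeta>\<in>dual_kernel \<alpha>. f (Dil i \<zeta>) * indicator I i)"
      by (rule nn_integral_count_space_finite[OF finite_kernel])
    finally show "(\<integral>\<^sup>+\<zeta>. ?g (i, \<zeta>) \<partial>count_space UNIV) = (\<Sum>\<zeta>\<in>dual_kernel \<alpha>. f (Dil i \<zeta>)) * indicator I i"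
      by (simp add: sum_distrib_right)
  qed
  also have "\<dots> = (\<integral>\<^sup>+i. (\<Sum>\<zeta>\<in>dual_kernel \<alpha>. f (Dil i \<zeta>)) \<partial>count_space I)"
    by (simp add: nn_integral_count_space_indicator)
  finally show ?thesis .
qed

lemma dilate_fun_measurable:
  assumes \<nu>: "\<And>i. i \<in> I \<Longrightarrow> borel_part (\<nu> i)" and F: "\<And>i. i \<in> I \<Longrightarrow> F i \<in> borel_measurable (\<nu> i)"
    and d: "d \<in> dilate_index \<alpha> I"
  shows "dilate_fun F d \<in> borel_measurable (dilate_family \<alpha> c \<nu> d)"
proof -
  obtain i \<zeta> where d: "d = Dil i \<zeta>" "i \<in> I" "\<zeta> \<in> dual_kernel \<alpha>" using d by (auto simp: dilate_index_def)
  let ?D = "dilate_measure \<alpha> c (\<nu> i) \<zeta>"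
  note part = borel_part_dilate[OF \<nu>[OF d(2)] d(3)]
  have b: "branch \<zeta> \<in> measurable ?D dual_borel"
    using measurable_branch[OF d(3)] by (intro borel_part_measurable[OF part])
      (simp add: measurable_haar_cong measurable_haar_cong')
  have "branch \<zeta> \<in> measurable ?D (restrict_space dual_borel (space (\<nu> i)))"
    by (rule measurable_restrict_space2[OF _ b])
       (auto simp: space_dilate[OF \<nu>[OF d(2)] d(3)] endo_cell[OF \<nu>[OF d(2)] d(3)])
  moreover have "F i \<in> borel_measurable (restrict_space dual_borel (space (\<nu> i)))"
    using F[OF d(2)] \<nu>[OF d(2)] measurable_cong_sets[of "\<nu> i" "restrict_space dual_borel (space (\<nu> i))"]
    by (auto simp: borel_part_def)
  ultimately have "(\<lambda>\<omega>. F i (branch \<zeta> \<omega>)) \<in> borel_measurable ?D" by (rule measurable_compose)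
  then show ?thesis by (simp add: d dilate_fun_Dil dilate_family_Dil)
qed

text \<open>The factor $1/\sqrt N$ in the dilation cancels the factor $N$ in the dilated measure.\<close>

lemma nsq_dilate:
  assumes \<nu>: "borel_part (\<nu> i)" and \<zeta>: "\<zeta> \<in> dual_kernel \<alpha>"
    and F: "dilate_fun F (Dil i \<zeta>) \<in> borel_measurable (dilate_measure \<alpha> c (\<nu> i) \<zeta>)"
  shows "nsq (dilate_measure \<alpha> c (\<nu> i) \<zeta>) (dilate_fun F (Dil i \<zeta>))
    = (\<integral>\<^sup>+\<omega>. ennreal ((norm (F i \<omega>))\<^sup>2) * indicator (cell (\<nu> i) \<zeta>) \<omega> \<partial>\<nu> i)"
proof -
  let ?N = "real (image_index \<alpha>)"
  have N: "?N > 0" using index by simp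
  have m: "(\<lambda>\<omega>. ennreal ((norm (dilate_fun F (Dil i \<zeta>) \<omega>))\<^sup>2)) \<in> borel_measurable (dilate_measure \<alpha> c (\<nu> i) \<zeta>)"
    using F by measurable
  have n: "(norm (dilate_fun F (Dil i \<zeta>) \<omega>))\<^sup>2 = (norm (F i (branch \<zeta> \<omega>)))\<^sup>2 / ?N" for \<omega>
    by (simp add: dilate_fun_def norm_mult norm_divide power_mult_distrib power_divide)
  have "nsq (dilate_measure \<alpha> c (\<nu> i) \<zeta>) (dilate_fun F (Dil i \<zeta>))
    = of_nat (image_index \<alpha>) * (\<integral>\<^sup>+\<omega>. ennreal ((norm (dilate_fun F (Dil i \<zeta>) (p \<omega>)))\<^sup>2) * indicator (cell (\<nu> i) \<zeta>) \<omega> \<partial>\<nu> i)"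
    unfolding nsq_def by (rule nn_integral_dilate[OF \<nu> \<zeta> m])
  also have "(\<integral>\<^sup>+\<omega>. ennreal ((norm (dilate_fun F (Dil i \<zeta>) (p \<omega>)))\<^sup>2) * indicator (cell (\<nu> i) \<zeta>) \<omega> \<partial>\<nu> i)
     = (\<integral>\<^sup>+\<omega>. ennreal ((norm (F i \<omega>))\<^sup>2 / ?N) * indicator (cell (\<nu> i) \<zeta>) \<omega> \<partial>\<nu> i)"
    using branch_cell[OF \<nu> \<zeta>] by (intro nn_integral_cong) (auto simp: indicator_def n)
  also have "of_nat (image_index \<alpha>) * \<dots> = (\<integral>\<^sup>+\<omega>. of_nat (image_index \<alpha>) * (ennreal ((norm (F i \<omega>))\<^sup>2 / ?N) * indicator (cell (\<nu> i) \<zeta>) \<omega>) \<partial>\<nu> i)"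
  proof (rule nn_integral_cmult[symmetric])
    (* on the cell, F is recovered from its dilation, hence measurable there *)
    have "(\<lambda>\<omega>. ennreal ((norm (dilate_fun F (Dil i \<zeta>) (p \<omega>)))\<^sup>2)) \<in> borel_measurable (restrict_space (\<nu> i) (cell (\<nu> i) \<zeta>))"
      by (rule measurable_compose[OF measurable_endo_cell[OF \<nu> \<zeta>] m[unfolded measurable_dilate_cong]])
    then have "(\<lambda>\<omega>. ennreal ((norm (dilate_fun F (Dil i \<zeta>) (p \<omega>)))\<^sup>2) * indicator (cell (\<nu> i) \<zeta>) \<omega>) \<in> borel_measurable (\<nu> i)"
      using cell_measurable(1)[OF \<nu> \<zeta>] by (subst (asm) borel_measurable_restrict_space_iff_ennreal) (auto simp: Int_absorb2 dest: sets.sets_into_space)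
    moreover have "(\<lambda>\<omega>. ennreal ((norm (dilate_fun F (Dil i \<zeta>) (p \<omega>)))\<^sup>2) * indicator (cell (\<nu> i) \<zeta>) \<omega>)
        = (\<lambda>\<omega>. ennreal ((norm (F i \<omega>))\<^sup>2 / ?N) * indicator (cell (\<nu> i) \<zeta>) \<omega>)"
      using branch_cell[OF \<nu> \<zeta>] by (intro ext) (auto simp: indicator_def n)
    ultimately show "(\<lambda>\<omega>. ennreal ((norm (F i \<omega>))\<^sup>2 / ?N) * indicator (cell (\<nu> i) \<zeta>) \<omega>) \<in> borel_measurable (\<nu> i)"
      by simp
  qed
  also have "\<dots> = (\<integral>\<^sup>+\<omega>. ennreal ((norm (F i \<omega>))\<^sup>2) * indicator (cell (\<nu> i) \<zeta>) \<omega> \<partial>\<nu> i)"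
    using N by (intro nn_integral_cong)
      (simp add: mult.assoc[symmetric] ennreal_of_nat_eq_real_of_nat ennreal_mult'[symmetric])
  finally show ?thesis .
qed

text \<open>The cells of the elements of the kernel partition each \<^term>\<open>space (\<nu> i)\<close>.\<close>

lemma fsq_dilate:
  assumes \<nu>: "\<And>i. i \<in> I \<Longrightarrow> borel_part (\<nu> i)" and F: "\<And>i. i \<in> I \<Longrightarrow> F i \<in> borel_measurable (\<nu> i)"
  shows "fsq (dilate_index \<alpha> I) (dilate_family \<alpha> c \<nu>) (dilate_fun F) = fsq I \<nu> F"
proof -
  have "(\<Sum>\<zeta>\<in>dual_kernel \<alpha>. nsq (dilate_measure \<alpha> c (\<nu> i) \<zeta>) (dilate_fun F (Dil i \<zeta>))) = nsq (\<nu> i) (F i)"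
    if i: "i \<in> I" for i
  proof -
    note S = borel_part_space[OF \<nu>[OF i]]
    have [measurable]: "F i \<in> borel_measurable (\<nu> i)" by (rule F[OF i])
    have "(\<Sum>\<zeta>\<in>dual_kernel \<alpha>. nsq (dilate_measure \<alpha> c (\<nu> i) \<zeta>) (dilate_fun F (Dil i \<zeta>)))
        = (\<Sum>\<zeta>\<in>dual_kernel \<alpha>. \<integral>\<^sup>+\<omega>. ennreal ((norm (F i \<omega>))\<^sup>2) * indicator (cell (\<nu> i) \<zeta>) \<omega> \<partial>\<nu> i)"
    proof (rule sum.cong[OF refl])
      fix \<zeta> assume \<zeta>: "\<zeta> \<in> dual_kernel \<alpha>"
      then have "Dil i \<zeta> \<in> dilate_index \<alpha> I" using i by (auto simp: dilate_index_def)
      from dilate_fun_measurable[OF \<nu> F this]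
      show "nsq (dilate_measure \<alpha> c (\<nu> i) \<zeta>) (dilate_fun F (Dil i \<zeta>))
        = (\<integral>\<^sup>+\<omega>. ennreal ((norm (F i \<omega>))\<^sup>2) * indicator (cell (\<nu> i) \<zeta>) \<omega> \<partial>\<nu> i)"
        by (intro nsq_dilate \<nu> i \<zeta>) (simp add: dilate_family_Dil)
    qed
    also have "\<dots> = (\<integral>\<^sup>+\<omega>. (\<Sum>\<zeta>\<in>dual_kernel \<alpha>. ennreal ((norm (F i \<omega>))\<^sup>2) * indicator (cell (\<nu> i) \<zeta>) \<omega>) \<partial>\<nu> i)"
    proof (rule nn_integral_sum[symmetric])
      fix \<zeta> assume "\<zeta> \<in> dual_kernel \<alpha>"
      then have [measurable]: "cell (\<nu> i) \<zeta> \<in> sets (\<nu> i)" by (intro cell_measurable \<nu> i)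
      show "(\<lambda>\<omega>. ennreal ((norm (F i \<omega>))\<^sup>2) * indicator (cell (\<nu> i) \<zeta>) \<omega>) \<in> borel_measurable (\<nu> i)"
        by measurable
    qed
    also have "\<dots> = nsq (\<nu> i) (F i)"
      unfolding nsq_def
    proof (rule nn_integral_cong)
      fix \<omega> assume \<omega>: "\<omega> \<in> space (\<nu> i)"
      then have k: "cocycle \<alpha> c \<omega> \<in> dual_kernel \<alpha>" using S by (intro kernel_cocycle) auto
      have "(\<Sum>\<zeta>\<in>dual_kernel \<alpha>. ennreal ((norm (F i \<omega>))\<^sup>2) * indicator (cell (\<nu> i) \<zeta>) \<omega>)
          = (\<Sum>\<zeta>\<in>dual_kernel \<alpha>. if cocycle \<alpha> c \<omega> = \<zeta> then ennreal ((norm (F i \<omega>))\<^sup>2) else 0)"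
        using \<omega> by (intro sum.cong) (auto simp: cell_def indicator_def)
      then show "(\<Sum>\<zeta>\<in>dual_kernel \<alpha>. ennreal ((norm (F i \<omega>))\<^sup>2) * indicator (cell (\<nu> i) \<zeta>) \<omega>) = ennreal ((norm (F i \<omega>))\<^sup>2)"
        using k by (simp add: finite_kernel)
    qed
    finally show ?thesis .
  qed
  then show ?thesis
    unfolding fsq_def nn_integral_dilate_index
    by (intro nn_integral_cong) (simp add: dilate_family_Dil)
qed

lemma dilate_operator:
  assumes \<nu>: "\<And>i. i \<in> I \<Longrightarrow> borel_part (\<nu> i)"
  shows "isometry (l2_sum I \<nu>) (l2_sum (dilate_index \<alpha> I) (dilate_family \<alpha> c \<nu>)) (dilate \<alpha> c I \<nu>) \<and>
    (\<forall>F. l2_fam I \<nu> F \<longrightarrow> l2_fam (dilate_index \<alpha> I) (dilate_family \<alpha> c \<nu>) (dilate_fun F) \<and>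
      dilate \<alpha> c I \<nu> (l2_vec I \<nu> F) = l2_vec (dilate_index \<alpha> I) (dilate_family \<alpha> c \<nu>) (dilate_fun F))"
proof (rule l2_isometryI[where \<Phi> = dilate_fun])
  fix F G :: "('g \<Rightarrow> complex) dindex \<Rightarrow> ('g \<Rightarrow> complex) \<Rightarrow> complex" and d
  assume "l2_fam I \<nu> F" "l2_fam I \<nu> G" and eq: "\<And>i. i \<in> I \<Longrightarrow> AE x in \<nu> i. F i x = G i x"
    and "d \<in> dilate_index \<alpha> I"
  then obtain i \<zeta> where d: "d = Dil i \<zeta>" "i \<in> I" "\<zeta> \<in> dual_kernel \<alpha>" by (auto simp: dilate_index_def)
  show "AE x in dilate_family \<alpha> c \<nu> d. dilate_fun F d x = dilate_fun G d x"
    using AE_dilate[OF \<nu>[OF d(2)] d(3) eq[OF d(2)]]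
    unfolding d(1) dilate_family_Dil dilate_fun_Dil by (auto elim: AE_mp)
next
  fix F assume F: "l2_fam I \<nu> F"
  show "\<forall>d\<in>dilate_index \<alpha> I. dilate_fun F d \<in> borel_measurable (dilate_family \<alpha> c \<nu> d)"
    using dilate_fun_measurable[OF \<nu> l2_famD(1)[OF F]] by simp
  show "fsq (dilate_index \<alpha> I) (dilate_family \<alpha> c \<nu>) (dilate_fun F) = fsq I \<nu> F"
    by (rule fsq_dilate[OF \<nu> l2_famD(1)[OF F]])
qed (auto simp: dilate_index_def dilate_fun_def algebra_simps dilate_eq)

lemmas dilate_isometry = dilate_operator[THEN conjunct1]
  dilate_operator[THEN conjunct2, rule_format, THEN conjunct1]
  dilate_operator[THEN conjunct2, rule_format, THEN conjunct2]

text \<open>The preimage of a family \<open>h\<close> is glued from its members along the cells: at \<open>\<omega>\<close> it takes the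
  value of the member with index \<open>cocycle \<omega>\<close> at the image of \<open>\<omega>\<close>, multiplied by $\sqrt N$.\<close>

lemma dilate_unitary:
  assumes \<nu>: "\<And>i. i \<in> I \<Longrightarrow> borel_part (\<nu> i)"
  shows "unitary (l2_sum I \<nu>) (l2_sum (dilate_index \<alpha> I) (dilate_family \<alpha> c \<nu>)) (dilate \<alpha> c I \<nu>)"
proof (rule unitaryI[OF prehilbert_l2_sum prehilbert_l2_sum dilate_isometry(1)[OF \<nu>]])
  let ?J = "dilate_index \<alpha> I" and ?\<rho> = "dilate_family \<alpha> c \<nu>"
  show "hcarrier (l2_sum ?J ?\<rho>) \<subseteq> dilate \<alpha> c I \<nu> ` hcarrier (l2_sum I \<nu>)"
  proof
    fix Y assume Y: "Y \<in> hcarrier (l2_sum ?J ?\<rho>)"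
    let ?h = "l2_reps Y"
    note fam = l2_sum_memD(2)[OF Y]
    define F where "F i \<omega> = sqrt (real (image_index \<alpha>)) * ?h (Dil i (cocycle \<alpha> c \<omega>)) (p \<omega>)" for i \<omega>
    have N: "sqrt (real (image_index \<alpha>)) \<noteq> 0" using index by simp
    have Fm: "F i \<in> borel_measurable (\<nu> i)" if i: "i \<in> I" for i
    proof -
      have h: "?h (Dil i \<zeta>) \<in> borel_measurable \<mu>" if \<zeta>: "\<zeta> \<in> dual_kernel \<alpha>" for \<zeta>
      proof -
        have d: "Dil i \<zeta> \<in> ?J" using i \<zeta> by (auto simp: dilate_index_def)
        have "?h (Dil i \<zeta>) \<in> borel_measurable dual_borel"
          by (rule borel_part_extend[OF borel_part_dilate_family[OF \<nu> d] l2_famD(1)[OF fam d]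
              L2_carrierD(4)[OF l2_sum_memD(1)[OF Y d]]])
        then show ?thesis by (simp add: measurable_haar_cong)
      qed
      have "(\<lambda>\<omega>. \<Sum>\<zeta>\<in>dual_kernel \<alpha>. indicator (cell (\<nu> i) \<zeta>) \<omega> *
          (sqrt (real (image_index \<alpha>)) * ?h (Dil i \<zeta>) (p \<omega>))) \<in> borel_measurable (\<nu> i)"
      proof (rule borel_measurable_sum)
        fix \<zeta> assume \<zeta>: "\<zeta> \<in> dual_kernel \<alpha>"
        have [measurable]: "cell (\<nu> i) \<zeta> \<in> sets (\<nu> i)" by (intro cell_measurable \<nu> i \<zeta>)
        have "(\<lambda>\<omega>. ?h (Dil i \<zeta>) (p \<omega>)) \<in> borel_measurable \<mu>"
          by (rule measurable_compose[OF measurable_endo h[OF \<zeta>]])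
        then have [measurable]: "(\<lambda>\<omega>. ?h (Dil i \<zeta>) (p \<omega>)) \<in> borel_measurable (\<nu> i)"
          by (intro borel_part_measurable[OF \<nu>[OF i]]) (simp add: measurable_haar_cong)
        show "(\<lambda>\<omega>. indicator (cell (\<nu> i) \<zeta>) \<omega> *
          (sqrt (real (image_index \<alpha>)) * ?h (Dil i \<zeta>) (p \<omega>))) \<in> borel_measurable (\<nu> i)" by measurable
      qed
      moreover have "(\<Sum>\<zeta>\<in>dual_kernel \<alpha>. indicator (cell (\<nu> i) \<zeta>) \<omega> *
          (sqrt (real (image_index \<alpha>)) * ?h (Dil i \<zeta>) (p \<omega>))) = F i \<omega>" if \<omega>: "\<omega> \<in> space (\<nu> i)" for \<omega>
      proof -
        have k: "cocycle \<alpha> c \<omega> \<in> dual_kernel \<alpha>"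
          using \<omega> borel_part_space[OF \<nu>[OF i]] by (intro kernel_cocycle) auto
        have "(\<Sum>\<zeta>\<in>dual_kernel \<alpha>. indicator (cell (\<nu> i) \<zeta>) \<omega> *
          (sqrt (real (image_index \<alpha>)) * ?h (Dil i \<zeta>) (p \<omega>)))
          = (\<Sum>\<zeta>\<in>dual_kernel \<alpha>. if cocycle \<alpha> c \<omega> = \<zeta> then F i \<omega> else 0)"
          using \<omega> by (intro sum.cong) (auto simp: cell_def indicator_def F_def)
        then show ?thesis using k by (simp add: finite_kernel)
      qed
      ultimately show ?thesis by (simp cong: measurable_cong)
    qed
    have D: "AE \<omega> in ?\<rho> d. dilate_fun F d \<omega> = ?h d \<omega>" if d: "d \<in> ?J" for d
    proof (rule AE_I2)
      obtain i \<zeta> where d: "d = Dil i \<zeta>" "i \<in> I" "\<zeta> \<in> dual_kernel \<alpha>" using d by (auto simp: dilate_index_def)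
      fix \<omega> assume "\<omega> \<in> space (?\<rho> d)"
      then have "\<omega> \<in> dual_group"
        using endo_cell[OF \<nu>[OF d(2)] d(3)] by (auto simp: d dilate_family_Dil space_dilate[OF \<nu>[OF d(2)] d(3)])
      then show "dilate_fun F d \<omega> = ?h d \<omega>"
        using N by (simp add: d dilate_fun_def F_def cocycle_branch[OF _ d(3)] endo_branch[OF d(3)])
    qed
    have "fsq I \<nu> F = fsq ?J ?\<rho> (dilate_fun F)" by (rule fsq_dilate[OF \<nu> Fm, symmetric])
    also have "\<dots> = fsq ?J ?\<rho> ?h" by (rule fsq_cong_AE[OF D])
    finally have F: "l2_fam I \<nu> F" using fam Fm by (simp add: l2_fam_def)
    have "dilate \<alpha> c I \<nu> (l2_vec I \<nu> F) = l2_vec ?J ?\<rho> (dilate_fun F)"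
      by (rule dilate_isometry(3)[OF \<nu> F])
    also have "\<dots> = l2_vec ?J ?\<rho> ?h" by (rule l2_vec_cong[OF D])
    also have "\<dots> = Y" by (rule l2_sum_memD(3)[OF Y])
    finally show "Y \<in> dilate \<alpha> c I \<nu> ` hcarrier (l2_sum I \<nu>)"
      using l2_vec_mem(1)[OF F] by (metis imageI)
  qed
qed

text \<open>Evaluating an inverse branch at \<open>\<alpha> \<gamma>\<close> gives the value of its argument at \<open>\<gamma>\<close>.\<close>

lemma dilate_mult_char:
  assumes \<nu>: "\<And>i. i \<in> I \<Longrightarrow> borel_part (\<nu> i)" and X: "X \<in> hcarrier (l2_sum I \<nu>)"
  shows "dilate \<alpha> c I \<nu> (mult_char I \<nu> (\<alpha> \<gamma>) X)
    = mult_char (dilate_index \<alpha> I) (dilate_family \<alpha> c \<nu>) \<gamma> (dilate \<alpha> c I \<nu> X)"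
proof -
  let ?J = "dilate_index \<alpha> I" and ?\<rho> = "dilate_family \<alpha> c \<nu>"
  note fam = l2_sum_memD(2)[OF X]
  have "dilate \<alpha> c I \<nu> (mult_char I \<nu> (\<alpha> \<gamma>) X)
      = l2_vec ?J ?\<rho> (dilate_fun (\<lambda>i \<omega>. \<omega> (\<alpha> \<gamma>) * l2_rep (X i) \<omega>))"
    unfolding mult_char_eq by (rule dilate_isometry(3)[OF \<nu> l2_fam_char[OF \<nu> fam]])
  also have "\<dots> = l2_vec ?J ?\<rho> (\<lambda>d \<omega>. \<omega> \<gamma> * dilate_fun (l2_reps X) d \<omega>)"
  proof (rule l2_vec_cong, rule AE_I2)
    fix d \<omega> assume "d \<in> ?J" and \<omega>: "\<omega> \<in> space (?\<rho> d)"
    then obtain i \<zeta> where d: "d = Dil i \<zeta>" "i \<in> I" "\<zeta> \<in> dual_kernel \<alpha>" by (auto simp: dilate_index_def)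
    have "\<omega> \<in> dual_group"
      using \<omega> endo_cell[OF \<nu>[OF d(2)] d(3)] by (auto simp: d dilate_family_Dil space_dilate[OF \<nu>[OF d(2)] d(3)])
    then have "branch \<zeta> \<omega> (\<alpha> \<gamma>) = \<omega> \<gamma>"
      using endo_branch[OF d(3)] by (metis dual_endo_def)
    then show "dilate_fun (\<lambda>i \<omega>. \<omega> (\<alpha> \<gamma>) * l2_rep (X i) \<omega>) d \<omega> = \<omega> \<gamma> * dilate_fun (l2_reps X) d \<omega>"
      by (simp add: d dilate_fun_def)
  qed
  also have "\<dots> = mult_char ?J ?\<rho> \<gamma> (l2_vec ?J ?\<rho> (dilate_fun (l2_reps X)))"
    by (rule mult_char_vec[symmetric])
       (use \<nu> borel_part_dilate_family l2_famD(1)[OF dilate_isometry(2)[OF \<nu> fam]] in auto)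
  finally show ?thesis by (simp add: dilate_eq)
qed

end

section \<open>Square matrices with orthonormal rows\<close>

lemma sum_swap3:
  "(\<Sum>x\<in>C. \<Sum>r\<in>R. \<Sum>s\<in>S. f r s x) = (\<Sum>r\<in>R. \<Sum>s\<in>S. \<Sum>x\<in>C. f r s x)"
proof -
  have "(\<Sum>x\<in>C. \<Sum>r\<in>R. \<Sum>s\<in>S. f r s x) = (\<Sum>r\<in>R. \<Sum>x\<in>C. \<Sum>s\<in>S. f r s x)" by (rule sum.swap)
  also have "\<dots> = (\<Sum>r\<in>R. \<Sum>s\<in>S. \<Sum>x\<in>C. f r s x)" by (intro sum.cong refl sum.swap)
  finally show ?thesis .
qed

text \<open>The matrix \<open>b\<close> of the projection onto the span of the conjugate rows is a self-adjoint idempotent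
  of trace \<^term>\<open>card R\<close>. Its squared distance from the identity matrix in the Frobenius norm is
  therefore \<^term>\<open>card C - card R\<close>, that is, zero.\<close>

lemma square_orthonormal:
  fixes a :: "'r \<Rightarrow> 'c \<Rightarrow> complex" and N :: real
  assumes fin: "finite R" "finite C" and card: "card R = card C" and N: "N > 0"
    and orth: "\<And>r r'. r \<in> R \<Longrightarrow> r' \<in> R \<Longrightarrow> (\<Sum>x\<in>C. a r x * cnj (a r' x)) = (if r = r' then of_real N else 0)"
    and x: "x \<in> C" and y: "y \<in> C"
  shows "(\<Sum>r\<in>R. cnj (a r x) * a r y) = (if x = y then of_real N else 0)"
proof -
  define b where "b x y = (\<Sum>r\<in>R. cnj (a r x) * a r y) / of_real N" for x y
  have bb: "(\<Sum>y\<in>C. b x y * cnj (b x y)) = b x x" for x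
  proof -
    have "(\<Sum>y\<in>C. b x y * cnj (b x y))
        = (\<Sum>y\<in>C. \<Sum>r\<in>R. \<Sum>r'\<in>R. cnj (a r x) * a r' x * (a r y * cnj (a r' y))) / (of_real N)\<^sup>2"
      by (simp add: b_def sum_divide_distrib[symmetric] sum_product power2_eq_square mult_ac)
    also have "(\<Sum>y\<in>C. \<Sum>r\<in>R. \<Sum>r'\<in>R. cnj (a r x) * a r' x * (a r y * cnj (a r' y)))
        = (\<Sum>r\<in>R. \<Sum>r'\<in>R. cnj (a r x) * a r' x * (\<Sum>y\<in>C. a r y * cnj (a r' y)))"
      unfolding sum_distrib_left by (rule sum_swap3)
    also have "\<dots> = (\<Sum>r\<in>R. \<Sum>r'\<in>R. if r = r' then of_real N * (cnj (a r x) * a r x) else 0)"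
      by (intro sum.cong refl) (simp add: orth)
    also have "\<dots> = of_real N * (\<Sum>r\<in>R. cnj (a r x) * a r x)"
      using fin by (simp add: sum_distrib_left)
    finally show ?thesis using N by (simp add: b_def power2_eq_square)
  qed
  have dist: "(\<Sum>y\<in>C. (norm ((if x = y then 1 else 0) - b x y))\<^sup>2) = 1 - Re (b x x)" if "x \<in> C" for x
  proof -
    have "complex_of_real (\<Sum>y\<in>C. (norm ((if x = y then 1 else 0) - b x y))\<^sup>2)
        = (\<Sum>y\<in>C. ((if x = y then 1 else 0) - b x y) * cnj ((if x = y then 1 else 0) - b x y))"
      by (simp only: of_real_sum complex_norm_square)
    also have "\<dots> = (\<Sum>y\<in>C. (if x = y then 1 - b x x - cnj (b x x) else 0) + b x y * cnj (b x y))"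
      by (intro sum.cong) (auto simp: algebra_simps)
    also have "\<dots> = 1 - b x x - cnj (b x x) + b x x"
      unfolding sum.distrib bb using fin that by simp
    finally have "Re (complex_of_real (\<Sum>y\<in>C. (norm ((if x = y then 1 else 0) - b x y))\<^sup>2))
        = Re (1 - b x x - cnj (b x x) + b x x)" by (rule arg_cong)
    then show ?thesis by simp
  qed
  have "(\<Sum>x\<in>C. \<Sum>r\<in>R. cnj (a r x) * a r x) = (\<Sum>r\<in>R. \<Sum>x\<in>C. cnj (a r x) * a r x)" by (rule sum.swap)
  then have "(\<Sum>x\<in>C. b x x) = (\<Sum>r\<in>R. \<Sum>x\<in>C. a r x * cnj (a r x)) / of_real N"
    by (simp add: b_def sum_divide_distrib[symmetric] mult.commute)
  also have "\<dots> = of_nat (card R)"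
    using N by (simp add: orth)
  finally have trace: "(\<Sum>x\<in>C. Re (b x x)) = real (card C)"
    by (metis Re_sum card complex_Re_of_nat)
  have "(\<Sum>x\<in>C. \<Sum>y\<in>C. (norm ((if x = y then 1 else 0) - b x y))\<^sup>2) = 0"
    by (simp add: dist sum_subtractf trace)
  then have "(norm ((if x = y then 1 else 0) - b x y))\<^sup>2 = 0"
    using x y fin by (simp add: sum_nonneg_eq_0_iff sum_nonneg)
  then have "b x y = (if x = y then 1 else 0)" by (simp split: if_splits)
  then show ?thesis using N by (simp add: b_def field_simps split: if_splits)
qed

lemma parseval:
  fixes a :: "'r \<Rightarrow> 'c \<Rightarrow> complex" and N :: real
  assumes fin: "finite R" "finite C"
    and orth: "\<And>r r'. r \<in> R \<Longrightarrow> r' \<in> R \<Longrightarrow> (\<Sum>x\<in>C. a r x * cnj (a r' x)) = (if r = r' then of_real N else 0)"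
  shows "(\<Sum>x\<in>C. (norm (\<Sum>r\<in>R. a r x * v r))\<^sup>2) = N * (\<Sum>r\<in>R. (norm (v r))\<^sup>2)"
proof -
  have "complex_of_real (\<Sum>x\<in>C. (norm (\<Sum>r\<in>R. a r x * v r))\<^sup>2)
      = (\<Sum>x\<in>C. (\<Sum>r\<in>R. a r x * v r) * cnj (\<Sum>r\<in>R. a r x * v r))"
    by (simp only: of_real_sum complex_norm_square)
  also have "\<dots> = (\<Sum>x\<in>C. \<Sum>r\<in>R. \<Sum>r'\<in>R. (v r * cnj (v r')) * (a r x * cnj (a r' x)))"
    by (simp add: sum_product mult_ac)
  also have "\<dots> = (\<Sum>r\<in>R. \<Sum>r'\<in>R. (v r * cnj (v r')) * (\<Sum>x\<in>C. a r x * cnj (a r' x)))"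
    unfolding sum_distrib_left by (rule sum_swap3)
  also have "\<dots> = (\<Sum>r\<in>R. \<Sum>r'\<in>R. if r = r' then of_real N * (v r * cnj (v r)) else 0)"
    by (intro sum.cong refl) (simp add: orth)
  also have "\<dots> = of_real N * (\<Sum>r\<in>R. v r * cnj (v r))"
    using fin by (simp add: sum_distrib_left)
  also have "\<dots> = complex_of_real (N * (\<Sum>r\<in>R. (norm (v r))\<^sup>2))"
    by (simp only: of_real_mult of_real_sum complex_norm_square)
  finally show ?thesis by (simp only: of_real_eq_iff)
qed

section \<open>The core space and the Ruelle operators\<close>

context dual_setting
begin

abbreviation measurable_mult :: "(('g \<Rightarrow> complex) \<Rightarrow> nat) \<Rightarrow> bool" where
  "measurable_mult m \<equiv> m \<in> measurable \<mu> (count_space UNIV)"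

abbreviation core where "core \<equiv> core_space \<mu>"
abbreviation core_fam where "core_fam m \<equiv> l2_fam {1..} (level_measure \<mu> m)"
abbreviation core_vec where "core_vec m \<equiv> l2_vec {1..} (level_measure \<mu> m)"
abbreviation core_sq where "core_sq m \<equiv> fsq {1..} (level_measure \<mu> m)"
abbreviation chr where "chr m \<gamma> \<equiv> mult_char {1..} (level_measure \<mu> m) \<gamma>"

lemma level_sets [measurable]:
  assumes [measurable]: "measurable_mult m" shows "level m i \<in> sets \<mu>"
proof -
  have "{\<omega> \<in> space \<mu>. i \<le> m \<omega>} \<in> sets \<mu>" by measurable
  then show ?thesis by (simp add: level_def)
qed

lemma level_sets_Int: "measurable_mult m \<Longrightarrow> level m i \<inter> space \<mu> \<in> sets \<mu>"
  using level_sets[of m i] by (simp add: level_def Int_def conj_commute)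

lemma space_level_measure: "measurable_mult m \<Longrightarrow> space (level_measure \<mu> m i) = level m i"
  by (auto simp: level_measure_def space_restrict_space level_def)

lemma borel_part_level:
  assumes "measurable_mult m" shows "borel_part (level_measure \<mu> m i)"
proof -
  have "sets (level_measure \<mu> m i) = sets (restrict_space dual_borel (level m i))"
    unfolding level_measure_def by (rule sets_restrict_space_cong) simp
  then show ?thesis
    using level_sets[OF assms, of i] by (simp add: borel_part_def space_level_measure[OF assms])
qed

lemma measurable_level_measure:
  "f \<in> measurable \<mu> N \<Longrightarrow> f \<in> measurable (level_measure \<mu> m i) N"
  unfolding level_measure_def by (rule measurable_restrict_space1)

lemma AE_level:
  assumes "measurable_mult m"
  shows "(AE \<omega> in level_measure \<mu> m i. P \<omega>) \<longleftrightarrow> (AE \<omega> in \<mu>. \<omega> \<in> level m i \<longrightarrow> P \<omega>)"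
  unfolding level_measure_def
  by (rule AE_restrict_space_iff[OF level_sets_Int[OF assms]])

lemma core_rep_off:
  assumes "measurable_mult m" "X \<in> hcarrier (core m)" "i \<ge> 1" "\<omega> \<notin> level m i"
  shows "l2_rep (X i) \<omega> = 0"
  using L2_carrierD(4)[OF l2_sum_memD(1)[OF assms(2)[unfolded core_space_def]]] assms(3,4)
  by (simp add: space_level_measure[OF assms(1)])

lemma core_rep_measurable:
  assumes m: "measurable_mult m" and X: "X \<in> hcarrier (core m)" and i: "i \<ge> 1"
  shows "l2_rep (X i) \<in> borel_measurable \<mu>"
proof -
  have c: "X i \<in> hcarrier (L2 (level_measure \<mu> m i))"
    using l2_sum_memD(1)[OF X[unfolded core_space_def], of i] i by simp
  have "l2_rep (X i) \<in> borel_measurable dual_borel"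
    by (rule borel_part_extend[OF borel_part_level[OF m] L2_carrierD(1)[OF c]])
       (rule L2_carrierD(4)[OF c])
  then show ?thesis by (simp add: measurable_haar_cong)
qed

lemma core_rep_vec:
  assumes m: "measurable_mult m" and F: "\<And>i. i \<ge> 1 \<Longrightarrow> F i \<in> borel_measurable \<mu>"
  shows "AE \<omega> in \<mu>. \<forall>i\<ge>1. \<omega> \<in> level m i \<longrightarrow> l2_rep (core_vec m F i) \<omega> = F i \<omega>"
proof -
  have "AE \<omega> in \<mu>. \<omega> \<in> level m i \<longrightarrow> l2_rep (core_vec m F i) \<omega> = F i \<omega>" if "i \<ge> 1" for i
    using l2_rep_vec[of i "{1..}" F "level_measure \<mu> m"] that F
    by (simp add: AE_level[OF m] measurable_level_measure)
  then show ?thesis by (simp add: AE_all_countable)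
qed

lemma measurable_sum_mult:
  fixes f :: "nat \<Rightarrow> ('g \<Rightarrow> complex) \<Rightarrow> 'b::{second_countable_topology, topological_comm_monoid_add}"
  assumes m: "measurable_mult m" and f: "\<And>i. i \<ge> 1 \<Longrightarrow> f i \<in> borel_measurable \<mu>"
  shows "(\<lambda>\<omega>. \<Sum>i=1..m \<omega>. f i \<omega>) \<in> borel_measurable \<mu>"
proof (rule measurable_compose_countable[where f = "\<lambda>n \<omega>. \<Sum>i=1..n. f i \<omega>", OF _ m])
  show "(\<lambda>\<omega>. \<Sum>i=1..n. f i \<omega>) \<in> borel_measurable \<mu>" for n
    using f by (intro borel_measurable_sum) auto
qed

text \<open>In the core the sum over the components can be taken inside of the integral, where it becomes a
  finite sum with as many terms as the multiplicity.\<close>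

lemma fsq_core:
  assumes m: "measurable_mult m" and F: "\<And>i. i \<ge> 1 \<Longrightarrow> F i \<in> borel_measurable (level_measure \<mu> m i)"
  shows "core_sq m F = (\<integral>\<^sup>+\<omega>. ennreal (\<Sum>i=1..m \<omega>. (norm (F i \<omega>))\<^sup>2) \<partial>\<mu>)"
proof -
  let ?f = "\<lambda>i \<omega>. ennreal ((norm (F i \<omega>))\<^sup>2) * indicator (level m i) \<omega>"
  note lev = level_sets_Int[OF m]
  have fm: "?f i \<in> borel_measurable \<mu>" if "i \<ge> 1" for i
  proof -
    have "(\<lambda>\<omega>. ennreal ((norm (F i \<omega>))\<^sup>2)) \<in> borel_measurable (restrict_space \<mu> (level m i))"
      using F[OF that] unfolding level_measure_def by measurable
    then show ?thesis by (subst (asm) borel_measurable_restrict_space_iff_ennreal[OF lev]) 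
  qed
  have "core_sq m F = (\<integral>\<^sup>+i. \<integral>\<^sup>+\<omega>. ?f i \<omega> \<partial>\<mu> \<partial>count_space {1..})"
    unfolding fsq_def nsq_def level_measure_def by (simp add: nn_integral_restrict_space[OF lev])
  also have "\<dots> = (\<integral>\<^sup>+\<omega>. \<integral>\<^sup>+i. ?f i \<omega> \<partial>count_space {1..} \<partial>\<mu>)"
    by (rule nn_integral_count_space_nn_integral[symmetric]) (use fm in auto)
  also have "\<dots> = (\<integral>\<^sup>+\<omega>. ennreal (\<Sum>i=1..m \<omega>. (norm (F i \<omega>))\<^sup>2) \<partial>\<mu>)"
  proof (rule nn_integral_cong)
    fix \<omega> assume "\<omega> \<in> space \<mu>"
    then have "(\<integral>\<^sup>+i. ?f i \<omega> \<partial>count_space {1..}) = (\<Sum>i=1..m \<omega>. ?f i \<omega>)"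
      by (intro nn_integral_count_space') (auto simp: level_def)
    also have "\<dots> = (\<Sum>i=1..m \<omega>. ennreal ((norm (F i \<omega>))\<^sup>2))"
      using \<open>\<omega> \<in> space \<mu>\<close> by (intro sum.cong) (auto simp: level_def)
    finally show "(\<integral>\<^sup>+i. ?f i \<omega> \<partial>count_space {1..}) = ennreal (\<Sum>i=1..m \<omega>. (norm (F i \<omega>))\<^sup>2)"
      by simp
  qed
  finally show ?thesis .
qed

text \<open>The sums over rows are cut off at the multiplicity, so that the values of the argument outside
  of its levels, where it need not be measurable, do not enter.\<close>

definition ruelle_fun :: "(('g \<Rightarrow> complex) \<Rightarrow> nat) \<Rightarrow> (nat \<Rightarrow> nat \<Rightarrow> ('g \<Rightarrow> complex) \<Rightarrow> complex) \<Rightarrow>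
    (nat \<Rightarrow> ('g \<Rightarrow> complex) \<Rightarrow> complex) \<Rightarrow> nat \<Rightarrow> ('g \<Rightarrow> complex) \<Rightarrow> complex" where
  "ruelle_fun n K F j \<omega> = (\<Sum>i=1..n (p \<omega>). K i j \<omega> * F i (p \<omega>))"

lemma ruelle_eq:
  assumes m: "measurable_mult m" and n: "measurable_mult n" and X: "X \<in> hcarrier (core n)"
  shows "ruelle \<alpha> \<mu> m K X = core_vec m (ruelle_fun n K (l2_reps X))"
  unfolding ruelle_def l2_vec_def[symmetric]
proof (rule l2_vec_cong, rule AE_I2)
  fix j \<omega> assume "\<omega> \<in> space (level_measure \<mu> m j)"
  then have \<omega>: "p \<omega> \<in> dual_group" by (auto simp: space_level_measure[OF m] level_def endo_dual)
  have "(\<Sum>\<^sub>\<infinity>i\<in>{1..}. K i j \<omega> * l2_rep (X i) (p \<omega>)) = (\<Sum>\<^sub>\<infinity>i\<in>{1..n (p \<omega>)}. K i j \<omega> * l2_rep (X i) (p \<omega>))"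
    by (rule infsum_cong_neutral) (auto simp: core_rep_off[OF n X] level_def)
  then show "(\<Sum>\<^sub>\<infinity>i\<in>{1..}. K i j \<omega> * l2_rep (X i) (p \<omega>)) = ruelle_fun n K (l2_reps X) j \<omega>"
    by (simp add: ruelle_fun_def)
qed

lemma ruelle_fun_measurable:
  assumes n: "measurable_mult n" and K: "\<And>i. i \<ge> 1 \<Longrightarrow> K i j \<in> borel_measurable \<mu>"
    and F: "\<And>i. i \<ge> 1 \<Longrightarrow> F i \<in> borel_measurable (level_measure \<mu> n i)"
  shows "ruelle_fun n K F j \<in> borel_measurable \<mu>"
proof -
  let ?F = "\<lambda>i \<omega>. if \<omega> \<in> level n i then F i \<omega> else 0"
  note lev = level_sets_Int[OF n]
  have Fm: "?F i \<in> borel_measurable \<mu>" if "i \<ge> 1" for i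
  proof -
    have "(\<lambda>\<omega>. indicator (level n i) \<omega> *\<^sub>R F i \<omega>) \<in> borel_measurable \<mu>"
      by (rule iffD1[OF borel_measurable_restrict_space_iff[OF lev]])
         (use F[OF that] in \<open>simp add: level_measure_def\<close>)
    moreover have "(\<lambda>\<omega>. indicator (level n i) \<omega> *\<^sub>R F i \<omega>) = ?F i" by (auto simp: indicator_def)
    ultimately show ?thesis by simp
  qed
  have "(\<lambda>\<omega>. \<Sum>i=1..n (p \<omega>). K i j \<omega> * ?F i (p \<omega>)) \<in> borel_measurable \<mu>"
  proof (rule measurable_sum_mult[where m = "\<lambda>\<omega>. n (p \<omega>)"])
    show "measurable_mult (\<lambda>\<omega>. n (p \<omega>))" by (rule measurable_compose[OF measurable_endo n])
    show "(\<lambda>\<omega>. K i j \<omega> * ?F i (p \<omega>)) \<in> borel_measurable \<mu>" if "i \<ge> 1" for i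
      using K[OF that] measurable_compose[OF measurable_endo Fm[OF that]] by simp
  qed
  moreover have "ruelle_fun n K F j \<omega> = (\<Sum>i=1..n (p \<omega>). K i j \<omega> * ?F i (p \<omega>))" if "\<omega> \<in> space \<mu>" for \<omega>
    unfolding ruelle_fun_def using that by (intro sum.cong) (auto simp: level_def endo_dual)
  ultimately show ?thesis by (subst measurable_cong)
qed

text \<open>Norm preservation is left as a hypothesis because it depends on the filter equations. Almost
  everywhere equality is respected because the endomorphism pulls null sets back to null sets.\<close>

lemma ruelle_operator:
  assumes m: "measurable_mult m" and n: "measurable_mult n"
    and K: "\<And>i j. i \<ge> 1 \<Longrightarrow> j \<ge> 1 \<Longrightarrow> K i j \<in> borel_measurable \<mu>"
    and norm: "\<And>F. core_fam n F \<Longrightarrow>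
      core_sq m (ruelle_fun n K F) = core_sq n F"
  shows "isometry (core n) (core m) (ruelle \<alpha> \<mu> m K) \<and>
    (\<forall>F. core_fam n F \<longrightarrow> core_fam m (ruelle_fun n K F) \<and>
      ruelle \<alpha> \<mu> m K (core_vec n F) = core_vec m (ruelle_fun n K F))"
  unfolding core_space_def
proof (rule l2_isometryI)
  fix F G :: "nat \<Rightarrow> ('g \<Rightarrow> complex) \<Rightarrow> complex" and j :: nat
  assume "core_fam n F" "core_fam n G"
    and eq: "\<And>i. i \<in> {1..} \<Longrightarrow> AE x in level_measure \<mu> n i. F i x = G i x"
  have "AE \<omega> in \<mu>. \<forall>i\<ge>1. \<omega> \<in> level n i \<longrightarrow> F i \<omega> = G i \<omega>"
    using eq by (simp add: AE_level[OF n] AE_all_countable)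
  then have "AE \<omega> in \<mu>. \<forall>i\<ge>1. p \<omega> \<in> level n i \<longrightarrow> F i (p \<omega>) = G i (p \<omega>)" by (rule AE_endo)
  then have "AE \<omega> in \<mu>. \<omega> \<in> dual_group \<longrightarrow> ruelle_fun n K F j \<omega> = ruelle_fun n K G j \<omega>"
    by (rule AE_mp) (auto intro!: AE_I2 sum.cong simp: ruelle_fun_def level_def endo_dual)
  then show "AE \<omega> in level_measure \<mu> m j. ruelle_fun n K F j \<omega> = ruelle_fun n K G j \<omega>"
    by (simp add: AE_level[OF m] level_def) (auto elim: AE_mp)
next
  fix F assume F: "core_fam n F"
  show "\<forall>j\<in>{1..}. ruelle_fun n K F j \<in> borel_measurable (level_measure \<mu> m j)"
    by (intro ballI measurable_level_measure, rule ruelle_fun_measurable[OF n]) (use l2_famD(1)[OF F] K in auto)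
  show "core_sq m (ruelle_fun n K F) = core_sq n F"
    by (rule norm[OF F])
next
  fix X assume "X \<in> hcarrier (l2_sum {1..} (level_measure \<mu> n))"
  then show "ruelle \<alpha> \<mu> m K X = core_vec m (ruelle_fun n K (l2_reps X))"
    by (intro ruelle_eq[OF m n]) (simp add: core_space_def)
qed (auto simp: ruelle_fun_def algebra_simps sum.distrib sum_distrib_left intro!: AE_I2)

lemma ruelle_fun_char: "ruelle_fun n K (\<lambda>i \<omega>. \<omega> \<gamma> * F i \<omega>) j \<omega> = \<omega> (\<alpha> \<gamma>) * ruelle_fun n K F j \<omega>"
  by (simp add: ruelle_fun_def sum_distrib_left dual_endo_def mult_ac)

end

section \<open>A filter and its complement form a unitary operator\<close>

text \<open>Rows and columns are indexed from 1 on, and the index sets should keep this form.\<close>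

declare One_nat_def [simp del]

locale filter_setting = dual_setting \<alpha> \<mu> c
  for \<alpha> :: "'g::{ab_group_add,countable} \<Rightarrow> 'g" and \<mu> :: "('g \<Rightarrow> complex) measure"
    and c :: "('g \<Rightarrow> complex) \<Rightarrow> ('g \<Rightarrow> complex)" +
  fixes m :: "('g \<Rightarrow> complex) \<Rightarrow> nat"
    and H G :: "nat \<Rightarrow> nat \<Rightarrow> ('g \<Rightarrow> complex) \<Rightarrow> complex"
  assumes mult: "multiplicity_function \<alpha> \<mu> m"
    and filter: "filter_relative \<alpha> \<mu> m H"
    and pure: "pure_isometry (core m) (ruelle \<alpha> \<mu> m H)"
    and compl: "complementary_filter \<alpha> \<mu> m H G"
begin

abbreviation n :: "('g \<Rightarrow> complex) \<Rightarrow> nat" where "n \<equiv> compl_mult \<alpha> m"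

abbreviation N :: nat where "N \<equiv> image_index \<alpha>"

lemma m_measurable [measurable]: "measurable_mult m"
  using mult by (simp add: multiplicity_function_def)

lemma n_measurable [measurable]: "measurable_mult n"
proof -
  (* a detour through real functions; nat is zero on negative integers, as is subtraction on nat *)
  have [measurable]: "(\<lambda>\<omega>. real (m \<omega>)) \<in> borel_measurable \<mu>" by measurable
  have "(\<lambda>\<omega>. (\<Sum>\<zeta>\<in>fibre \<alpha> \<omega>. real (m \<zeta>)) - real (m \<omega>)) \<in> borel_measurable \<mu>"
    by (intro borel_measurable_diff measurable_sum_fibre) measurable
  then have "(\<lambda>\<omega>. nat \<lfloor>(\<Sum>\<zeta>\<in>fibre \<alpha> \<omega>. real (m \<zeta>)) - real (m \<omega>)\<rfloor>) \<in> measurable \<mu> (count_space UNIV)"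
    by measurable
  moreover have "nat \<lfloor>(\<Sum>\<zeta>\<in>fibre \<alpha> \<omega>. real (m \<zeta>)) - real (m \<omega>)\<rfloor> = n \<omega>" for \<omega>
  proof -
    have "(\<Sum>\<zeta>\<in>fibre \<alpha> \<omega>. real (m \<zeta>)) - real (m \<omega>) = of_int (int (\<Sum>\<zeta>\<in>fibre \<alpha> \<omega>. m \<zeta>) - int (m \<omega>))" by simp
    then have "\<lfloor>(\<Sum>\<zeta>\<in>fibre \<alpha> \<omega>. real (m \<zeta>)) - real (m \<omega>)\<rfloor> = int (\<Sum>\<zeta>\<in>fibre \<alpha> \<omega>. m \<zeta>) - int (m \<omega>)"
      by (simp only: floor_of_int)
    then show ?thesis by (simp only: compl_mult_def nat_minus_as_int)
  qed
  ultimately show ?thesis by simp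
qed

lemma H_measurable: "i \<ge> 1 \<Longrightarrow> j \<ge> 1 \<Longrightarrow> H i j \<in> borel_measurable \<mu>"
  using filter by (simp add: filter_relative_def)

lemma G_measurable: "i \<ge> 1 \<Longrightarrow> j \<ge> 1 \<Longrightarrow> G i j \<in> borel_measurable \<mu>"
  using compl by (simp add: complementary_filter_def)

text \<open>The pointwise content of the hypotheses on \<open>m\<close>, \<open>H\<close> and \<open>G\<close> over the fibre of \<open>\<omega>\<close>, with the
  support conditions used to make the sums over the columns finite.\<close>

definition filter_identities :: "('g \<Rightarrow> complex) \<Rightarrow> bool" where
  "filter_identities \<omega> \<longleftrightarrow> \<omega> \<in> dual_group \<and> m \<omega> \<le> (\<Sum>\<zeta>\<in>fibre \<alpha> \<omega>. m \<zeta>) \<and>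
     (\<forall>\<zeta>\<in>fibre \<alpha> \<omega>. \<forall>i\<ge>1. \<forall>j\<ge>1. m \<zeta> < j \<longrightarrow> H i j \<zeta> = 0 \<and> G i j \<zeta> = 0) \<and>
     (\<forall>i\<ge>1. \<forall>i'\<ge>1. (\<Sum>\<zeta>\<in>fibre \<alpha> \<omega>. \<Sum>j=1..m \<zeta>. H i j \<zeta> * cnj (H i' j \<zeta>)) =
        (if i = i' \<and> i \<le> m \<omega> then of_nat N else 0)) \<and>
     (\<forall>k\<ge>1. \<forall>k'\<ge>1. (\<Sum>\<zeta>\<in>fibre \<alpha> \<omega>. \<Sum>j=1..m \<zeta>. G k j \<zeta> * cnj (G k' j \<zeta>)) =
        (if k = k' \<and> k \<le> n \<omega> then of_nat N else 0)) \<and>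
     (\<forall>k\<ge>1. \<forall>i\<ge>1. (\<Sum>\<zeta>\<in>fibre \<alpha> \<omega>. \<Sum>j=1..m \<zeta>. G k j \<zeta> * cnj (H i j \<zeta>)) = 0)"

lemma AE_filter_identities: "AE \<omega> in \<mu>. filter_identities \<omega>"
proof -
  have "AE \<zeta> in \<mu>. \<zeta> \<notin> level m j \<longrightarrow> H i j \<zeta> = 0 \<and> G i j \<zeta> = 0" if "i \<ge> 1" "j \<ge> 1" for i j
  proof -
    have "AE \<zeta> in \<mu>. \<zeta> \<notin> level m j \<longrightarrow> H i j \<zeta> = 0" "AE \<zeta> in \<mu>. \<zeta> \<notin> level m j \<longrightarrow> G i j \<zeta> = 0"
      using filter compl that unfolding filter_relative_def complementary_filter_def by blast+
    then show ?thesis by eventually_elim blast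
  qed
  then have "AE \<zeta> in \<mu>. \<forall>i\<ge>1. \<forall>j\<ge>1. \<zeta> \<notin> level m j \<longrightarrow> H i j \<zeta> = 0 \<and> G i j \<zeta> = 0"
    by (simp add: AE_all_countable)
  then have supp: "AE \<omega> in \<mu>. \<forall>\<zeta>\<in>fibre \<alpha> \<omega>. \<forall>i\<ge>1. \<forall>j\<ge>1. \<zeta> \<notin> level m j \<longrightarrow> H i j \<zeta> = 0 \<and> G i j \<zeta> = 0"
    by (rule AE_fibre)
  have HH: "AE \<omega> in \<mu>. \<forall>i\<ge>1. \<forall>i'\<ge>1. (\<Sum>\<zeta>\<in>fibre \<alpha> \<omega>. \<Sum>\<^sub>\<infinity>j\<in>{1..}. H i j \<zeta> * cnj (H i' j \<zeta>)) =
        of_nat N * (if i = i' then 1 else 0) * indicator (level m i) \<omega>"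
    using filter by (simp add: filter_relative_def AE_all_countable)
  have GG: "AE \<omega> in \<mu>. \<forall>k\<ge>1. \<forall>k'\<ge>1. (\<Sum>\<zeta>\<in>fibre \<alpha> \<omega>. \<Sum>\<^sub>\<infinity>j\<in>{1..}. G k j \<zeta> * cnj (G k' j \<zeta>)) =
        of_nat N * (if k = k' then 1 else 0) * indicator (level n k) \<omega>"
    using compl by (simp add: complementary_filter_def AE_all_countable)
  have GH: "AE \<omega> in \<mu>. \<forall>k\<ge>1. \<forall>i\<ge>1. (\<Sum>\<zeta>\<in>fibre \<alpha> \<omega>. \<Sum>\<^sub>\<infinity>j\<in>{1..}. G k j \<zeta> * cnj (H i j \<zeta>)) = 0"
    using compl by (simp add: complementary_filter_def AE_all_countable)
  have le: "AE \<omega> in \<mu>. m \<omega> \<le> (\<Sum>\<zeta>\<in>fibre \<alpha> \<omega>. m \<zeta>)"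
    using mult by (simp add: multiplicity_function_def)
  from supp HH GG GH le AE_space show ?thesis
  proof eventually_elim
    fix \<omega> assume supp: "\<forall>\<zeta>\<in>fibre \<alpha> \<omega>. \<forall>i\<ge>1. \<forall>j\<ge>1. \<zeta> \<notin> level m j \<longrightarrow> H i j \<zeta> = 0 \<and> G i j \<zeta> = 0"
      and HH: "\<forall>i\<ge>1. \<forall>i'\<ge>1. (\<Sum>\<zeta>\<in>fibre \<alpha> \<omega>. \<Sum>\<^sub>\<infinity>j\<in>{1..}. H i j \<zeta> * cnj (H i' j \<zeta>)) =
        of_nat N * (if i = i' then 1 else 0) * indicator (level m i) \<omega>"
      and GG: "\<forall>k\<ge>1. \<forall>k'\<ge>1. (\<Sum>\<zeta>\<in>fibre \<alpha> \<omega>. \<Sum>\<^sub>\<infinity>j\<in>{1..}. G k j \<zeta> * cnj (G k' j \<zeta>)) =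
        of_nat N * (if k = k' then 1 else 0) * indicator (level n k) \<omega>"
      and GH: "\<forall>k\<ge>1. \<forall>i\<ge>1. (\<Sum>\<zeta>\<in>fibre \<alpha> \<omega>. \<Sum>\<^sub>\<infinity>j\<in>{1..}. G k j \<zeta> * cnj (H i j \<zeta>)) = 0"
      and le: "m \<omega> \<le> (\<Sum>\<zeta>\<in>fibre \<alpha> \<omega>. m \<zeta>)" and \<omega>: "\<omega> \<in> space \<mu>"
    have supp': "H i j \<zeta> = 0 \<and> G i j \<zeta> = 0" if "\<zeta> \<in> fibre \<alpha> \<omega>" "i \<ge> 1" "j \<ge> 1" "m \<zeta> < j" for \<zeta> i j
      using supp that by (auto simp: level_def)
    have fin: "(\<Sum>\<zeta>\<in>fibre \<alpha> \<omega>. \<Sum>\<^sub>\<infinity>j\<in>{1..}. A i j \<zeta> * cnj (B i' j \<zeta>)) = (\<Sum>\<zeta>\<in>fibre \<alpha> \<omega>. \<Sum>j=1..m \<zeta>. A i j \<zeta> * cnj (B i' j \<zeta>))"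
      if "i \<ge> 1" "i' \<ge> 1" "A = H \<or> A = G" for A B and i i' :: nat
    proof (rule sum.cong[OF refl])
      fix \<zeta> assume "\<zeta> \<in> fibre \<alpha> \<omega>"
      then have "(\<Sum>\<^sub>\<infinity>j\<in>{1..}. A i j \<zeta> * cnj (B i' j \<zeta>)) = (\<Sum>\<^sub>\<infinity>j\<in>{1..m \<zeta>}. A i j \<zeta> * cnj (B i' j \<zeta>))"
        using supp' that by (intro infsum_cong_neutral) auto
      then show "(\<Sum>\<^sub>\<infinity>j\<in>{1..}. A i j \<zeta> * cnj (B i' j \<zeta>)) = (\<Sum>j=1..m \<zeta>. A i j \<zeta> * cnj (B i' j \<zeta>))"
        by simp
    qed
    show "filter_identities \<omega>"
      unfolding filter_identities_def using \<omega> le supp' HH GG GH fin by (auto simp: level_def)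
  qed
qed

text \<open>The rows of the two matrices over a fibre, as one matrix with a sum type as index set of the
  rows; a column is a point of the fibre together with a column index.\<close>

definition row :: "nat + nat \<Rightarrow> ('g \<Rightarrow> complex) \<times> nat \<Rightarrow> complex" where
  "row r x = (case r of Inl i \<Rightarrow> H i (snd x) (fst x) | Inr k \<Rightarrow> G k (snd x) (fst x))"

abbreviation rows :: "('g \<Rightarrow> complex) \<Rightarrow> (nat + nat) set" where
  "rows \<omega> \<equiv> {1..m \<omega>} <+> {1..n \<omega>}"

abbreviation cols :: "('g \<Rightarrow> complex) \<Rightarrow> (('g \<Rightarrow> complex) \<times> nat) set" where
  "cols \<omega> \<equiv> Sigma (fibre \<alpha> \<omega>) (\<lambda>\<zeta>. {1..m \<zeta>})"

lemma sum_cols: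
  assumes "\<omega> \<in> dual_group"
  shows "(\<Sum>x\<in>cols \<omega>. f x) = (\<Sum>\<zeta>\<in>fibre \<alpha> \<omega>. \<Sum>j=1..m \<zeta>. f (\<zeta>, j))"
  using sum.Sigma[OF finite_fibre[OF assms], of "\<lambda>\<zeta>. {1..m \<zeta>}" "\<lambda>\<zeta> j. f (\<zeta>, j)"] by simp

lemma finite_cols: "\<omega> \<in> dual_group \<Longrightarrow> finite (cols \<omega>)"
  by (simp add: finite_fibre)

lemma rows_orthonormal:
  assumes \<omega>: "filter_identities \<omega>" and r: "r \<in> rows \<omega>" and r': "r' \<in> rows \<omega>"
  shows "(\<Sum>x\<in>cols \<omega>. row r x * cnj (row r' x)) = (if r = r' then of_real (real N) else 0)"
proof -
  have d: "\<omega> \<in> dual_group" using \<omega> by (simp add: filter_identities_def)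
  have HG: "(\<Sum>\<zeta>\<in>fibre \<alpha> \<omega>. \<Sum>j=1..m \<zeta>. H i j \<zeta> * cnj (G k j \<zeta>)) = 0" if "i \<ge> 1" "k \<ge> 1" for i k
  proof -
    have zero: "(\<Sum>\<zeta>\<in>fibre \<alpha> \<omega>. \<Sum>j=1..m \<zeta>. G k j \<zeta> * cnj (H i j \<zeta>)) = 0"
      using \<omega> that unfolding filter_identities_def by blast
    have "(\<Sum>\<zeta>\<in>fibre \<alpha> \<omega>. \<Sum>j=1..m \<zeta>. H i j \<zeta> * cnj (G k j \<zeta>)) = cnj (\<Sum>\<zeta>\<in>fibre \<alpha> \<omega>. \<Sum>j=1..m \<zeta>. G k j \<zeta> * cnj (H i j \<zeta>))"
      by (simp add: mult.commute)
    then show ?thesis unfolding zero by simp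
  qed
  have HH: "(\<Sum>\<zeta>\<in>fibre \<alpha> \<omega>. \<Sum>j=1..m \<zeta>. H i j \<zeta> * cnj (H i' j \<zeta>)) = (if i = i' \<and> i \<le> m \<omega> then of_nat N else 0)"
    and GG: "(\<Sum>\<zeta>\<in>fibre \<alpha> \<omega>. \<Sum>j=1..m \<zeta>. G i j \<zeta> * cnj (G i' j \<zeta>)) = (if i = i' \<and> i \<le> n \<omega> then of_nat N else 0)"
    and GH: "(\<Sum>\<zeta>\<in>fibre \<alpha> \<omega>. \<Sum>j=1..m \<zeta>. G i j \<zeta> * cnj (H i' j \<zeta>)) = 0"
    if "i \<ge> 1" "i' \<ge> 1" for i i'
    using \<omega> that unfolding filter_identities_def by blast+
  consider i i' where "r = Inl i" "r' = Inl i'" "i \<in> {1..m \<omega>}" "i' \<in> {1..m \<omega>}"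
    | i k where "r = Inl i" "r' = Inr k" "i \<in> {1..m \<omega>}" "k \<in> {1..n \<omega>}"
    | k i where "r = Inr k" "r' = Inl i" "k \<in> {1..n \<omega>}" "i \<in> {1..m \<omega>}"
    | k k' where "r = Inr k" "r' = Inr k'" "k \<in> {1..n \<omega>}" "k' \<in> {1..n \<omega>}"
    using r r' by blast
  then show ?thesis
    by cases (simp_all add: sum_cols[OF d] row_def HH GG GH HG)
qed

text \<open>This is the definition of the complementary multiplicity; without truncation, since the
  multiplicity is at most its sum over the fibre.\<close>

lemma card_rows_cols: "filter_identities \<omega> \<Longrightarrow> card (rows \<omega>) = card (cols \<omega>)"
  by (simp add: card_Plus card_SigmaI finite_fibre filter_identities_def compl_mult_def)

definition join_fun :: "(nat \<Rightarrow> ('g \<Rightarrow> complex) \<Rightarrow> complex) \<Rightarrow> (nat \<Rightarrow> ('g \<Rightarrow> complex) \<Rightarrow> complex) \<Rightarrow>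
    nat \<Rightarrow> ('g \<Rightarrow> complex) \<Rightarrow> complex" where
  "join_fun F E j \<omega> = ruelle_fun m H F j \<omega> + ruelle_fun n G E j \<omega>"

lemma join_fun_fibre:
  assumes "\<zeta> \<in> fibre \<alpha> \<omega>"
  shows "join_fun F E j \<zeta> = (\<Sum>r\<in>rows \<omega>. row r (\<zeta>, j) * (case r of Inl i \<Rightarrow> F i \<omega> | Inr k \<Rightarrow> E k \<omega>))"
  using assms by (simp add: join_fun_def ruelle_fun_def row_def sum.Plus mem_fibre_iff)

lemma join_fun_parseval:
  assumes \<omega>: "filter_identities \<omega>"
  shows "(\<Sum>\<zeta>\<in>fibre \<alpha> \<omega>. \<Sum>j=1..m \<zeta>. (norm (join_fun F E j \<zeta>))\<^sup>2)
    = real N * ((\<Sum>i=1..m \<omega>. (norm (F i \<omega>))\<^sup>2) + (\<Sum>k=1..n \<omega>. (norm (E k \<omega>))\<^sup>2))"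
proof -
  have d: "\<omega> \<in> dual_group" using \<omega> by (simp add: filter_identities_def)
  let ?v = "\<lambda>r. case r of Inl i \<Rightarrow> F i \<omega> | Inr k \<Rightarrow> E k \<omega>"
  have "(\<Sum>\<zeta>\<in>fibre \<alpha> \<omega>. \<Sum>j=1..m \<zeta>. (norm (join_fun F E j \<zeta>))\<^sup>2)
      = (\<Sum>x\<in>cols \<omega>. (norm (\<Sum>r\<in>rows \<omega>. row r x * ?v r))\<^sup>2)"
    unfolding sum_cols[OF d] by (intro sum.cong refl) (simp add: join_fun_fibre)
  also have "\<dots> = real N * (\<Sum>r\<in>rows \<omega>. (norm (?v r))\<^sup>2)"
    by (rule parseval[OF _ finite_cols[OF d] rows_orthonormal[OF \<omega>]]) auto
  finally show ?thesis by (simp add: sum.Plus)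
qed

lemma join_fun_measurable:
  assumes F: "\<And>i. i \<ge> 1 \<Longrightarrow> F i \<in> borel_measurable (level_measure \<mu> m i)"
    and E: "\<And>i. i \<ge> 1 \<Longrightarrow> E i \<in> borel_measurable (level_measure \<mu> n i)" and j: "j \<ge> 1"
  shows "join_fun F E j \<in> borel_measurable \<mu>"
  unfolding join_fun_def[abs_def]
  by (intro borel_measurable_add ruelle_fun_measurable m_measurable n_measurable F E H_measurable G_measurable j)

text \<open>The fibre formula for the integral turns Parseval's identity over the fibres into an identity for
  the squared norms.\<close>

lemma fsq_join_fun_deg:
  assumes F: "\<And>i. i \<ge> 1 \<Longrightarrow> F i \<in> borel_measurable (level_measure \<mu> m i)"
    and E: "\<And>i. i \<ge> 1 \<Longrightarrow> E i \<in> borel_measurable (level_measure \<mu> n i)"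
  shows "of_nat deg * core_sq m (join_fun F E)
    = of_nat N * (core_sq m F + core_sq n E)"
proof -
  let ?t = "\<lambda>\<omega>. \<Sum>j=1..m \<omega>. (norm (join_fun F E j \<omega>))\<^sup>2"
  let ?F = "\<lambda>\<omega>. \<Sum>i=1..m \<omega>. (norm (F i \<omega>))\<^sup>2" and ?E = "\<lambda>\<omega>. \<Sum>k=1..n \<omega>. (norm (E k \<omega>))\<^sup>2"
  have tm: "(\<lambda>\<omega>. ennreal (?t \<omega>)) \<in> borel_measurable \<mu>"
    using measurable_sum_mult[OF m_measurable, of "\<lambda>j \<omega>. (norm (join_fun F E j \<omega>))\<^sup>2"] join_fun_measurable[OF F E] by simp
  have cut: "(\<lambda>\<omega>. \<Sum>i=1..k \<omega>. (norm (D i \<omega>))\<^sup>2) \<in> borel_measurable \<mu>"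
    if k: "measurable_mult k" and D: "\<And>i. i \<ge> 1 \<Longrightarrow> D i \<in> borel_measurable (level_measure \<mu> k i)" for D k
  proof -
    have "(\<lambda>\<omega>. (norm (D i \<omega>))\<^sup>2) \<in> borel_measurable (restrict_space \<mu> (level k i))" if "i \<ge> 1" for i
      using D[OF that] unfolding level_measure_def by measurable
    then have "(\<lambda>\<omega>. indicator (level k i) \<omega> *\<^sub>R (norm (D i \<omega>))\<^sup>2) \<in> borel_measurable \<mu>" if "i \<ge> 1" for i
      by (rule iffD1[OF borel_measurable_restrict_space_iff[OF level_sets_Int[OF k]]]) (use that in auto)
    from measurable_sum_mult[OF k this]
    have "(\<lambda>\<omega>. \<Sum>i=1..k \<omega>. indicator (level k i) \<omega> *\<^sub>R (norm (D i \<omega>))\<^sup>2) \<in> borel_measurable \<mu>" .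
    moreover have "(\<Sum>i=1..k \<omega>. (norm (D i \<omega>))\<^sup>2) = (\<Sum>i=1..k \<omega>. indicator (level k i) \<omega> *\<^sub>R (norm (D i \<omega>))\<^sup>2)"
      if "\<omega> \<in> space \<mu>" for \<omega>
      using that by (intro sum.cong) (auto simp: level_def)
    ultimately show ?thesis by (subst measurable_cong)
  qed
  have "of_nat deg * core_sq m (join_fun F E) = of_nat deg * (\<integral>\<^sup>+\<omega>. ennreal (?t \<omega>) \<partial>\<mu>)"
    using join_fun_measurable[OF F E] by (subst fsq_core[OF m_measurable]) (auto intro: measurable_level_measure)
  also have "\<dots> = (\<integral>\<^sup>+\<omega>. (\<Sum>\<zeta>\<in>fibre \<alpha> \<omega>. ennreal (?t \<zeta>)) \<partial>\<mu>)"
    by (rule nn_integral_sum_fibre[OF tm, symmetric])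
  also have "\<dots> = (\<integral>\<^sup>+\<omega>. of_nat N * (ennreal (?F \<omega>) + ennreal (?E \<omega>)) \<partial>\<mu>)"
  proof (rule nn_integral_cong_AE)
    show "AE \<omega> in \<mu>. (\<Sum>\<zeta>\<in>fibre \<alpha> \<omega>. ennreal (?t \<zeta>)) = of_nat N * (ennreal (?F \<omega>) + ennreal (?E \<omega>))"
      using AE_filter_identities
    proof (rule AE_mp, intro AE_I2 impI)
      fix \<omega> assume "filter_identities \<omega>"
      have "(\<Sum>\<zeta>\<in>fibre \<alpha> \<omega>. ennreal (?t \<zeta>)) = ennreal (\<Sum>\<zeta>\<in>fibre \<alpha> \<omega>. ?t \<zeta>)"
        by (simp add: sum_nonneg)
      also have "\<dots> = ennreal (real N * (?F \<omega> + ?E \<omega>))"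
        by (simp only: join_fun_parseval[OF \<open>filter_identities \<omega>\<close>])
      finally show "(\<Sum>\<zeta>\<in>fibre \<alpha> \<omega>. ennreal (?t \<zeta>)) = of_nat N * (ennreal (?F \<omega>) + ennreal (?E \<omega>))"
        by (simp add: ennreal_mult ennreal_plus sum_nonneg ennreal_of_nat_eq_real_of_nat)
    qed
  qed
  also have "\<dots> = of_nat N * ((\<integral>\<^sup>+\<omega>. ennreal (?F \<omega>) \<partial>\<mu>) + (\<integral>\<^sup>+\<omega>. ennreal (?E \<omega>) \<partial>\<mu>))"
    using cut[OF m_measurable F] cut[OF n_measurable E]
    by (subst nn_integral_cmult) (auto simp: nn_integral_add)
  finally show ?thesis by (simp add: fsq_core[OF m_measurable F] fsq_core[OF n_measurable E])
qed

lemma fsq_zero: "fsq I \<nu> (\<lambda>_ _. 0) = 0"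
  by (simp add: fsq_def nsq_def)

lemma ruelle_fun_zero: "ruelle_fun k K (\<lambda>_ _. 0) = (\<lambda>_ _. 0)"
  by (simp add: ruelle_fun_def fun_eq_iff)

text \<open>The Ruelle operator of \<open>H\<close> multiplies squared norms by $N / |\ker\alpha^*|$. Since it is
  isometric, this factor is 1 unless the core is trivial. It is tested on the first unit vector.\<close>

lemma deg_eq_index: "deg = N \<or> (AE \<omega> in \<mu>. m \<omega> = 0)"
proof -
  let ?L = "level_measure \<mu> m"
  define F :: "nat \<Rightarrow> ('g \<Rightarrow> complex) \<Rightarrow> complex" where "F i \<omega> = (if i = 1 then 1 else 0)" for i \<omega>
  have Fm: "F i \<in> borel_measurable (level_measure \<mu> k i)" for i k by (simp add: F_def[abs_def])
  have fsqF: "fsq {1..} ?L F = emeasure \<mu> (level m 1)"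
  proof -
    have "fsq {1..} ?L F = (\<integral>\<^sup>+\<omega>. indicator (level m 1) \<omega> \<partial>\<mu>)"
      unfolding fsq_core[OF m_measurable Fm]
    proof (rule nn_integral_cong)
      fix \<omega> assume "\<omega> \<in> space \<mu>"
      have "(\<Sum>i=1..m \<omega>. (norm (F i \<omega>))\<^sup>2) = (\<Sum>i=1..m \<omega>. if i = 1 then 1 else 0)"
        by (intro sum.cong) (auto simp: F_def)
      then show "ennreal (\<Sum>i=1..m \<omega>. (norm (F i \<omega>))\<^sup>2) = indicator (level m 1) \<omega>"
        using \<open>\<omega> \<in> space \<mu>\<close> by (auto simp: level_def indicator_def)
    qed
    then show ?thesis using level_sets[OF m_measurable] by simp
  qed
  have fam: "l2_fam {1..} ?L F"
    using Fm fsqF by (simp add: l2_fam_def less_top[symmetric] haar_finite.emeasure_finite)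
  let ?X = "l2_vec {1..} ?L F"
  have X: "?X \<in> hcarrier (core m)" unfolding core_space_def by (rule l2_vec_mem[OF fam])
  let ?R = "l2_reps ?X"
  have Rm: "?R i \<in> borel_measurable (?L i)" if "i \<ge> 1" for i
    using l2_famD(1)[OF l2_sum_memD(2)[OF X[unfolded core_space_def]], of i] that by simp
  have rm: "ruelle_fun m H ?R j \<in> borel_measurable (?L j)" if "j \<ge> 1" for j
    by (intro measurable_level_measure, rule ruelle_fun_measurable[OF m_measurable]) (use Rm H_measurable that in auto)
  have "of_nat deg * fsq {1..} ?L (join_fun ?R (\<lambda>_ _. 0)) = of_nat N * (fsq {1..} ?L ?R + core_sq n (\<lambda>_ _. 0))"
    by (rule fsq_join_fun_deg) (use Rm in auto)
  moreover have "join_fun ?R (\<lambda>_ _. 0) = ruelle_fun m H ?R" by (simp add: join_fun_def ruelle_fun_zero fun_eq_iff)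
  moreover have nX: "ennreal ((hnorm (core m) ?X)\<^sup>2) = fsq {1..} ?L ?R"
    unfolding core_space_def by (rule l2_sum_memD(4)[OF X[unfolded core_space_def]])
  ultimately have eq: "of_nat deg * fsq {1..} ?L (ruelle_fun m H ?R) = of_nat N * fsq {1..} ?L ?R"
    by (simp add: fsq_zero)
  have "fsq {1..} ?L (ruelle_fun m H ?R) < \<infinity>"
  proof -
    have "of_nat deg * fsq {1..} ?L (ruelle_fun m H ?R) < \<infinity>"
      unfolding eq nX[symmetric] by (simp add: ennreal_mult_less_top ennreal_of_nat_eq_real_of_nat)
    then show ?thesis using deg_pos by (auto simp: ennreal_mult_less_top)
  qed
  then have rfam: "l2_fam {1..} ?L (ruelle_fun m H ?R)" using rm by (simp add: l2_fam_def)
  have "hnorm (core m) (ruelle \<alpha> \<mu> m H ?X) = hnorm (core m) ?X"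
    using pure X by (simp add: pure_isometry_def isometry_def)
  then have "fsq {1..} ?L (ruelle_fun m H ?R) = fsq {1..} ?L ?R"
    using l2_vec_mem(2)[OF rfam] nX ruelle_eq[OF m_measurable m_measurable X, of H] by (simp add: core_space_def)
  then have eq2: "of_nat deg * fsq {1..} ?L ?R = of_nat N * fsq {1..} ?L ?R" using eq by simp
  obtain t where t: "fsq {1..} ?L ?R = ennreal t" "t \<ge> 0"
    using nX by (metis zero_le_power2)
  have "real deg * t = real N * t"
    using eq2 t by (simp add: ennreal_of_nat_eq_real_of_nat ennreal_mult[symmetric])
  then have "deg = N \<or> t = 0" by auto
  moreover have "AE \<omega> in \<mu>. m \<omega> = 0" if "t = 0"
  proof -
    have "fsq {1..} ?L ?R = fsq {1..} ?L F"
      by (intro fsq_cong_AE l2_rep_vec Fm)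
    then have "emeasure \<mu> (level m 1) = 0" using t that fsqF by simp
    then have "level m 1 \<in> null_sets \<mu>" using level_sets[OF m_measurable, of 1] by auto
    then have "AE \<omega> in \<mu>. \<omega> \<notin> level m 1" by (rule AE_not_in)
    then show ?thesis
      by (rule AE_mp) (auto intro!: AE_I2 simp: level_def)
  qed
  ultimately show ?thesis by blast
qed

lemma fsq_core_trivial:
  assumes "AE \<omega> in \<mu>. k \<omega> = 0" and k: "measurable_mult k"
    and F: "\<And>i. i \<ge> 1 \<Longrightarrow> F i \<in> borel_measurable (level_measure \<mu> k i)"
  shows "core_sq k F = 0"
proof -
  have "(\<integral>\<^sup>+\<omega>. ennreal (\<Sum>i=1..k \<omega>. (norm (F i \<omega>))\<^sup>2) \<partial>\<mu>) = (\<integral>\<^sup>+\<omega>. 0 \<partial>\<mu>)"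
    using assms(1) by (intro nn_integral_cong_AE) auto
  then show ?thesis by (simp add: fsq_core[OF k F])
qed

text \<open>If the multiplicity vanishes almost everywhere, then so does the complementary one, and both
  sides are zero.\<close>

lemma fsq_join_fun:
  assumes F: "\<And>i. i \<ge> 1 \<Longrightarrow> F i \<in> borel_measurable (level_measure \<mu> m i)"
    and E: "\<And>i. i \<ge> 1 \<Longrightarrow> E i \<in> borel_measurable (level_measure \<mu> n i)"
  shows "core_sq m (join_fun F E)
    = core_sq m F + core_sq n E"
  using deg_eq_index
proof
  assume "deg = N"
  then show ?thesis
    using fsq_join_fun_deg[OF F E] deg_pos
    by (simp add: ennreal_mult_cancel_left ennreal_of_nat_eq_real_of_nat)
next
  assume z: "AE \<omega> in \<mu>. m \<omega> = 0"
  then have "AE \<omega> in \<mu>. \<forall>\<zeta>\<in>fibre \<alpha> \<omega>. m \<zeta> = 0" by (rule AE_fibre)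
  then have zn: "AE \<omega> in \<mu>. n \<omega> = 0" by (rule AE_mp) (auto intro!: AE_I2 simp: compl_mult_def)
  show ?thesis
    using fsq_core_trivial[OF z m_measurable F] fsq_core_trivial[OF zn n_measurable E]
      fsq_core_trivial[OF z m_measurable, of "join_fun F E"] join_fun_measurable[OF F E]
    by (simp add: measurable_level_measure)
qed

lemma H_operator:
  "isometry (core m) (core m) (ruelle \<alpha> \<mu> m H) \<and>
    (\<forall>F. core_fam m F \<longrightarrow> core_fam m (ruelle_fun m H F) \<and>
      ruelle \<alpha> \<mu> m H (core_vec m F) = core_vec m (ruelle_fun m H F))"
proof (rule ruelle_operator[OF m_measurable m_measurable H_measurable])
  fix F assume F: "core_fam m F"
  have "join_fun F (\<lambda>_ _. 0) = ruelle_fun m H F" by (simp add: join_fun_def ruelle_fun_zero fun_eq_iff)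
  then show "core_sq m (ruelle_fun m H F) = core_sq m F"
    using fsq_join_fun[of F "\<lambda>_ _. 0"] l2_famD(1)[OF F] by (simp add: fsq_zero)
qed auto

lemma G_operator:
  "isometry (core n) (core m) (ruelle \<alpha> \<mu> m G) \<and>
    (\<forall>F. core_fam n F \<longrightarrow> core_fam m (ruelle_fun n G F) \<and>
      ruelle \<alpha> \<mu> m G (core_vec n F) = core_vec m (ruelle_fun n G F))"
proof (rule ruelle_operator[OF m_measurable n_measurable G_measurable])
  fix F assume F: "core_fam n F"
  have "join_fun (\<lambda>_ _. 0) F = ruelle_fun n G F" by (simp add: join_fun_def ruelle_fun_zero fun_eq_iff)
  then show "core_sq m (ruelle_fun n G F) = core_sq n F"
    using fsq_join_fun[of "\<lambda>_ _. 0" F] l2_famD(1)[OF F] by (simp add: fsq_zero)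
qed auto

text \<open>The operator $S_H \oplus S_G$.\<close>

definition join where
  "join z = hplus (core m) (ruelle \<alpha> \<mu> m H (fst z)) (ruelle \<alpha> \<mu> m G (snd z))"

lemma join_vec:
  assumes F: "core_fam m F" and E: "core_fam n E"
  shows "join (core_vec m F, core_vec n E)
    = core_vec m (join_fun F E)"
    and "core_fam m (join_fun F E)"
proof -
  have HF: "core_fam m (ruelle_fun m H F)"
    "ruelle \<alpha> \<mu> m H (core_vec m F) = core_vec m (ruelle_fun m H F)"
    using H_operator F by auto
  have GE: "core_fam m (ruelle_fun n G E)"
    "ruelle \<alpha> \<mu> m G (core_vec n E) = core_vec m (ruelle_fun n G E)"
    using G_operator E by auto
  show "join (core_vec m F, core_vec n E)
    = core_vec m (join_fun F E)"
    unfolding join_def core_space_def fst_conv snd_conv HF GE join_fun_def[abs_def]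
    by (rule l2_vec_plus) (use l2_famD(1)[OF HF(1)] l2_famD(1)[OF GE(1)] in auto)
  have "core_sq m (join_fun F E) < \<infinity>"
    using F E by (subst fsq_join_fun) (auto simp: l2_fam_def)
  moreover have "join_fun F E j \<in> borel_measurable (level_measure \<mu> m j)" if "j \<ge> 1" for j
    by (rule measurable_level_measure, rule join_fun_measurable) (use F E that in \<open>auto simp: l2_fam_def\<close>)
  ultimately show "core_fam m (join_fun F E)" by (simp add: l2_fam_def)
qed

lemma prehilbert_core: "prehilbert (core k)"
  unfolding core_space_def by (rule prehilbert_l2_sum)

lemma core_vecE:
  assumes "X \<in> hcarrier (core k)"
  obtains F where "core_fam k F" "X = core_vec k F"
    "ennreal ((hnorm (core k) X)\<^sup>2) = core_sq k F"
  using l2_sum_memD(2-4)[OF assms[unfolded core_space_def]] by (metis core_space_def)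

lemma join_isometry: "isometry (hprod (core m) (core n)) (core m) join"
  unfolding isometry_def
proof (intro conjI ballI)
  show "linear_map (hprod (core m) (core n)) (core m) join"
    unfolding join_def[abs_def]
    using H_operator G_operator
    by (intro linear_map_sum prehilbert_core) (auto simp: isometry_def)
  fix z assume z: "z \<in> hcarrier (hprod (core m) (core n))"
  then obtain X Y where XY: "z = (X, Y)" "X \<in> hcarrier (core m)" "Y \<in> hcarrier (core n)" by auto
  obtain F where F: "core_fam m F" "X = core_vec m F"
    "ennreal ((hnorm (core m) X)\<^sup>2) = core_sq m F" by (rule core_vecE[OF XY(2)])
  obtain E where E: "core_fam n E" "Y = core_vec n E"
    "ennreal ((hnorm (core n) Y)\<^sup>2) = core_sq n E" by (rule core_vecE[OF XY(3)])
  have j: "join z = core_vec m (join_fun F E)"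
    using join_vec(1)[OF F(1) E(1)] F(2) E(2) XY(1) by simp
  have jc: "join z \<in> hcarrier (core m)"
    unfolding j core_space_def by (rule l2_vec_mem[OF join_vec(2)[OF F(1) E(1)]])
  have "ennreal ((hnorm (core m) (join z))\<^sup>2) = core_sq m (join_fun F E)"
    unfolding j core_space_def by (rule l2_vec_mem[OF join_vec(2)[OF F(1) E(1)]])
  also have "\<dots> = core_sq m F + core_sq n E"
    by (rule fsq_join_fun) (use l2_famD(1)[OF F(1)] l2_famD(1)[OF E(1)] in auto)
  also have "\<dots> = ennreal ((hnorm (core m) X)\<^sup>2 + (hnorm (core n) Y)\<^sup>2)"
    by (simp add: F(3)[symmetric] E(3)[symmetric] ennreal_plus)
  also have "\<dots> = ennreal ((hnorm (hprod (core m) (core n)) z)\<^sup>2)"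
    unfolding XY(1) by (subst hnorm_hprod[OF prehilbert_core prehilbert_core XY(2,3)]) simp
  finally have "(hnorm (core m) (join z))\<^sup>2 = (hnorm (hprod (core m) (core n)) z)\<^sup>2"
    by simp
  moreover have "hnorm (core m) (join z) \<ge> 0" "hnorm (hprod (core m) (core n)) z \<ge> 0"
    using prehilbert.inner_nonneg[OF prehilbert_core jc]
      prehilbert.inner_nonneg[OF prehilbert_hprod[OF prehilbert_core prehilbert_core] z]
    by (simp_all add: hnorm_def del: hprod_simps)
  ultimately show "hnorm (core m) (join z) = hnorm (hprod (core m) (core n)) z"
    by (simp add: power2_eq_iff_nonneg)
qed

text \<open>The columns over a fibre are orthogonal as well, so that applying the adjoint matrix, divided by
  $N$, and then the matrix itself gives back the function \<open>h\<close>.\<close>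

lemma join_fun_reconstruct:
  assumes \<omega>: "filter_identities \<omega>" and \<zeta>: "\<zeta> \<in> fibre \<alpha> \<omega>" and j: "j \<in> {1..m \<zeta>}"
    and F: "\<And>i. i \<in> {1..m \<omega>} \<Longrightarrow> F i \<omega> = (\<Sum>\<zeta>\<in>fibre \<alpha> \<omega>. \<Sum>j=1..m \<zeta>. cnj (H i j \<zeta>) * h j \<zeta>) / of_nat N"
    and E: "\<And>k. k \<in> {1..n \<omega>} \<Longrightarrow> E k \<omega> = (\<Sum>\<zeta>\<in>fibre \<alpha> \<omega>. \<Sum>j=1..m \<zeta>. cnj (G k j \<zeta>) * h j \<zeta>) / of_nat N"
  shows "join_fun F E j \<zeta> = h j \<zeta>"
proof -
  have d: "\<omega> \<in> dual_group" using \<omega> by (simp add: filter_identities_def)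
  have N0: "real N > 0" using index by simp
  let ?h = "\<lambda>x. h (snd x) (fst x)"
  have v: "(case r of Inl i \<Rightarrow> F i \<omega> | Inr k \<Rightarrow> E k \<omega>) = (\<Sum>x\<in>cols \<omega>. cnj (row r x) * ?h x) / of_nat N"
    if "r \<in> rows \<omega>" for r
    using that by (auto simp: sum_cols[OF d] row_def F E)
  have "join_fun F E j \<zeta> = (\<Sum>r\<in>rows \<omega>. row r (\<zeta>, j) * ((\<Sum>x\<in>cols \<omega>. cnj (row r x) * ?h x) / of_nat N))"
    unfolding join_fun_fibre[OF \<zeta>] by (intro sum.cong refl) (simp add: v)
  also have "\<dots> = (\<Sum>r\<in>rows \<omega>. \<Sum>x\<in>cols \<omega>. (cnj (row r x) * row r (\<zeta>, j)) * ?h x) / of_nat N"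
    by (simp add: sum_distrib_left sum_divide_distrib mult_ac)
  also have "(\<Sum>r\<in>rows \<omega>. \<Sum>x\<in>cols \<omega>. (cnj (row r x) * row r (\<zeta>, j)) * ?h x)
      = (\<Sum>x\<in>cols \<omega>. (\<Sum>r\<in>rows \<omega>. cnj (row r x) * row r (\<zeta>, j)) * ?h x)"
    unfolding sum_distrib_right by (rule sum.swap)
  also have "\<dots> = (\<Sum>x\<in>cols \<omega>. if x = (\<zeta>, j) then of_real (real N) * ?h x else 0)"
  proof (intro sum.cong refl)
    fix x assume x: "x \<in> cols \<omega>"
    have "(\<Sum>r\<in>rows \<omega>. cnj (row r x) * row r (\<zeta>, j)) = (if x = (\<zeta>, j) then of_real (real N) else 0)"
      by (rule square_orthonormal[OF _ finite_cols[OF d] card_rows_cols[OF \<omega>] N0 rows_orthonormal[OF \<omega>] x])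
         (use \<zeta> j in auto)
    then show "(\<Sum>r\<in>rows \<omega>. cnj (row r x) * row r (\<zeta>, j)) * ?h x = (if x = (\<zeta>, j) then of_real (real N) * ?h x else 0)"
      by simp
  qed
  also have "\<dots> = of_real (real N) * h j \<zeta>"
    using finite_cols[OF d] \<zeta> j by simp
  finally show ?thesis using N0 by simp
qed

text \<open>The preimage of \<open>h\<close> is given by the adjoint matrix. Its square-integrability follows from the
  norm identity, which holds for all measurable families.\<close>

lemma join_unitary: "unitary (hprod (core m) (core n)) (core m) join"
proof (rule unitaryI[OF prehilbert_hprod[OF prehilbert_core prehilbert_core] prehilbert_core join_isometry], rule subsetI)
  fix Y assume Y: "Y \<in> hcarrier (core m)"
  let ?h = "l2_reps Y" and ?Lm = "level_measure \<mu> m" and ?Ln = "level_measure \<mu> n"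
  have N0: "of_nat N \<noteq> (0::ennreal)" using index by simp
  note Y' = Y[unfolded core_space_def]
  define F where "F i \<omega> = (\<Sum>\<zeta>\<in>fibre \<alpha> \<omega>. \<Sum>j=1..m \<zeta>. cnj (H i j \<zeta>) * ?h j \<zeta>) / of_nat N" for i \<omega>
  define E where "E k \<omega> = (\<Sum>\<zeta>\<in>fibre \<alpha> \<omega>. \<Sum>j=1..m \<zeta>. cnj (G k j \<zeta>) * ?h j \<zeta>) / of_nat N" for k \<omega>
  have meas: "(\<lambda>\<omega>. (\<Sum>\<zeta>\<in>fibre \<alpha> \<omega>. \<Sum>j=1..m \<zeta>. cnj (K i j \<zeta>) * ?h j \<zeta>) / of_nat N) \<in> borel_measurable \<mu>"
    if K: "\<And>j. j \<ge> 1 \<Longrightarrow> K i j \<in> borel_measurable \<mu>" for K and i :: nat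
  proof -
    have "(\<lambda>\<zeta>. cnj (K i j \<zeta>) * ?h j \<zeta>) \<in> borel_measurable \<mu>" if "j \<ge> 1" for j
    proof -
      have "(\<lambda>\<zeta>. cnj (K i j \<zeta>)) \<in> borel_measurable \<mu>"
        by (intro borel_measurable_continuous_on[OF _ K[OF that]] continuous_intros)
      then show ?thesis using core_rep_measurable[OF m_measurable Y that] by simp
    qed
    from measurable_sum_fibre[OF measurable_sum_mult[OF m_measurable this]]
    show ?thesis by simp
  qed
  have Fm: "F i \<in> borel_measurable (?Lm i)" if "i \<ge> 1" for i
    unfolding F_def[abs_def] by (intro measurable_level_measure meas H_measurable that)
  have Em: "E i \<in> borel_measurable (?Ln i)" if "i \<ge> 1" for i
    unfolding E_def[abs_def] by (intro measurable_level_measure meas G_measurable that)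
  have "AE \<zeta> in \<mu>. \<forall>j\<ge>1. \<zeta> \<in> level m j \<longrightarrow> join_fun F E j \<zeta> = ?h j \<zeta>"
    using AE_endo[OF AE_filter_identities]
  proof (rule AE_mp, intro AE_I2 impI allI)
    fix \<zeta> j assume "\<zeta> \<in> space \<mu>" "filter_identities (p \<zeta>)" "j \<ge> 1" "\<zeta> \<in> level m j"
    then show "join_fun F E j \<zeta> = ?h j \<zeta>"
      by (intro join_fun_reconstruct[of "p \<zeta>"]) (auto simp: mem_fibre_iff level_def F_def E_def)
  qed
  then have eq: "AE \<zeta> in ?Lm j. join_fun F E j \<zeta> = ?h j \<zeta>" if "j \<in> {1..}" for j
    using that by (auto simp: AE_level[OF m_measurable] elim: AE_mp)
  have "fsq {1..} ?Lm F + fsq {1..} ?Ln E = fsq {1..} ?Lm (join_fun F E)"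
    by (rule fsq_join_fun[OF Fm Em, symmetric])
  also have "\<dots> = fsq {1..} ?Lm ?h" by (rule fsq_cong_AE[OF eq])
  also have "\<dots> < \<infinity>" using l2_sum_memD(2)[OF Y'] by (simp add: l2_fam_def)
  finally have F: "l2_fam {1..} ?Lm F" and E: "l2_fam {1..} ?Ln E"
    using Fm Em by (auto simp: l2_fam_def)
  have "join (l2_vec {1..} ?Lm F, l2_vec {1..} ?Ln E) = l2_vec {1..} ?Lm (join_fun F E)"
    by (rule join_vec(1)[OF F E])
  also have "\<dots> = l2_vec {1..} ?Lm ?h" by (rule l2_vec_cong[OF eq])
  also have "\<dots> = Y" by (rule l2_sum_memD(3)[OF Y'])
  finally have "Y = join (l2_vec {1..} ?Lm F, l2_vec {1..} ?Ln E)" by simp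
  moreover have "(l2_vec {1..} ?Lm F, l2_vec {1..} ?Ln E) \<in> hcarrier (hprod (core m) (core n))"
    using l2_vec_mem(1)[OF F] l2_vec_mem(1)[OF E] by (simp add: core_space_def)
  ultimately show "Y \<in> join ` hcarrier (hprod (core m) (core n))" by (rule image_eqI)
qed

lemma chr_closed:
  "measurable_mult k \<Longrightarrow> X \<in> hcarrier (core k) \<Longrightarrow> chr k \<gamma> X \<in> hcarrier (core k)"
  unfolding core_space_def by (intro mult_char_closed borel_part_level)

lemma join_char:
  assumes X: "X \<in> hcarrier (core m)" and Y: "Y \<in> hcarrier (core n)"
  shows "join (chr m \<gamma> X, chr n \<gamma> Y) = chr m (\<alpha> \<gamma>) (join (X, Y))"
proof -
  obtain F where F: "core_fam m F" "X = core_vec m F" by (rule core_vecE[OF X])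
  obtain E where E: "core_fam n E" "Y = core_vec n E" by (rule core_vecE[OF Y])
  have "join (chr m \<gamma> X, chr n \<gamma> Y)
      = core_vec m (join_fun (\<lambda>i \<omega>. \<omega> \<gamma> * F i \<omega>) (\<lambda>i \<omega>. \<omega> \<gamma> * E i \<omega>))"
  proof -
    have "chr m \<gamma> X = core_vec m (\<lambda>i \<omega>. \<omega> \<gamma> * F i \<omega>)"
      unfolding F(2) by (rule mult_char_vec) (use borel_part_level l2_famD(1)[OF F(1)] in auto)
    moreover have "chr n \<gamma> Y = core_vec n (\<lambda>i \<omega>. \<omega> \<gamma> * E i \<omega>)"
      unfolding E(2) by (rule mult_char_vec) (use borel_part_level l2_famD(1)[OF E(1)] in auto)
    moreover have "core_fam m (\<lambda>i \<omega>. \<omega> \<gamma> * F i \<omega>)"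
      by (rule l2_fam_char[OF _ F(1)]) (simp add: borel_part_level)
    moreover have "core_fam n (\<lambda>i \<omega>. \<omega> \<gamma> * E i \<omega>)"
      by (rule l2_fam_char[OF _ E(1)]) (simp add: borel_part_level)
    ultimately show ?thesis by (simp add: join_vec(1))
  qed
  also have "\<dots> = core_vec m (\<lambda>j \<omega>. \<omega> (\<alpha> \<gamma>) * join_fun F E j \<omega>)"
    by (simp add: join_fun_def[abs_def] ruelle_fun_char distrib_left)
  also have "\<dots> = chr m (\<alpha> \<gamma>) (core_vec m (join_fun F E))"
    by (rule mult_char_vec[symmetric]) (use borel_part_level l2_famD(1)[OF join_vec(2)[OF F(1) E(1)]] in auto)
  finally show ?thesis using join_vec(1)[OF F(1) E(1)] F(2) E(2) by simp
qed

end

section \<open>Equivalence is decided on the core\<close>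

declare hsum_simps [simp del]

lemma unitary_zero:
  assumes "prehilbert K" "prehilbert L" and U: "unitary K L U"
  shows "U (hzero K) = hzero L"
  using assms unitaryD(1,5)[OF U] prehilbert.zero_closed[OF assms(1)] prehilbert.inner_zero[OF assms(1)]
  by (intro prehilbert.zero_unique[OF assms(2)]) auto

lemma unitary_hprod:
  assumes U: "unitary K K' U" and V: "unitary L L' V"
  shows "unitary (hprod K L) (hprod K' L') (\<lambda>z. (U (fst z), V (snd z)))"
proof -
  have "bij_betw (\<lambda>z. (U (fst z), V (snd z))) (hcarrier K \<times> hcarrier L) (hcarrier K' \<times> hcarrier L')"
    using bij_betw_map_prod[OF unitaryD(4)[OF U] unitaryD(4)[OF V]]
    by (simp add: map_prod_def case_prod_beta')
  then show ?thesis
    unfolding unitary_def linear_map_def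
    using unitaryD(1,2,3,5)[OF U] unitaryD(1,2,3,5)[OF V] by auto
qed

text \<open>A ladder abstracts from the canonical analysis: the core \<open>C\<close> is unitarily equivalent to
  $C \oplus W_0$ by \<open>join\<close>, and each $W_k$ to $W_{k+1}$ by $D_k$. Along these maps the action of
  \<open>\<gamma>\<close> on the one side corresponds to that of \<open>\<alpha> \<gamma>\<close> on the other.\<close>

locale ladder =
  fixes C :: "'v hilb" and W :: "nat \<Rightarrow> 'w hilb"
    and join :: "'v \<times> 'w \<Rightarrow> 'v" and D :: "nat \<Rightarrow> 'w \<Rightarrow> 'w"
    and rep_core :: "'g \<Rightarrow> 'v \<Rightarrow> 'v" and rep_level :: "nat \<Rightarrow> 'g \<Rightarrow> 'w \<Rightarrow> 'w"
    and \<alpha> :: "'g \<Rightarrow> 'g"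
  assumes prehilbert_C: "prehilbert C" and prehilbert_W: "\<And>k. prehilbert (W k)"
    and join: "unitary (hprod C (W 0)) C join"
    and D: "\<And>k. unitary (W k) (W (Suc k)) (D k)"
    and rep_core_closed: "\<And>\<gamma> x. x \<in> hcarrier C \<Longrightarrow> rep_core \<gamma> x \<in> hcarrier C"
    and rep_level_closed: "\<And>k \<gamma> w. w \<in> hcarrier (W k) \<Longrightarrow> rep_level k \<gamma> w \<in> hcarrier (W k)"
    and rep_level_zero: "\<And>k \<gamma>. rep_level k \<gamma> (hzero (W k)) = hzero (W k)"
    and join_rep: "\<And>\<gamma> x w. x \<in> hcarrier C \<Longrightarrow> w \<in> hcarrier (W 0) \<Longrightarrow>
      join (rep_core \<gamma> x, rep_level 0 \<gamma> w) = rep_core (\<alpha> \<gamma>) (join (x, w))"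
    and D_rep: "\<And>k \<gamma> w. w \<in> hcarrier (W k) \<Longrightarrow>
      D k (rep_level k (\<alpha> \<gamma>) w) = rep_level (Suc k) \<gamma> (D k w)"
begin

abbreviation detail :: "(nat \<Rightarrow> 'w) hilb" where "detail \<equiv> hsum UNIV W"

abbreviation amb :: "('v \<times> (nat \<Rightarrow> 'w)) hilb" where "amb \<equiv> hprod C detail"

abbreviation Dinv :: "nat \<Rightarrow> 'w \<Rightarrow> 'w" where "Dinv k \<equiv> inv_into (hcarrier (W k)) (D k)"

definition T :: "'v \<times> (nat \<Rightarrow> 'w) \<Rightarrow> 'v \<times> (nat \<Rightarrow> 'w)" where
  "T x = (join (fst x, snd x 0), \<lambda>k. Dinv k (snd x (Suc k)))"

definition rep_amb :: "'g \<Rightarrow> 'v \<times> (nat \<Rightarrow> 'w) \<Rightarrow> 'v \<times> (nat \<Rightarrow> 'w)" where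
  "rep_amb \<gamma> x = (rep_core \<gamma> (fst x), \<lambda>k. rep_level k \<gamma> (snd x k))"

abbreviation dl where "dl \<equiv> inv_into (hcarrier amb) T"

abbreviation V0 where "V0 \<equiv> hcarrier C \<times> {hzero detail}"

definition analysis :: "('g, 'v \<times> (nat \<Rightarrow> 'w)) gmra" where
  "analysis = \<lparr>ambient = amb, repr = rep_amb, dil = dl,
     subsp = (\<lambda>j. if 0 \<le> j then (dl ^^ nat j) ` V0 else (T ^^ nat (- j)) ` V0)\<rparr>"

lemma prehilbert_detail: "prehilbert detail" by (intro prehilbert_hsum prehilbert_W)

lemma detail_zero: "hzero detail = (\<lambda>k. hzero (W k))" by (simp add: hsum_simps restrict_def)

lemma detail_mem:
  "w \<in> hcarrier detail \<longleftrightarrow> (\<forall>k. w k \<in> hcarrier (W k)) \<and> summable (\<lambda>k. (hnorm (W k) (w k))\<^sup>2)"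
  by (simp add: hsum_simps PiE_iff summable_on_UNIV_nonneg_real_iff)

lemma amb_memD:
  assumes "x \<in> hcarrier amb"
  shows "fst x \<in> hcarrier C" "snd x \<in> hcarrier detail" "snd x k \<in> hcarrier (W k)"
  using assms by (auto simp: detail_mem)

lemma zeros: "hzero C \<in> hcarrier C" "hzero (W k) \<in> hcarrier (W k)" "hzero detail \<in> hcarrier detail"
  using prehilbert.zero_closed prehilbert_C prehilbert_W prehilbert_detail by blast+

lemma bij_T: "bij_betw T (hcarrier amb) (hcarrier amb)"
proof (rule bij_betw_byWitness)
  define J where "J = inv_into (hcarrier (hprod C (W 0))) join"
  (* the inverse of T shifts the detail components back and splits the core component by join *)
  define T' where "T' y = (let z = J (fst y) in
    (fst z, \<lambda>k. case k of 0 \<Rightarrow> snd z | Suc j \<Rightarrow> D j (snd y j)))" for y :: "'v \<times> (nat \<Rightarrow> 'w)"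
  note Jinv = unitary_inv[OF join, folded J_def] and DI = unitary_inv[OF D]
  show "\<forall>x\<in>hcarrier amb. T' (T x) = x"
  proof
    fix x assume x: "x \<in> hcarrier amb"
    have "J (join (fst x, snd x 0)) = (fst x, snd x 0)"
      using amb_memD[OF x] by (intro Jinv(1)) simp
    moreover have "(case k of 0 \<Rightarrow> snd x 0 | Suc j \<Rightarrow> D j (Dinv j (snd x (Suc j)))) = snd x k" for k
      using DI(2)[OF amb_memD(3)[OF x]] by (cases k) auto
    ultimately show "T' (T x) = x" by (simp add: T_def T'_def Let_def prod_eq_iff fun_eq_iff)
  qed
  show "\<forall>y\<in>hcarrier amb. T (T' y) = y"
  proof
    fix y assume y: "y \<in> hcarrier amb"
    have "join (J (fst y)) = fst y" using amb_memD(1)[OF y] by (rule Jinv(2))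
    moreover have "Dinv k (D k (snd y k)) = snd y k" for k using DI(1)[OF amb_memD(3)[OF y]] .
    ultimately show "T (T' y) = y" by (simp add: T_def T'_def Let_def)
  qed
  show "T ` hcarrier amb \<subseteq> hcarrier amb"
  proof (rule image_subsetI)
    fix z assume z: "z \<in> hcarrier amb"
    obtain x w where xw: "z = (x, w)" by fastforce
    have x: "(x, w) \<in> hcarrier amb" using z xw by simp
    note xd = amb_memD[OF x, simplified]
    have "join (x, w 0) \<in> hcarrier C"
      using unitaryD(1)[OF join, of "(x, w 0)"] xd by simp
    moreover have nk: "hnorm (W k) (Dinv k (w (Suc k))) = hnorm (W (Suc k)) (w (Suc k))" for k
      using unitaryD(6)[OF D, of "Dinv k (w (Suc k))" k] DI(2,3)[of "w (Suc k)" k] xd(3) by simp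
    have "(\<lambda>k. Dinv k (w (Suc k))) \<in> hcarrier detail"
      using xd(2) DI(3)[OF xd(3)] summable_Suc_iff[of "\<lambda>k. (hnorm (W k) (w k))\<^sup>2"]
      by (auto simp: detail_mem nk)
    ultimately show "T z \<in> hcarrier amb" by (simp add: T_def xw)
  qed
  show "T' ` hcarrier amb \<subseteq> hcarrier amb"
  proof (rule image_subsetI)
    fix z assume z: "z \<in> hcarrier amb"
    obtain x w where xw: "z = (x, w)" by fastforce
    have x: "(x, w) \<in> hcarrier amb" using z xw by simp
    note xd = amb_memD[OF x, simplified]
    let ?w = "\<lambda>k. case k of 0 \<Rightarrow> snd (J x) | Suc j \<Rightarrow> D j (w j)"
    have Jx: "J x \<in> hcarrier (hprod C (W 0))" using xd(1) by (rule Jinv(3))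
    have nk: "hnorm (W (Suc k)) (D k (w k)) = hnorm (W k) (w k)" for k
      using unitaryD(6)[OF D] xd(3) by simp
    have "summable (\<lambda>k. (hnorm (W (Suc k)) (?w (Suc k)))\<^sup>2)"
      using xd(2) by (simp add: nk detail_mem)
    then have "summable (\<lambda>k. (hnorm (W k) (?w k))\<^sup>2)"
      by (rule summable_Suc_iff[THEN iffD1])
    moreover have "?w k \<in> hcarrier (W k)" for k
      using Jx unitaryD(1)[OF D xd(3)] by (cases k) auto
    ultimately have "?w \<in> hcarrier detail" by (simp only: detail_mem) blast
    then show "T' z \<in> hcarrier amb" using Jx by (simp add: T'_def Let_def xw mem_Times_iff)
  qed
qed

lemma T_closed: "x \<in> hcarrier amb \<Longrightarrow> T x \<in> hcarrier amb"
  using bij_T unfolding bij_betw_def by blast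

lemma dl_closed: "x \<in> hcarrier amb \<Longrightarrow> dl x \<in> hcarrier amb"
  using bij_T unfolding bij_betw_def by (metis inv_into_into)

lemma dl_T: "x \<in> hcarrier amb \<Longrightarrow> dl (T x) = x"
  using bij_T unfolding bij_betw_def by (metis inv_into_f_f)

lemma T_dl: "x \<in> hcarrier amb \<Longrightarrow> T (dl x) = x"
  using bij_T unfolding bij_betw_def by (metis f_inv_into_f)

lemma Dinv_zero: "Dinv k (hzero (W (Suc k))) = hzero (W k)"
  using unitary_zero[OF prehilbert_W prehilbert_W unitary_inv_into[OF prehilbert_W D]] .

lemma T_core: "T (x, hzero detail) = (join (x, hzero (W 0)), hzero detail)"
  by (simp add: T_def detail_zero Dinv_zero)

lemma V0_amb: "V0 \<subseteq> hcarrier amb"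
  using zeros by (auto)

end

lemma image_funpow:
  assumes A: "A \<subseteq> X" and f: "\<And>x. x \<in> X \<Longrightarrow> f x \<in> X" and U: "\<And>x. x \<in> X \<Longrightarrow> U (f x) = g (U x)"
  shows "U ` ((f ^^ k) ` A) = (g ^^ k) ` (U ` A)"
proof -
  have "(f ^^ k) x \<in> X \<and> U ((f ^^ k) x) = (g ^^ k) (U x)" if "x \<in> X" for x
    using that by (induction k) (auto simp: f U)
  then show ?thesis using A by (auto simp: image_image) (metis imageI subsetD)+
qed

text \<open>Restricting an equivalence to the core subspace gives \<open>U\<close>. In the other direction \<open>U\<close> is carried
  along the ladder: first to \<open>V\<close> on $W_0$ through the orthogonal splitting, then by conjugation with
  the maps $D_k$.\<close>

theorem ladder_equivalence:
  assumes L: "ladder C W join D rep_core rep_level \<alpha>" and L': "ladder C' W' join' D' rep_core' rep_level' \<alpha>"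
  shows "gmra_equivalent (ladder.analysis C W join D rep_core rep_level)
      (ladder.analysis C' W' join' D' rep_core' rep_level') \<longleftrightarrow>
    (\<exists>U. unitary C C' U \<and>
      (\<forall>x\<in>hcarrier C. U (join (x, hzero (W 0))) = join' (U x, hzero (W' 0))) \<and>
      (\<forall>\<gamma>. \<forall>x\<in>hcarrier C. U (rep_core \<gamma> x) = rep_core' \<gamma> (U x)))"
    (is "?lhs \<longleftrightarrow> ?rhs")
proof
  interpret A: ladder C W join D rep_core rep_level \<alpha> by fact
  interpret B: ladder C' W' join' D' rep_core' rep_level' \<alpha> by fact
  let ?z = "hzero A.detail" and ?z' = "hzero B.detail"
  {
    assume ?lhs
    then obtain U where *: "unitary (ambient A.analysis) (ambient B.analysis) U"
      "\<forall>j. U ` subsp A.analysis j = subsp B.analysis j"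
      "\<forall>\<gamma>. \<forall>x\<in>hcarrier (ambient A.analysis). U (repr A.analysis \<gamma> x) = repr B.analysis \<gamma> (U x)"
      "\<forall>x\<in>hcarrier (ambient A.analysis). U (dil A.analysis x) = dil B.analysis (U x)"
      unfolding gmra_equivalent_def by blast
    have U: "unitary A.amb B.amb U" using *(1) by (simp add: A.analysis_def B.analysis_def)
    have UV: "U ` A.V0 = B.V0" using *(2)[rule_format, of 0] by (simp add: A.analysis_def B.analysis_def)
    have rep: "U (A.rep_amb \<gamma> x) = B.rep_amb \<gamma> (U x)" if "x \<in> hcarrier A.amb" for \<gamma> x
      using *(3) that by (simp add: A.analysis_def B.analysis_def del: hprod_simps)
    have dil: "U (A.dl x) = B.dl (U x)" if "x \<in> hcarrier A.amb" for x
      using *(4) that by (simp add: A.analysis_def B.analysis_def del: hprod_simps)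
    define U0 where "U0 x = fst (U (x, ?z))" for x
    have c: "(x, ?z) \<in> hcarrier A.amb" if "x \<in> hcarrier C" for x
      using that A.V0_amb by blast
    have Ux: "U (x, ?z) = (U0 x, ?z')" and U0c: "U0 x \<in> hcarrier C'" if "x \<in> hcarrier C" for x
    proof -
      have "U (x, ?z) \<in> B.V0" using that unfolding UV[symmetric] by (intro imageI) simp
      then show "U (x, ?z) = (U0 x, ?z')" "U0 x \<in> hcarrier C'" by (auto simp: U0_def)
    qed
    have plus: "hplus A.amb (x, ?z) (y, ?z) = (hplus C x y, ?z)" for x y
      using prehilbert.zero_left[OF A.prehilbert_detail A.zeros(3)] by (simp)
    have plus': "hplus B.amb (x, ?z') (y, ?z') = (hplus C' x y, ?z')" for x y
      using prehilbert.zero_left[OF B.prehilbert_detail B.zeros(3)] by (simp)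
    have U0: "unitary C C' U0"
    proof (rule unitaryI[OF A.prehilbert_C B.prehilbert_C])
      show "isometry C C' U0"
        unfolding isometry_def linear_map_def
      proof (intro conjI ballI allI)
        show "U0 \<in> hcarrier C \<rightarrow> hcarrier C'" using U0c by auto
        fix x assume x: "x \<in> hcarrier C"
        have "hinner C' (U0 x) (U0 x) = hinner C x x"
          using unitaryD(5)[OF U c[OF x] c[OF x]]
            prehilbert.inner_zero[OF A.prehilbert_detail A.zeros(3)]
            prehilbert.inner_zero[OF B.prehilbert_detail B.zeros(3)]
          by (simp add: Ux[OF x])
        then show "hnorm C' (U0 x) = hnorm C x" by (simp add: hnorm_def)
        show "U0 (hplus C x y) = hplus C' (U0 x) (U0 y)" if y: "y \<in> hcarrier C" for y
          using unitaryD(2)[OF U c[OF x] c[OF y]] prehilbert.plus_closed[OF A.prehilbert_C x y]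
          unfolding plus by (simp add: Ux x y plus' del: hprod_simps)
        show "U0 (hscale C a x) = hscale C' a (U0 x)" for a
        proof -
          have s: "hscale C a x \<in> hcarrier C" by (rule prehilbert.scale_closed[OF A.prehilbert_C x])
          have sz: "hscale A.detail a ?z = ?z"
            using A.prehilbert_detail prehilbert.scale_closed[OF A.prehilbert_detail A.zeros(3), of a]
            by (intro prehilbert.zero_unique)
               (simp_all add: prehilbert.inner_scale[OF A.prehilbert_detail A.zeros(3)]
                  prehilbert.inner_zero[OF A.prehilbert_detail])
          have "hscale A.amb a (x, ?z) = (hscale C a x, ?z)"
            using sz by (simp)
          then show ?thesis
            using unitaryD(3)[OF U c[OF x], of a] by (simp add: Ux x s)
        qed
      qed
      show "hcarrier C' \<subseteq> U0 ` hcarrier C"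
      proof
        fix y assume "y \<in> hcarrier C'"
        then have "(y, ?z') \<in> U ` A.V0" unfolding UV by simp
        then obtain x where "x \<in> hcarrier C" "U (x, ?z) = (y, ?z')" by auto
        then show "y \<in> U0 ` hcarrier C" using Ux by auto
      qed
    qed
    have "U0 (join (x, hzero (W 0))) = join' (U0 x, hzero (W' 0))" if x: "x \<in> hcarrier C" for x
    proof -
      have T: "A.T (x, ?z) = (join (x, hzero (W 0)), ?z)" by (rule A.T_core)
      have jx: "join (x, hzero (W 0)) \<in> hcarrier C"
        using unitaryD(1)[OF A.join, of "(x, hzero (W 0))"] x A.zeros by simp
      have Tc: "A.T (x, ?z) \<in> hcarrier A.amb" by (rule A.T_closed[OF c[OF x]])
      have "B.T (U (x, ?z)) = B.T (U (A.dl (A.T (x, ?z))))" using A.dl_T[OF c[OF x]] by simp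
      also have "\<dots> = B.T (B.dl (U (A.T (x, ?z))))" using dil[OF Tc] by simp
      also have "\<dots> = U (A.T (x, ?z))" by (rule B.T_dl[OF unitaryD(1)[OF U Tc]])
      finally show ?thesis
        unfolding T Ux[OF x] Ux[OF jx] B.T_core by simp
    qed
    moreover have "U0 (rep_core \<gamma> x) = rep_core' \<gamma> (U0 x)" if x: "x \<in> hcarrier C" for \<gamma> x
    proof -
      have "A.rep_amb \<gamma> (x, ?z) = (rep_core \<gamma> x, ?z)"
        by (simp add: A.rep_amb_def A.detail_zero A.rep_level_zero)
      moreover have "B.rep_amb \<gamma> (U0 x, ?z') = (rep_core' \<gamma> (U0 x), ?z')"
        by (simp add: B.rep_amb_def B.detail_zero B.rep_level_zero)
      ultimately show ?thesis
        using rep[OF c[OF x], of \<gamma>] by (simp add: Ux x A.rep_core_closed)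
    qed
    ultimately show ?rhs using U0 by blast
  next
    assume ?rhs
    then obtain U where U: "unitary C C' U"
      and S: "\<And>x. x \<in> hcarrier C \<Longrightarrow> U (join (x, hzero (W 0))) = join' (U x, hzero (W' 0))"
      and rep: "\<And>\<gamma> x. x \<in> hcarrier C \<Longrightarrow> U (rep_core \<gamma> x) = rep_core' \<gamma> (U x)" by blast
    note pAB = prehilbert_hprod[OF A.prehilbert_C A.prehilbert_W] prehilbert_hprod[OF B.prehilbert_C B.prehilbert_W]
    let ?J' = "inv_into (hcarrier (hprod C' (W' 0))) join'"
    note J' = unitary_inv[OF B.join]
    have Q: "unitary (hprod C (W 0)) (hprod C' (W' 0)) (?J' \<circ> (U \<circ> join))"
      by (intro unitary_comp[OF unitary_comp[OF A.join U]] unitary_inv_into[OF pAB(2) B.join])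
    have "(?J' \<circ> (U \<circ> join)) (x, hzero (W 0)) = (U x, hzero (W' 0))" if "x \<in> hcarrier C" for x
      using that S[OF that] J'(1)[of "(U x, hzero (W' 0))"] unitaryD(1)[OF U that] B.zeros by simp
    from unitary_splits[OF A.prehilbert_C B.prehilbert_C A.prehilbert_W B.prehilbert_W Q unitaryD(4)[OF U] this]
    obtain V where V: "unitary (W 0) (W' 0) V"
      and UV: "\<And>x y. x \<in> hcarrier C \<Longrightarrow> y \<in> hcarrier (W 0) \<Longrightarrow> ?J' (U (join (x, y))) = (U x, V y)"
      by auto
    have joinUV: "join' (U x, V y) = U (join (x, y))" if "x \<in> hcarrier C" "y \<in> hcarrier (W 0)" for x y
    proof -
      have "U (join (x, y)) \<in> hcarrier C'"
        using unitaryD(1)[OF A.join, of "(x, y)"] unitaryD(1)[OF U] that by simp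
      then show ?thesis using J'(2) UV[OF that] by metis
    qed
    have V_rep: "V (rep_level 0 \<gamma> y) = rep_level' 0 \<gamma> (V y)" if y: "y \<in> hcarrier (W 0)" for \<gamma> y
    proof -
      let ?o = "hzero C"
      note o = A.zeros(1)
      have j: "join (?o, y) \<in> hcarrier C" using unitaryD(1)[OF A.join, of "(?o, y)"] o y by simp
      have "join' (U (rep_core \<gamma> ?o), V (rep_level 0 \<gamma> y)) = U (join (rep_core \<gamma> ?o, rep_level 0 \<gamma> y))"
        by (rule joinUV[OF A.rep_core_closed[OF o] A.rep_level_closed[OF y]])
      also have "\<dots> = rep_core' (\<alpha> \<gamma>) (join' (U ?o, V y))"
        by (simp add: A.join_rep[OF o y] rep[OF j] joinUV[OF o y])
      also have "\<dots> = join' (rep_core' \<gamma> (U ?o), rep_level' 0 \<gamma> (V y))"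
        using unitaryD(1)[OF U o] unitaryD(1)[OF V y] by (simp add: B.join_rep)
      finally have eq: "join' (U (rep_core \<gamma> ?o), V (rep_level 0 \<gamma> y)) = join' (rep_core' \<gamma> (U ?o), rep_level' 0 \<gamma> (V y))" .
      have "(U (rep_core \<gamma> ?o), V (rep_level 0 \<gamma> y)) = (rep_core' \<gamma> (U ?o), rep_level' 0 \<gamma> (V y))"
        using unitaryD(4)[OF B.join] eq o y unitaryD(1)[OF U] unitaryD(1)[OF V]
        by (auto simp: bij_betw_def A.rep_core_closed A.rep_level_closed B.rep_core_closed B.rep_level_closed
            dest!: inj_onD[where x = "(U (rep_core \<gamma> ?o), V (rep_level 0 \<gamma> y))"])
      then show ?thesis by simp
    qed
    (* VV k is the component of the equivalence on the k-th detail space *)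
    define VV where "VV = rec_nat V (\<lambda>k Vk. D' k \<circ> (Vk \<circ> A.Dinv k))"
    have VV: "VV 0 = V" "VV (Suc k) = D' k \<circ> (VV k \<circ> A.Dinv k)" for k by (simp_all add: VV_def)
    have VVu: "unitary (W k) (W' k) (VV k)" for k
    proof (induction k)
      case (Suc k)
      show ?case
        unfolding VV by (intro unitary_comp[OF unitary_comp[OF unitary_inv_into[OF A.prehilbert_W A.D] Suc] B.D])
    qed (simp add: VV V)
    note DI = unitary_inv[OF A.D] and DI' = unitary_inv[OF B.D]
    have VV_rep: "VV k (rep_level k \<gamma> w) = rep_level' k \<gamma> (VV k w)" if "w \<in> hcarrier (W k)" for k \<gamma> w
      using that
    proof (induction k arbitrary: \<gamma> w)
      case 0
      then show ?case by (simp add: VV V_rep)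
    next
      case (Suc k)
      let ?v = "A.Dinv k w"
      have v: "?v \<in> hcarrier (W k)" "D k ?v = w" using DI(3,2)[OF Suc.prems] .
      have "rep_level (Suc k) \<gamma> w = D k (rep_level k (\<alpha> \<gamma>) ?v)"
        using A.D_rep[OF v(1), of \<gamma>] v(2) by simp
      then have "A.Dinv k (rep_level (Suc k) \<gamma> w) = rep_level k (\<alpha> \<gamma>) ?v"
        using DI(1)[OF A.rep_level_closed[OF v(1)]] by simp
      then show ?case
        using Suc.IH[OF v(1)] B.D_rep[OF unitaryD(1)[OF VVu v(1)]] by (simp add: VV)
    qed
    define UU where "UU x = (U (fst x), \<lambda>k. VV k (snd x k))" for x
    have UUu: "unitary A.amb B.amb UU"
      unfolding UU_def
      using unitary_hprod[OF U unitary_hsum[where U = VV, OF A.prehilbert_W B.prehilbert_W VVu]] by simp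
    have UU_T: "UU (A.T x) = B.T (UU x)" if x: "x \<in> hcarrier A.amb" for x
    proof -
      note xd = A.amb_memD[OF x]
      have "VV k (A.Dinv k (snd x (Suc k))) = B.Dinv k (VV (Suc k) (snd x (Suc k)))" for k
        using DI'(1)[OF unitaryD(1)[OF VVu DI(3)[OF xd(3)]]] by (simp add: VV)
      moreover have "U (join (fst x, snd x 0)) = join' (U (fst x), VV 0 (snd x 0))"
        using joinUV[OF xd(1) xd(3)] by (simp add: VV)
      ultimately show ?thesis by (simp add: UU_def A.T_def B.T_def)
    qed
    have UU_dl: "UU (A.dl x) = B.dl (UU x)" if x: "x \<in> hcarrier A.amb" for x
    proof -
      have y: "A.dl x \<in> hcarrier A.amb" by (rule A.dl_closed[OF x])
      have "B.dl (UU x) = B.dl (UU (A.T (A.dl x)))" using A.T_dl[OF x] by simp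
      also have "\<dots> = B.dl (B.T (UU (A.dl x)))" using UU_T[OF y] by simp
      also have "\<dots> = UU (A.dl x)" by (rule B.dl_T[OF unitaryD(1)[OF UUu y]])
      finally show ?thesis by simp
    qed
    have UU_V0: "UU ` A.V0 = B.V0"
    proof -
      have "(\<lambda>k. VV k (?z k)) = ?z'"
        using unitary_zero[OF A.prehilbert_W B.prehilbert_W VVu]
        by (simp add: A.detail_zero B.detail_zero)
      then have "UU ` A.V0 = (U ` hcarrier C) \<times> {?z'}"
        by (auto simp: UU_def image_iff)
      then show ?thesis using unitaryD(4)[OF U] by (simp add: bij_betw_def)
    qed
    have "UU ` subsp A.analysis j = subsp B.analysis j" for j
      using image_funpow[where f = A.dl and g = B.dl and U = UU, OF A.V0_amb A.dl_closed UU_dl, of "nat j"]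
        image_funpow[where f = A.T and g = B.T and U = UU, OF A.V0_amb A.T_closed UU_T, of "nat (- j)"]
      by (simp add: A.analysis_def B.analysis_def UU_V0 del: hprod_simps)
    moreover have "UU (A.rep_amb \<gamma> x) = B.rep_amb \<gamma> (UU x)" if x: "x \<in> hcarrier A.amb" for \<gamma> x
      using A.amb_memD[OF x] by (simp add: UU_def A.rep_amb_def B.rep_amb_def rep VV_rep)
    ultimately show ?lhs
      unfolding gmra_equivalent_def using UUu UU_dl
      by (intro exI[of _ UU]) (simp add: A.analysis_def B.analysis_def del: hprod_simps)
  }
qed

section \<open>The canonical analysis as a ladder\<close>

context filter_setting
begin

abbreviation WI where "WI \<equiv> wavelet_index \<alpha>"
abbreviation WF where "WF \<equiv> wavelet_family \<alpha> c \<mu> m"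
abbreviation WS where "WS \<equiv> wavelet_space \<alpha> c \<mu> m"

lemma borel_part_wavelet: "d \<in> WI k \<Longrightarrow> borel_part (WF k d)"
proof (induction k arbitrary: d)
  case 0
  then show ?case by (auto simp: borel_part_level)
next
  case (Suc k)
  then show ?case using borel_part_dilate_family[of "WI k" "WF k"] by simp
qed

lemma dilate_wavelet_unitary: "unitary (WS k) (WS (Suc k)) (dilate \<alpha> c (WI k) (WF k))"
  using dilate_unitary[of "WI k" "WF k"] borel_part_wavelet by (simp add: wavelet_space_def)

text \<open>The first detail space is the core space of the complementary multiplicity up to the names of the
  indices.\<close>

definition unbase :: "(('g \<Rightarrow> complex) dindex \<Rightarrow> 'h) \<Rightarrow> nat \<Rightarrow> 'h" where
  "unbase w = (\<lambda>k\<in>{1..}. w (Base k))"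

lemma fsq_base: "fsq (WI 0) (WF 0) F = core_sq n (\<lambda>k. F (Base k))"
proof -
  have "bij_betw Base {1..} (WI 0)" by (auto simp: bij_betw_def inj_on_def)
  from nn_integral_bij_count_space[OF this, of "\<lambda>d. nsq (WF 0 d) (F d)"]
  show ?thesis by (simp add: fsq_def)
qed

lemma unbase_unitary: "unitary (WS 0) (core n) unbase"
  unfolding wavelet_space_def core_space_def
proof (rule unitaryI[OF prehilbert_l2_sum prehilbert_l2_sum])
  have "isometry (l2_sum (WI 0) (WF 0)) (l2_sum {1..} (level_measure \<mu> n)) unbase \<and>
    (\<forall>F. l2_fam (WI 0) (WF 0) F \<longrightarrow> core_fam n (\<lambda>k. F (Base k)) \<and>
      unbase (l2_vec (WI 0) (WF 0) F) = core_vec n (\<lambda>k. F (Base k)))"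
  proof (rule l2_isometryI[where \<Phi> = "\<lambda>F k. F (Base k)"])
    fix F assume F: "l2_fam (WI 0) (WF 0) F"
    show "\<forall>j\<in>{1..}. F (Base j) \<in> borel_measurable (level_measure \<mu> n j)"
      using l2_famD(1)[OF F, of "Base _"] by auto
    show "core_sq n (\<lambda>k. F (Base k)) = fsq (WI 0) (WF 0) F"
      by (rule fsq_base[symmetric])
  next
    fix F G :: "('g \<Rightarrow> complex) dindex \<Rightarrow> ('g \<Rightarrow> complex) \<Rightarrow> complex" and j :: nat
    assume eq: "\<And>i. i \<in> WI 0 \<Longrightarrow> AE x in WF 0 i. F i x = G i x" and j: "j \<in> {1..}"
    have wf: "WF 0 (Base j) = level_measure \<mu> n j" by simp
    show "AE x in level_measure \<mu> n j. F (Base j) x = G (Base j) x"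
      using eq[of "Base j"] j unfolding wf by simp
  next
    fix X assume X: "X \<in> hcarrier (l2_sum (WI 0) (WF 0))"
    have "X (Base k) = l2_class (level_measure \<mu> n k) (l2_rep (X (Base k)))" if "k \<ge> 1" for k
      using L2_carrierD(3)[OF l2_sum_memD(1)[OF X, of "Base k"]] that by simp
    then show "unbase X = core_vec n (\<lambda>k. l2_rep (X (Base k)))"
      by (auto simp: unbase_def l2_vec_def intro!: restrict_ext)
  qed auto
  then have iso: "isometry (l2_sum (WI 0) (WF 0)) (l2_sum {1..} (level_measure \<mu> n)) unbase"
    and vec: "\<And>F. l2_fam (WI 0) (WF 0) F \<Longrightarrow>
      unbase (l2_vec (WI 0) (WF 0) F) = core_vec n (\<lambda>k. F (Base k))" by blast+
  show "isometry (l2_sum (WI 0) (WF 0)) (l2_sum {1..} (level_measure \<mu> n)) unbase" by (rule iso)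
  show "hcarrier (l2_sum {1..} (level_measure \<mu> n)) \<subseteq> unbase ` hcarrier (l2_sum (WI 0) (WF 0))"
  proof
    fix Y assume Y: "Y \<in> hcarrier (l2_sum {1..} (level_measure \<mu> n))"
    define F where "F d = (case d of Base k \<Rightarrow> l2_rep (Y k) | Dil i \<zeta> \<Rightarrow> undefined)"
      for d :: "('g \<Rightarrow> complex) dindex"
    note fam = l2_sum_memD(2)[OF Y]
    have FB: "(\<lambda>k. F (Base k)) = l2_reps Y" by (simp add: F_def)
    have F: "l2_fam (WI 0) (WF 0) F"
      using fam unfolding l2_fam_def fsq_base FB by (auto simp: F_def)
    have "unbase (l2_vec (WI 0) (WF 0) F) = Y"
      unfolding vec[OF F] FB by (rule l2_sum_memD(3)[OF Y])
    then show "Y \<in> unbase ` hcarrier (l2_sum (WI 0) (WF 0))"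
      using l2_vec_mem(1)[OF F] by (metis imageI)
  qed
qed

text \<open>\<open>join\<close> with the first detail space as its second summand.\<close>

definition step where
  "step z = hplus (core m) (ruelle \<alpha> \<mu> m H (fst z)) (ruelle \<alpha> \<mu> m G (\<lambda>k. snd z (Base k)))"

lemma step_eq: "step z = join (fst z, unbase (snd z))"
proof -
  have "ruelle \<alpha> \<mu> m G (\<lambda>k. snd z (Base k)) = ruelle \<alpha> \<mu> m G (unbase (snd z))"
    unfolding ruelle_def unbase_def
    by (intro restrict_ext arg_cong[where f = "l2_class _"] ext infsum_cong) simp
  then show ?thesis by (simp add: step_def join_def)
qed

lemma prehilbert_wavelet: "prehilbert (WS k)"
  unfolding wavelet_space_def by (rule prehilbert_l2_sum)

lemma step_unitary: "unitary (hprod (core m) (WS 0)) (core m) step"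
proof -
  have id: "unitary (core m) (core m) (\<lambda>x. x)"
    by (simp add: unitary_def linear_map_def bij_betw_def)
  have "step = join \<circ> (\<lambda>z. (fst z, unbase (snd z)))" by (simp add: fun_eq_iff step_eq)
  then show ?thesis
    using unitary_comp[OF unitary_hprod[OF id unbase_unitary] join_unitary] by simp
qed

abbreviation rep_wavelet where "rep_wavelet k \<gamma> \<equiv> mult_char (WI k) (WF k) \<gamma>"

lemma unbase_char:
  assumes "w \<in> hcarrier (WS 0)"
  shows "unbase (rep_wavelet 0 \<gamma> w) = chr n \<gamma> (unbase w)"
  by (simp add: unbase_def mult_char_def fun_eq_iff)

sublocale ladder: ladder "core m" WS step "\<lambda>k. dilate \<alpha> c (WI k) (WF k)"
  "\<lambda>\<gamma>. chr m \<gamma>" rep_wavelet \<alpha>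
proof (rule ladder.intro)
    show "prehilbert (core m)" by (rule prehilbert_core)
    show "prehilbert (WS k)" for k by (rule prehilbert_wavelet)
    show "unitary (hprod (core m) (WS 0)) (core m) step" by (rule step_unitary)
    show "unitary (WS k) (WS (Suc k)) (dilate \<alpha> c (WI k) (WF k))" for k by (rule dilate_wavelet_unitary)
    show "chr m \<gamma> x \<in> hcarrier (core m)" if "x \<in> hcarrier (core m)" for \<gamma> x
      by (rule chr_closed[OF m_measurable that])
    show "rep_wavelet k \<gamma> w \<in> hcarrier (WS k)" if "w \<in> hcarrier (WS k)" for k \<gamma> w
      using that borel_part_wavelet unfolding wavelet_space_def by (intro mult_char_closed)
    show "rep_wavelet k \<gamma> (hzero (WS k)) = hzero (WS k)" for k \<gamma>
      unfolding wavelet_space_def l2_sum_zero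
      by (subst mult_char_vec) (auto intro: borel_part_wavelet)
    show "step (chr m \<gamma> x, rep_wavelet 0 \<gamma> w) = chr m (\<alpha> \<gamma>) (step (x, w))"
      if x: "x \<in> hcarrier (core m)" and w: "w \<in> hcarrier (WS 0)" for \<gamma> x w
      by (simp only: step_eq fst_conv snd_conv unbase_char[OF w] join_char[OF x unitaryD(1)[OF unbase_unitary w]])
    show "dilate \<alpha> c (WI k) (WF k) (rep_wavelet k (\<alpha> \<gamma>) w) = rep_wavelet (Suc k) \<gamma> (dilate \<alpha> c (WI k) (WF k) w)"
      if "w \<in> hcarrier (WS k)" for k \<gamma> w
      using dilate_mult_char[of "WI k" "WF k" w \<gamma>] that borel_part_wavelet by (simp add: wavelet_space_def)
qed

lemma canonical_gmra_eq: "canonical_gmra \<alpha> c \<mu> m H G = ladder.analysis"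
proof -
  have T: "canonical_T \<alpha> c \<mu> m H G = ladder.T"
    by (simp add: canonical_T_def ladder.T_def step_def fun_eq_iff)
  have R: "canonical_repr \<alpha> c \<mu> m = ladder.rep_amb"
    by (simp add: canonical_repr_def ladder.rep_amb_def fun_eq_iff)
  show ?thesis
    unfolding canonical_gmra_def ladder.analysis_def Let_def T R canonical_space_def ..
qed

lemma step_zero:
  assumes X: "X \<in> hcarrier (core m)"
  shows "step (X, hzero (WS 0)) = ruelle \<alpha> \<mu> m H X"
proof -
  have z: "unbase (hzero (WS 0)) = hzero (core n)"
    by (rule unitary_zero[OF prehilbert_wavelet prehilbert_core unbase_unitary])
  have iso: "isometry (core n) (core m) (ruelle \<alpha> \<mu> m G)" using G_operator by blast
  have z0: "hzero (core n) \<in> hcarrier (core n)"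
    by (rule prehilbert.zero_closed[OF prehilbert_core])
  have "ruelle \<alpha> \<mu> m G (hzero (core n)) = hzero (core m)"
  proof (rule prehilbert.zero_unique[OF prehilbert_core])
    show "ruelle \<alpha> \<mu> m G (hzero (core n)) \<in> hcarrier (core m)"
      using iso z0 by (auto simp: isometry_def linear_map_def)
    show "hinner (core m) (ruelle \<alpha> \<mu> m G (hzero (core n))) (ruelle \<alpha> \<mu> m G (hzero (core n))) = 0"
      using isometry_inner[OF prehilbert_core prehilbert_core iso z0 z0] prehilbert.inner_zero[OF prehilbert_core z0] by simp
  qed
  moreover have "ruelle \<alpha> \<mu> m H X \<in> hcarrier (core m)"
    using H_operator X by (auto simp: isometry_def linear_map_def)
  ultimately show ?thesis
    by (simp add: step_eq z join_def prehilbert.zero_right[OF prehilbert_core])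
qed

end

section \<open>Unitaries of core spaces that commute with the characters\<close>

context dual_setting
begin

lemma measurable_cut_sum:
  fixes F :: "nat \<Rightarrow> ('g \<Rightarrow> complex) \<Rightarrow> complex"
  assumes m: "measurable_mult m" and K: "\<And>i. i \<ge> 1 \<Longrightarrow> K i \<in> borel_measurable \<mu>"
    and F: "\<And>i. i \<ge> 1 \<Longrightarrow> F i \<in> borel_measurable (level_measure \<mu> m i)"
  shows "(\<lambda>\<omega>. \<Sum>i=1..m \<omega>. K i \<omega> * F i \<omega>) \<in> borel_measurable \<mu>"
proof -
  have "(\<lambda>\<omega>. K i \<omega> * (indicator (level m i) \<omega> *\<^sub>R F i \<omega>)) \<in> borel_measurable \<mu>" if "i \<ge> 1" for i
  proof (rule borel_measurable_times[OF K[OF that]])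
    show "(\<lambda>\<omega>. indicator (level m i) \<omega> *\<^sub>R F i \<omega>) \<in> borel_measurable \<mu>"
      by (rule iffD1[OF borel_measurable_restrict_space_iff[OF level_sets_Int[OF m]]])
         (use F[OF that] in \<open>simp add: level_measure_def\<close>)
  qed
  from measurable_sum_mult[OF m this]
  have "(\<lambda>\<omega>. \<Sum>i=1..m \<omega>. K i \<omega> * (indicator (level m i) \<omega> *\<^sub>R F i \<omega>)) \<in> borel_measurable \<mu>" .
  moreover have "(\<Sum>i=1..m \<omega>. K i \<omega> * F i \<omega>) = (\<Sum>i=1..m \<omega>. K i \<omega> * (indicator (level m i) \<omega> *\<^sub>R F i \<omega>))"
    if "\<omega> \<in> space \<mu>" for \<omega>
    using that by (intro sum.cong) (auto simp: level_def)
  ultimately show ?thesis by (subst measurable_cong)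
qed

lemma core_norm:
  assumes m: "measurable_mult m" and X: "X \<in> hcarrier (core m)"
  shows "integrable \<mu> (\<lambda>\<omega>. \<Sum>i=1..m \<omega>. (norm (l2_rep (X i) \<omega>))\<^sup>2)"
    and "(hnorm (core m) X)\<^sup>2 = (\<integral>\<omega>. (\<Sum>i=1..m \<omega>. (norm (l2_rep (X i) \<omega>))\<^sup>2) \<partial>\<mu>)"
proof -
  let ?f = "\<lambda>\<omega>. \<Sum>i=1..m \<omega>. (norm (l2_rep (X i) \<omega>))\<^sup>2"
  have fm: "?f \<in> borel_measurable \<mu>"
    using core_rep_measurable[OF m X] by (intro measurable_sum_mult[OF m]) auto
  have "(\<integral>\<^sup>+\<omega>. ennreal (?f \<omega>) \<partial>\<mu>) = ennreal ((hnorm (core m) X)\<^sup>2)"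
    using l2_sum_memD(4)[OF X[unfolded core_space_def]] core_rep_measurable[OF m X]
    by (subst (asm) fsq_core[OF m]) (auto intro: measurable_level_measure simp: core_space_def)
  moreover from this show "integrable \<mu> ?f"
    using fm by (intro integrableI_nonneg) (auto simp: sum_nonneg)
  ultimately have "ennreal (\<integral>\<omega>. ?f \<omega> \<partial>\<mu>) = ennreal ((hnorm (core m) X)\<^sup>2)"
    by (subst (asm) nn_integral_eq_integral) (auto simp: sum_nonneg)
  then show "(hnorm (core m) X)\<^sup>2 = (\<integral>\<omega>. ?f \<omega> \<partial>\<mu>)"
    by (simp add: integral_nonneg_AE sum_nonneg)
qed

lemma core_product_integrable:
  assumes m: "measurable_mult m" and X: "X \<in> hcarrier (core m)" and Y: "Y \<in> hcarrier (core m)"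
  shows "integrable \<mu> (\<lambda>\<omega>. \<Sum>i=1..m \<omega>. l2_rep (X i) \<omega> * cnj (l2_rep (Y i) \<omega>))"
proof (rule Bochner_Integration.integrable_bound)
  show "integrable \<mu> (\<lambda>\<omega>. (\<Sum>i=1..m \<omega>. (norm (l2_rep (X i) \<omega>))\<^sup>2) + (\<Sum>i=1..m \<omega>. (norm (l2_rep (Y i) \<omega>))\<^sup>2))"
    by (intro Bochner_Integration.integrable_add core_norm(1)[OF m] X Y)
  have "(\<lambda>\<omega>. l2_rep (X i) \<omega> * cnj (l2_rep (Y i) \<omega>)) \<in> borel_measurable \<mu>" if "i \<ge> 1" for i
    by (intro borel_measurable_times core_rep_measurable[OF m X that]
        borel_measurable_continuous_on[OF _ core_rep_measurable[OF m Y that]] continuous_intros)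
  then show "(\<lambda>\<omega>. \<Sum>i=1..m \<omega>. l2_rep (X i) \<omega> * cnj (l2_rep (Y i) \<omega>)) \<in> borel_measurable \<mu>"
    by (rule measurable_sum_mult[OF m])
  have ab: "a * b \<le> a\<^sup>2 + b\<^sup>2" if "0 \<le> a" "0 \<le> b" for a b :: real
    using sum_squares_bound[of a b] mult_nonneg_nonneg[OF that] by linarith
  show "AE \<omega> in \<mu>. norm (\<Sum>i=1..m \<omega>. l2_rep (X i) \<omega> * cnj (l2_rep (Y i) \<omega>))
      \<le> norm ((\<Sum>i=1..m \<omega>. (norm (l2_rep (X i) \<omega>))\<^sup>2) + (\<Sum>i=1..m \<omega>. (norm (l2_rep (Y i) \<omega>))\<^sup>2))"
  proof (rule AE_I2)
    fix \<omega>
    have "norm (\<Sum>i=1..m \<omega>. l2_rep (X i) \<omega> * cnj (l2_rep (Y i) \<omega>))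
        \<le> (\<Sum>i=1..m \<omega>. (norm (l2_rep (X i) \<omega>))\<^sup>2 + (norm (l2_rep (Y i) \<omega>))\<^sup>2)"
      by (rule sum_norm_le) (simp add: norm_mult ab)
    then show "norm (\<Sum>i=1..m \<omega>. l2_rep (X i) \<omega> * cnj (l2_rep (Y i) \<omega>))
      \<le> norm ((\<Sum>i=1..m \<omega>. (norm (l2_rep (X i) \<omega>))\<^sup>2) + (\<Sum>i=1..m \<omega>. (norm (l2_rep (Y i) \<omega>))\<^sup>2))"
      by (simp add: sum.distrib sum_nonneg)
  qed
qed

text \<open>Both sides are sesquilinear with the same quadratic form, the squared norm, hence they are equal
  by polarization.\<close>

lemma core_inner:
  assumes m: "measurable_mult m" and X: "X \<in> hcarrier (core m)" and Y: "Y \<in> hcarrier (core m)"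
  shows "hinner (core m) X Y = (\<integral>\<omega>. (\<Sum>i=1..m \<omega>. l2_rep (X i) \<omega> * cnj (l2_rep (Y i) \<omega>)) \<partial>\<mu>)"
    (is "_ = ?B")
proof -
  interpret C: prehilbert "core m" unfolding core_space_def by (rule prehilbert_l2_sum)
  have lin: "(\<integral>\<omega>. f \<omega> + r * g \<omega> + 2 * Re (a * h \<omega>) \<partial>\<mu>) = (\<integral>\<omega>. f \<omega> \<partial>\<mu>) + r * (\<integral>\<omega>. g \<omega> \<partial>\<mu>) + 2 * Re (a * (\<integral>\<omega>. h \<omega> \<partial>\<mu>))"
    if "integrable \<mu> f" "integrable \<mu> g" "integrable \<mu> h"
    for f g :: "('g \<Rightarrow> complex) \<Rightarrow> real" and h :: "('g \<Rightarrow> complex) \<Rightarrow> complex" and r a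
  proof -
    have "(\<integral>\<omega>. Re (a * h \<omega>) \<partial>\<mu>) = Re (\<integral>\<omega>. a * h \<omega> \<partial>\<mu>)"
      by (rule integral_Re) (use that in simp)
    then have "(\<integral>\<omega>. Re (a * h \<omega>) \<partial>\<mu>) = Re (a * (\<integral>\<omega>. h \<omega> \<partial>\<mu>))" by simp
    moreover have "integrable \<mu> (\<lambda>\<omega>. Re (a * h \<omega>))"
      by (rule integrable_Re) (use that in simp)
    ultimately show ?thesis using that by (simp del: times_complex.sel)
  qed
  have "Re (cnj a * hinner (core m) X Y) = Re (cnj a * ?B)" for a
  proof -
    let ?Z = "hplus (core m) X (hscale (core m) a Y)"
    have Z: "?Z \<in> hcarrier (core m)" by (intro C.plus_closed C.scale_closed X Y)
    let ?x = "\<lambda>i. l2_rep (X i)" and ?y = "\<lambda>i. l2_rep (Y i)"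
    have xm: "?x i \<in> borel_measurable \<mu>" and ym: "?y i \<in> borel_measurable \<mu>" if "i \<ge> 1" for i
      using core_rep_measurable[OF m] X Y that by auto
    have s: "hscale (core m) a Y = core_vec m (\<lambda>i \<omega>. a * ?y i \<omega>)"
      unfolding core_space_def l2_sum_scale ..
    have xv: "X = core_vec m ?x"
      using l2_sum_memD(3)[OF X[unfolded core_space_def]] by simp
    have "?Z = core_vec m (\<lambda>i \<omega>. ?x i \<omega> + a * ?y i \<omega>)"
      unfolding s by (subst xv, unfold core_space_def, rule l2_vec_plus) (use xm ym in \<open>auto intro!: measurable_level_measure\<close>)
    moreover have "AE \<omega> in \<mu>. \<forall>i\<ge>1. \<omega> \<in> level m i \<longrightarrow>
        l2_rep (core_vec m (\<lambda>i \<omega>. ?x i \<omega> + a * ?y i \<omega>) i) \<omega> = ?x i \<omega> + a * ?y i \<omega>"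
      by (rule core_rep_vec[OF m]) (use xm ym in auto)
    ultimately have zr: "AE \<omega> in \<mu>. \<forall>i\<ge>1. \<omega> \<in> level m i \<longrightarrow> l2_rep (?Z i) \<omega> = ?x i \<omega> + a * ?y i \<omega>" by simp
    have "AE \<omega> in \<mu>. (\<Sum>i=1..m \<omega>. (norm (l2_rep (?Z i) \<omega>))\<^sup>2)
        = (\<Sum>i=1..m \<omega>. (norm (?x i \<omega>))\<^sup>2) + (norm a)\<^sup>2 * (\<Sum>i=1..m \<omega>. (norm (?y i \<omega>))\<^sup>2)
          + 2 * Re (cnj a * (\<Sum>i=1..m \<omega>. ?x i \<omega> * cnj (?y i \<omega>)))"
      using zr AE_space
    proof eventually_elim
      fix \<omega> assume zr: "\<forall>i\<ge>1. \<omega> \<in> level m i \<longrightarrow> l2_rep (?Z i) \<omega> = ?x i \<omega> + a * ?y i \<omega>" and \<omega>: "\<omega> \<in> space \<mu>"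
      have sq: "(norm (u + a * v))\<^sup>2 = (norm u)\<^sup>2 + (norm a)\<^sup>2 * (norm v)\<^sup>2 + 2 * Re (cnj a * (u * cnj v))" for u v
        unfolding cmod_power2 by (simp add: power2_eq_square algebra_simps)
      have "(\<Sum>i=1..m \<omega>. (norm (l2_rep (?Z i) \<omega>))\<^sup>2)
         = (\<Sum>i=1..m \<omega>. (norm (?x i \<omega>))\<^sup>2 + (norm a)\<^sup>2 * (norm (?y i \<omega>))\<^sup>2 + 2 * Re (cnj a * (?x i \<omega> * cnj (?y i \<omega>))))"
        using zr \<omega> by (intro sum.cong) (auto simp: level_def sq)
      then show "(\<Sum>i=1..m \<omega>. (norm (l2_rep (?Z i) \<omega>))\<^sup>2)
        = (\<Sum>i=1..m \<omega>. (norm (?x i \<omega>))\<^sup>2) + (norm a)\<^sup>2 * (\<Sum>i=1..m \<omega>. (norm (?y i \<omega>))\<^sup>2)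
          + 2 * Re (cnj a * (\<Sum>i=1..m \<omega>. ?x i \<omega> * cnj (?y i \<omega>)))"
        by (simp only: sum.distrib sum_distrib_left Re_sum)
    qed
    then have "(\<integral>\<omega>. (\<Sum>i=1..m \<omega>. (norm (l2_rep (?Z i) \<omega>))\<^sup>2) \<partial>\<mu>)
        = (\<integral>\<omega>. (\<Sum>i=1..m \<omega>. (norm (?x i \<omega>))\<^sup>2) + (norm a)\<^sup>2 * (\<Sum>i=1..m \<omega>. (norm (?y i \<omega>))\<^sup>2)
          + 2 * Re (cnj a * (\<Sum>i=1..m \<omega>. ?x i \<omega> * cnj (?y i \<omega>))) \<partial>\<mu>)"
      using core_norm(1)[OF m Z] core_norm(1)[OF m X] core_norm(1)[OF m Y] core_product_integrable[OF m X Y]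
      by (intro integral_cong_AE borel_measurable_integrable Bochner_Integration.integrable_add integrable_mult_right integrable_Re) auto
    also have "\<dots> = (\<integral>\<omega>. (\<Sum>i=1..m \<omega>. (norm (?x i \<omega>))\<^sup>2) \<partial>\<mu>) + (norm a)\<^sup>2 * (\<integral>\<omega>. (\<Sum>i=1..m \<omega>. (norm (?y i \<omega>))\<^sup>2) \<partial>\<mu>)
        + 2 * Re (cnj a * ?B)"
      by (rule lin[OF core_norm(1)[OF m X] core_norm(1)[OF m Y] core_product_integrable[OF m X Y]])
    finally show ?thesis
      using C.norm_combination[OF X Y, of a] by (simp add: core_norm(2)[OF m] X Y Z)
  qed
  from this[of 1] this[of \<i>] show ?thesis by (simp add: complex_eq_iff)
qed

lemma core_inner_char:
  assumes m: "measurable_mult m" and X: "X \<in> hcarrier (core m)" and Y: "Y \<in> hcarrier (core m)"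
  shows "hinner (core m) (chr m \<gamma> X) Y
    = (\<integral>\<omega>. \<omega> \<gamma> * (\<Sum>i=1..m \<omega>. l2_rep (X i) \<omega> * cnj (l2_rep (Y i) \<omega>)) \<partial>\<mu>)"
proof -
  have c: "chr m \<gamma> X \<in> hcarrier (core m)"
    using X unfolding core_space_def by (intro mult_char_closed borel_part_level m)
  have "AE \<omega> in \<mu>. \<forall>i\<ge>1. \<omega> \<in> level m i \<longrightarrow> l2_rep (chr m \<gamma> X i) \<omega> = \<omega> \<gamma> * l2_rep (X i) \<omega>"
    unfolding mult_char_eq
    by (rule core_rep_vec[OF m]) (use core_rep_measurable[OF m X] measurable_eval_haar in auto)
  then have "AE \<omega> in \<mu>. (\<Sum>i=1..m \<omega>. l2_rep (chr m \<gamma> X i) \<omega> * cnj (l2_rep (Y i) \<omega>))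
      = \<omega> \<gamma> * (\<Sum>i=1..m \<omega>. l2_rep (X i) \<omega> * cnj (l2_rep (Y i) \<omega>))"
    using AE_space
  proof eventually_elim
    fix \<omega> assume e: "\<forall>i\<ge>1. \<omega> \<in> level m i \<longrightarrow> l2_rep (chr m \<gamma> X i) \<omega> = \<omega> \<gamma> * l2_rep (X i) \<omega>" and \<omega>: "\<omega> \<in> space \<mu>"
    show "(\<Sum>i=1..m \<omega>. l2_rep (chr m \<gamma> X i) \<omega> * cnj (l2_rep (Y i) \<omega>))
      = \<omega> \<gamma> * (\<Sum>i=1..m \<omega>. l2_rep (X i) \<omega> * cnj (l2_rep (Y i) \<omega>))"
      unfolding sum_distrib_left using e \<omega> by (intro sum.cong) (auto simp: level_def)
  qed
  then show ?thesis
    unfolding core_inner[OF m c Y]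
    by (intro integral_cong_AE borel_measurable_times measurable_eval_haar
        borel_measurable_integrable[OF core_product_integrable[OF m c Y]]
        borel_measurable_integrable[OF core_product_integrable[OF m X Y]])
qed

text \<open>A unitary which commutes with the characters preserves the inner products in almost every
  fibre, because all Fourier coefficients of the difference of the two sides vanish.\<close>

lemma pointwise_isometry:
  assumes m: "measurable_mult m" and m': "measurable_mult m'"
    and U: "unitary (core m) (core m') U"
    and chr: "\<forall>\<gamma>. \<forall>X\<in>hcarrier (core m). U (chr m \<gamma> X) = chr m' \<gamma> (U X)"
    and X: "X \<in> hcarrier (core m)" and Y: "Y \<in> hcarrier (core m)"
  shows "AE \<omega> in \<mu>. (\<Sum>i=1..m' \<omega>. l2_rep (U X i) \<omega> * cnj (l2_rep (U Y i) \<omega>))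
    = (\<Sum>i=1..m \<omega>. l2_rep (X i) \<omega> * cnj (l2_rep (Y i) \<omega>))"
proof -
  let ?F = "\<lambda>\<omega>. \<Sum>i=1..m' \<omega>. l2_rep (U X i) \<omega> * cnj (l2_rep (U Y i) \<omega>)"
  let ?G = "\<lambda>\<omega>. \<Sum>i=1..m \<omega>. l2_rep (X i) \<omega> * cnj (l2_rep (Y i) \<omega>)"
  note UX = unitaryD(1)[OF U X] and UY = unitaryD(1)[OF U Y]
  have F: "integrable \<mu> ?F" and G: "integrable \<mu> ?G"
    by (rule core_product_integrable[OF m' UX UY] core_product_integrable[OF m X Y])+
  have e: "integrable \<mu> (\<lambda>\<omega>. \<omega> \<gamma> * f \<omega>)" if "integrable \<mu> f" for f and \<gamma> :: 'g
    by (rule integrable_continuous_mult[OF that])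
       (intro continuous_on_subset[OF continuous_on_product_coordinates]; simp)
  have "AE \<omega> in \<mu>. ?F \<omega> - ?G \<omega> = 0"
  proof (rule fourier_unique)
    fix \<gamma>
    have c: "chr m \<gamma> X \<in> hcarrier (core m)"
      using X unfolding core_space_def by (intro mult_char_closed borel_part_level m)
    have "(\<integral>\<omega>. \<omega> \<gamma> * (?F \<omega> - ?G \<omega>) \<partial>\<mu>) = (\<integral>\<omega>. \<omega> \<gamma> * ?F \<omega> \<partial>\<mu>) - (\<integral>\<omega>. \<omega> \<gamma> * ?G \<omega> \<partial>\<mu>)"
      using e[OF F] e[OF G] by (simp add: right_diff_distrib)
    also have "\<dots> = hinner (core m') (chr m' \<gamma> (U X)) (U Y) - hinner (core m) (chr m \<gamma> X) Y"
      by (simp only: core_inner_char[OF m' UX UY] core_inner_char[OF m X Y])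
    also have "\<dots> = 0"
      unfolding chr[rule_format, OF X, symmetric] unitaryD(5)[OF U c Y] by simp
    finally show "(\<integral>\<omega>. \<omega> \<gamma> * (?F \<omega> - ?G \<omega>) \<partial>\<mu>) = 0" .
  qed (use F G in auto)
  then show ?thesis by (rule AE_mp) (auto intro!: AE_I2)
qed

text \<open>Restricted to the levels of \<open>m\<close>, these are the standard unit vectors in almost every fibre.\<close>

definition unit_vec :: "(('g \<Rightarrow> complex) \<Rightarrow> nat) \<Rightarrow> nat \<Rightarrow> nat \<Rightarrow> (('g \<Rightarrow> complex) \<Rightarrow> complex) set" where
  "unit_vec m i = core_vec m (\<lambda>k \<omega>. if k = i then 1 else 0)"

lemma unit_vec_mem:
  assumes m: "measurable_mult m" and "i \<ge> 1"
  shows "unit_vec m i \<in> hcarrier (core m)"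
  unfolding unit_vec_def core_space_def
proof (rule l2_vec_mem(1))
  have "core_sq m (\<lambda>k \<omega>. if k = i then 1 else 0)
      = (\<integral>\<^sup>+\<omega>. ennreal (\<Sum>k=1..m \<omega>. (norm (if k = i then 1 else 0 :: complex))\<^sup>2) \<partial>\<mu>)"
    by (rule fsq_core[OF m]) simp
  also have "\<dots> \<le> (\<integral>\<^sup>+\<omega>. 1 \<partial>\<mu>)"
  proof (rule nn_integral_mono)
    fix \<omega>
    have "(\<Sum>k=1..m \<omega>. (norm (if k = i then 1 else 0 :: complex))\<^sup>2) = (\<Sum>k=1..m \<omega>. if k = i then 1 else 0)"
      by (intro sum.cong) auto
    also have "\<dots> \<le> 1" by simp
    finally show "ennreal (\<Sum>k=1..m \<omega>. (norm (if k = i then 1 else 0 :: complex))\<^sup>2) \<le> 1" by simp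
  qed
  also have "\<dots> < \<infinity>" by (simp add: emeasure_haar_space)
  finally show "core_fam m (\<lambda>k \<omega>. if k = i then 1 else 0)"
    by (simp add: l2_fam_def)
qed

lemma unit_vec_rep:
  assumes m: "measurable_mult m"
  shows "AE \<omega> in \<mu>. \<forall>i\<ge>1. \<forall>k\<ge>1. \<omega> \<in> level m k \<longrightarrow> l2_rep (unit_vec m i k) \<omega> = (if k = i then 1 else 0)"
proof -
  have "AE \<omega> in \<mu>. \<forall>k\<ge>1. \<omega> \<in> level m k \<longrightarrow> l2_rep (unit_vec m i k) \<omega> = (if k = i then 1 else 0)" for i
    unfolding unit_vec_def by (rule core_rep_vec[OF m]) simp
  then show ?thesis by (simp add: AE_all_countable)
qed

definition matrix_of :: "((nat \<Rightarrow> (('g \<Rightarrow> complex) \<Rightarrow> complex) set) \<Rightarrow> nat \<Rightarrow> (('g \<Rightarrow> complex) \<Rightarrow> complex) set) \<Rightarrow>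
    (('g \<Rightarrow> complex) \<Rightarrow> nat) \<Rightarrow> nat \<Rightarrow> nat \<Rightarrow> ('g \<Rightarrow> complex) \<Rightarrow> complex" where
  "matrix_of U m j i = l2_rep (U (unit_vec m i) j)"

lemma matrix_of_measurable:
  assumes m: "measurable_mult m" and m': "measurable_mult m'"
    and U: "unitary (core m) (core m') U" and "i \<ge> 1" "j \<ge> 1"
  shows "matrix_of U m j i \<in> borel_measurable \<mu>"
  unfolding matrix_of_def
  by (intro core_rep_measurable[OF m'] unitaryD(1)[OF U] unit_vec_mem[OF m] assms)

lemma matrix_of_off:
  assumes m: "measurable_mult m" and m': "measurable_mult m'"
    and U: "unitary (core m) (core m') U" and "i \<ge> 1" "j \<ge> 1" "\<omega> \<notin> level m' j"
  shows "matrix_of U m j i \<omega> = 0"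
  unfolding matrix_of_def
  by (intro core_rep_off[OF m'] unitaryD(1)[OF U] unit_vec_mem[OF m] assms)

lemma matrix_of_orthonormal:
  assumes m: "measurable_mult m" and m': "measurable_mult m'"
    and U: "unitary (core m) (core m') U"
    and chr: "\<forall>\<gamma>. \<forall>X\<in>hcarrier (core m). U (chr m \<gamma> X) = chr m' \<gamma> (U X)"
  shows "AE \<omega> in \<mu>. \<forall>i\<ge>1. \<forall>k\<ge>1. (\<Sum>j=1..m' \<omega>. matrix_of U m j i \<omega> * cnj (matrix_of U m j k \<omega>))
    = (if i = k \<and> i \<le> m \<omega> then 1 else 0)"
proof -
  have "AE \<omega> in \<mu>. (\<Sum>j=1..m' \<omega>. matrix_of U m j i \<omega> * cnj (matrix_of U m j k \<omega>))
    = (if i = k \<and> i \<le> m \<omega> then 1 else 0)" if i: "i \<ge> 1" and k: "k \<ge> 1" for i k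
    using pointwise_isometry[OF m m' U chr unit_vec_mem[OF m i] unit_vec_mem[OF m k]] unit_vec_rep[OF m] AE_space
  proof eventually_elim
    fix \<omega>
    assume e: "(\<Sum>j=1..m' \<omega>. l2_rep (U (unit_vec m i) j) \<omega> * cnj (l2_rep (U (unit_vec m k) j) \<omega>))
        = (\<Sum>j=1..m \<omega>. l2_rep (unit_vec m i j) \<omega> * cnj (l2_rep (unit_vec m k j) \<omega>))"
      and u: "\<forall>i\<ge>1. \<forall>k\<ge>1. \<omega> \<in> level m k \<longrightarrow> l2_rep (unit_vec m i k) \<omega> = (if k = i then 1 else 0)"
      and \<omega>: "\<omega> \<in> space \<mu>"
    have "(\<Sum>j=1..m \<omega>. l2_rep (unit_vec m i j) \<omega> * cnj (l2_rep (unit_vec m k j) \<omega>))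
       = (\<Sum>j=1..m \<omega>. if j = i then (if i = k then 1 else 0) else 0)"
      using u i k \<omega> by (intro sum.cong) (auto simp: level_def)
    then show "(\<Sum>j=1..m' \<omega>. matrix_of U m j i \<omega> * cnj (matrix_of U m j k \<omega>)) = (if i = k \<and> i \<le> m \<omega> then 1 else 0)"
      using e i by (simp add: matrix_of_def)
  qed
  then show ?thesis by (simp add: AE_all_countable)
qed

lemma inverse_chr:
  assumes m: "measurable_mult m"
    and U: "unitary (core m) (core m') U"
    and chr: "\<forall>\<gamma>. \<forall>X\<in>hcarrier (core m). U (chr m \<gamma> X) = chr m' \<gamma> (U X)"
  shows "\<forall>\<gamma>. \<forall>Y\<in>hcarrier (core m').
    inv_into (hcarrier (core m)) U (chr m' \<gamma> Y) = chr m \<gamma> (inv_into (hcarrier (core m)) U Y)"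
proof (intro allI ballI)
  fix \<gamma> Y assume Y: "Y \<in> hcarrier (core m')"
  let ?V = "inv_into (hcarrier (core m)) U"
  have v: "?V Y \<in> hcarrier (core m)" "U (?V Y) = Y"
    using unitary_inv(2,3)[OF U Y] by auto
  have "chr m \<gamma> (?V Y) \<in> hcarrier (core m)"
    using v(1) unfolding core_space_def by (intro mult_char_closed borel_part_level m)
  then have "?V (U (chr m \<gamma> (?V Y))) = chr m \<gamma> (?V Y)" by (rule unitary_inv(1)[OF U])
  then show "?V (chr m' \<gamma> Y) = chr m \<gamma> (?V Y)" using chr[rule_format, OF v(1)] v(2) by simp
qed

text \<open>Testing against the preimages of the unit vectors shows that the unitary acts as the matrix of
  its values on the unit vectors, and that the inverse has the adjoint matrix.\<close>

lemma unitary_acts_as_matrix: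
  assumes m: "measurable_mult m" and m': "measurable_mult m'"
    and U: "unitary (core m) (core m') U"
    and chr: "\<forall>\<gamma>. \<forall>X\<in>hcarrier (core m). U (chr m \<gamma> X) = chr m' \<gamma> (U X)"
  defines "V \<equiv> inv_into (hcarrier (core m)) U"
  shows "AE \<omega> in \<mu>. \<forall>i\<ge>1. \<forall>j\<ge>1. matrix_of U m j i \<omega> = cnj (matrix_of V m' i j \<omega>)"
    and "X \<in> hcarrier (core m) \<Longrightarrow>
      AE \<omega> in \<mu>. \<forall>j\<ge>1. l2_rep (U X j) \<omega> = (\<Sum>l=1..m \<omega>. matrix_of U m j l \<omega> * l2_rep (X l) \<omega>)"
proof -
  have C: "prehilbert (core m)" unfolding core_space_def by (rule prehilbert_l2_sum)
  have V: "unitary (core m') (core m) V"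
    unfolding V_def by (rule unitary_inv_into[OF C U])
  have key: "AE \<omega> in \<mu>. l2_rep (U X j) \<omega> = (\<Sum>l=1..m \<omega>. l2_rep (X l) \<omega> * cnj (matrix_of V m' l j \<omega>))"
    if X: "X \<in> hcarrier (core m)" and j: "j \<ge> 1" for X j
  proof -
    note e = unit_vec_mem[OF m' j]
    have UV: "U (V (unit_vec m' j)) = unit_vec m' j" unfolding V_def by (rule unitary_inv(2)[OF U e])
    show ?thesis
      using pointwise_isometry[OF m m' U chr X unitaryD(1)[OF V e], unfolded UV] unit_vec_rep[OF m'] AE_space
    proof eventually_elim
      fix \<omega>
      assume p: "(\<Sum>i=1..m' \<omega>. l2_rep (U X i) \<omega> * cnj (l2_rep (unit_vec m' j i) \<omega>))
          = (\<Sum>i=1..m \<omega>. l2_rep (X i) \<omega> * cnj (l2_rep (V (unit_vec m' j) i) \<omega>))"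
        and u: "\<forall>i\<ge>1. \<forall>k\<ge>1. \<omega> \<in> level m' k \<longrightarrow> l2_rep (unit_vec m' i k) \<omega> = (if k = i then 1 else 0)"
        and \<omega>: "\<omega> \<in> space \<mu>"
      have "(\<Sum>i=1..m' \<omega>. l2_rep (U X i) \<omega> * cnj (l2_rep (unit_vec m' j i) \<omega>))
          = (\<Sum>i=1..m' \<omega>. if i = j then l2_rep (U X j) \<omega> else 0)"
        using u j \<omega> by (intro sum.cong) (auto simp: level_def)
      also have "\<dots> = l2_rep (U X j) \<omega>"
        using j \<omega> core_rep_off[OF m' unitaryD(1)[OF U X] j, of \<omega>] by (auto simp: level_def)
      finally show "l2_rep (U X j) \<omega> = (\<Sum>l=1..m \<omega>. l2_rep (X l) \<omega> * cnj (matrix_of V m' l j \<omega>))"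
        using p by (simp add: matrix_of_def)
    qed
  qed
  have adj: "AE \<omega> in \<mu>. matrix_of U m j i \<omega> = cnj (matrix_of V m' i j \<omega>)" if i: "i \<ge> 1" and j: "j \<ge> 1" for i j
    using key[OF unit_vec_mem[OF m i] j] unit_vec_rep[OF m] AE_space
  proof eventually_elim
    fix \<omega>
    assume k: "l2_rep (U (unit_vec m i) j) \<omega> = (\<Sum>l=1..m \<omega>. l2_rep (unit_vec m i l) \<omega> * cnj (matrix_of V m' l j \<omega>))"
      and u: "\<forall>i\<ge>1. \<forall>k\<ge>1. \<omega> \<in> level m k \<longrightarrow> l2_rep (unit_vec m i k) \<omega> = (if k = i then 1 else 0)"
      and \<omega>: "\<omega> \<in> space \<mu>"
    have "(\<Sum>l=1..m \<omega>. l2_rep (unit_vec m i l) \<omega> * cnj (matrix_of V m' l j \<omega>))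
        = (\<Sum>l=1..m \<omega>. if l = i then cnj (matrix_of V m' i j \<omega>) else 0)"
      using u i \<omega> by (intro sum.cong) (auto simp: level_def)
    also have "\<dots> = cnj (matrix_of V m' i j \<omega>)"
      using i j \<omega> matrix_of_off[OF m' m V j i, of \<omega>] by (auto simp: level_def)
    finally show "matrix_of U m j i \<omega> = cnj (matrix_of V m' i j \<omega>)"
      using k by (simp add: matrix_of_def)
  qed
  then show adj': "AE \<omega> in \<mu>. \<forall>i\<ge>1. \<forall>j\<ge>1. matrix_of U m j i \<omega> = cnj (matrix_of V m' i j \<omega>)"
    by (simp add: AE_all_countable)
  show "AE \<omega> in \<mu>. \<forall>j\<ge>1. l2_rep (U X j) \<omega> = (\<Sum>l=1..m \<omega>. matrix_of U m j l \<omega> * l2_rep (X l) \<omega>)"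
    if X: "X \<in> hcarrier (core m)"
  proof -
    have "AE \<omega> in \<mu>. \<forall>j\<ge>1. l2_rep (U X j) \<omega> = (\<Sum>l=1..m \<omega>. l2_rep (X l) \<omega> * cnj (matrix_of V m' l j \<omega>))"
      using key[OF X] by (simp add: AE_all_countable)
    from this adj' show ?thesis
    proof eventually_elim
      fix \<omega>
      assume k: "\<forall>j\<ge>1. l2_rep (U X j) \<omega> = (\<Sum>l=1..m \<omega>. l2_rep (X l) \<omega> * cnj (matrix_of V m' l j \<omega>))"
        and a: "\<forall>i\<ge>1. \<forall>j\<ge>1. matrix_of U m j i \<omega> = cnj (matrix_of V m' i j \<omega>)"
      show "\<forall>j\<ge>1. l2_rep (U X j) \<omega> = (\<Sum>l=1..m \<omega>. matrix_of U m j l \<omega> * l2_rep (X l) \<omega>)"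
        using k a by (auto intro!: sum.cong simp: mult.commute)
    qed
  qed
qed

text \<open>The squared Frobenius norm of the matrix is at once the number of its orthonormal columns and
  that of its orthonormal rows, so the two multiplicities agree.\<close>

lemma matrix_of_unitary_corner:
  assumes m: "measurable_mult m" and m': "measurable_mult m'"
    and U: "unitary (core m) (core m') U"
    and chr: "\<forall>\<gamma>. \<forall>X\<in>hcarrier (core m). U (chr m \<gamma> X) = chr m' \<gamma> (U X)"
  shows "AE \<omega> in \<mu>. m \<omega> = m' \<omega> \<and> unitary_corner (m \<omega>) (\<lambda>i j. matrix_of U m i j \<omega>)"
proof -
  let ?V = "inv_into (hcarrier (core m)) U"
  have C: "prehilbert (core m)" unfolding core_space_def by (rule prehilbert_l2_sum)
  have V: "unitary (core m') (core m) ?V" by (rule unitary_inv_into[OF C U])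
  note chrV = inverse_chr[OF m U chr]
  from matrix_of_orthonormal[OF m m' U chr] matrix_of_orthonormal[OF m' m V chrV]
    unitary_acts_as_matrix(1)[OF m m' U chr] AE_space
  show ?thesis
  proof eventually_elim
    fix \<omega>
    let ?A = "\<lambda>i j. matrix_of U m i j \<omega>"
    assume cols: "\<forall>i\<ge>1. \<forall>k\<ge>1. (\<Sum>j=1..m' \<omega>. ?A j i * cnj (?A j k)) = (if i = k \<and> i \<le> m \<omega> then 1 else 0)"
      and rows: "\<forall>i\<ge>1. \<forall>k\<ge>1. (\<Sum>j=1..m \<omega>. matrix_of ?V m' j i \<omega> * cnj (matrix_of ?V m' j k \<omega>))
        = (if i = k \<and> i \<le> m' \<omega> then 1 else 0)"
      and adj: "\<forall>i\<ge>1. \<forall>j\<ge>1. ?A j i = cnj (matrix_of ?V m' i j \<omega>)" and \<omega>: "\<omega> \<in> space \<mu>"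
    have rows': "(\<Sum>j=1..m \<omega>. ?A k j * cnj (?A i j)) = (if i = k \<and> i \<le> m' \<omega> then 1 else 0)"
      if "i \<ge> 1" "k \<ge> 1" for i k
    proof -
      have "(\<Sum>j=1..m \<omega>. ?A k j * cnj (?A i j)) = (\<Sum>j=1..m \<omega>. matrix_of ?V m' j i \<omega> * cnj (matrix_of ?V m' j k \<omega>))"
        using adj that by (intro sum.cong) (auto simp: mult.commute)
      then show ?thesis using rows that by simp
    qed
    have off: "?A j i = 0" if "i \<ge> 1" "j \<ge> 1" "m \<omega> < i \<or> m' \<omega> < j" for i j
      using that adj matrix_of_off[OF m m' U, of i j \<omega>] matrix_of_off[OF m' m V, of j i \<omega>]
      by (auto simp: level_def)
    have "of_nat (m \<omega>) = (\<Sum>i=1..m \<omega>. \<Sum>j=1..m' \<omega>. ?A j i * cnj (?A j i))"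
      using cols by simp
    also have "\<dots> = (\<Sum>j=1..m' \<omega>. \<Sum>i=1..m \<omega>. ?A j i * cnj (?A j i))" by (rule sum.swap)
    also have "\<dots> = of_nat (m' \<omega>)" using rows' by simp
    finally have eq: "m \<omega> = m' \<omega>" by simp
    have "(\<Sum>j=1..m \<omega>. cnj (?A j i) * ?A j k) = (if i = k then 1 else 0)"
      if "i \<in> {1..m \<omega>}" "k \<in> {1..m \<omega>}" for i k
      using cols[rule_format, of k i] that eq by (simp add: mult.commute) 
    moreover have "(\<Sum>j=1..m \<omega>. ?A i j * cnj (?A k j)) = (if i = k then 1 else 0)"
      if "i \<in> {1..m \<omega>}" "k \<in> {1..m \<omega>}" for i k
      using rows'[of k i] that eq by auto
    ultimately show "m \<omega> = m' \<omega> \<and> unitary_corner (m \<omega>) ?A"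
      unfolding unitary_corner_def using eq off by auto
  qed
qed

end

section \<open>Classification of canonical analyses\<close>

text \<open>For an index beyond the multiplicity the filter equation says that the row has length zero.\<close>

lemma (in filter_setting) filter_vanishes:
  "AE \<omega> in \<mu>. \<forall>i\<ge>1. \<forall>j\<ge>1. m (p \<omega>) < i \<or> m \<omega> < j \<longrightarrow> H i j \<omega> = 0"
  using AE_endo[OF AE_filter_identities] AE_space
proof eventually_elim
  fix \<omega> assume g: "filter_identities (p \<omega>)" and \<omega>: "\<omega> \<in> space \<mu>"
  have mem: "\<omega> \<in> fibre \<alpha> (p \<omega>)" using \<omega> by (simp add: mem_fibre_iff)
  have d: "p \<omega> \<in> dual_group" using g by (simp add: filter_identities_def)
  have supp: "H i j \<omega> = 0" if "i \<ge> 1" "j \<ge> 1" "m \<omega> < j" for i j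
    using g mem that unfolding filter_identities_def by blast
  have "H i j \<omega> = 0" if i: "i \<ge> 1" and j: "j \<ge> 1" and big: "m (p \<omega>) < i" for i j
  proof (cases "m \<omega> < j")
    case False
    have "(\<Sum>\<zeta>\<in>fibre \<alpha> (p \<omega>). \<Sum>j=1..m \<zeta>. H i j \<zeta> * cnj (H i j \<zeta>))
        = (if i = i \<and> i \<le> m (p \<omega>) then of_nat N else 0)"
      using g i unfolding filter_identities_def by blast
    then have "complex_of_real (\<Sum>\<zeta>\<in>fibre \<alpha> (p \<omega>). \<Sum>j=1..m \<zeta>. (norm (H i j \<zeta>))\<^sup>2) = 0"
      using big by (simp only: of_real_sum complex_norm_square) simp
    then have "(\<Sum>\<zeta>\<in>fibre \<alpha> (p \<omega>). \<Sum>j=1..m \<zeta>. (norm (H i j \<zeta>))\<^sup>2) = 0"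
      by (simp only: of_real_eq_0_iff)
    then have "(\<Sum>j=1..m \<omega>. (norm (H i j \<omega>))\<^sup>2) = 0"
      using finite_fibre[OF d] mem by (simp add: sum_nonneg_eq_0_iff sum_nonneg)
    then show ?thesis
      using False j by (simp add: sum_nonneg_eq_0_iff)
  qed (use supp i j in simp)
  then show "\<forall>i\<ge>1. \<forall>j\<ge>1. m (p \<omega>) < i \<or> m \<omega> < j \<longrightarrow> H i j \<omega> = 0" using supp by blast
qed

lemma canonical_equivalent_iff:
  assumes A: "filter_setting \<alpha> \<mu> c m H G" and B: "filter_setting \<alpha> \<mu> c m' H' G'"
  shows "gmra_equivalent (canonical_gmra \<alpha> c \<mu> m H G) (canonical_gmra \<alpha> c \<mu> m' H' G') \<longleftrightarrow>
    (\<exists>U. unitary (core_space \<mu> m) (core_space \<mu> m') U \<and>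
      (\<forall>X\<in>hcarrier (core_space \<mu> m). U (ruelle \<alpha> \<mu> m H X) = ruelle \<alpha> \<mu> m' H' (U X)) \<and>
      (\<forall>\<gamma>. \<forall>X\<in>hcarrier (core_space \<mu> m).
        U (mult_char {1..} (level_measure \<mu> m) \<gamma> X) = mult_char {1..} (level_measure \<mu> m') \<gamma> (U X)))"
proof -
  interpret A: filter_setting \<alpha> \<mu> c m H G by fact
  interpret B: filter_setting \<alpha> \<mu> c m' H' G' by fact
  have step: "(\<forall>X\<in>hcarrier (core_space \<mu> m). U (A.step (X, hzero (A.WS 0))) = B.step (U X, hzero (B.WS 0))) \<longleftrightarrow>
      (\<forall>X\<in>hcarrier (core_space \<mu> m). U (ruelle \<alpha> \<mu> m H X) = ruelle \<alpha> \<mu> m' H' (U X))"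
    if U: "unitary (core_space \<mu> m) (core_space \<mu> m') U" for U
    using A.step_zero B.step_zero[OF unitaryD(1)[OF U]] by simp
  show ?thesis
    unfolding A.canonical_gmra_eq B.canonical_gmra_eq
      ladder_equivalence[OF A.ladder.ladder_axioms B.ladder.ladder_axioms]
    by (intro ex_cong1) (use step in blast)
qed

text \<open>Both sides of the matrix equation are the components of the image of the \<open>i\<close>-th unit vector under
  $U S_H = S_{H'} U$. The cut-off of that vector at the multiplicity is invisible because the rows of
  the filter vanish there.\<close>

lemma matrix_from_unitary:
  assumes A: "filter_setting \<alpha> \<mu> c m H G" and B: "filter_setting \<alpha> \<mu> c m' H' G'"
    and U: "unitary (core_space \<mu> m) (core_space \<mu> m') U"
    and S: "\<forall>X\<in>hcarrier (core_space \<mu> m). U (ruelle \<alpha> \<mu> m H X) = ruelle \<alpha> \<mu> m' H' (U X)"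
    and chr: "\<forall>\<gamma>. \<forall>X\<in>hcarrier (core_space \<mu> m).
        U (mult_char {1..} (level_measure \<mu> m) \<gamma> X) = mult_char {1..} (level_measure \<mu> m') \<gamma> (U X)"
  shows "(AE \<omega> in \<mu>. m \<omega> = m' \<omega>) \<and>
    (\<exists>A :: nat \<Rightarrow> nat \<Rightarrow> ('g::{ab_group_add,countable} \<Rightarrow> complex) \<Rightarrow> complex.
       (\<forall>i\<ge>1. \<forall>j\<ge>1. A i j \<in> borel_measurable \<mu>) \<and>
       (AE \<omega> in \<mu>.
          unitary_corner (m \<omega>) (\<lambda>i j. A i j \<omega>) \<and>
          (\<forall>i\<ge>1. \<forall>j\<ge>1.
             (\<Sum>\<^sub>\<infinity>l\<in>{1..}. H i l \<omega> * A j l \<omega>) =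
             (\<Sum>\<^sub>\<infinity>l\<in>{1..}. A l i (dual_endo \<alpha> \<omega>) * H' l j \<omega>))))"
proof -
  interpret A: filter_setting \<alpha> \<mu> c m H G by fact
  interpret B: filter_setting \<alpha> \<mu> c m' H' G' by fact
  note m = A.m_measurable and m' = B.m_measurable
  let ?A = "A.matrix_of U m" and ?e = "A.unit_vec m"
  let ?S = "ruelle \<alpha> \<mu> m H" and ?S' = "ruelle \<alpha> \<mu> m' H'"
  have corner: "AE \<omega> in \<mu>. m \<omega> = m' \<omega> \<and> unitary_corner (m \<omega>) (\<lambda>i j. ?A i j \<omega>)"
    by (rule A.matrix_of_unitary_corner[OF m m' U chr])
  have Se: "?S (?e i) \<in> hcarrier (core_space \<mu> m)" if "i \<ge> 1" for i
    using A.H_operator A.unit_vec_mem[OF m that] by (auto simp: isometry_def linear_map_def)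
  have Ue: "U (?e i) \<in> hcarrier (core_space \<mu> m')" if "i \<ge> 1" for i
    by (rule unitaryD(1)[OF U A.unit_vec_mem[OF m that]])
  have US: "AE \<omega> in \<mu>. \<forall>i\<ge>1. \<forall>j\<ge>1. l2_rep (U (?S (?e i)) j) \<omega> = (\<Sum>l=1..m \<omega>. ?A j l \<omega> * l2_rep (?S (?e i) l) \<omega>)"
    using A.unitary_acts_as_matrix(2)[OF m m' U chr Se] by (simp add: AE_all_countable)
  have SU: "AE \<omega> in \<mu>. \<forall>i\<ge>1. \<forall>j\<ge>1. \<omega> \<in> level m' j \<longrightarrow>
      l2_rep (U (?S (?e i)) j) \<omega> = (\<Sum>l=1..m' (A.p \<omega>). H' l j \<omega> * ?A l i (A.p \<omega>))"
  proof -
    have "AE \<omega> in \<mu>. \<forall>j\<ge>1. \<omega> \<in> level m' j \<longrightarrow>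
      l2_rep (U (?S (?e i)) j) \<omega> = (\<Sum>l=1..m' (A.p \<omega>). H' l j \<omega> * ?A l i (A.p \<omega>))" if i: "i \<ge> 1" for i
    proof -
      have "U (?S (?e i)) = l2_vec {1..} (level_measure \<mu> m') (A.ruelle_fun m' H' (l2_reps (U (?e i))))"
        using S A.unit_vec_mem[OF m i] A.ruelle_eq[OF m' m' Ue[OF i], of H'] by simp
      moreover have "A.ruelle_fun m' H' (l2_reps (U (?e i))) j \<in> borel_measurable \<mu>" if "j \<ge> 1" for j
        using B.H_measurable that A.core_rep_measurable[OF m' Ue[OF i]]
        by (intro A.ruelle_fun_measurable[OF m']) (auto intro: A.measurable_level_measure)
      ultimately show ?thesis
        using A.core_rep_vec[OF m', of "A.ruelle_fun m' H' (l2_reps (U (?e i)))"]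
        by (simp add: A.ruelle_fun_def A.matrix_of_def)
    qed
    then show ?thesis by (simp add: AE_all_countable)
  qed
  have Srep: "AE \<omega> in \<mu>. \<forall>i\<ge>1. \<forall>l\<ge>1. \<omega> \<in> level m l \<longrightarrow>
      l2_rep (?S (?e i) l) \<omega> = (\<Sum>k=1..m (A.p \<omega>). H k l \<omega> * l2_rep (?e i k) (A.p \<omega>))"
  proof -
    have "AE \<omega> in \<mu>. \<forall>l\<ge>1. \<omega> \<in> level m l \<longrightarrow>
      l2_rep (?S (?e i) l) \<omega> = (\<Sum>k=1..m (A.p \<omega>). H k l \<omega> * l2_rep (?e i k) (A.p \<omega>))" if i: "i \<ge> 1" for i
    proof -
      note e = A.unit_vec_mem[OF m i]
      have "A.ruelle_fun m H (l2_reps (?e i)) j \<in> borel_measurable \<mu>" if "j \<ge> 1" for j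
        using A.H_measurable that A.core_rep_measurable[OF m e]
        by (intro A.ruelle_fun_measurable[OF m]) (auto intro: A.measurable_level_measure)
      then show ?thesis
        unfolding A.ruelle_eq[OF m m e]
        using A.core_rep_vec[OF m, of "A.ruelle_fun m H (l2_reps (?e i))"]
        by (simp add: A.ruelle_fun_def)
    qed
    then show ?thesis by (simp add: AE_all_countable)
  qed
  have "AE \<omega> in \<mu>. unitary_corner (m \<omega>) (\<lambda>i j. ?A i j \<omega>) \<and>
      (\<forall>i\<ge>1. \<forall>j\<ge>1. (\<Sum>\<^sub>\<infinity>l\<in>{1..}. H i l \<omega> * ?A j l \<omega>) = (\<Sum>\<^sub>\<infinity>l\<in>{1..}. ?A l i (A.p \<omega>) * H' l j \<omega>))"
    using corner US SU Srep A.AE_endo[OF A.unit_vec_rep[OF m]] A.filter_vanishes B.filter_vanishes AE_space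
  proof eventually_elim
    fix \<omega>
    assume c: "m \<omega> = m' \<omega> \<and> unitary_corner (m \<omega>) (\<lambda>i j. ?A i j \<omega>)"
      and US: "\<forall>i\<ge>1. \<forall>j\<ge>1. l2_rep (U (?S (?e i)) j) \<omega> = (\<Sum>l=1..m \<omega>. ?A j l \<omega> * l2_rep (?S (?e i) l) \<omega>)"
      and SU: "\<forall>i\<ge>1. \<forall>j\<ge>1. \<omega> \<in> level m' j \<longrightarrow>
        l2_rep (U (?S (?e i)) j) \<omega> = (\<Sum>l=1..m' (A.p \<omega>). H' l j \<omega> * ?A l i (A.p \<omega>))"
      and Srep: "\<forall>i\<ge>1. \<forall>l\<ge>1. \<omega> \<in> level m l \<longrightarrow>
        l2_rep (?S (?e i) l) \<omega> = (\<Sum>k=1..m (A.p \<omega>). H k l \<omega> * l2_rep (?e i k) (A.p \<omega>))"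
      and e: "\<forall>i\<ge>1. \<forall>k\<ge>1. A.p \<omega> \<in> level m k \<longrightarrow> l2_rep (?e i k) (A.p \<omega>) = (if k = i then 1 else 0)"
      and van: "\<forall>i\<ge>1. \<forall>j\<ge>1. m (A.p \<omega>) < i \<or> m \<omega> < j \<longrightarrow> H i j \<omega> = 0"
      and van': "\<forall>i\<ge>1. \<forall>j\<ge>1. m' (A.p \<omega>) < i \<or> m' \<omega> < j \<longrightarrow> H' i j \<omega> = 0"
      and \<omega>: "\<omega> \<in> space \<mu>"
    have p\<omega>: "A.p \<omega> \<in> dual_group" using \<omega> by (simp add: A.endo_dual)
    have off: "?A i j \<omega> = 0" if "i \<ge> 1" "j \<ge> 1" "m \<omega> < i \<or> m \<omega> < j" for i j
      using c that unfolding unitary_corner_def by blast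
    have "(\<Sum>\<^sub>\<infinity>l\<in>{1..}. H i l \<omega> * ?A j l \<omega>) = (\<Sum>\<^sub>\<infinity>l\<in>{1..}. ?A l i (A.p \<omega>) * H' l j \<omega>)"
      if i: "i \<ge> 1" and j: "j \<ge> 1" for i j
    proof -
      have L: "(\<Sum>\<^sub>\<infinity>l\<in>{1..}. H i l \<omega> * ?A j l \<omega>) = (\<Sum>l=1..m \<omega>. H i l \<omega> * ?A j l \<omega>)"
        using off[OF j] by (subst infsum_cong_neutral[where T = "{1..m \<omega>}"]) auto
      have R: "(\<Sum>\<^sub>\<infinity>l\<in>{1..}. ?A l i (A.p \<omega>) * H' l j \<omega>) = (\<Sum>l=1..m' (A.p \<omega>). H' l j \<omega> * ?A l i (A.p \<omega>))"
        using A.matrix_of_off[OF m m' U i, of _ "A.p \<omega>"] 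
        by (subst infsum_cong_neutral[where T = "{1..m' (A.p \<omega>)}"]) (auto simp: level_def mult.commute)
      show ?thesis
      proof (cases "j \<le> m' \<omega>")
        case True
        have s: "l2_rep (?S (?e i) l) \<omega> = H i l \<omega>" if l: "l \<in> {1..m \<omega>}" for l
        proof -
          have "l2_rep (?S (?e i) l) \<omega> = (\<Sum>k=1..m (A.p \<omega>). H k l \<omega> * l2_rep (?e i k) (A.p \<omega>))"
            using Srep i l \<omega> by (auto simp: level_def)
          also have "\<dots> = (\<Sum>k=1..m (A.p \<omega>). if k = i then H i l \<omega> else 0)"
            using e i p\<omega> by (intro sum.cong) (auto simp: level_def)
          also have "\<dots> = H i l \<omega>" using van i l by auto
          finally show ?thesis .
        qed
        have "(\<Sum>l=1..m \<omega>. H i l \<omega> * ?A j l \<omega>) = (\<Sum>l=1..m \<omega>. ?A j l \<omega> * l2_rep (?S (?e i) l) \<omega>)"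
          by (intro sum.cong) (auto simp: s)
        also have "\<dots> = l2_rep (U (?S (?e i)) j) \<omega>" using US i j by simp
        also have "\<dots> = (\<Sum>l=1..m' (A.p \<omega>). H' l j \<omega> * ?A l i (A.p \<omega>))"
          using SU i j True \<omega> by (auto simp: level_def)
        finally show ?thesis using L R by simp
      next
        case False
        then have "(\<Sum>l=1..m \<omega>. H i l \<omega> * ?A j l \<omega>) = 0"
          using off j c by (intro sum.neutral) auto
        moreover have "(\<Sum>l=1..m' (A.p \<omega>). H' l j \<omega> * ?A l i (A.p \<omega>)) = 0"
          using van' j False by (intro sum.neutral) auto
        ultimately show ?thesis using L R by simp
      qed
    qed
    then show "unitary_corner (m \<omega>) (\<lambda>i j. ?A i j \<omega>) \<and>
      (\<forall>i\<ge>1. \<forall>j\<ge>1. (\<Sum>\<^sub>\<infinity>l\<in>{1..}. H i l \<omega> * ?A j l \<omega>) = (\<Sum>\<^sub>\<infinity>l\<in>{1..}. ?A l i (A.p \<omega>) * H' l j \<omega>))"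
      using c by blast
  qed
  moreover have "AE \<omega> in \<mu>. m \<omega> = m' \<omega>" using corner by eventually_elim simp
  moreover have "\<forall>i\<ge>1. \<forall>j\<ge>1. ?A i j \<in> borel_measurable \<mu>"
    using A.matrix_of_measurable[OF m m' U] by blast
  ultimately show ?thesis by blast
qed

text \<open>The operator is pointwise multiplication by the matrix. It is onto because multiplication by the
  adjoint matrix is a right inverse, and it intertwines the Ruelle operators by the transpose of the
  matrix equation.\<close>

lemma unitary_from_matrix:
  fixes A :: "nat \<Rightarrow> nat \<Rightarrow> ('g::{ab_group_add,countable} \<Rightarrow> complex) \<Rightarrow> complex"
  assumes F1: "filter_setting \<alpha> \<mu> c m H G" and F2: "filter_setting \<alpha> \<mu> c m' H' G'"
    and mm: "AE \<omega> in \<mu>. m \<omega> = m' \<omega>"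
    and A: "\<forall>i\<ge>1. \<forall>j\<ge>1. A i j \<in> borel_measurable \<mu>"
    and AE: "AE \<omega> in \<mu>. unitary_corner (m \<omega>) (\<lambda>i j. A i j \<omega>) \<and>
          (\<forall>i\<ge>1. \<forall>j\<ge>1.
             (\<Sum>\<^sub>\<infinity>l\<in>{1..}. H i l \<omega> * A j l \<omega>) =
             (\<Sum>\<^sub>\<infinity>l\<in>{1..}. A l i (dual_endo \<alpha> \<omega>) * H' l j \<omega>))"
  shows "\<exists>U. unitary (core_space \<mu> m) (core_space \<mu> m') U \<and>
      (\<forall>X\<in>hcarrier (core_space \<mu> m). U (ruelle \<alpha> \<mu> m H X) = ruelle \<alpha> \<mu> m' H' (U X)) \<and>
      (\<forall>\<gamma>. \<forall>X\<in>hcarrier (core_space \<mu> m).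
        U (mult_char {1..} (level_measure \<mu> m) \<gamma> X) = mult_char {1..} (level_measure \<mu> m') \<gamma> (U X))"
proof -
  interpret A: filter_setting \<alpha> \<mu> c m H G by fact
  interpret B: filter_setting \<alpha> \<mu> c m' H' G' by fact
  note m = A.m_measurable and m' = B.m_measurable
  let ?L = "level_measure \<mu> m" and ?L' = "level_measure \<mu> m'"
  define \<Phi> where "\<Phi> F j \<omega> = (\<Sum>l=1..m \<omega>. A j l \<omega> * F l \<omega>)" for F :: "nat \<Rightarrow> ('g \<Rightarrow> complex) \<Rightarrow> complex" and j \<omega>
  define U where "U X = l2_vec {1..} ?L' (\<Phi> (l2_reps X))" for X
  have corner: "AE \<omega> in \<mu>. m \<omega> = m' \<omega> \<and> unitary_corner (m \<omega>) (\<lambda>i j. A i j \<omega>)"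
    using mm AE by eventually_elim simp
  have \<Phi>m: "\<Phi> F j \<in> borel_measurable \<mu>" if "\<And>i. i \<ge> 1 \<Longrightarrow> F i \<in> borel_measurable (?L i)" "j \<ge> 1" for F j
    unfolding \<Phi>_def[abs_def] by (rule A.measurable_cut_sum[OF m]) (use A that in auto)
  have \<Phi>n: "fsq {1..} ?L' (\<Phi> F) = fsq {1..} ?L F" if F: "\<And>i. i \<ge> 1 \<Longrightarrow> F i \<in> borel_measurable (?L i)" for F
  proof -
    have "fsq {1..} ?L' (\<Phi> F) = (\<integral>\<^sup>+\<omega>. ennreal (\<Sum>j=1..m' \<omega>. (norm (\<Phi> F j \<omega>))\<^sup>2) \<partial>\<mu>)"
      using \<Phi>m[OF F] by (intro A.fsq_core[OF m'] A.measurable_level_measure)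
    also have "\<dots> = (\<integral>\<^sup>+\<omega>. ennreal (\<Sum>i=1..m \<omega>. (norm (F i \<omega>))\<^sup>2) \<partial>\<mu>)"
    proof (rule nn_integral_cong_AE)
      show "AE \<omega> in \<mu>. ennreal (\<Sum>j=1..m' \<omega>. (norm (\<Phi> F j \<omega>))\<^sup>2) = ennreal (\<Sum>i=1..m \<omega>. (norm (F i \<omega>))\<^sup>2)"
        using corner
      proof eventually_elim
        fix \<omega> assume c: "m \<omega> = m' \<omega> \<and> unitary_corner (m \<omega>) (\<lambda>i j. A i j \<omega>)"
        have "(\<Sum>j=1..m \<omega>. A j i \<omega> * cnj (A j k \<omega>)) = (if i = k then of_real 1 else 0)"
          if "i \<in> {1..m \<omega>}" "k \<in> {1..m \<omega>}" for i k
        proof -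
          have "(\<Sum>j=1..m \<omega>. cnj (A j k \<omega>) * A j i \<omega>) = (if k = i then 1 else 0)"
            using c that unfolding unitary_corner_def by blast
          then show ?thesis by (simp add: mult.commute)
        qed
        from parseval[of "{1..m \<omega>}" "{1..m \<omega>}" "\<lambda>l j. A j l \<omega>" 1 "\<lambda>l. F l \<omega>", OF _ _ this]
        have "(\<Sum>j=1..m \<omega>. (norm (\<Phi> F j \<omega>))\<^sup>2) = (\<Sum>i=1..m \<omega>. (norm (F i \<omega>))\<^sup>2)"
          by (simp add: \<Phi>_def)
        then show "ennreal (\<Sum>j=1..m' \<omega>. (norm (\<Phi> F j \<omega>))\<^sup>2) = ennreal (\<Sum>i=1..m \<omega>. (norm (F i \<omega>))\<^sup>2)"
          using c by simp
      qed
    qed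
    also have "\<dots> = fsq {1..} ?L F" by (rule A.fsq_core[OF m F, symmetric])
    finally show ?thesis .
  qed
  have op: "isometry (l2_sum {1..} ?L) (l2_sum {1..} ?L') U \<and>
    (\<forall>F. l2_fam {1..} ?L F \<longrightarrow> l2_fam {1..} ?L' (\<Phi> F) \<and> U (l2_vec {1..} ?L F) = l2_vec {1..} ?L' (\<Phi> F))"
  proof (rule l2_isometryI)
    fix F assume F: "l2_fam {1..} ?L F"
    show "\<forall>j\<in>{1..}. \<Phi> F j \<in> borel_measurable (?L' j)"
      by (rule ballI, rule A.measurable_level_measure, rule \<Phi>m) (use l2_famD(1)[OF F] in auto)
    show "fsq {1..} ?L' (\<Phi> F) = fsq {1..} ?L F"
      using l2_famD(1)[OF F] by (intro \<Phi>n) auto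
  next
    fix F G :: "nat \<Rightarrow> ('g \<Rightarrow> complex) \<Rightarrow> complex" and j :: nat
    assume "\<And>i. i \<in> {1..} \<Longrightarrow> AE x in ?L i. F i x = G i x"
    then have "AE \<omega> in \<mu>. \<forall>i\<ge>1. \<omega> \<in> level m i \<longrightarrow> F i \<omega> = G i \<omega>"
      by (simp add: A.AE_level[OF m] AE_all_countable)
    then have "AE \<omega> in \<mu>. \<omega> \<in> level m' j \<longrightarrow> \<Phi> F j \<omega> = \<Phi> G j \<omega>"
      by (rule AE_mp) (auto intro!: AE_I2 sum.cong simp: \<Phi>_def level_def)
    then show "AE \<omega> in ?L' j. \<Phi> F j \<omega> = \<Phi> G j \<omega>" by (simp add: A.AE_level[OF m'])
  qed (auto simp: \<Phi>_def U_def algebra_simps sum.distrib sum_distrib_left intro!: AE_I2)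
  have fam: "l2_fam {1..} ?L' (\<Phi> F)" and vec: "U (l2_vec {1..} ?L F) = l2_vec {1..} ?L' (\<Phi> F)"
    if "l2_fam {1..} ?L F" for F using op that by blast+
  have Xfam: "l2_fam {1..} ?L (l2_reps X)" if "X \<in> hcarrier (core_space \<mu> m)" for X
    using l2_sum_memD(2) that unfolding core_space_def by blast
  have "unitary (core_space \<mu> m) (core_space \<mu> m') U"
  proof (rule unitaryI[OF A.prehilbert_core A.prehilbert_core])
    show "isometry (core_space \<mu> m) (core_space \<mu> m') U" using op by (simp add: core_space_def)
    show "hcarrier (core_space \<mu> m') \<subseteq> U ` hcarrier (core_space \<mu> m)"
    proof
      fix Y assume Y: "Y \<in> hcarrier (core_space \<mu> m')"
      let ?h = "l2_reps Y"
      define F where "F l \<omega> = (\<Sum>j=1..m \<omega>. cnj (A j l \<omega>) * ?h j \<omega>)" for l \<omega>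
      have Fm: "F l \<in> borel_measurable \<mu>" if l: "l \<ge> 1" for l
        unfolding F_def[abs_def]
      proof (rule A.measurable_cut_sum[OF m])
        fix i :: nat assume i: "i \<ge> 1"
        show "(\<lambda>\<omega>. cnj (A i l \<omega>)) \<in> borel_measurable \<mu>"
          by (intro borel_measurable_continuous_on[OF _ A[rule_format, OF i l]] continuous_intros)
        show "?h i \<in> borel_measurable (?L i)"
          by (intro A.measurable_level_measure A.core_rep_measurable[OF m' Y i])
      qed
      then have FL: "F l \<in> borel_measurable (?L l)" if "l \<ge> 1" for l
        using that by (intro A.measurable_level_measure)
      have "AE \<omega> in \<mu>. \<forall>j\<ge>1. \<omega> \<in> level m' j \<longrightarrow> \<Phi> F j \<omega> = ?h j \<omega>"
        using corner
      proof eventually_elim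
        fix \<omega> assume c: "m \<omega> = m' \<omega> \<and> unitary_corner (m \<omega>) (\<lambda>i j. A i j \<omega>)"
        show "\<forall>j\<ge>1. \<omega> \<in> level m' j \<longrightarrow> \<Phi> F j \<omega> = ?h j \<omega>"
        proof (intro allI impI)
          fix j assume j: "j \<ge> 1" "\<omega> \<in> level m' j"
          then have jm: "j \<in> {1..m \<omega>}" using c by (auto simp: level_def)
          have "\<Phi> F j \<omega> = (\<Sum>l=1..m \<omega>. \<Sum>k=1..m \<omega>. (A j l \<omega> * cnj (A k l \<omega>)) * ?h k \<omega>)"
            by (simp add: \<Phi>_def F_def sum_distrib_left mult.assoc)
          also have "\<dots> = (\<Sum>k=1..m \<omega>. (\<Sum>l=1..m \<omega>. A j l \<omega> * cnj (A k l \<omega>)) * ?h k \<omega>)"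
            unfolding sum_distrib_right by (rule sum.swap)
          also have "\<dots> = (\<Sum>k=1..m \<omega>. (if j = k then 1 else 0) * ?h k \<omega>)"
          proof (rule sum.cong[OF refl])
            fix k assume "k \<in> {1..m \<omega>}"
            then have "(\<Sum>l=1..m \<omega>. A j l \<omega> * cnj (A k l \<omega>)) = (if j = k then 1 else 0)"
              using c jm unfolding unitary_corner_def by blast
            then show "(\<Sum>l=1..m \<omega>. A j l \<omega> * cnj (A k l \<omega>)) * ?h k \<omega> = (if j = k then 1 else 0) * ?h k \<omega>"
              by simp
          qed
          also have "\<dots> = (\<Sum>k=1..m \<omega>. if j = k then ?h j \<omega> else 0)" by (intro sum.cong) auto
          also have "\<dots> = ?h j \<omega>" using jm by simp
          finally show "\<Phi> F j \<omega> = ?h j \<omega>" .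
        qed
      qed
      then have eq: "AE \<omega> in ?L' j. \<Phi> F j \<omega> = ?h j \<omega>" if "j \<in> {1..}" for j
        using that by (auto simp: A.AE_level[OF m'] elim: AE_mp)
      have "fsq {1..} ?L F = fsq {1..} ?L' ?h"
        using \<Phi>n[OF FL] fsq_cong_AE[where I = "{1..}" and \<nu> = ?L' and F = "\<Phi> F" and G = ?h, OF eq] by simp
      then have F: "l2_fam {1..} ?L F"
        using FL l2_sum_memD(2)[OF Y[unfolded core_space_def]] by (simp add: l2_fam_def)
      have "U (l2_vec {1..} ?L F) = l2_vec {1..} ?L' ?h"
        unfolding vec[OF F] by (rule l2_vec_cong[OF eq])
      also have "\<dots> = Y" by (rule l2_sum_memD(3)[OF Y[unfolded core_space_def]])
      finally show "Y \<in> U ` hcarrier (core_space \<mu> m)"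
        using l2_vec_mem(1)[OF F] unfolding core_space_def by (metis imageI)
    qed
  qed
  moreover have "U (ruelle \<alpha> \<mu> m H X) = ruelle \<alpha> \<mu> m' H' (U X)" if X: "X \<in> hcarrier (core_space \<mu> m)" for X
  proof -
    let ?x = "l2_reps X"
    note fx = Xfam[OF X]
    have rf: "l2_fam {1..} ?L (A.ruelle_fun m H ?x)" using A.H_operator fx by blast
    have "U (ruelle \<alpha> \<mu> m H X) = l2_vec {1..} ?L' (\<Phi> (A.ruelle_fun m H ?x))"
      unfolding A.ruelle_eq[OF m m X] by (rule vec[OF rf])
    also have "\<dots> = l2_vec {1..} ?L' (A.ruelle_fun m' H' (\<Phi> ?x))"
    proof (rule l2_vec_cong)
      fix j :: nat assume "j \<in> {1..}"
      then have j: "j \<ge> 1" by simp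
      have "AE \<omega> in \<mu>. \<Phi> (A.ruelle_fun m H ?x) j \<omega> = A.ruelle_fun m' H' (\<Phi> ?x) j \<omega>"
        using AE A.AE_endo[OF corner]
      proof eventually_elim
        fix \<omega>
        assume a: "unitary_corner (m \<omega>) (\<lambda>i j. A i j \<omega>) \<and>
          (\<forall>i\<ge>1. \<forall>j\<ge>1. (\<Sum>\<^sub>\<infinity>l\<in>{1..}. H i l \<omega> * A j l \<omega>) = (\<Sum>\<^sub>\<infinity>l\<in>{1..}. A l i (A.p \<omega>) * H' l j \<omega>))"
          and cp: "m (A.p \<omega>) = m' (A.p \<omega>) \<and> unitary_corner (m (A.p \<omega>)) (\<lambda>i j. A i j (A.p \<omega>))"
        have eq: "(\<Sum>l=1..m \<omega>. H i l \<omega> * A j l \<omega>) = (\<Sum>l=1..m (A.p \<omega>). A l i (A.p \<omega>) * H' l j \<omega>)" if i: "i \<ge> 1" for i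
        proof -
          have "A j l \<omega> = 0" if "l \<ge> 1" "m \<omega> < l" for l
            using a j that unfolding unitary_corner_def by blast
          then have "(\<Sum>\<^sub>\<infinity>l\<in>{1..}. H i l \<omega> * A j l \<omega>) = (\<Sum>l=1..m \<omega>. H i l \<omega> * A j l \<omega>)"
            by (subst infsum_cong_neutral[where T = "{1..m \<omega>}"]) auto
          moreover have "A l i (A.p \<omega>) = 0" if "l \<ge> 1" "m (A.p \<omega>) < l" for l
            using cp i that unfolding unitary_corner_def by blast
          then have "(\<Sum>\<^sub>\<infinity>l\<in>{1..}. A l i (A.p \<omega>) * H' l j \<omega>) = (\<Sum>l=1..m (A.p \<omega>). A l i (A.p \<omega>) * H' l j \<omega>)"
            by (subst infsum_cong_neutral[where T = "{1..m (A.p \<omega>)}"]) auto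
          ultimately show ?thesis using a i j by simp
        qed
        have "\<Phi> (A.ruelle_fun m H ?x) j \<omega> = (\<Sum>l=1..m \<omega>. \<Sum>i=1..m (A.p \<omega>). (H i l \<omega> * A j l \<omega>) * ?x i (A.p \<omega>))"
          by (simp add: \<Phi>_def A.ruelle_fun_def sum_distrib_left mult_ac)
        also have "\<dots> = (\<Sum>i=1..m (A.p \<omega>). (\<Sum>l=1..m \<omega>. H i l \<omega> * A j l \<omega>) * ?x i (A.p \<omega>))"
          unfolding sum_distrib_right by (rule sum.swap)
        also have "\<dots> = (\<Sum>i=1..m (A.p \<omega>). (\<Sum>l=1..m (A.p \<omega>). A l i (A.p \<omega>) * H' l j \<omega>) * ?x i (A.p \<omega>))"
          by (intro sum.cong refl) (simp add: eq)
        also have "\<dots> = (\<Sum>l=1..m (A.p \<omega>). \<Sum>i=1..m (A.p \<omega>). (A l i (A.p \<omega>) * H' l j \<omega>) * ?x i (A.p \<omega>))"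
          unfolding sum_distrib_right by (rule sum.swap)
        also have "\<dots> = A.ruelle_fun m' H' (\<Phi> ?x) j \<omega>"
          using cp by (simp add: \<Phi>_def A.ruelle_fun_def sum_distrib_left mult_ac)
        finally show "\<Phi> (A.ruelle_fun m H ?x) j \<omega> = A.ruelle_fun m' H' (\<Phi> ?x) j \<omega>" .
      qed
      then show "AE \<omega> in ?L' j. \<Phi> (A.ruelle_fun m H ?x) j \<omega> = A.ruelle_fun m' H' (\<Phi> ?x) j \<omega>"
        by (auto simp: A.AE_level[OF m'] elim: AE_mp)
    qed
    also have "\<dots> = ruelle \<alpha> \<mu> m' H' (U X)"
      unfolding U_def using B.H_operator fam[OF fx] by simp
    finally show ?thesis .
  qed
  moreover have "U (mult_char {1..} ?L \<gamma> X) = mult_char {1..} ?L' \<gamma> (U X)"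
    if X: "X \<in> hcarrier (core_space \<mu> m)" for \<gamma> X
  proof -
    note fx = Xfam[OF X]
    have "U (mult_char {1..} ?L \<gamma> X) = l2_vec {1..} ?L' (\<Phi> (\<lambda>i \<omega>. \<omega> \<gamma> * l2_rep (X i) \<omega>))"
      unfolding mult_char_eq by (rule vec, rule l2_fam_char[OF _ fx]) (simp add: A.borel_part_level[OF m])
    also have "\<Phi> (\<lambda>i \<omega>. \<omega> \<gamma> * l2_rep (X i) \<omega>) = (\<lambda>j \<omega>. \<omega> \<gamma> * \<Phi> (l2_reps X) j \<omega>)"
      by (simp add: \<Phi>_def fun_eq_iff sum_distrib_left mult_ac)
    also have "l2_vec {1..} ?L' (\<lambda>j \<omega>. \<omega> \<gamma> * \<Phi> (l2_reps X) j \<omega>) = mult_char {1..} ?L' \<gamma> (U X)"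
      unfolding U_def
      by (rule mult_char_vec[symmetric]) (use A.borel_part_level[OF m'] l2_famD(1)[OF fam[OF fx]] in auto)
    finally show ?thesis .
  qed
  ultimately show ?thesis by blast
qed

theorem theorem13:
  fixes \<alpha> :: "'g::{ab_group_add, countable} \<Rightarrow> 'g"
    and \<mu> :: "('g \<Rightarrow> complex) measure"
    and c :: "('g \<Rightarrow> complex) \<Rightarrow> ('g \<Rightarrow> complex)"
    and m m' :: "('g \<Rightarrow> complex) \<Rightarrow> nat"
    and H H' G G' :: "nat \<Rightarrow> nat \<Rightarrow> ('g \<Rightarrow> complex) \<Rightarrow> complex"
  assumes "\<And>x y. \<alpha> (x + y) = \<alpha> x + \<alpha> y"
    and "inj \<alpha>"
    and "image_index \<alpha> > 1"
    and "(\<Inter>n. range (\<alpha> ^^ n)) = {0}"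
    and "haar_measure \<mu>"
    and "borel_cross_section \<alpha> c"
    and "multiplicity_function \<alpha> \<mu> m"
    and "multiplicity_function \<alpha> \<mu> m'"
    and "filter_relative \<alpha> \<mu> m H"
    and "filter_relative \<alpha> \<mu> m' H'"
    and "pure_isometry (core_space \<mu> m) (ruelle \<alpha> \<mu> m H)"
    and "pure_isometry (core_space \<mu> m') (ruelle \<alpha> \<mu> m' H')"
    and "complementary_filter \<alpha> \<mu> m H G"
    and "complementary_filter \<alpha> \<mu> m' H' G'"
  shows "gmra_equivalent (canonical_gmra \<alpha> c \<mu> m H G) (canonical_gmra \<alpha> c \<mu> m' H' G') \<longleftrightarrow>
    (AE \<omega> in \<mu>. m \<omega> = m' \<omega>) \<and>
    (\<exists>A :: nat \<Rightarrow> nat \<Rightarrow> ('g \<Rightarrow> complex) \<Rightarrow> complex.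
       (\<forall>i\<ge>1. \<forall>j\<ge>1. A i j \<in> borel_measurable \<mu>) \<and>
       (AE \<omega> in \<mu>.
          unitary_corner (m \<omega>) (\<lambda>i j. A i j \<omega>) \<and>
          (\<forall>i\<ge>1. \<forall>j\<ge>1.
             (\<Sum>\<^sub>\<infinity>l\<in>{1..}. H i l \<omega> * A j l \<omega>) =
             (\<Sum>\<^sub>\<infinity>l\<in>{1..}. A l i (dual_endo \<alpha> \<omega>) * H' l j \<omega>))))"
    (is "_ \<longleftrightarrow> ?matrix")
proof -
  have A: "filter_setting \<alpha> \<mu> c m H G" and B: "filter_setting \<alpha> \<mu> c m' H' G'"
    by unfold_locales (use assms in auto)
  show ?thesis
    unfolding canonical_equivalent_iff[OF A B]
  proof
    assume "\<exists>U. unitary (core_space \<mu> m) (core_space \<mu> m') U \<and>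
      (\<forall>X\<in>hcarrier (core_space \<mu> m). U (ruelle \<alpha> \<mu> m H X) = ruelle \<alpha> \<mu> m' H' (U X)) \<and>
      (\<forall>\<gamma>. \<forall>X\<in>hcarrier (core_space \<mu> m).
        U (mult_char {1..} (level_measure \<mu> m) \<gamma> X) = mult_char {1..} (level_measure \<mu> m') \<gamma> (U X))"
    then show ?matrix by (elim exE conjE) (rule matrix_from_unitary[OF A B])
  next
    assume ?matrix
    then show "\<exists>U. unitary (core_space \<mu> m) (core_space \<mu> m') U \<and>
      (\<forall>X\<in>hcarrier (core_space \<mu> m). U (ruelle \<alpha> \<mu> m H X) = ruelle \<alpha> \<mu> m' H' (U X)) \<and>
      (\<forall>\<gamma>. \<forall>X\<in>hcarrier (core_space \<mu> m).
        U (mult_char {1..} (level_measure \<mu> m) \<gamma> X) = mult_char {1..} (level_measure \<mu> m') \<gamma> (U X))"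
      by (elim exE conjE) (rule unitary_from_matrix[OF A B])
  qed
qed

end
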